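(* Let $F$ be a field. Every countable dimensional stable algebraic primitive associative $F$-algebra is $M_\infty$-embeddable as a left ideal in a 2-generated algebraic primitive $F$-algebra.
   Context: Algebras are associative over the field $F$ and are not assumed to have an identity. Countable dimensional means countable dimensional as an $F$-vector space. An algebra is algebraic if each of its elements is algebraic over $F$ (generates a finite dimensional subalgebra). An algebra $A$ is stable algebraic if all matrix algebras $M_n(A)$, $n\geq 1$, are algebraic. An algebra is (left) primitive if it has a faithful irreducible left module. An algebra is 2-generated if it is generated by two elements as an $F$-algebra. Let $X$ be a countable (infinite) set. For an algebra $A$, $M_\infty(A)$ denotes the algebra of $X\times X$ matrices over $A$ having finitely many nonzero entries. $A$ is $M_\infty$-embeddable in an algebra $B$ if there exists an embedding (injective $F$-algebra homomorphism) $\varphi: M_\infty(A)\to B$; $A$ is $M_\infty$-embeddable in $B$ as a left ideal if moreover the image of $\varphi$ is a left ideal of $B$. *)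

theory Defs
  imports "HOL-Algebra.Module" "HOL-Library.Countable_Set" "HOL.Hull"
begin

text \<open>
  Algebras, vector spaces and modules over a field are all carried by the \<open>module\<close> record of
  HOL-Algebra. Its field \<open>one\<close> is never constrained or used below, so algebras need not have an
  identity; for vector spaces the field \<open>mult\<close> is ignored as well. (The locale \<open>algebra\<close> of
  HOL-Algebra is about commutative algebras with identity.)
\<close>

locale assoc_algebra = F?: field F + A?: module F A for F (structure) and A (structure) +
  assumes mult_closed:
      "\<lbrakk>x \<in> carrier A; y \<in> carrier A\<rbrakk> \<Longrightarrow> x \<otimes>\<^bsub>A\<^esub> y \<in> carrier A"
    and mult_assoc:
      "\<lbrakk>x \<in> carrier A; y \<in> carrier A; z \<in> carrier A\<rbrakk> \<Longrightarrow>
        (x \<otimes>\<^bsub>A\<^esub> y) \<otimes>\<^bsub>A\<^esub> z = x \<otimes>\<^bsub>A\<^esub> (y \<otimes>\<^bsub>A\<^esub> z)"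
    and mult_l_distr:
      "\<lbrakk>x \<in> carrier A; y \<in> carrier A; z \<in> carrier A\<rbrakk> \<Longrightarrow>
        (x \<oplus>\<^bsub>A\<^esub> y) \<otimes>\<^bsub>A\<^esub> z = x \<otimes>\<^bsub>A\<^esub> z \<oplus>\<^bsub>A\<^esub> y \<otimes>\<^bsub>A\<^esub> z"
    and mult_r_distr:
      "\<lbrakk>x \<in> carrier A; y \<in> carrier A; z \<in> carrier A\<rbrakk> \<Longrightarrow>
        z \<otimes>\<^bsub>A\<^esub> (x \<oplus>\<^bsub>A\<^esub> y) = z \<otimes>\<^bsub>A\<^esub> x \<oplus>\<^bsub>A\<^esub> z \<otimes>\<^bsub>A\<^esub> y"
    and mult_smult_left:
      "\<lbrakk>c \<in> carrier F; x \<in> carrier A; y \<in> carrier A\<rbrakk> \<Longrightarrow>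
        (c \<odot>\<^bsub>A\<^esub> x) \<otimes>\<^bsub>A\<^esub> y = c \<odot>\<^bsub>A\<^esub> (x \<otimes>\<^bsub>A\<^esub> y)"
    and mult_smult_right:
      "\<lbrakk>c \<in> carrier F; x \<in> carrier A; y \<in> carrier A\<rbrakk> \<Longrightarrow>
        x \<otimes>\<^bsub>A\<^esub> (c \<odot>\<^bsub>A\<^esub> y) = c \<odot>\<^bsub>A\<^esub> (x \<otimes>\<^bsub>A\<^esub> y)"

subsection \<open>Dimension\<close>

definition lin_span ::
  "('c, 'n) ring_scheme \<Rightarrow> ('c, 'v, 'm) module_scheme \<Rightarrow> 'v set \<Rightarrow> 'v set" where
  "lin_span F V S = (\<lambda>W. submodule W F V) hull S"

definition lin_basis ::
  "('c, 'n) ring_scheme \<Rightarrow> ('c, 'v, 'm) module_scheme \<Rightarrow> 'v set \<Rightarrow> bool" where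
  "lin_basis F V B \<longleftrightarrow>
     B \<subseteq> carrier V \<and> (\<forall>b\<in>B. b \<notin> lin_span F V (B - {b})) \<and> lin_span F V B = carrier V"

definition finite_dimensional ::
  "('c, 'n) ring_scheme \<Rightarrow> ('c, 'v, 'm) module_scheme \<Rightarrow> bool" where
  "finite_dimensional F V \<longleftrightarrow> (\<exists>B. lin_basis F V B \<and> finite B)"

text \<open>Finite dimensional spaces count as countable dimensional.\<close>

definition countable_dimensional ::
  "('c, 'n) ring_scheme \<Rightarrow> ('c, 'v, 'm) module_scheme \<Rightarrow> bool" where
  "countable_dimensional F V \<longleftrightarrow> (\<exists>B. lin_basis F V B \<and> countable B)"

subsection \<open>Subalgebras, left ideals, homomorphisms\<close>

definition subalgebra ::
  "'a set \<Rightarrow> ('c, 'n) ring_scheme \<Rightarrow> ('c, 'a, 'm) module_scheme \<Rightarrow> bool" where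
  "subalgebra S F A \<longleftrightarrow> submodule S F A \<and> (\<forall>x\<in>S. \<forall>y\<in>S. x \<otimes>\<^bsub>A\<^esub> y \<in> S)"

definition alg_generated ::
  "('c, 'n) ring_scheme \<Rightarrow> ('c, 'a, 'm) module_scheme \<Rightarrow> 'a set \<Rightarrow> 'a set" where
  "alg_generated F A S = (\<lambda>T. subalgebra T F A) hull S"

definition two_generated ::
  "('c, 'n) ring_scheme \<Rightarrow> ('c, 'a, 'm) module_scheme \<Rightarrow> bool" where
  "two_generated F A \<longleftrightarrow>
     (\<exists>x\<in>carrier A. \<exists>y\<in>carrier A. alg_generated F A {x, y} = carrier A)"

text \<open>
  A 2-generated algebra \<open>B\<close> over \<open>F\<close> is spanned by the countably many words in its generators.
  Replacing each element by its coordinates with respect to a countable basis gives an isomorphic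
  algebra whose carrier consists of functions \<open>nat \<Rightarrow> 'c\<close>, where \<open>'c\<close> is the type of the scalars. So
  an existential statement about 2-generated algebras loses nothing by ranging over
  \<open>('c, nat \<Rightarrow> 'c) module\<close> only.
\<close>

definition left_ideal ::
  "'a set \<Rightarrow> ('c, 'n) ring_scheme \<Rightarrow> ('c, 'a, 'm) module_scheme \<Rightarrow> bool" where
  "left_ideal I F A \<longleftrightarrow> submodule I F A \<and> (\<forall>a\<in>carrier A. \<forall>x\<in>I. a \<otimes>\<^bsub>A\<^esub> x \<in> I)"

definition alg_hom ::
  "('c, 'n) ring_scheme \<Rightarrow> ('c, 'a, 'm) module_scheme \<Rightarrow> ('c, 'b, 'l) module_scheme
    \<Rightarrow> ('a \<Rightarrow> 'b) set" where
  "alg_hom F A B = {\<phi> \<in> carrier A \<rightarrow> carrier B.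
     (\<forall>x\<in>carrier A. \<forall>y\<in>carrier A. \<phi> (x \<oplus>\<^bsub>A\<^esub> y) = \<phi> x \<oplus>\<^bsub>B\<^esub> \<phi> y) \<and>
     (\<forall>x\<in>carrier A. \<forall>y\<in>carrier A. \<phi> (x \<otimes>\<^bsub>A\<^esub> y) = \<phi> x \<otimes>\<^bsub>B\<^esub> \<phi> y) \<and>
     (\<forall>c\<in>carrier F. \<forall>x\<in>carrier A. \<phi> (c \<odot>\<^bsub>A\<^esub> x) = c \<odot>\<^bsub>B\<^esub> \<phi> x)}"

subsection \<open>Matrix algebras\<close>

text \<open>
  The algebra of \<open>X \<times> X\<close> matrices over \<open>A\<close> with finitely many nonzero entries. A matrix is a total
  function of its two indices that is zero outside \<open>X \<times> X\<close>. In the product the summation index is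
  restricted to a finite set, since \<open>finsum\<close> over an infinite index set is zero by convention.
\<close>

definition matrix_algebra ::
  "'i set \<Rightarrow> ('c, 'a, 'm) module_scheme \<Rightarrow> ('c, 'i \<Rightarrow> 'i \<Rightarrow> 'a) module" where
  "matrix_algebra X A = \<lparr>
     carrier = {M. (\<forall>i j. M i j \<in> carrier A) \<and>
                   (\<forall>i j. M i j \<noteq> \<zero>\<^bsub>A\<^esub> \<longrightarrow> i \<in> X \<and> j \<in> X) \<and>
                   finite {(i, j). M i j \<noteq> \<zero>\<^bsub>A\<^esub>}},
     mult = (\<lambda>M N i j. \<Oplus>\<^bsub>A\<^esub>k\<in>{k \<in> X. M i k \<noteq> \<zero>\<^bsub>A\<^esub>}. M i k \<otimes>\<^bsub>A\<^esub> N k j),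
     one = undefined,
     zero = (\<lambda>i j. \<zero>\<^bsub>A\<^esub>),
     add = (\<lambda>M N i j. M i j \<oplus>\<^bsub>A\<^esub> N i j),
     smult = (\<lambda>c M i j. c \<odot>\<^bsub>A\<^esub> M i j)\<rparr>"

definition M_infinity_embeddable_as_left_ideal ::
  "'i set \<Rightarrow> ('c, 'n) ring_scheme \<Rightarrow> ('c, 'a, 'm) module_scheme \<Rightarrow> ('c, 'b, 'l) module_scheme
    \<Rightarrow> bool" where
  "M_infinity_embeddable_as_left_ideal X F A B \<longleftrightarrow>
     (\<exists>\<phi> \<in> alg_hom F (matrix_algebra X A) B.
        inj_on \<phi> (carrier (matrix_algebra X A)) \<and>
        left_ideal (\<phi> ` carrier (matrix_algebra X A)) F B)"

subsection \<open>Algebraic and stable algebraic algebras\<close>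

definition algebraic_algebra ::
  "('c, 'n) ring_scheme \<Rightarrow> ('c, 'a, 'm) module_scheme \<Rightarrow> bool" where
  "algebraic_algebra F A \<longleftrightarrow>
     (\<forall>a\<in>carrier A. finite_dimensional F (A\<lparr>carrier := alg_generated F A {a}\<rparr>))"

definition stable_algebraic ::
  "('c, 'n) ring_scheme \<Rightarrow> ('c, 'a, 'm) module_scheme \<Rightarrow> bool" where
  "stable_algebraic F A \<longleftrightarrow>
     (\<forall>n\<ge>1. algebraic_algebra F (matrix_algebra {..<n::nat} A))"

subsection \<open>Primitive algebras\<close>

locale left_module = assoc_algebra F A + V?: module F V
  for F (structure) and A (structure) and V (structure) +
  fixes act :: "'b \<Rightarrow> 'd \<Rightarrow> 'd"
  assumes act_closed:
      "\<lbrakk>a \<in> carrier A; v \<in> carrier V\<rbrakk> \<Longrightarrow> act a v \<in> carrier V"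
    and act_mult:
      "\<lbrakk>a \<in> carrier A; b \<in> carrier A; v \<in> carrier V\<rbrakk> \<Longrightarrow> act (a \<otimes>\<^bsub>A\<^esub> b) v = act a (act b v)"
    and act_add_left:
      "\<lbrakk>a \<in> carrier A; b \<in> carrier A; v \<in> carrier V\<rbrakk> \<Longrightarrow>
        act (a \<oplus>\<^bsub>A\<^esub> b) v = act a v \<oplus>\<^bsub>V\<^esub> act b v"
    and act_add_right:
      "\<lbrakk>a \<in> carrier A; v \<in> carrier V; w \<in> carrier V\<rbrakk> \<Longrightarrow>
        act a (v \<oplus>\<^bsub>V\<^esub> w) = act a v \<oplus>\<^bsub>V\<^esub> act a w"
    and act_smult_left:
      "\<lbrakk>c \<in> carrier F; a \<in> carrier A; v \<in> carrier V\<rbrakk> \<Longrightarrow> act (c \<odot>\<^bsub>A\<^esub> a) v = c \<odot>\<^bsub>V\<^esub> act a v"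
    and act_smult_right:
      "\<lbrakk>c \<in> carrier F; a \<in> carrier A; v \<in> carrier V\<rbrakk> \<Longrightarrow> act a (c \<odot>\<^bsub>V\<^esub> v) = c \<odot>\<^bsub>V\<^esub> act a v"

text \<open>
  As \<open>A\<close> need not have an identity, irreducibility includes the condition \<open>AV \<noteq> 0\<close>.
\<close>

definition irreducible_left_module ::
  "('c, 'n) ring_scheme \<Rightarrow> ('c, 'a, 'm) module_scheme \<Rightarrow> ('c, 'v, 'l) module_scheme
    \<Rightarrow> ('a \<Rightarrow> 'v \<Rightarrow> 'v) \<Rightarrow> bool" where
  "irreducible_left_module F A V act \<longleftrightarrow>
     left_module F A V act \<and>
     (\<exists>a\<in>carrier A. \<exists>v\<in>carrier V. act a v \<noteq> \<zero>\<^bsub>V\<^esub>) \<and>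
     (\<forall>W. submodule W F V \<and> (\<forall>a\<in>carrier A. \<forall>w\<in>W. act a w \<in> W) \<longrightarrow>
        W = {\<zero>\<^bsub>V\<^esub>} \<or> W = carrier V)"

definition faithful_action ::
  "('c, 'a, 'm) module_scheme \<Rightarrow> ('c, 'v, 'l) module_scheme \<Rightarrow> ('a \<Rightarrow> 'v \<Rightarrow> 'v) \<Rightarrow> bool" where
  "faithful_action A V act \<longleftrightarrow>
     (\<forall>a\<in>carrier A. (\<forall>v\<in>carrier V. act a v = \<zero>\<^bsub>V\<^esub>) \<longrightarrow> a = \<zero>\<^bsub>A\<^esub>)"

text \<open>
  An irreducible module \<open>V\<close> equals \<open>Av\<close> for some vector \<open>v\<close>, so it is isomorphic to the quotient of
  \<open>A\<close> by the annihilator of \<open>v\<close>, whose elements are subsets of \<open>A\<close>. Hence it is no restriction to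
  let \<open>V\<close> range over modules on the type \<open>'a set\<close>; the lemma \<open>primitiveI\<close> below makes this precise.
\<close>

definition primitive_algebra ::
  "('c, 'n) ring_scheme \<Rightarrow> ('c, 'a, 'm) module_scheme \<Rightarrow> bool" where
  "primitive_algebra F A \<longleftrightarrow>
     (\<exists>(V :: ('c, 'a set) module) act.
        irreducible_left_module F A V act \<and> faithful_action A V act)"

lemma irreducible_left_module_cyclic:
  assumes irr: "irreducible_left_module F A V act"
  obtains v where "v \<in> carrier V" "carrier V = (\<lambda>a. act a v) ` carrier A"
proof -
  interpret left_module F A V act
    using irr by (simp add: irreducible_left_module_def)
  obtain a v where av: "a \<in> carrier A" "v \<in> carrier V" "act a v \<noteq> \<zero>\<^bsub>V\<^esub>"
    using irr by (auto simp: irreducible_left_module_def)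
  let ?W = "(\<lambda>a. act a v) ` carrier A"
  have m1: "act (\<zero>\<^bsub>F\<^esub> \<odot>\<^bsub>A\<^esub> \<zero>\<^bsub>A\<^esub>) v = \<zero>\<^bsub>V\<^esub>"
    using av by (simp add: act_smult_left act_closed del: A.smult_r_null A.smult_l_null)
  have neg: "\<ominus>\<^bsub>V\<^esub> act b v = act ((\<ominus>\<^bsub>F\<^esub> \<one>\<^bsub>F\<^esub>) \<odot>\<^bsub>A\<^esub> b) v" if "b \<in> carrier A" for b
    using that av by (simp add: act_smult_left act_closed V.smult_l_minus)
  have "submodule ?W F V"
  proof (rule V.submoduleI)
    show "?W \<subseteq> carrier V" using av by (auto simp: act_closed)
    show "\<zero>\<^bsub>V\<^esub> \<in> ?W" using m1 by (metis A.M.zero_closed F.zero_closed A.smult_closed image_eqI)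
    show "\<ominus>\<^bsub>V\<^esub> x \<in> ?W" if "x \<in> ?W" for x
      using that neg by (auto intro!: image_eqI)
    show "x \<oplus>\<^bsub>V\<^esub> y \<in> ?W" if "x \<in> ?W" "y \<in> ?W" for x y
      using that av by (auto simp: act_add_left[symmetric] intro!: image_eqI)
    show "c \<odot>\<^bsub>V\<^esub> x \<in> ?W" if "c \<in> carrier F" "x \<in> ?W" for c x
      using that av by (auto simp: act_smult_left[symmetric] intro!: image_eqI)
  qed
  moreover have "\<forall>b\<in>carrier A. \<forall>w\<in>?W. act b w \<in> ?W"
    using av by (auto simp: act_mult[symmetric] mult_closed intro!: image_eqI)
  ultimately have "?W = {\<zero>\<^bsub>V\<^esub>} \<or> ?W = carrier V"
    using irr by (simp add: irreducible_left_module_def)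
  then have "carrier V = ?W" using av by auto
  with av that show ?thesis by blast
qed

lemma primitiveI:
  fixes F :: "('c, 'n) ring_scheme" and A :: "('c, 'a, 'm) module_scheme"
    and V :: "('c, 'v, 'l) module_scheme"
  assumes irr: "irreducible_left_module F A V act" and faith: "faithful_action A V act"
  shows "primitive_algebra F A"
proof -
  interpret left_module F A V act
    using irr by (simp add: irreducible_left_module_def)
  obtain v where v: "v \<in> carrier V" "carrier V = (\<lambda>a. act a v) ` carrier A"
    using irreducible_left_module_cyclic[OF irr] .
  define g where "g w = {a \<in> carrier A. act a v = w}" for w
  define h where "h = inv_into (carrier V) g"
  have inj: "inj_on g (carrier V)"
    unfolding inj_on_def g_def v(2) by blast
  have hg [simp]: "h (g w) = w" if "w \<in> carrier V" for w
    using that inj by (simp add: h_def)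
  define U :: "('c, 'a set) module" where
    "U = \<lparr>carrier = g ` carrier V, mult = undefined, one = undefined, zero = g \<zero>\<^bsub>V\<^esub>,
          add = (\<lambda>x y. g (h x \<oplus>\<^bsub>V\<^esub> h y)), smult = (\<lambda>c x. g (c \<odot>\<^bsub>V\<^esub> h x))\<rparr>"
  define act' where "act' a x = g (act a (h x))" for a x
  have [simp]: "carrier U = g ` carrier V" "\<zero>\<^bsub>U\<^esub> = g \<zero>\<^bsub>V\<^esub>"
    "x \<oplus>\<^bsub>U\<^esub> y = g (h x \<oplus>\<^bsub>V\<^esub> h y)" "c \<odot>\<^bsub>U\<^esub> x = g (c \<odot>\<^bsub>V\<^esub> h x)" for x y c
    by (simp_all add: U_def)
  have "abelian_group U"
  proof (rule abelian_groupI)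
    show "\<exists>y\<in>carrier U. y \<oplus>\<^bsub>U\<^esub> x = \<zero>\<^bsub>U\<^esub>" if x: "x \<in> carrier U" for x
    proof -
      obtain w where w: "w \<in> carrier V" "x = g w" using x by auto
      then show ?thesis by (intro bexI[of _ "g (\<ominus>\<^bsub>V\<^esub> w)"]) (auto simp: V.M.l_neg)
    qed
  qed (auto simp: V.M.a_ac)
  then have "module F U"
    using F.is_cring
    by (intro moduleI)
      (auto simp: V.smult_l_distr V.smult_r_distr V.smult_assoc1)
  then have lm: "left_module F A U act'"
    using assoc_algebra_axioms
    by (intro left_module.intro left_module_axioms.intro)
      (auto simp: act'_def act_closed act_mult act_add_left act_add_right
         act_smult_left act_smult_right)
  have nz: "\<exists>a\<in>carrier A. \<exists>x\<in>carrier U. act' a x \<noteq> \<zero>\<^bsub>U\<^esub>"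
  proof -
    obtain a w where "a \<in> carrier A" "w \<in> carrier V" "act a w \<noteq> \<zero>\<^bsub>V\<^esub>"
      using irr by (auto simp: irreducible_left_module_def)
    then show ?thesis
      by (intro bexI[of _ a] bexI[of _ "g w"])
        (auto simp: act'_def act_closed inj_on_eq_iff[OF inj])
  qed
  have sub: "W = {\<zero>\<^bsub>U\<^esub>} \<or> W = carrier U"
    if W: "submodule W F U" and inv: "\<forall>a\<in>carrier A. \<forall>w\<in>W. act' a w \<in> W" for W
  proof -
    interpret U: module F U by fact
    note WE = U.submoduleE[OF W]
    have zW: "g \<zero>\<^bsub>V\<^esub> \<in> W" 
      using WE(2,4) U.smult_l_null WE(1) F.zero_closed by (metis all_not_in_conv subsetD
          \<open>\<zero>\<^bsub>U\<^esub> = g \<zero>\<^bsub>V\<^esub>\<close>)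
    let ?W = "{w \<in> carrier V. g w \<in> W}"
    have Wim: "W = g ` ?W" using WE(1) by auto
    have smW: "g (c \<odot>\<^bsub>V\<^esub> w) \<in> W" if "c \<in> carrier F" "w \<in> carrier V" "g w \<in> W" for c w
      using WE(4)[of c "g w"] that by simp
    have "submodule ?W F V"
    proof (rule V.submoduleI)
      show "\<ominus>\<^bsub>V\<^esub> w \<in> ?W" if "w \<in> ?W" for w
      proof -
        have "\<ominus>\<^bsub>V\<^esub> w = (\<ominus>\<^bsub>F\<^esub> \<one>\<^bsub>F\<^esub>) \<odot>\<^bsub>V\<^esub> w" using that by (simp add: V.smult_l_minus)
        then show ?thesis using smW[of "\<ominus>\<^bsub>F\<^esub> \<one>\<^bsub>F\<^esub>" w] that by auto
      qed
      show "x \<oplus>\<^bsub>V\<^esub> y \<in> ?W" if "x \<in> ?W" "y \<in> ?W" for x y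
        using WE(5)[of "g x" "g y"] that by simp
    qed (use zW smW in auto)
    moreover have "\<forall>a\<in>carrier A. \<forall>w\<in>?W. act a w \<in> ?W"
      using inv by (metis (mono_tags, lifting) act'_def act_closed hg mem_Collect_eq)
    ultimately have "?W = {\<zero>\<^bsub>V\<^esub>} \<or> ?W = carrier V"
      using irr by (simp add: irreducible_left_module_def)
    then show ?thesis using Wim by auto
  qed
  have "irreducible_left_module F A U act'"
    unfolding irreducible_left_module_def using lm nz sub by blast
  moreover have "faithful_action A U act'"
    using faith by (auto simp: faithful_action_def act'_def act_closed inj_on_eq_iff[OF inj])
  ultimately show ?thesis unfolding primitive_algebra_def by blast
qed

end

theory Submission
  imports Defs Complex_Main "HOL-Library.Multiset" "HOL.Zorn"
begin

text \<open>
  The algebra \<open>B\<close> is an algebra of operators on \<open>M \<otimes> V\<close>. Here \<open>V\<close> is a faithful irreducible module of the given algebra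
  \<open>A\<close>, and \<open>M\<close> is an infinite dimensional cyclic graded module over the free algebra in two letters \<open>x\<close> and \<open>y\<close> on which
  every element without constant term is nilpotent. After the choice of a basis \<open>S\<close> of \<open>M\<close> consisting of words, operators
  on \<open>M \<otimes> V\<close> can be described by \<open>S \<times> S\<close> matrices over \<open>A\<close>. Two kinds of operators are used: words act on the factor
  \<open>M\<close>, and a linear map \<open>\<eta>\<close> from \<open>M\<close> to \<open>A\<close> defines the row operator \<open>w \<otimes> v \<mapsto> 1 \<otimes> \<eta>(w) v\<close>, where \<open>1\<close> is the generator
  of \<open>M\<close>. The generators of \<open>B\<close> are \<open>X = x\<close> and \<open>Z = y + row \<Gamma>\<close>, where \<open>\<Gamma>\<close> is the formal sum of \<open>\<gamma> k \<cdot> a k\<close>, the elements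
  \<open>a k\<close> run through a spanning set of \<open>A\<close>, each one infinitely often, and the \<open>\<gamma> k\<close> are functionals on \<open>M\<close> in widely separated
  degrees.

  If \<open>M\<close> and the \<open>\<gamma> k\<close> are chosen well, \<open>B\<close> contains every elementary matrix. As \<open>y\<close> kills the generator of \<open>M\<close> and
  \<open>y ^ \<kappa> = 0\<close>, the power \<open>Z ^ \<kappa>\<close> is the row operator of \<open>w \<mapsto> \<Gamma> (y ^ (\<kappa> - 1) w)\<close>. There are elements \<open>b k\<close> such that
  \<open>\<gamma> i (y ^ (\<kappa> - 1) b k w)\<close> is zero for \<open>i > k\<close> but not for \<open>i = k\<close>; multiplying \<open>Z ^ \<kappa>\<close> on the right by \<open>b k\<close> isolates
  the element \<open>a k\<close> (\<open>\<theta>_sum\<close>, \<open>\<theta>_a\<close>). Since \<open>a k\<close> recurs in arbitrarily large degrees, all rows \<open>f \<cdot> a k\<close> with a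
  homogeneous functional \<open>f\<close> on \<open>M\<close> follow (\<open>gen_rows_f_a\<close>). The elementary matrices span the algebra of finite
  matrices, and left multiplication by \<open>X\<close> and \<open>Z\<close> maps elementary matrices to finite ones, so they form a left
  ideal (\<open>matrices_embed\<close>). Irreducibility and faithfulness of \<open>M \<otimes> V\<close> over \<open>B\<close> are immediate from this
  (\<open>B_irreducible\<close>, \<open>B_faithful\<close>).

  The algebra \<open>B\<close> is algebraic (\<open>B_power_dependent\<close>): each of its elements is a combination of nonempty words plus a matrix
  with finitely many nonzero rows. The first part is nilpotent and the matrices of the second kind absorb products, so a
  power of the element is a matrix with finitely many nonzero rows. Its image lies in finitely many coordinates, on which it
  acts as a finite square matrix over \<open>A\<close>, and such a matrix is algebraic because \<open>A\<close> is stable algebraic.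

  The module \<open>M\<close> comes from the Golod-Shafarevich construction, carried out on the dual side: graded left ideals of the
  free algebra are represented by their annihilators, spaces of functions on words. The relations that make all
  elements without constant term nilpotent are sparse enough for the quotient to be nonzero in each degree
  (\<open>golod_shafarevich_inequality\<close>, \<open>Ann_nonzero\<close>, \<open>nil_relations_small\<close>). Zorn's lemma provides a just infinite quotient
  algebra, and then a just infinite cyclic module whose generator is killed by \<open>y\<close> (\<open>just_infinite_pair_exists\<close>). Over
  a just infinite algebra an element \<open>p\<close> that does not annihilate \<open>M\<close> acts nontrivially in arbitrarily high degrees, and
  \<open>p t p\<close> does not annihilate \<open>M\<close> either for a suitable word \<open>t\<close> (\<open>torsion_free\<close>, \<open>semiprime\<close>). Together with nilpotency this allows the functionals \<open>\<gamma> k\<close> and the elements \<open>b k\<close> to be chosen one after the other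
  (\<open>separating_step\<close>).

  Finally, a 2-generated algebra is spanned by countably many words, so it is isomorphic to one whose elements are
  sequences of scalars (\<open>two_generated_imp_coordinates\<close>).
\<close>

section \<open>Linear algebra of function spaces\<close>

context abelian_monoid begin

lemma finsum_swap:
  assumes "finite I" "finite J" "\<And>i j. i \<in> I \<Longrightarrow> j \<in> J \<Longrightarrow> f i j \<in> carrier G"
  shows "(\<Oplus>i\<in>I. \<Oplus>j\<in>J. f i j) = (\<Oplus>j\<in>J. \<Oplus>i\<in>I. f i j)"
  using assms(1,3)
proof (induction I)
  case empty
  then show ?case by (simp add: finsum_zero)
next
  case (insert i I)
  have "(\<Oplus>k\<in>insert i I. \<Oplus>j\<in>J. f k j) = (\<Oplus>j\<in>J. f i j) \<oplus> (\<Oplus>k\<in>I. \<Oplus>j\<in>J. f k j)"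
    using insert by (intro finsum_insert) (auto intro!: finsum_closed)
  also have "\<dots> = (\<Oplus>j\<in>J. f i j \<oplus> (\<Oplus>k\<in>I. f k j))"
    using insert by (subst finsum_addf) (auto intro!: finsum_closed)
  also have "\<dots> = (\<Oplus>j\<in>J. \<Oplus>k\<in>insert i I. f k j)"
    using insert by (intro finsum_cong') (auto intro!: finsum_closed)
  finally show ?case .
qed

lemma finsum_superset:
  assumes "finite J" "I \<subseteq> J" "\<And>i. i \<in> J - I \<Longrightarrow> f i = \<zero>" "\<And>i. i \<in> I \<Longrightarrow> f i \<in> carrier G"
  shows "finsum G f J = finsum G f I"
proof -
  have "finsum G f J = finsum G f (I \<union> (J - I))" using assms(2) by (simp add: Un_absorb1)
  also have "\<dots> = finsum G f I \<oplus> finsum G f (J - I)"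
    using assms by (intro finsum_Un_disjoint) (auto intro: finite_subset)
  also have "finsum G f (J - I) = \<zero>"
    using assms(3) by (intro add.finprod_one_eqI) auto
  finally show ?thesis using assms(4) by (simp add: finsum_closed Pi_def)
qed

lemma finsum_only:
  assumes "finite J" "i \<in> J" "\<And>j. j \<in> J \<Longrightarrow> j \<noteq> i \<Longrightarrow> f j = \<zero>" "f i \<in> carrier G"
  shows "finsum G f J = f i"
proof -
  have "finsum G f J = finsum G f {i}" using assms by (intro finsum_superset) auto
  then show ?thesis using assms(4) by simp
qed

lemma finsum_0I: "(\<And>i. i \<in> I \<Longrightarrow> f i = \<zero>) \<Longrightarrow> finsum G f I = \<zero>"
  by (rule add.finprod_one_eqI)

end

text \<open>
  Subspaces of a space of functions, with addition and scaling packed into one closure condition.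
  Functions carry no module structure here: all later spaces consist of functions on words, and
  everything is done pointwise.
\<close>
definition (in ring) fun_subspace :: "('i \<Rightarrow> 'a) set \<Rightarrow> bool" where
  "fun_subspace U \<longleftrightarrow> (\<forall>f\<in>U. \<forall>i. f i \<in> carrier R) \<and> (\<lambda>_. \<zero>) \<in> U \<and>
     (\<forall>f\<in>U. \<forall>g\<in>U. \<forall>c\<in>carrier R. (\<lambda>i. f i \<oplus> c \<otimes> g i) \<in> U)"

text \<open>
  The reduced echelon form of \<open>U\<close> restricted to \<open>S\<close>: an element of \<open>U\<close> is determined on \<open>S\<close> by its
  values at the pivots \<open>T\<close>, and \<open>e\<close> is the basis dual to evaluation at the pivots. The cardinality of
  \<open>T\<close> plays the role of the dimension of the restriction of \<open>U\<close> to \<open>S\<close>.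
\<close>
definition (in ring) dual_basis ::
    "('i \<Rightarrow> 'a) set \<Rightarrow> 'i set \<Rightarrow> 'i set \<Rightarrow> ('i \<Rightarrow> 'i \<Rightarrow> 'a) \<Rightarrow> bool" where
  "dual_basis U S T e \<longleftrightarrow> T \<subseteq> S \<and> (\<forall>t\<in>T. e t \<in> U) \<and>
     (\<forall>t\<in>T. \<forall>t'\<in>T. e t t' = (if t = t' then \<one> else \<zero>)) \<and>
     (\<forall>g\<in>U. \<forall>s\<in>S. g s = (\<Oplus>t\<in>T. g t \<otimes> e t s))"

context field begin

lemma dual_basisI:
  assumes "T \<subseteq> S" "\<And>t. t \<in> T \<Longrightarrow> e t \<in> U"
    "\<And>t t'. t \<in> T \<Longrightarrow> t' \<in> T \<Longrightarrow> e t t' = (if t = t' then \<one> else \<zero>)"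
    "\<And>g s. g \<in> U \<Longrightarrow> s \<in> S \<Longrightarrow> g s = (\<Oplus>t\<in>T. g t \<otimes> e t s)"
  shows "dual_basis U S T e"
  using assms unfolding dual_basis_def by blast

lemma dual_basisD:
  assumes "dual_basis U S T e"
  shows "T \<subseteq> S" "\<And>t. t \<in> T \<Longrightarrow> e t \<in> U"
    "\<And>t t'. t \<in> T \<Longrightarrow> t' \<in> T \<Longrightarrow> e t t' = (if t = t' then \<one> else \<zero>)"
    "\<And>g s. g \<in> U \<Longrightarrow> s \<in> S \<Longrightarrow> g s = (\<Oplus>t\<in>T. g t \<otimes> e t s)"
  using assms unfolding dual_basis_def by blast+

lemma fun_subspaceI:
  assumes "\<And>f i. f \<in> U \<Longrightarrow> f i \<in> carrier R" "(\<lambda>_. \<zero>) \<in> U"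
    "\<And>f g c. f \<in> U \<Longrightarrow> g \<in> U \<Longrightarrow> c \<in> carrier R \<Longrightarrow> (\<lambda>i. f i \<oplus> c \<otimes> g i) \<in> U"
  shows "fun_subspace U"
  using assms by (auto simp: fun_subspace_def)

lemma fun_subspaceD:
  assumes "fun_subspace U"
  shows "f \<in> U \<Longrightarrow> f i \<in> carrier R" "(\<lambda>_. \<zero>) \<in> U"
    "f \<in> U \<Longrightarrow> g \<in> U \<Longrightarrow> c \<in> carrier R \<Longrightarrow> (\<lambda>i. f i \<oplus> c \<otimes> g i) \<in> U"
  using assms by (auto simp: fun_subspace_def)

lemma fun_subspace_finsum:
  assumes "fun_subspace U" "finite K" "\<And>k. k \<in> K \<Longrightarrow> e k \<in> U" "\<And>k. k \<in> K \<Longrightarrow> c k \<in> carrier R"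
  shows "(\<lambda>i. \<Oplus>k\<in>K. c k \<otimes> e k i) \<in> U"
  using assms(2-)
proof (induction K)
  case empty
  then show ?case using fun_subspaceD(2)[OF assms(1)] by simp
next
  case (insert k K)
  note D = fun_subspaceD[OF assms(1)]
  have "(\<lambda>i. (\<Oplus>k\<in>K. c k \<otimes> e k i) \<oplus> c k \<otimes> e k i) \<in> U"
    using insert by (intro D(3)) auto
  moreover have "(\<lambda>i. (\<Oplus>k\<in>K. c k \<otimes> e k i) \<oplus> c k \<otimes> e k i) = (\<lambda>i. \<Oplus>k\<in>insert k K. c k \<otimes> e k i)"
    using insert by (intro ext, subst finsum_insert) (auto simp: Pi_def D(1) intro!: a_comm finsum_closed)
  ultimately show ?case by simp
qed

lemma fun_subspace_smult:
  assumes "fun_subspace U" "f \<in> U" "c \<in> carrier R" shows "(\<lambda>i. c \<otimes> f i) \<in> U"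
proof -
  note D = fun_subspaceD[OF assms(1)]
  have "(\<lambda>i. \<zero> \<oplus> c \<otimes> f i) \<in> U" using D(3)[OF D(2) assms(2,3)] .
  then show ?thesis using D(1) assms by (simp add: D(1)[OF assms(2)])
qed

lemma minus_zero_imp_eq:
  assumes "a \<in> carrier R" "b \<in> carrier R" "a \<ominus> b = \<zero>" shows "a = b"
proof -
  have "a = a \<ominus> b \<oplus> b" using assms(1,2) by (simp add: minus_eq a_assoc l_neg)
  then show ?thesis using assms by simp
qed

lemma fun_subspace_diff:
  assumes "fun_subspace U" "f \<in> U" "g \<in> U" shows "(\<lambda>i. f i \<ominus> g i) \<in> U"
proof -
  note D = fun_subspaceD[OF assms(1)]
  have "(\<lambda>i. f i \<oplus> (\<ominus> \<one>) \<otimes> g i) \<in> U" using D(3)[OF assms(2,3)] by simp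
  moreover have "(\<lambda>i. f i \<oplus> (\<ominus> \<one>) \<otimes> g i) = (\<lambda>i. f i \<ominus> g i)"
    using D(1) assms by (intro ext) (simp add: minus_eq l_minus)
  ultimately show ?thesis by simp
qed

lemma normalize_at:
  assumes "fun_subspace U" "g \<in> U" "g s \<noteq> \<zero>"
  obtains h where "h \<in> U" "h s = \<one>" "\<And>i. g i = \<zero> \<Longrightarrow> h i = \<zero>"
proof
  have c: "g s \<in> Units R" using assms fun_subspaceD(1)[OF assms(1,2)] field_Units by auto
  show "(\<lambda>i. inv (g s) \<otimes> g i) \<in> U"
    using assms c by (intro fun_subspace_smult) auto
  show "inv (g s) \<otimes> g s = \<one>" using c by simp
  show "\<And>i. g i = \<zero> \<Longrightarrow> inv (g s) \<otimes> g i = \<zero>" using c by simp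
qed

text \<open>
  Gaussian elimination, one point at a time. A new point \<open>s\<close> becomes a pivot exactly if some function
  in \<open>U\<close> that vanishes at all earlier pivots does not vanish at \<open>s\<close>.
\<close>
lemma dual_basis_exists:
  assumes "finite S" "fun_subspace U"
  shows "\<exists>T e. dual_basis U S T e"
  using assms(1)
proof (induction S)
  case empty
  have "dual_basis U {} {} (\<lambda>_. undefined)" by (intro dual_basisI) auto
  then show ?case by blast
next
  case (insert s S)
  note D = fun_subspaceD[OF assms(2)]
  obtain T e where Te: "dual_basis U S T e" using insert.IH by blast
  note T = dual_basisD[OF Te]
  have finT: "finite T" using T(1) insert.hyps finite_subset by blast
  have sT: "s \<notin> T" using T(1) insert.hyps by blast
  have red: "(\<lambda>i. g i \<ominus> (\<Oplus>t\<in>T. g t \<otimes> e t i)) \<in> U" if "g \<in> U" for g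
    using that T(2) finT D(1) by (intro fun_subspace_diff assms(2) fun_subspace_finsum) auto
  have redT: "g t \<ominus> (\<Oplus>t'\<in>T. g t' \<otimes> e t' t) = \<zero>" if "g \<in> U" "t \<in> T" for g t
    using T(4)[OF that(1), of t] T(1) that D(1)[OF that(1)] by (metis r_neg minus_eq subsetD)
  show ?case
  proof (cases "\<exists>g\<in>U. (\<forall>t\<in>T. g t = \<zero>) \<and> g s \<noteq> \<zero>")
    case False
    have "g s = (\<Oplus>t\<in>T. g t \<otimes> e t s)" if g: "g \<in> U" for g
    proof -
      have "\<And>k. k \<in> U \<Longrightarrow> (\<forall>t\<in>T. k t = \<zero>) \<Longrightarrow> k s = \<zero>" using False by blast
      from this[OF red[OF g]] have "g s \<ominus> (\<Oplus>t\<in>T. g t \<otimes> e t s) = \<zero>" using redT[OF g] by simp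
      moreover have "(\<Oplus>t\<in>T. g t \<otimes> e t s) \<in> carrier R"
        using D(1)[OF g] D(1)[OF T(2)] by (intro finsum_closed) auto
      ultimately show ?thesis using D(1)[OF g] minus_zero_imp_eq by blast
    qed
    then have "dual_basis U (insert s S) T e" using T by (intro dual_basisI) auto
    then show ?thesis by blast
  next
    case True
    then obtain g where "g \<in> U" "\<forall>t\<in>T. g t = \<zero>" "g s \<noteq> \<zero>" by blast
    then obtain h where h: "h \<in> U" "h s = \<one>" "\<And>t. t \<in> T \<Longrightarrow> h t = \<zero>"
      using normalize_at[OF assms(2), of g s] by metis
    \<comment> \<open>A function vanishing at the old pivots vanishes on all of the old set, so subtracting multiples of it changes nothing there.\<close>
    have hS: "h r = \<zero>" if "r \<in> S" for r
    proof -
      have "(\<Oplus>t\<in>T. h t \<otimes> e t r) = \<zero>" using h(3) D(1)[OF T(2)] by (intro finsum_0I) auto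
      then show ?thesis using T(4)[OF h(1) that] by (rule trans[rotated])
    qed
    define e' where "e' t = (if t = s then h else (\<lambda>i. e t i \<ominus> e t s \<otimes> h i))" for t
    have e'U: "e' t \<in> U" if "t \<in> insert s T" for t
      using that h T(2) D(1)[OF T(2)] unfolding e'_def
      by (auto intro!: fun_subspace_diff fun_subspace_smult assms(2))
    have e'd: "e' t t' = (if t = t' then \<one> else \<zero>)" if "t \<in> insert s T" "t' \<in> insert s T" for t t'
      using that h T(3) D(1)[OF T(2)] sT unfolding e'_def by (auto simp: r_neg minus_eq)
    have exp: "k r = (\<Oplus>t\<in>insert s T. k t \<otimes> e' t r)" if k: "k \<in> U" and r: "r \<in> insert s S" for k r
    proof -
      have cl: "e' t r \<in> carrier R" "e t r \<in> carrier R" if "t \<in> T" for t 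
        using e'U[of t] T(2) that D(1) by auto
      have "(\<Oplus>t\<in>insert s T. k t \<otimes> e' t r) = k s \<otimes> h r \<oplus> (\<Oplus>t\<in>T. k t \<otimes> e' t r)"
        using finT sT cl D(1)[OF k] D(1)[OF h(1)] by (subst finsum_insert) (auto simp: e'_def)
      also have "\<dots> = k r"
      proof (cases "r = s")
        case True
        have "e' t s = \<zero>" if "t \<in> T" for t using e'd[of t s] that sT by auto
        then have "(\<Oplus>t\<in>T. k t \<otimes> e' t s) = \<zero>" using D(1)[OF k] by (simp add: finsum_0I)
        then show ?thesis using True h(2) D(1)[OF k] by simp
      next
        case False
        then have rS: "r \<in> S" using r by simp
        have "(\<Oplus>t\<in>T. k t \<otimes> e' t r) = (\<Oplus>t\<in>T. k t \<otimes> e t r)"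
          using cl D(1)[OF k] D(1)[OF T(2)] sT rS hS
          by (intro finsum_cong') (auto simp: e'_def minus_eq)
        also have "\<dots> = k r" using T(4)[OF k rS] by simp
        finally show ?thesis using hS[OF rS] D(1)[OF k] by simp
      qed
      finally show ?thesis by simp
    qed
    have "insert s T \<subseteq> insert s S" using T(1) by blast
    from dual_basisI[of _ _ e', OF this e'U e'd exp] show ?thesis by blast
  qed
qed

text \<open>
  Fewer equations than unknowns: eliminate one unknown with the first equation that is not trivial.
\<close>
lemma nontrivial_solution:
  assumes "finite E" "finite K" "card E < card K"
    and "\<And>e k. e \<in> E \<Longrightarrow> k \<in> K \<Longrightarrow> m e k \<in> carrier R"
  shows "\<exists>h. (\<forall>k. h k \<in> carrier R) \<and> (\<exists>k\<in>K. h k \<noteq> \<zero>) \<and> (\<forall>e\<in>E. (\<Oplus>k\<in>K. m e k \<otimes> h k) = \<zero>)"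
  using assms
proof (induction E arbitrary: K m)
  case empty
  then show ?case by (intro exI[of _ "\<lambda>_. \<one>"]) (auto simp: card_gt_0_iff)
next
  case (insert e E)
  show ?case
  proof (cases "\<forall>k\<in>K. m e k = \<zero>")
    case True
    have "\<exists>h. (\<forall>k. h k \<in> carrier R) \<and> (\<exists>k\<in>K. h k \<noteq> \<zero>) \<and> (\<forall>e\<in>E. (\<Oplus>k\<in>K. m e k \<otimes> h k) = \<zero>)"
      using insert by (intro insert.IH) auto
    then obtain h where h: "\<forall>k. h k \<in> carrier R" "\<exists>k\<in>K. h k \<noteq> \<zero>" "\<forall>e\<in>E. (\<Oplus>k\<in>K. m e k \<otimes> h k) = \<zero>" by blast
    have "(\<Oplus>k\<in>K. m e k \<otimes> h k) = \<zero>" using True h by (intro finsum_0I) auto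
    with h show ?thesis by (intro exI[of _ h]) auto
  next
    case False
    then obtain p where p: "p \<in> K" "m e p \<noteq> \<zero>" by blast
    have mp: "m e p \<in> Units R" using p insert.prems field_Units by auto
    define q where "q = inv (m e p)"
    have q: "q \<in> carrier R" "m e p \<otimes> q = \<one>" using mp by (auto simp: q_def)
    let ?K = "K - {p}"
    define m' where "m' e' k = m e' k \<ominus> m e' p \<otimes> (q \<otimes> m e k)" for e' k
    note cl = insert.prems(3)
    have "\<exists>h. (\<forall>k. h k \<in> carrier R) \<and> (\<exists>k\<in>?K. h k \<noteq> \<zero>) \<and> (\<forall>e\<in>E. (\<Oplus>k\<in>?K. m' e k \<otimes> h k) = \<zero>)"
      using insert.prems insert.hyps p q by (intro insert.IH) (auto simp: m'_def)
    then obtain h where h: "\<And>k. h k \<in> carrier R" "\<exists>k\<in>?K. h k \<noteq> \<zero>"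
      "\<And>e. e \<in> E \<Longrightarrow> (\<Oplus>k\<in>?K. m' e k \<otimes> h k) = \<zero>" by blast
    define s where "s = (\<Oplus>k\<in>?K. m e k \<otimes> h k)"
    have s: "s \<in> carrier R" unfolding s_def using cl h by (intro finsum_closed) auto
    define h' where "h' = h(p := \<ominus> (q \<otimes> s))"
    have sum: "(\<Oplus>k\<in>K. m e' k \<otimes> h' k) = (\<Oplus>k\<in>?K. m e' k \<otimes> h k) \<ominus> m e' p \<otimes> (q \<otimes> s)"
      if e': "e' \<in> insert e E" for e'
    proof -
      have "(\<Oplus>k\<in>insert p ?K. m e' k \<otimes> h' k) = m e' p \<otimes> h' p \<oplus> (\<Oplus>k\<in>?K. m e' k \<otimes> h' k)"
        using insert.prems p q s h cl e' by (intro finsum_insert) (auto simp: h'_def)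
      also have "(\<Oplus>k\<in>?K. m e' k \<otimes> h' k) = (\<Oplus>k\<in>?K. m e' k \<otimes> h k)"
        using cl h e' by (intro finsum_cong') (auto simp: h'_def)
      finally show ?thesis using p cl e' q s h 
        by (simp add: insert_absorb h'_def r_minus minus_eq a_comm finsum_closed Pi_def)
    qed
    have "(\<Oplus>k\<in>K. m e' k \<otimes> h' k) = \<zero>" if e': "e' \<in> insert e E" for e'
    proof (cases "e' = e")
      case True
      have "m e p \<otimes> (q \<otimes> s) = s" using q s p cl by (simp add: m_assoc[symmetric])
      then show ?thesis using sum[of e] True s by (simp add: s_def[symmetric] minus_eq r_neg)
    next
      case False
      then have eE: "e' \<in> E" using e' by simp
      have "m e' p \<otimes> (q \<otimes> s) = (\<Oplus>k\<in>?K. m e' p \<otimes> (q \<otimes> m e k) \<otimes> h k)"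
        unfolding s_def using q p cl eE h insert.prems
        by (subst finsum_rdistr, force, force, force, subst finsum_rdistr)
          (auto intro!: finsum_cong' simp: m_assoc)
      moreover have "(\<Oplus>k\<in>?K. m' e' k \<otimes> h k) \<oplus> (\<Oplus>k\<in>?K. m e' p \<otimes> (q \<otimes> m e k) \<otimes> h k)
          = (\<Oplus>k\<in>?K. m' e' k \<otimes> h k \<oplus> m e' p \<otimes> (q \<otimes> m e k) \<otimes> h k)"
        using q p cl eE h by (subst finsum_addf) (auto simp: m'_def)
      moreover have "\<dots> = (\<Oplus>k\<in>?K. m e' k \<otimes> h k)"
      proof (intro finsum_cong')
        fix k assume k: "k \<in> ?K"
        have "m' e' k \<otimes> h k \<oplus> m e' p \<otimes> (q \<otimes> m e k) \<otimes> h k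
            = (m' e' k \<oplus> m e' p \<otimes> (q \<otimes> m e k)) \<otimes> h k"
          using q p cl eE h k by (simp add: m'_def l_distr)
        also have "m' e' k \<oplus> m e' p \<otimes> (q \<otimes> m e k) = m e' k"
          using q p cl eE k by (simp add: m'_def minus_eq a_assoc l_neg)
        finally show "m' e' k \<otimes> h k \<oplus> m e' p \<otimes> (q \<otimes> m e k) \<otimes> h k = m e' k \<otimes> h k" .
      qed (use cl eE h in auto)
      ultimately have "m e' p \<otimes> (q \<otimes> s) = (\<Oplus>k\<in>?K. m e' k \<otimes> h k)"
        using h(3)[OF eE] q p cl eE h by (simp add: finsum_closed Pi_def)
      then show ?thesis using sum[OF e'] q p cl eE s m_closed by (metis insertI2 minus_eq r_neg)
    qed
    moreover have "\<exists>k\<in>K. h' k \<noteq> \<zero>" using h(2) by (auto simp: h'_def)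
    moreover have "h' k \<in> carrier R" for k using h q s by (simp add: h'_def)
    ultimately show ?thesis by blast
  qed
qed

text \<open>
  In finite dimension a subspace that no nonzero linear functional annihilates is everything. If a point
  \<open>s\<close> were not a pivot, the expansion of the value at \<open>s\<close> through the pivots would be such a
  functional.
\<close>
lemma separating_imp_all:
  assumes "finite S" "fun_subspace U"
    and sep: "\<And>h. (\<And>s. h s \<in> carrier R) \<Longrightarrow> (\<And>g. g \<in> U \<Longrightarrow> (\<Oplus>s\<in>S. h s \<otimes> g s) = \<zero>) \<Longrightarrow> \<forall>s\<in>S. h s = \<zero>"
    and g: "\<And>s. s \<in> S \<Longrightarrow> g s \<in> carrier R"
  shows "\<exists>f\<in>U. \<forall>s\<in>S. f s = g s"
proof -
  note D = fun_subspaceD[OF assms(2)]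
  obtain T e where Te: "dual_basis U S T e" using dual_basis_exists[OF assms(1,2)] by blast
  note T = dual_basisD[OF Te]
  have finT: "finite T" using T(1) assms(1) finite_subset by blast
  have "S \<subseteq> T"
  proof (rule ccontr)
    assume "\<not> S \<subseteq> T"
    then obtain s where s: "s \<in> S" "s \<notin> T" by blast
    define h where "h r = (if r \<in> T then e r s else if r = s then \<ominus> \<one> else \<zero>)" for r
    have "(\<Oplus>r\<in>S. h r \<otimes> f r) = \<zero>" if f: "f \<in> U" for f
    proof -
      have "(\<Oplus>r\<in>S. h r \<otimes> f r) = (\<Oplus>r\<in>insert s T. h r \<otimes> f r)"
        using assms(1) T(1,2) D(1) s f by (intro finsum_superset) (auto simp: h_def)
      also have "\<dots> = h s \<otimes> f s \<oplus> (\<Oplus>r\<in>T. h r \<otimes> f r)"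
        using finT s D(1) T(2) f by (intro finsum_insert) (auto simp: h_def)
      also have "(\<Oplus>r\<in>T. h r \<otimes> f r) = f s"
        unfolding T(4)[OF f s(1)] using D(1) T(2) f by (intro finsum_cong') (auto simp: h_def m_comm)
      finally show ?thesis using s D(1)[OF f] by (simp add: h_def l_minus l_neg)
    qed
    moreover have "h r \<in> carrier R" for r using D(1) T(2) by (simp add: h_def)
    ultimately have "h s = \<zero>" using sep s by blast
    then show False using s by (simp add: h_def)
  qed
  then have TS: "T = S" using T(1) by blast
  have "(\<lambda>i. \<Oplus>t\<in>T. g t \<otimes> e t i) \<in> U"
    using finT T(2) g TS by (intro fun_subspace_finsum assms(2)) auto
  moreover have "(\<Oplus>t\<in>T. g t \<otimes> e t s) = g s" if "s \<in> S" for s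
  proof -
    have "(\<Oplus>t\<in>T. g t \<otimes> e t s) = g s \<otimes> e s s"
      using finT TS T(3) that g by (intro finsum_only) auto
    then show ?thesis using T(3)[of s s] TS that g by simp
  qed
  ultimately show ?thesis by (intro bexI[of _ "\<lambda>i. \<Oplus>t\<in>T. g t \<otimes> e t i"]) auto
qed

text \<open>
  A descending chain of subspaces becomes stationary after restriction to a finite set, as the
  restrictions have finite dimension. This is what makes Zorn's lemma applicable to spaces that have to
  stay nonzero in every degree. The induction removes a point \<open>w\<close>: the subspaces of functions vanishing
  at \<open>w\<close> stabilize by induction, and the value at \<open>w\<close> is handled by one more function.
\<close>
lemma chain_of_subspaces_has_least_restriction:
  assumes "finite S" "\<C> \<noteq> {}" "\<And>C. C \<in> \<C> \<Longrightarrow> fun_subspace C"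
    "\<And>C C'. C \<in> \<C> \<Longrightarrow> C' \<in> \<C> \<Longrightarrow> C \<subseteq> C' \<or> C' \<subseteq> C"
  shows "\<exists>C\<in>\<C>. \<forall>C'\<in>\<C>. \<forall>f\<in>C. \<exists>f'\<in>C'. \<forall>s\<in>S. f s = f' s"
  using assms
proof (induction S arbitrary: \<C>)
  case empty
  then show ?case using fun_subspaceD(2) by (metis all_not_in_conv empty_iff)
next
  case (insert w S)
  let ?Z = "\<lambda>C. {f \<in> C. f w = \<zero>}"
  have sub: "fun_subspace (?Z C)" if "C \<in> \<C>" for C
    using fun_subspaceD[OF insert.prems(2)[OF that]] by (intro fun_subspaceI) auto
  have "\<exists>D\<in>?Z ` \<C>. \<forall>C'\<in>?Z ` \<C>. \<forall>f\<in>D. \<exists>f'\<in>C'. \<forall>s\<in>S. f s = f' s"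
    using insert.prems(1) sub insert.prems(3) by (intro insert.IH) (simp, blast, blast)
  then obtain C1 where C1: "C1 \<in> \<C>"
    "\<And>C' f. C' \<in> \<C> \<Longrightarrow> f \<in> C1 \<Longrightarrow> f w = \<zero> \<Longrightarrow> \<exists>f'\<in>C'. f' w = \<zero> \<and> (\<forall>s\<in>S. f s = f' s)" by fastforce
  have "\<exists>C\<in>\<C>. C \<subseteq> C1 \<and> ((\<forall>f\<in>C. f w = \<zero>) \<or> (\<forall>C'\<in>\<C>. \<exists>g\<in>C'. g w \<noteq> \<zero>))"
    using C1(1) insert.prems(3) by (metis (no_types, lifting) subset_iff)
  then obtain C where C: "C \<in> \<C>" "C \<subseteq> C1" "(\<forall>f\<in>C. f w = \<zero>) \<or> (\<forall>C'\<in>\<C>. \<exists>g\<in>C'. g w \<noteq> \<zero>)" by blast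
  show ?case
  proof (intro bexI[OF _ C(1)] ballI)
    fix C' f assume C': "C' \<in> \<C>" and f: "f \<in> C"
    note D = fun_subspaceD[OF insert.prems(2)[OF C']] and D0 = fun_subspaceD[OF insert.prems(2)[OF C(1)]]
    show "\<exists>f'\<in>C'. \<forall>s\<in>insert w S. f s = f' s"
    proof (cases "C \<subseteq> C' \<or> f w = \<zero>")
      case True
      then consider "f \<in> C'" | "f w = \<zero>" using f by blast
      then show ?thesis
      proof cases
        case 2
        then obtain f' where "f' \<in> C'" "f' w = \<zero>" "\<forall>s\<in>S. f s = f' s"
          using C1(2)[OF C', of f] f C(2) by blast
        then show ?thesis using 2 by (intro bexI[of _ f']) auto
      qed blast
    next
      case False
      then have sub: "C' \<subseteq> C" using insert.prems(3)[OF C' C(1)] by blast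
      obtain g where "g \<in> C'" "g w \<noteq> \<zero>" using C(3) f False C' by blast
      then obtain h where h: "h \<in> C'" "h w = \<one>"
        using normalize_at[OF insert.prems(2)[OF C'], of g w] by metis
      have "(\<lambda>i. f i \<ominus> f w \<otimes> h i) \<in> C"
        using f h sub D0 C by (intro fun_subspace_diff fun_subspace_smult insert.prems(2)) auto
      moreover have "f w \<ominus> f w \<otimes> h w = \<zero>" using h D0(1)[OF f] by (simp add: minus_eq r_neg)
      ultimately obtain f' where f': "f' \<in> C'" "f' w = \<zero>" "\<And>s. s \<in> S \<Longrightarrow> f s \<ominus> f w \<otimes> h s = f' s"
        using C1(2)[OF C'] C(2) by blast
      show ?thesis
      proof (intro bexI ballI)
        show "(\<lambda>i. f' i \<oplus> f w \<otimes> h i) \<in> C'" using f' h D(3) D0(1)[OF f] by auto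
        fix s assume "s \<in> insert w S"
        moreover have "f s = f s \<ominus> f w \<otimes> h s \<oplus> f w \<otimes> h s"
          using D0(1)[OF f] D(1)[OF h(1)] by (simp add: minus_eq a_assoc l_neg)
        ultimately show "f s = f' s \<oplus> f w \<otimes> h s"
          using f' h D0(1)[OF f] by auto
      qed
    qed
  qed
qed

end

section \<open>The Golod-Shafarevich inequality\<close>

definition words :: "nat \<Rightarrow> bool list set" where "words n = {w. length w = n}"

lemma words_iff [simp]: "w \<in> words n \<longleftrightarrow> length w = n" by (simp add: words_def)

lemma finite_words [simp, intro]: "finite (words n)"
  using finite_lists_length_eq[of "UNIV :: bool set" n] by (simp add: words_def)

context field begin
lemma finsum_closed': "(\<And>i. i \<in> A \<Longrightarrow> f i \<in> carrier R) \<Longrightarrow> finsum R f A \<in> carrier R"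
  by (intro finsum_closed) auto
end

text \<open>
  Words in two letters are lists of booleans. A relation is a finite set of lists of words and stands for
  the homogeneous element \<open>\<Sum>l\<in>r. concat l\<close> of the free algebra; different lists may have the same
  concatenation, which is why a relation is not simply a set of words.
\<close>
locale homogeneous_relations = field R for R (structure) +
  fixes Rel :: "bool list list set set" and dg :: "bool list list set \<Rightarrow> nat"
  assumes finite_rel: "r \<in> Rel \<Longrightarrow> finite r"
    and dg: "r \<in> Rel \<Longrightarrow> l \<in> r \<Longrightarrow> length (concat l) = dg r"
    and dg_pos: "r \<in> Rel \<Longrightarrow> 0 < dg r"
    and finite_dg: "finite {r \<in> Rel. dg r \<le> n}"
begin

text \<open>
  The linear functionals on the free algebra that annihilate the two-sided ideal generated by the
  relations; \<open>AnnH n\<close> is the dual of the component of degree \<open>n\<close> of the quotient algebra.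
\<close>
definition Ann :: "(bool list \<Rightarrow> 'a) set" where
  "Ann = {f. (\<forall>w. f w \<in> carrier R) \<and> (\<forall>r\<in>Rel. \<forall>w w'. (\<Oplus>l\<in>r. f (w @ concat l @ w')) = \<zero>)}"

definition AnnH :: "nat \<Rightarrow> (bool list \<Rightarrow> 'a) set" where
  "AnnH n = {f \<in> Ann. \<forall>w. length w \<noteq> n \<longrightarrow> f w = \<zero>}"

lemma AnnD: "f \<in> Ann \<Longrightarrow> f w \<in> carrier R" "f \<in> Ann \<Longrightarrow> r \<in> Rel \<Longrightarrow> (\<Oplus>l\<in>r. f (w @ concat l @ w')) = \<zero>"
  by (auto simp: Ann_def)

lemma AnnHI:
  assumes "\<And>w. f w \<in> carrier R" "\<And>r w w'. r \<in> Rel \<Longrightarrow> (\<Oplus>l\<in>r. f (w @ concat l @ w')) = \<zero>"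
    "\<And>w. length w \<noteq> n \<Longrightarrow> f w = \<zero>"
  shows "f \<in> AnnH n"
  using assms by (auto simp: AnnH_def Ann_def)

lemma Ann_subspace: "fun_subspace Ann"
proof (intro fun_subspaceI)
  fix f g c assume fg: "f \<in> Ann" "g \<in> Ann" "c \<in> carrier R"
  have "(\<Oplus>l\<in>r. f (w @ concat l @ w') \<oplus> c \<otimes> g (w @ concat l @ w')) = \<zero>" if r: "r \<in> Rel" for r w w'
  proof -
    have "(\<Oplus>l\<in>r. f (w @ concat l @ w') \<oplus> c \<otimes> g (w @ concat l @ w'))
       = (\<Oplus>l\<in>r. f (w @ concat l @ w')) \<oplus> (\<Oplus>l\<in>r. c \<otimes> g (w @ concat l @ w'))"
      using AnnD(1) fg by (intro finsum_addf) auto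
    also have "(\<Oplus>l\<in>r. c \<otimes> g (w @ concat l @ w')) = c \<otimes> (\<Oplus>l\<in>r. g (w @ concat l @ w'))"
      using AnnD(1) fg finite_rel[OF r] by (subst finsum_rdistr) auto
    finally show ?thesis using AnnD(2)[OF fg(1) r] AnnD(2)[OF fg(2) r] fg by simp
  qed
  moreover have "f w \<oplus> c \<otimes> g w \<in> carrier R" for w using AnnD(1)[OF fg(1)] AnnD(1)[OF fg(2)] fg(3) by simp
  ultimately show "(\<lambda>i. f i \<oplus> c \<otimes> g i) \<in> Ann" unfolding Ann_def by blast
qed (auto simp: Ann_def intro!: finsum_0I)

lemma AnnH_subspace: "fun_subspace (AnnH n)"
proof (rule fun_subspaceI)
  fix f g c assume "f \<in> AnnH n" "g \<in> AnnH n" "c \<in> carrier R"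
  then show "(\<lambda>i. f i \<oplus> c \<otimes> g i) \<in> AnnH n"
    using fun_subspaceD(3)[OF Ann_subspace, of f g c] by (simp add: AnnH_def)
qed (use fun_subspaceD(2)[OF Ann_subspace] in \<open>auto simp: AnnH_def Ann_def\<close>)

lemma Ann_shift_left: "f \<in> Ann \<Longrightarrow> (\<lambda>w. f (u @ w)) \<in> Ann"
  using AnnD(2)[of f _ "u @ _"] by (auto simp: Ann_def)

lemma Ann_shift_right: "f \<in> Ann \<Longrightarrow> (\<lambda>w. f (w @ u)) \<in> Ann"
  using AnnD(2)[of f _ _ "_ @ u"] by (auto simp: Ann_def)

lemma Ann_truncate: 
  assumes f: "f \<in> Ann" shows "(\<lambda>w. if length w = n then f w else \<zero>) \<in> Ann"
proof -
  have "(\<Oplus>l\<in>r. if length (w @ concat l @ w') = n then f (w @ concat l @ w') else \<zero>) = \<zero>"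
    if r: "r \<in> Rel" for r w w'
  proof (cases "length w + dg r + length w' = n")
    case True
    then have "(\<Oplus>l\<in>r. if length (w @ concat l @ w') = n then f (w @ concat l @ w') else \<zero>)
      = (\<Oplus>l\<in>r. f (w @ concat l @ w'))"
      using dg[OF r] AnnD(1)[OF f] by (intro finsum_cong') (auto simp: add.assoc)
    then show ?thesis using AnnD(2)[OF f r] by simp
  next
    case False
    then show ?thesis using dg[OF r] by (intro finsum_0I) (auto simp: add.assoc)
  qed
  then show ?thesis using AnnD(1)[OF f] by (auto simp: Ann_def)
qed

text \<open>
  A set of words of length \<open>n\<close> that forms a basis of the quotient algebra in degree \<open>n\<close>; its
  cardinality is the dimension of that component.
\<close>
definition basis_words :: "nat \<Rightarrow> bool list set" where
  "basis_words n = (SOME T. \<exists>e. dual_basis (AnnH n) (words n) T e)"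

lemma basis_words: "\<exists>e. dual_basis (AnnH n) (words n) (basis_words n) e"
  unfolding basis_words_def
  by (rule someI_ex[of "\<lambda>T. \<exists>e. dual_basis (AnnH n) (words n) T e"])
    (rule dual_basis_exists[OF finite_words AnnH_subspace])

lemma finite_basis_words [simp]: "finite (basis_words n)"
proof -
  from basis_words[of n] obtain e where "dual_basis (AnnH n) (words n) (basis_words n) e" ..
  from dual_basisD(1)[OF this] show ?thesis using finite_words finite_subset by blast
qed

lemma AnnH_zeroI:
  assumes "f \<in> AnnH n" "\<And>t. t \<in> basis_words n \<Longrightarrow> f t = \<zero>" shows "f w = \<zero>"
proof (cases "length w = n")
  case True
  from basis_words[of n] obtain e where e: "dual_basis (AnnH n) (words n) (basis_words n) e" ..
  have "f w = (\<Oplus>t\<in>basis_words n. f t \<otimes> e t w)" using True by (intro dual_basisD(4)[OF e assms(1)]) simp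
  also have "\<dots> = \<zero>"
  proof (rule finsum_0I)
    fix t assume t: "t \<in> basis_words n"
    have "e t w \<in> carrier R" by (rule fun_subspaceD(1)[OF AnnH_subspace dual_basisD(2)[OF e t]])
    then show "f t \<otimes> e t w = \<zero>" using assms(2)[OF t] by simp
  qed
  finally show ?thesis .
qed (use assms(1) in \<open>auto simp: AnnH_def\<close>)

text \<open>
  With \<open>u n\<close> the dimension of the quotient in degree \<open>n\<close>, this is
  \<open>2 * u n \<le> u (n + 1) + (\<Sum>r. u (n + 1 - dg r))\<close>. A pair of functionals of degree \<open>n\<close>, one for each last
  letter, glues to a function \<open>F\<close> on words of length \<open>n + 1\<close>. Such an \<open>F\<close> annihilates every multiple of a
  relation that ends in a further letter, so it lies in the annihilator as soon as
  \<open>\<lambda>w. \<Sum>l\<in>r. F (w @ concat l)\<close> vanishes for each relation \<open>r\<close>. That function is itself an annihilating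
  functional of degree \<open>n + 1 - dg r\<close>, hence it vanishes after \<open>u (n + 1 - dg r)\<close> linear conditions, and then
  \<open>u (n + 1)\<close> more conditions force \<open>F = 0\<close>. If the inequality failed, there would be fewer conditions than
  unknowns, and some nonzero pair would glue to zero, which is absurd.
\<close>
lemma golod_shafarevich_inequality:
  "2 * card (basis_words n) \<le> card (basis_words (Suc n)) +
     (\<Sum>r | r \<in> Rel \<and> dg r \<le> Suc n. card (basis_words (Suc n - dg r)))"
proof (rule ccontr)
  assume neg: "\<not> ?thesis"
  from basis_words[of n] obtain e where e: "dual_basis (AnnH n) (words n) (basis_words n) e" ..
  note eD = dual_basisD[OF e]
  have ecl: "e t w \<in> carrier R" if "t \<in> basis_words n" for t w
    using fun_subspaceD(1)[OF AnnH_subspace] eD(2) that by blast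
  define Rs where "Rs = {r \<in> Rel. dg r \<le> Suc n}"
  have finRs: "finite Rs" using finite_dg by (simp add: Rs_def)
  \<comment> \<open>The equations: the first summand forces F to vanish, the second one forces F to annihilate the relations.\<close>
  define E where "E = basis_words (Suc n) <+> Sigma Rs (\<lambda>r. basis_words (Suc n - dg r))"
  \<comment> \<open>The unknowns: coordinates of the pair of functionals; G lists the corresponding functions of degree n + 1.\<close>
  define K where "K = basis_words n \<times> (UNIV :: bool set)"
  define G where "G = (\<lambda>(t, a) w. if w \<noteq> [] \<and> last w = a then e t (butlast w) else \<zero>)"
  define m where "m x k = (case x of Inl w \<Rightarrow> G k w | Inr (r, w) \<Rightarrow> \<Oplus>l\<in>r. G k (w @ concat l))"
    for x :: "bool list + (bool list list set \<times> bool list)" and k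
  have Gcl: "G k w \<in> carrier R" if "k \<in> K" for k w
    using that ecl by (auto simp: G_def K_def split: prod.splits)
  have finK: "finite K" by (simp add: K_def)
  have "\<exists>h. (\<forall>k. h k \<in> carrier R) \<and> (\<exists>k\<in>K. h k \<noteq> \<zero>) \<and> (\<forall>x\<in>E. (\<Oplus>k\<in>K. m x k \<otimes> h k) = \<zero>)"
  proof (rule nontrivial_solution)
    show "finite E" using finRs by (auto simp: E_def)
    have "card E = card (basis_words (Suc n)) + (\<Sum>r\<in>Rs. card (basis_words (Suc n - dg r)))"
      unfolding E_def using finRs by (subst card_Plus) (auto simp: card_SigmaI)
    moreover have "card K = 2 * card (basis_words n)" by (simp add: K_def card_cartesian_product)
    ultimately show "card E < card K" using neg by (simp add: Rs_def)
    show "m x k \<in> carrier R" if "x \<in> E" "k \<in> K" for x k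
      using that Gcl by (auto simp: m_def intro!: finsum_closed' split: sum.splits)
  qed (rule finK)
  then obtain h where h: "\<And>k. h k \<in> carrier R" "\<exists>k\<in>K. h k \<noteq> \<zero>"
    "\<And>x. x \<in> E \<Longrightarrow> (\<Oplus>k\<in>K. m x k \<otimes> h k) = \<zero>" by blast
  define F where "F w = (\<Oplus>k\<in>K. G k w \<otimes> h k)" for w
  have Fcl: "F w \<in> carrier R" for w unfolding F_def using Gcl h(1) by (intro finsum_closed') auto
  have Fsnoc: "F (w @ [a]) = (\<Oplus>t\<in>basis_words n. h (t, a) \<otimes> e t w)" for w a
  proof -
    have "F (w @ [a]) = (\<Oplus>k\<in>(\<lambda>t. (t, a)) ` basis_words n. G k (w @ [a]) \<otimes> h k)"
      unfolding F_def
    proof (rule finsum_superset[OF finK])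
      show "(\<lambda>t. (t, a)) ` basis_words n \<subseteq> K" by (auto simp: K_def)
      show "G k (w @ [a]) \<otimes> h k \<in> carrier R" if "k \<in> (\<lambda>t. (t, a)) ` basis_words n" for k
        using that h(1) Gcl[of k] by (auto simp: K_def)
      show "G k (w @ [a]) \<otimes> h k = \<zero>" if "k \<in> K - (\<lambda>t. (t, a)) ` basis_words n" for k
        using that h(1) by (auto simp: K_def G_def)
    qed
    also have "\<dots> = (\<Oplus>t\<in>basis_words n. G (t, a) (w @ [a]) \<otimes> h (t, a))"
    proof (rule finsum_reindex)
      show "(\<lambda>k. G k (w @ [a]) \<otimes> h k) \<in> (\<lambda>t. (t, a)) ` basis_words n \<rightarrow> carrier R"
        using h(1) Gcl by (auto simp: K_def)
    qed (auto simp: inj_on_def)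
    also have "\<dots> = (\<Oplus>t\<in>basis_words n. h (t, a) \<otimes> e t w)"
      using ecl h(1) by (intro finsum_cong') (auto simp: G_def m_comm)
    finally show ?thesis .
  qed
  have Fa: "(\<lambda>w. F (w @ [a])) \<in> AnnH n" for a
    unfolding Fsnoc using eD(2) h(1) by (intro fun_subspace_finsum AnnH_subspace) auto
  have F0: "F w = \<zero>" if "length w \<noteq> Suc n" for w
  proof (cases w rule: rev_cases)
    case Nil
    then show ?thesis unfolding F_def using h(1) by (intro finsum_0I) (auto simp: G_def K_def)
  next
    case (snoc v a)
    then show ?thesis using Fa[of a] that by (auto simp: AnnH_def)
  qed
  have rel1: "(\<Oplus>l\<in>r. F (w @ concat l @ v @ [a])) = \<zero>" if "r \<in> Rel" for r w v a
    using AnnD(2)[of "\<lambda>w. F (w @ [a])" r w v] Fa[of a] that by (auto simp: AnnH_def)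
  have rel0: "(\<Oplus>l\<in>r. F (w @ concat l)) = \<zero>" if r: "r \<in> Rel" for r w
  proof (cases "dg r \<le> Suc n")
    case False
    then show ?thesis using F0 dg[OF r] by (intro finsum_0I) auto
  next
    case True
    let ?g = "\<lambda>w. \<Oplus>l\<in>r. F (w @ concat l)"
    have mem: "?g \<in> AnnH (Suc n - dg r)"
    proof (rule AnnHI)
      show "?g w \<in> carrier R" for w using Fcl by (intro finsum_closed') auto
      show "?g w = \<zero>" if "length w \<noteq> Suc n - dg r" for w
        using that True dg[OF r] by (intro finsum_0I F0) auto
      fix r' w w' assume r': "r' \<in> Rel"
      have "(\<Oplus>l'\<in>r'. \<Oplus>l\<in>r. F ((w @ concat l' @ w') @ concat l))
         = (\<Oplus>l\<in>r. \<Oplus>l'\<in>r'. F ((w @ concat l' @ w') @ concat l))"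
        using finite_rel r r' Fcl by (intro finsum_swap) auto
      also have "\<dots> = \<zero>"
      proof (rule finsum_0I)
        fix l assume l: "l \<in> r"
        then have "concat l \<noteq> []" using dg[OF r l] dg_pos[OF r] by (metis length_0_conv less_irrefl)
        then obtain v a where "concat l = v @ [a]" by (cases "concat l" rule: rev_cases) auto
        then show "(\<Oplus>l'\<in>r'. F ((w @ concat l' @ w') @ concat l)) = \<zero>"
          using rel1[OF r', of w "w' @ v" a] by simp
      qed
      finally show "(\<Oplus>l'\<in>r'. ?g (w @ concat l' @ w')) = \<zero>" .
    qed
    have "?g t = \<zero>" if t: "t \<in> basis_words (Suc n - dg r)" for t
    proof -
      have "?g t = (\<Oplus>l\<in>r. \<Oplus>k\<in>K. G k (t @ concat l) \<otimes> h k)" by (simp only: F_def)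
      also have "\<dots> = (\<Oplus>k\<in>K. \<Oplus>l\<in>r. G k (t @ concat l) \<otimes> h k)"
        by (rule finsum_swap[OF finite_rel[OF r] finK]) (simp add: Gcl h(1))
      also have "\<dots> = (\<Oplus>k\<in>K. m (Inr (r, t)) k \<otimes> h k)"
      proof (rule finsum_cong'[OF refl])
        fix k assume k: "k \<in> K"
        have "(\<Oplus>l\<in>r. G k (t @ concat l) \<otimes> h k) = (\<Oplus>l\<in>r. G k (t @ concat l)) \<otimes> h k"
          using Gcl k h(1) by (intro finsum_ldistr[symmetric] finite_rel r) auto
        then show "(\<Oplus>l\<in>r. G k (t @ concat l) \<otimes> h k) = m (Inr (r, t)) k \<otimes> h k"
          by (simp add: m_def)
      next
        show "(\<lambda>k. m (Inr (r, t)) k \<otimes> h k) \<in> K \<rightarrow> carrier R"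
          using Gcl h(1) by (auto simp: m_def intro!: finsum_closed')
      qed
      also have "\<dots> = \<zero>" using h(3)[of "Inr (r, t)"] t r True by (auto simp: E_def Rs_def)
      finally show ?thesis .
    qed
    then show ?thesis by (rule AnnH_zeroI[OF mem])
  qed
  have "F \<in> AnnH (Suc n)"
  proof (rule AnnHI[OF Fcl _ F0])
    fix r w w' assume r: "r \<in> Rel"
    show "(\<Oplus>l\<in>r. F (w @ concat l @ w')) = \<zero>"
      using rel0[OF r, of w] rel1[OF r, of w] by (cases w' rule: rev_cases) auto
  qed
  moreover have "F t = \<zero>" if "t \<in> basis_words (Suc n)" for t
    using h(3)[of "Inl t"] that unfolding F_def by (simp add: E_def m_def InlI)
  ultimately have Fz: "F w = \<zero>" for w by (rule AnnH_zeroI)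
  obtain t a where ta: "t \<in> basis_words n" "h (t, a) \<noteq> \<zero>" using h(2) by (auto simp: K_def)
  have "F (t @ [a]) = h (t, a) \<otimes> e t t"
    unfolding Fsnoc using ta(1) h(1) eD(3) by (intro finsum_only) auto
  then show False using Fz ta eD(3) h(1) by simp
qed

text \<open>
  If the relations are so sparse that their weights \<open>(2/3) ^ dg r\<close> sum to at most 1/3, the inequality gives
  \<open>u (n + 1) \<ge> 3/2 * u n\<close> by induction, so the quotient algebra is nonzero in every degree.
\<close>
lemma Ann_nonzero:
  assumes small: "\<And>n. (\<Sum>r | r \<in> Rel \<and> dg r \<le> n. (2/3::real) ^ dg r) \<le> 1/3"
  shows "\<exists>f\<in>Ann. \<exists>w. length w = n \<and> f w \<noteq> \<zero>"
proof -
  define u where "u n = real (card (basis_words n))" for n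
  have growth: "u j \<le> (2/3) ^ (n - j) * u n" if "j \<le> n" for j n
    using that
  proof (induction n arbitrary: j)
    case 0
    then show ?case by simp
  next
    case (Suc n)
    let ?R = "{r. r \<in> Rel \<and> dg r \<le> Suc n}"
    have "real (2 * card (basis_words n)) \<le> real (card (basis_words (Suc n)) +
       (\<Sum>r\<in>?R. card (basis_words (Suc n - dg r))))"
      using golod_shafarevich_inequality[of n] by (simp only: of_nat_le_iff)
    then have "2 * u n \<le> u (Suc n) + (\<Sum>r\<in>?R. u (Suc n - dg r))" by (simp add: u_def)
    also have "(\<Sum>r\<in>?R. u (Suc n - dg r)) \<le> (\<Sum>r\<in>?R. (2/3) ^ dg r * (3/2 * u n))"
    proof (intro sum_mono)
      fix r assume r: "r \<in> ?R"
      then obtain d where d: "dg r = Suc d" using dg_pos[of r] gr0_implies_Suc by blast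
      have "u (n - d) \<le> (2/3) ^ (n - (n - d)) * u n" using r d by (intro Suc.IH) auto
      then show "u (Suc n - dg r) \<le> (2/3) ^ dg r * (3/2 * u n)" using r d by (simp add: mult.commute)
    qed
    also have "\<dots> = (\<Sum>r\<in>?R. (2/3) ^ dg r) * (3/2 * u n)" by (rule sum_distrib_right[symmetric])
    also have "\<dots> \<le> 1/3 * (3/2 * u n)"
      using small by (intro mult_right_mono) (auto simp: u_def)
    finally have step: "u n \<le> 2/3 * u (Suc n)" by simp
    show ?case
    proof (cases "j = Suc n")
      case False
      then have j: "j \<le> n" using Suc.prems by simp
      have "u j \<le> (2/3) ^ (n - j) * u n" using Suc.IH[OF j] .
      also have "\<dots> \<le> (2/3) ^ (n - j) * (2/3 * u (Suc n))" using step by (intro mult_left_mono) auto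
      finally show ?thesis using j by (simp add: Suc_diff_le)
    qed simp
  qed
  define d where "d w = (if w = [] then \<one> else \<zero>)" for w :: "bool list"
  have "d \<in> AnnH 0"
  proof (rule AnnHI)
    fix r w w' assume r: "r \<in> Rel"
    have "concat l \<noteq> []" if "l \<in> r" for l
      using dg[OF r that] dg_pos[OF r] by (metis length_0_conv less_irrefl)
    then have "d (w @ concat l @ w') = \<zero>" if "l \<in> r" for l using that unfolding d_def by (metis append_is_Nil_conv)
    then show "(\<Oplus>l\<in>r. d (w @ concat l @ w')) = \<zero>" by (rule finsum_0I)
  qed (auto simp: d_def)
  then have "basis_words 0 \<noteq> {}" using AnnH_zeroI[of d 0 "[]"] by (auto simp: d_def)
  then have "0 < card (basis_words 0)" by (simp add: card_gt_0_iff)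
  then have "0 < u 0" by (simp add: u_def)
  then have "0 < (2/3) ^ n * u n" using growth[of 0 n] by simp
  then have "0 < u n" by (simp add: zero_less_mult_iff)
  then obtain t where t: "t \<in> basis_words n" by (auto simp: u_def card_gt_0_iff)
  from basis_words[of n] obtain e where e: "dual_basis (AnnH n) (words n) (basis_words n) e" ..
  have "e t \<in> Ann" "length t = n" "e t t \<noteq> \<zero>"
    using dual_basisD(1)[OF e] dual_basisD(2)[OF e t] dual_basisD(3)[OF e t t] t
    by (auto simp: AnnH_def)
  then show ?thesis by blast
qed

end

section \<open>Relations that make a graded algebra nil\<close>

definition short_words :: "nat \<Rightarrow> bool list set" where
  "short_words D = {w. w \<noteq> [] \<and> length w \<le> D}"

lemma finite_short_words [simp, intro]: "finite (short_words D)"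
  using finite_lists_length_le[of "UNIV :: bool set" D]
  by (rule finite_subset[rotated]) (auto simp: short_words_def)

text \<open>
  The number of multisets of size \<open>m\<close> over \<open>q\<close> words is polynomial in \<open>m\<close>. So the total weight of the
  corresponding relations, all of degree at least \<open>m\<close>, can be made as small as desired.
\<close>
lemma exponential_beats_power: "\<exists>m>D. real ((m + 1) ^ q) * (2/3) ^ m \<le> 1/6 * (1/2) ^ D"
proof -
  \<comment> \<open>Splitting 2/3 into equal factors reduces the claim to m * y ^ m \<longlonglongrightarrow> 0.\<close>
  define y where "y = root (Suc q) (2/3)"
  have y: "0 \<le> y" "y < 1" "y ^ Suc q = 2/3"
    using real_root_pow_pos2[of "Suc q" "2/3"] by (simp_all only: y_def) auto
  have "(\<lambda>m. (real m * y ^ m + y ^ m) ^ Suc q) \<longlonglongrightarrow> (0 + 0) ^ Suc q"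
    using y by (intro tendsto_power tendsto_add powser_times_n_limit_0 LIMSEQ_realpow_zero) auto
  moreover have "(real m * y ^ m + y ^ m) ^ Suc q = real ((m + 1) ^ Suc q) * (2/3) ^ m" for m
  proof -
    have "real m * y ^ m + y ^ m = real (m + 1) * y ^ m" by (simp add: algebra_simps)
    moreover have "(y ^ m) ^ Suc q = (2/3) ^ m" unfolding y(3)[symmetric] power_mult[symmetric] by (simp only: mult.commute)
    ultimately show ?thesis by (simp only: power_mult_distrib of_nat_power)
  qed
  ultimately have lim: "(\<lambda>m. real ((m + 1) ^ Suc q) * (2/3) ^ m) \<longlonglongrightarrow> 0" by simp
  have "(\<lambda>m. real ((m + 1) ^ q) * (2/3) ^ m) \<longlonglongrightarrow> 0"
    by (rule tendsto_sandwich[OF _ _ tendsto_const lim])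
      (auto intro!: always_eventually mult_right_mono simp flip: of_nat_Suc of_nat_power)
  then have "eventually (\<lambda>m. real ((m + 1) ^ q) * (2/3) ^ m < 1/6 * (1/2) ^ D) sequentially"
    by (rule order_tendstoD) simp
  moreover have "eventually (\<lambda>m. m > D) sequentially" by (rule eventually_gt_at_top)
  ultimately have "eventually (\<lambda>m. m > D \<and> real ((m + 1) ^ q) * (2/3) ^ m < 1/6 * (1/2) ^ D) sequentially"
    by eventually_elim simp
  then obtain m where "m > D \<and> real ((m + 1) ^ q) * (2/3) ^ m < 1/6 * (1/2) ^ D"
    using eventually_happens'[OF sequentially_bot] by blast
  then show ?thesis by (intro exI[of _ m]) auto
qed

definition multisets_of_size :: "'x set \<Rightarrow> nat \<Rightarrow> 'x multiset set" where
  "multisets_of_size W m = {\<mu>. set_mset \<mu> \<subseteq> W \<and> size \<mu> = m}"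

lemma multisets_of_size_bound:
  assumes "finite W"
  shows "finite (multisets_of_size W m)" "card (multisets_of_size W m) \<le> (m + 1) ^ card W"
proof -
  let ?f = "\<lambda>\<mu>. restrict (count \<mu>) W" and ?P = "W \<rightarrow>\<^sub>E {..m}"
  have inj: "inj_on ?f (multisets_of_size W m)"
  proof (intro inj_onI multiset_eqI)
    fix \<mu> \<nu> x assume *: "\<mu> \<in> multisets_of_size W m" "\<nu> \<in> multisets_of_size W m" "?f \<mu> = ?f \<nu>"
    show "count \<mu> x = count \<nu> x"
    proof (cases "x \<in> W")
      case True then show ?thesis using fun_cong[OF *(3), of x] by simp
    next
      case False
      then have "x \<notin># \<mu>" "x \<notin># \<nu>" using * by (auto simp: multisets_of_size_def)
      then show ?thesis by (simp add: not_in_iff)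
    qed
  qed
  have sub: "?f ` multisets_of_size W m \<subseteq> ?P"
    by (auto simp: multisets_of_size_def count_le_size)
  have finP: "finite ?P" using assms by (intro finite_PiE) auto
  show "finite (multisets_of_size W m)" using inj sub finP by (meson inj_on_finite)
  have "card (multisets_of_size W m) \<le> card ?P" using inj sub finP by (rule card_inj_on_le)
  also have "\<dots> = (m + 1) ^ card W" using assms by (simp add: card_PiE)
  finally show "card (multisets_of_size W m) \<le> (m + 1) ^ card W" .
qed

definition nil_exponent :: "nat \<Rightarrow> nat" where
  "nil_exponent D = (SOME m. m > D \<and>
     real ((m + 1) ^ card (short_words D)) * (2/3) ^ m \<le> 1/6 * (1/2) ^ D)"

lemma nil_exponent: "nil_exponent D > D"
  "real ((nil_exponent D + 1) ^ card (short_words D)) * (2/3) ^ nil_exponent D \<le> 1/6 * (1/2) ^ D"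
  using someI_ex[OF exponential_beats_power[of D "card (short_words D)"]]
  unfolding nil_exponent_def by auto

text \<open>
  Let \<open>p\<close> be a combination of the words of length 1 to \<open>D\<close> with scalar coefficients. Expanding \<open>p ^ m\<close> and
  collecting equal products of coefficients leaves, for each multiset of \<open>m\<close> words, the sum of all products of these
  words in all orders. Imposing these sums as relations makes all such \<open>p\<close> nilpotent of exponent
  \<open>m = nil_exponent D\<close> at once, whatever the field is. There are only finitely many multisets for each \<open>D\<close>.
\<close>
definition nil_relations :: "bool list list set set" where
  "nil_relations = (\<Union>D. (\<lambda>\<mu>. {l. mset l = \<mu>}) ` multisets_of_size (short_words D) (nil_exponent D))"

definition relation_degree :: "bool list list set \<Rightarrow> nat" where
  "relation_degree r = length (concat (SOME l. l \<in> r))"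

lemma length_concat_mset: "length (concat l) = \<Sum>\<^sub># (image_mset length (mset l))"
  by (induction l) auto

lemma relation_degree_eq:
  "relation_degree {l. mset l = \<mu>} = \<Sum>\<^sub># (image_mset length \<mu>)"
proof -
  have "(SOME l. l \<in> {l. mset l = \<mu>}) \<in> {l. mset l = \<mu>}"
    using ex_mset[of \<mu>] by (metis (mono_tags, lifting) mem_Collect_eq someI_ex)
  then show ?thesis by (simp add: relation_degree_def length_concat_mset)
qed

lemma relation_degree_ge:
  assumes "\<mu> \<in> multisets_of_size (short_words D) (nil_exponent D)"
  shows "nil_exponent D \<le> relation_degree {l. mset l = \<mu>}"
proof -
  have "size \<mu> \<le> \<Sum>\<^sub># (image_mset length \<mu>)" if "set_mset \<mu> \<subseteq> short_words D"
    using that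
  proof (induction \<mu>)
    case (add x \<mu>)
    then have "Suc 0 \<le> length x" by (auto simp: short_words_def Suc_le_eq)
    then show ?case using add by simp
  qed simp
  then show ?thesis using assms by (simp add: relation_degree_eq multisets_of_size_def)
qed

lemma low_degree_nil_relations:
  "{r \<in> nil_relations. relation_degree r \<le> n} \<subseteq>
     (\<Union>D\<in>{..<n}. (\<lambda>\<mu>. {l. mset l = \<mu>}) ` multisets_of_size (short_words D) (nil_exponent D))"
proof
  fix r assume r: "r \<in> {r \<in> nil_relations. relation_degree r \<le> n}"
  then obtain D \<mu> where D: "\<mu> \<in> multisets_of_size (short_words D) (nil_exponent D)" "r = {l. mset l = \<mu>}"
    by (auto simp: nil_relations_def)
  then have "D < n" using relation_degree_ge[OF D(1)] nil_exponent(1)[of D] r by simp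
  with D show "r \<in> (\<Union>D\<in>{..<n}. (\<lambda>\<mu>. {l. mset l = \<mu>}) ` multisets_of_size (short_words D) (nil_exponent D))"
    by blast
qed

text \<open>
  The relations for words of length at most \<open>D\<close> contribute at most \<open>1/6 * (1/2) ^ D\<close> by the choice of
  \<open>nil_exponent\<close>, and the geometric series has sum 1/3.
\<close>
lemma nil_relations_small:
  "(\<Sum>r | r \<in> nil_relations \<and> relation_degree r \<le> n. (2/3::real) ^ relation_degree r) \<le> 1/3"
proof -
  let ?M = "\<lambda>D. multisets_of_size (short_words D) (nil_exponent D)"
  let ?r = "\<lambda>\<mu>. {l. mset l = \<mu>}"
  have fin: "finite (?M D)" for D by (intro multisets_of_size_bound) auto
  let ?h = "\<lambda>r. (2/3::real) ^ relation_degree r"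
  let ?I = "Sigma {..<n} ?M"
  have "sum ?h {r. r \<in> nil_relations \<and> relation_degree r \<le> n} \<le> sum ?h ((\<lambda>(D, \<mu>). ?r \<mu>) ` ?I)"
  proof (rule sum_mono2)
    show "{r. r \<in> nil_relations \<and> relation_degree r \<le> n} \<subseteq> (\<lambda>(D, \<mu>). ?r \<mu>) ` ?I"
      using low_degree_nil_relations[of n] by (rule order_trans) force
  qed (use fin in auto)
  also have "\<dots> \<le> sum (?h \<circ> (\<lambda>(D, \<mu>). ?r \<mu>)) ?I"
    using fin by (intro sum_image_le) auto
  also have "\<dots> = (\<Sum>D<n. \<Sum>\<mu>\<in>?M D. ?h (?r \<mu>))"
    using fin by (subst sum.Sigma) (auto simp: case_prod_unfold o_def)
  also have "\<dots> \<le> (\<Sum>D<n. 1/6 * (1/2) ^ D)"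
  proof (rule sum_mono)
    fix D
    have "(\<Sum>\<mu>\<in>?M D. ?h (?r \<mu>)) \<le> (\<Sum>\<mu>\<in>?M D. (2/3::real) ^ nil_exponent D)"
      using relation_degree_ge by (intro sum_mono power_decreasing) auto
    also have "\<dots> = real (card (?M D)) * (2/3) ^ nil_exponent D" by simp
    also have "\<dots> \<le> real ((nil_exponent D + 1) ^ card (short_words D)) * (2/3) ^ nil_exponent D"
      using multisets_of_size_bound(2)[of "short_words D" "nil_exponent D"]
      by (intro mult_right_mono of_nat_mono) auto
    also have "\<dots> \<le> 1/6 * (1/2) ^ D" by (rule nil_exponent)
    finally show "(\<Sum>\<mu>\<in>?M D. ?h (?r \<mu>)) \<le> 1/6 * (1/2) ^ D" .
  qed
  also have "\<dots> = 1/6 * (\<Sum>D<n. (1/2) ^ D)" by (simp add: sum_distrib_left)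
  also have "\<dots> \<le> 1/3" unfolding sum_gp_strict by simp
  finally show ?thesis .
qed

lemma finite_mset_lists: "finite {l. mset l = \<mu>}"
proof (rule finite_subset)
  show "{l. mset l = \<mu>} \<subseteq> {l. set l \<subseteq> set_mset \<mu> \<and> length l = size \<mu>}" by auto
qed (simp add: finite_lists_length_eq)

context field begin

definition coeff_prod :: "('x \<Rightarrow> 'a) \<Rightarrow> 'x list \<Rightarrow> 'a" where
  "coeff_prod p l = foldr (\<lambda>x c. p x \<otimes> c) l \<one>"

lemma coeff_prod_simps [simp]: "coeff_prod p [] = \<one>" "coeff_prod p (x # l) = p x \<otimes> coeff_prod p l"
  by (simp_all add: coeff_prod_def)

lemma coeff_prod_closed [simp, intro]: "(\<And>x. p x \<in> carrier R) \<Longrightarrow> coeff_prod p l \<in> carrier R"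
  by (induction l) auto

lemma coeff_prod_append:
  "(\<And>x. p x \<in> carrier R) \<Longrightarrow> coeff_prod p (l @ l') = coeff_prod p l \<otimes> coeff_prod p l'"
  by (induction l) (auto simp: m_assoc)

lemma coeff_prod_mset:
  assumes p: "\<And>x. p x \<in> carrier R"
  shows "mset l = mset l' \<Longrightarrow> coeff_prod p l = coeff_prod p l'"
proof (induction l arbitrary: l')
  case Nil
  then show ?case by simp
next
  case (Cons x l)
  then have "x \<in> set l'" by (metis list.set_intros(1) mset_eq_setD)
  then obtain u v where l': "l' = u @ x # v" by (meson split_list)
  then have "mset l = mset (u @ v)" using Cons.prems by simp
  then have "coeff_prod p l = coeff_prod p u \<otimes> coeff_prod p v" using Cons.IH coeff_prod_append p by metis
  then show ?case using p by (simp add: l' coeff_prod_append m_lcomm)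
qed

lemma homogeneous_nil_relations: "homogeneous_relations R nil_relations relation_degree"
proof
  show "finite r" if "r \<in> nil_relations" for r
    using that finite_mset_lists by (auto simp: nil_relations_def)
  show "length (concat l) = relation_degree r" if "r \<in> nil_relations" "l \<in> r" for r l
    using that by (auto simp: nil_relations_def relation_degree_eq length_concat_mset)
  show "0 < relation_degree r" if "r \<in> nil_relations" for r
    using that relation_degree_ge nil_exponent(1) 
    by (fastforce simp: nil_relations_def intro: less_le_trans[OF le_less_trans[OF le0]])
  show "finite {r \<in> nil_relations. relation_degree r \<le> n}" for n
    by (rule finite_subset[OF low_degree_nil_relations]) (auto intro!: multisets_of_size_bound)
qed

interpretation nil: homogeneous_relations R nil_relations relation_degree
  by (rule homogeneous_nil_relations)

text \<open>
  The expansion of \<open>w p ^ m w'\<close> under a functional that annihilates the relations, where \<open>m\<close> is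
  \<open>nil_exponent D\<close>.
\<close>
lemma nil_expansion:
  assumes f: "f \<in> nil.Ann" and p: "\<And>w. p w \<in> carrier R"
  shows "(\<Oplus>l\<in>{l. set l \<subseteq> short_words D \<and> length l = nil_exponent D}.
     coeff_prod p l \<otimes> f (w @ concat l @ w')) = \<zero>"
proof -
  let ?M = "multisets_of_size (short_words D) (nil_exponent D)"
  let ?g = "\<lambda>l. coeff_prod p l \<otimes> f (w @ concat l @ w')"
  have fcl: "f v \<in> carrier R" for v by (rule nil.AnnD(1)[OF f])
  have gcl: "?g l \<in> carrier R" for l by (simp add: fcl coeff_prod_closed p)
  have "{l. set l \<subseteq> short_words D \<and> length l = nil_exponent D} = (\<Union>\<mu>\<in>?M. {l. mset l = \<mu>})"
    by (auto simp: multisets_of_size_def)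
  then have "finsum R ?g {l. set l \<subseteq> short_words D \<and> length l = nil_exponent D}
     = finsum R ?g (\<Union>\<mu>\<in>?M. {l. mset l = \<mu>})" by simp
  also have "\<dots> = (\<Oplus>\<mu>\<in>?M. finsum R ?g {l. mset l = \<mu>})"
    using gcl finite_mset_lists
    by (intro add.finprod_UN_disjoint multisets_of_size_bound) (auto simp: pairwise_def disjnt_def)
  also have "\<dots> = \<zero>"
  proof (rule finsum_0I)
    fix \<mu> assume \<mu>: "\<mu> \<in> ?M"
    obtain l0 where l0: "mset l0 = \<mu>" using ex_mset by blast
    have "finsum R ?g {l. mset l = \<mu>} = (\<Oplus>l\<in>{l. mset l = \<mu>}. coeff_prod p l0 \<otimes> f (w @ concat l @ w'))"
    proof (rule finsum_cong'[OF refl])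
      fix l assume "l \<in> {l. mset l = \<mu>}"
      then have "coeff_prod p l = coeff_prod p l0" using l0 by (intro coeff_prod_mset p) simp
      then show "?g l = coeff_prod p l0 \<otimes> f (w @ concat l @ w')" by simp
    qed (simp add: fcl coeff_prod_closed p)
    also have "\<dots> = coeff_prod p l0 \<otimes> (\<Oplus>l\<in>{l. mset l = \<mu>}. f (w @ concat l @ w'))"
      by (rule finsum_rdistr[symmetric]) (simp_all add: finite_mset_lists fcl coeff_prod_closed p)
    also have "(\<Oplus>l\<in>{l. mset l = \<mu>}. f (w @ concat l @ w')) = \<zero>"
      using \<mu> by (intro nil.AnnD(2)[OF f]) (auto simp: nil_relations_def)
    finally show "finsum R ?g {l. mset l = \<mu>} = \<zero>" using p by simp
  qed
  finally show ?thesis .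
qed

lemma nil_nonzero: "\<exists>f\<in>nil.Ann. \<exists>w. length w = n \<and> f w \<noteq> \<zero>"
  by (rule nil.Ann_nonzero) (rule nil_relations_small)

end

section \<open>Functionals on cyclic graded modules\<close>

context abelian_monoid begin

lemma finsum_cartesian:
  assumes "finite I" "finite J" "\<And>i j. i \<in> I \<Longrightarrow> j \<in> J \<Longrightarrow> f (i, j) \<in> carrier G"
  shows "finsum G f (I \<times> J) = (\<Oplus>i\<in>I. \<Oplus>j\<in>J. f (i, j))"
  using assms(1,3)
proof (induction I)
  case empty
  then show ?case by simp
next
  case (insert i I)
  have "insert i I \<times> J = Pair i ` J \<union> I \<times> J" by auto
  then have "finsum G f (insert i I \<times> J) = finsum G f (Pair i ` J) \<oplus> finsum G f (I \<times> J)"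
    using insert assms(2) by (simp only:) (intro finsum_Un_disjoint, auto)
  also have "finsum G f (Pair i ` J) = (\<Oplus>j\<in>J. f (i, j))"
    using insert by (intro finsum_reindex) (auto simp: inj_on_def)
  also have "finsum G f (I \<times> J) = (\<Oplus>i\<in>I. \<Oplus>j\<in>J. f (i, j))"
    using insert.prems by (intro insert.IH) auto
  also have "(\<Oplus>j\<in>J. f (i, j)) \<oplus> \<dots> = (\<Oplus>i\<in>insert i I. \<Oplus>j\<in>J. f (i, j))"
    using insert by (intro finsum_insert[symmetric]) (auto intro!: finsum_closed)
  finally show ?case .
qed

end

text \<open>
  A function on words is a linear functional on the free algebra. \<open>shl u f\<close> is the functional
  \<open>z \<mapsto> f (u z)\<close> and \<open>shr u f\<close> is \<open>z \<mapsto> f (z u)\<close>.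
\<close>
definition shl :: "'x list \<Rightarrow> ('x list \<Rightarrow> 'c) \<Rightarrow> 'x list \<Rightarrow> 'c" where "shl u f w = f (u @ w)"
definition shr :: "'x list \<Rightarrow> ('x list \<Rightarrow> 'c) \<Rightarrow> 'x list \<Rightarrow> 'c" where "shr u f w = f (w @ u)"

lemma shl_shl: "shl u (shl v f) = shl (v @ u) f" by (simp add: shl_def fun_eq_iff)

context ring begin

definition trunc :: "nat \<Rightarrow> ('x list \<Rightarrow> 'a) \<Rightarrow> 'x list \<Rightarrow> 'a" where
  "trunc n f w = (if length w = n then f w else \<zero>)"

text \<open>
  The annihilators of graded left ideals: closure under \<open>trunc\<close> expresses that the ideal is graded and closure under
  \<open>shl\<close> that it is a left ideal. With the right shifts as \<open>G\<close>, one gets the annihilators of two-sided ideals. Such a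
  space thus consists of functionals on a cyclic graded left module.
\<close>
definition stable :: "((bool list \<Rightarrow> 'a) \<Rightarrow> bool list \<Rightarrow> 'a) set \<Rightarrow> (bool list \<Rightarrow> 'a) set \<Rightarrow> bool" where
  "stable G U \<longleftrightarrow> fun_subspace U \<and> (\<forall>n. \<forall>f\<in>U. trunc n f \<in> U) \<and> (\<forall>u. \<forall>f\<in>U. shl u f \<in> U) \<and>
     (\<forall>g\<in>G. \<forall>f\<in>U. g f \<in> U)"

text \<open>
  The cyclic module dual to \<open>U\<close> is nonzero in all degrees.
\<close>
definition full :: "(bool list \<Rightarrow> 'a) set \<Rightarrow> bool" where
  "full U \<longleftrightarrow> (\<forall>n. \<exists>f\<in>U. \<exists>w. length w = n \<and> f w \<noteq> \<zero>)"

text \<open>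
  Dually: an infinite dimensional cyclic module all of whose proper graded quotients are finite dimensional
  (a just infinite module).
\<close>
definition minimal_stable where
  "minimal_stable G U \<longleftrightarrow> stable G U \<and> full U \<and> (\<forall>U'\<subseteq>U. stable G U' \<longrightarrow> full U' \<longrightarrow> U' = U)"

end

context field begin

lemma stableI:
  assumes "fun_subspace U" "\<And>n f. f \<in> U \<Longrightarrow> trunc n f \<in> U" "\<And>u f. f \<in> U \<Longrightarrow> shl u f \<in> U"
    "\<And>g f. g \<in> G \<Longrightarrow> f \<in> U \<Longrightarrow> g f \<in> U"
  shows "stable G U"
  using assms unfolding stable_def by blast

lemma stableD:
  assumes "stable G U"
  shows "fun_subspace U" "f \<in> U \<Longrightarrow> trunc n f \<in> U" "f \<in> U \<Longrightarrow> shl u f \<in> U"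
    "g \<in> G \<Longrightarrow> f \<in> U \<Longrightarrow> g f \<in> U" "f \<in> U \<Longrightarrow> f w \<in> carrier R"
proof -
  show *: "fun_subspace U" "f \<in> U \<Longrightarrow> trunc n f \<in> U" "f \<in> U \<Longrightarrow> shl u f \<in> U"
    "g \<in> G \<Longrightarrow> f \<in> U \<Longrightarrow> g f \<in> U"
    using assms unfolding stable_def by blast+
  show "f \<in> U \<Longrightarrow> f w \<in> carrier R" by (rule fun_subspaceD(1)[OF *(1)])
qed

lemma fun_subspace_Inter:
  assumes "\<C> \<noteq> {}" "\<And>C. C \<in> \<C> \<Longrightarrow> fun_subspace C" shows "fun_subspace (\<Inter>\<C>)"
proof (rule fun_subspaceI)
  show "f i \<in> carrier R" if "f \<in> \<Inter>\<C>" for f i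
  proof -
    obtain C where C: "C \<in> \<C>" using assms(1) by blast
    show ?thesis using that C by (intro fun_subspaceD(1)[OF assms(2)[OF C]]) blast
  qed
  show "(\<lambda>_. \<zero>) \<in> \<Inter>\<C>" by (intro InterI fun_subspaceD(2) assms(2))
  show "(\<lambda>i. f i \<oplus> c \<otimes> g i) \<in> \<Inter>\<C>" if "f \<in> \<Inter>\<C>" "g \<in> \<Inter>\<C>" "c \<in> carrier R" for f g c
    using that by (intro InterI fun_subspaceD(3)[OF assms(2)]) auto
qed

text \<open>
  Zorn's lemma for descending chains. The intersection of a chain is again nonzero in degree \<open>n\<close>, because
  its members have the same restriction to words of length \<open>n\<close> from some point on.
\<close>
lemma minimal_stable_exists:
  assumes "stable G U0" "full U0"
  shows "\<exists>U\<subseteq>U0. minimal_stable G U"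
proof -
  let ?A = "{U. U \<subseteq> U0 \<and> stable G U \<and> full U}"
  have chain: "\<Inter>\<C> \<in> ?A" if ne: "\<C> \<noteq> {}" and sub: "\<C> \<subseteq> ?A"
    and ch: "\<And>C C'. C \<in> \<C> \<Longrightarrow> C' \<in> \<C> \<Longrightarrow> C \<subseteq> C' \<or> C' \<subseteq> C" for \<C>
  proof -
    have st: "stable G C" "full C" if "C \<in> \<C>" for C using sub that by auto
    have "stable G (\<Inter>\<C>)"
    proof (rule stableI)
      show "fun_subspace (\<Inter>\<C>)" by (rule fun_subspace_Inter[OF ne stableD(1)[OF st(1)]])
      show "trunc n f \<in> \<Inter>\<C>" if "f \<in> \<Inter>\<C>" for n f
        using that by (intro InterI) (rule stableD(2)[OF st(1)], assumption, erule (1) InterD)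
      show "shl u f \<in> \<Inter>\<C>" if "f \<in> \<Inter>\<C>" for u f
        using that by (intro InterI) (rule stableD(3)[OF st(1)], assumption, erule (1) InterD)
      show "g f \<in> \<Inter>\<C>" if "g \<in> G" "f \<in> \<Inter>\<C>" for g f
        using that by (intro InterI) (rule stableD(4)[OF st(1)], assumption, assumption, erule (1) InterD)
    qed
    moreover have "full (\<Inter>\<C>)"
      unfolding full_def
    proof
      fix n
      obtain C where C: "C \<in> \<C>" "\<And>C' f. C' \<in> \<C> \<Longrightarrow> f \<in> C \<Longrightarrow> \<exists>f'\<in>C'. \<forall>w\<in>words n. f w = f' w"
        using chain_of_subspaces_has_least_restriction[OF finite_words ne stableD(1)[OF st(1)] ch, of n] by blast
      obtain f w where fw: "f \<in> C" "length w = n" "f w \<noteq> \<zero>"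
        using st(2)[OF C(1)] unfolding full_def by blast
      have "trunc n f \<in> C'" if C': "C' \<in> \<C>" for C'
      proof -
        obtain f' where "f' \<in> C'" "\<forall>w\<in>words n. f w = f' w" using C(2)[OF C' fw(1)] by blast
        moreover from this have "trunc n f = trunc n f'" by (auto simp: trunc_def)
        ultimately show ?thesis using stableD(2)[OF st(1)[OF C']] by simp
      qed
      moreover have "trunc n f w \<noteq> \<zero>" using fw by (simp add: trunc_def)
      ultimately show "\<exists>f\<in>\<Inter>\<C>. \<exists>w. length w = n \<and> f w \<noteq> \<zero>" using fw(2) by blast
    qed
    moreover have "\<Inter>\<C> \<subseteq> U0" using ne sub by blast
    ultimately show ?thesis by blast
  qed
  \<comment> \<open>Complements turn descending chains into ascending ones.\<close>
  have "\<exists>M\<in>uminus ` ?A. \<forall>X\<in>uminus ` ?A. M \<subseteq> X \<longrightarrow> X = M"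
  proof (rule subset_Zorn_nonempty)
    show "uminus ` ?A \<noteq> {}" using assms by auto
    fix \<C> assume C: "\<C> \<noteq> {}" "subset.chain (uminus ` ?A) \<C>"
    let ?D = "uminus ` \<C>"
    have C1: "- X \<in> ?A" if "X \<in> \<C>" for X
    proof -
      have "X \<in> uminus ` ?A" using C(2) that unfolding subset_chain_def by (rule_tac subsetD) (elim conjE)
      then obtain X' where "X' \<in> ?A" "X = - X'" by (rule imageE)
      then show ?thesis by (simp only: double_compl)
    qed
    have C2: "X \<subseteq> Y \<or> Y \<subseteq> X" if "X \<in> \<C>" "Y \<in> \<C>" for X Y
      using C(2) that unfolding subset_chain_def by (elim conjE) (drule (1) bspec, drule (1) bspec)
    have "\<Inter>?D \<in> ?A"
    proof (rule chain)
      show "?D \<noteq> {}" using C(1) by simp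
      show "?D \<subseteq> ?A" using C1 by (intro subsetI, elim imageE) (simp only:)
      fix X Y assume "X \<in> ?D" "Y \<in> ?D"
      then obtain X' Y' where *: "X' \<in> \<C>" "Y' \<in> \<C>" "X = - X'" "Y = - Y'" by (elim imageE)
      show "X \<subseteq> Y \<or> Y \<subseteq> X" using C2[OF *(1,2)] unfolding *(3,4) by (simp only: Compl_subset_Compl_iff disj_commute)
    qed
    moreover have "\<Union>\<C> = - \<Inter>?D" by auto
    ultimately show "\<Union>\<C> \<in> uminus ` ?A" by (rule image_eqI[rotated])
  qed
  then obtain M where M: "M \<in> uminus ` ?A" "\<forall>X\<in>uminus ` ?A. M \<subseteq> X \<longrightarrow> X = M" by (elim bexE)
  obtain U where U: "U \<in> ?A" "M = - U" using M(1) by (elim imageE)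
  have "U' = U" if "U' \<subseteq> U" "stable G U'" "full U'" for U'
  proof -
    have "U' \<in> ?A" using that U(1) by auto
    then have "- U' \<in> uminus ` ?A" by (rule imageI)
    from bspec[OF M(2) this] show ?thesis using that(1) by (simp add: U(2))
  qed
  then have "minimal_stable G U" using U(1) by (simp add: minimal_stable_def)
  then show ?thesis using U(1) by auto
qed

text \<open>
  A proper stable subspace of a minimal one is zero in some degree, hence in all larger degrees, since its
  module is cyclic with generator in degree 0.
\<close>
lemma minimal_stable_vanish:
  assumes "minimal_stable G U" "stable G U'" "U' \<subseteq> U" "f0 \<in> U" "f0 \<notin> U'"
  shows "\<exists>m. \<forall>f\<in>U'. \<forall>w. m \<le> length w \<longrightarrow> f w = \<zero>"
proof -
  have "\<not> full U'" using assms unfolding minimal_stable_def by blast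
  then obtain m where m: "\<And>f w. f \<in> U' \<Longrightarrow> length w = m \<Longrightarrow> f w = \<zero>" unfolding full_def by blast
  have "f w = \<zero>" if "f \<in> U'" "m \<le> length w" for f w
  proof -
    let ?u = "take (length w - m) w" and ?v = "drop (length w - m) w"
    have "shl ?u f ?v = \<zero>" using that by (intro m stableD(3)[OF assms(2)]) auto
    then show ?thesis by (simp add: shl_def)
  qed
  then show ?thesis by blast
qed

definition Fn :: "(bool list \<Rightarrow> 'a) set" where "Fn = {f. \<forall>w. f w \<in> carrier R}"

lemma FnI: "(\<And>w. f w \<in> carrier R) \<Longrightarrow> f \<in> Fn" by (simp add: Fn_def)
lemma FnD [simp]: "f \<in> Fn \<Longrightarrow> f w \<in> carrier R" by (simp add: Fn_def)

text \<open>
  A function \<open>p\<close> on words also stands for the elements \<open>\<Sum>u. p u * u\<close> of the free algebra with \<open>u\<close> running over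
  the words of a fixed length. Functionals form a right module over the free algebra by
  \<open>(f p) z = f (p z)\<close>; \<open>ract e p\<close> is the action of the component of degree \<open>e\<close> of \<open>p\<close>.
\<close>
definition ract :: "nat \<Rightarrow> (bool list \<Rightarrow> 'a) \<Rightarrow> (bool list \<Rightarrow> 'a) \<Rightarrow> bool list \<Rightarrow> 'a" where
  "ract e p f w = (\<Oplus>u\<in>words e. p u \<otimes> f (u @ w))"

lemma ract_Fn [simp]: "p \<in> Fn \<Longrightarrow> f \<in> Fn \<Longrightarrow> ract e p f \<in> Fn"
proof (rule FnI)
  fix w assume "p \<in> Fn" "f \<in> Fn"
  then have "p u \<otimes> f (u @ w) \<in> carrier R" for u by (intro m_closed FnD)
  then show "ract e p f w \<in> carrier R" unfolding ract_def by (intro finsum_closed')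
qed

lemma stable_Fn: "stable G U \<Longrightarrow> f \<in> U \<Longrightarrow> f \<in> Fn"
  by (rule FnI) (rule stableD(5))

lemma stable_ract:
  assumes "stable G U" "f \<in> U" "p \<in> Fn" shows "ract e p f \<in> U"
proof -
  have "(\<lambda>w. \<Oplus>u\<in>words e. p u \<otimes> shl u f w) \<in> U"
    by (rule fun_subspace_finsum[OF stableD(1)[OF assms(1)] finite_words])
      (use assms(3) in \<open>simp_all add: stableD(3)[OF assms(1,2)]\<close>)
  then show ?thesis by (simp add: shl_def ract_def[abs_def])
qed

lemma ract_ract:
  assumes "p \<in> Fn" "q \<in> Fn" "f \<in> Fn"
  shows "ract e' q (ract e p f) = ract (e + e') (\<lambda>x. p (take e x) \<otimes> q (drop e x)) f"
proof
  fix w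
  let ?g = "\<lambda>x. p (take e x) \<otimes> q (drop e x) \<otimes> f (x @ w)"
  let ?h = "\<lambda>(u, v). u @ v"
  have im: "words (e + e') = ?h ` (words e \<times> words e')"
  proof
    show "words (e + e') \<subseteq> ?h ` (words e \<times> words e')"
    proof
      fix x :: "bool list" assume "x \<in> words (e + e')"
      then show "x \<in> ?h ` (words e \<times> words e')"
        by (intro image_eqI[of _ _ "(take e x, drop e x)"]) auto
    qed
  qed auto
  have cl: "?g x \<in> carrier R" for x using assms by simp
  have "ract (e + e') (\<lambda>x. p (take e x) \<otimes> q (drop e x)) f w = finsum R ?g (?h ` (words e \<times> words e'))"
    unfolding ract_def im ..
  also have "\<dots> = finsum R (\<lambda>x. ?g (?h x)) (words e \<times> words e')"
    using cl by (intro finsum_reindex) (auto simp: inj_on_def)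
  also have "\<dots> = (\<Oplus>u\<in>words e. \<Oplus>v\<in>words e'. ?g (?h (u, v)))"
    using assms by (intro finsum_cartesian) auto
  also have "\<dots> = (\<Oplus>v\<in>words e'. \<Oplus>u\<in>words e. ?g (?h (u, v)))"
    using assms by (intro finsum_swap) auto
  also have "\<dots> = (\<Oplus>v\<in>words e'. q v \<otimes> (\<Oplus>u\<in>words e. p u \<otimes> f (u @ v @ w)))"
  proof (rule finsum_cong'[OF refl])
    fix v assume v: "v \<in> words e'"
    have "(\<Oplus>u\<in>words e. ?g (?h (u, v))) = (\<Oplus>u\<in>words e. q v \<otimes> (p u \<otimes> f (u @ v @ w)))"
      using assms v by (intro finsum_cong') (auto simp: m_ac)
    then show "(\<Oplus>u\<in>words e. ?g (?h (u, v))) = q v \<otimes> (\<Oplus>u\<in>words e. p u \<otimes> f (u @ v @ w))"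
      using assms by (subst finsum_rdistr) auto
  qed (intro Pi_I m_closed FnD finsum_closed' assms)
  finally show "ract e' q (ract e p f) w = ract (e + e') (\<lambda>x. p (take e x) \<otimes> q (drop e x)) f w"
    by (simp add: ract_def)
qed

text \<open>
  Operators by which homogeneous elements of degree \<open>e\<close> act. Composition of operators corresponds to the
  product of elements, and this avoids computing with coefficients of products.
\<close>
definition hop :: "nat \<Rightarrow> ((bool list \<Rightarrow> 'a) \<Rightarrow> bool list \<Rightarrow> 'a) \<Rightarrow> bool" where
  "hop e T \<longleftrightarrow> (\<exists>p\<in>Fn. \<forall>f\<in>Fn. T f = ract e p f)"

lemma hopE:
  assumes "hop e T"
  obtains p where "p \<in> Fn" "\<And>f. f \<in> Fn \<Longrightarrow> T f = ract e p f"
proof -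
  obtain p where p: "p \<in> Fn" "\<forall>f\<in>Fn. T f = ract e p f"
    using assms unfolding hop_def by (elim bexE)
  show ?thesis by (rule that[OF p(1) bspec[OF p(2)]])
qed

lemma hop_Fn: "hop e T \<Longrightarrow> f \<in> Fn \<Longrightarrow> T f \<in> Fn" 
proof -
  assume *: "hop e T" "f \<in> Fn"
  obtain p where p: "p \<in> Fn" "\<And>f. f \<in> Fn \<Longrightarrow> T f = ract e p f" by (rule hopE[OF *(1)]) (rule that)
  show "T f \<in> Fn" unfolding p(2)[OF *(2)] by (rule ract_Fn[OF p(1) *(2)])
qed

lemma hop_stable: "hop e T \<Longrightarrow> stable G U \<Longrightarrow> f \<in> U \<Longrightarrow> T f \<in> U"
proof -
  assume *: "hop e T" "stable G U" "f \<in> U"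
  obtain p where p: "p \<in> Fn" "\<And>f. f \<in> Fn \<Longrightarrow> T f = ract e p f" by (rule hopE[OF *(1)]) (rule that)
  show "T f \<in> U" unfolding p(2)[OF stable_Fn[OF *(2,3)]] by (rule stable_ract[OF *(2,3) p(1)])
qed

lemma hop_comp:
  assumes "hop e T" "hop e' T'" shows "hop (e + e') (\<lambda>f. T' (T f))"
proof -
  obtain p where p: "p \<in> Fn" "\<And>f. f \<in> Fn \<Longrightarrow> T f = ract e p f" by (rule hopE[OF assms(1)]) (rule that)
  obtain q where q: "q \<in> Fn" "\<And>f. f \<in> Fn \<Longrightarrow> T' f = ract e' q f" by (rule hopE[OF assms(2)]) (rule that)
  have "T' (T f) = ract (e + e') (\<lambda>x. p (take e x) \<otimes> q (drop e x)) f" if "f \<in> Fn" for f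
    unfolding p(2)[OF that] q(2)[OF ract_Fn[OF p(1) that]] by (rule ract_ract[OF p(1) q(1) that])
  moreover have "(\<lambda>x. p (take e x) \<otimes> q (drop e x)) \<in> Fn" using p(1) q(1) by (intro FnI) simp
  ultimately show ?thesis unfolding hop_def by (intro bexI ballI)
qed

lemma hop_shl: "hop (length t) (shl t)"
  unfolding hop_def
proof (intro bexI ballI)
  let ?d = "\<lambda>u. if u = t then \<one> else \<zero>"
  show "?d \<in> Fn" by (intro FnI) simp
  fix f :: "bool list \<Rightarrow> 'a" assume f: "f \<in> Fn"
  have "(\<Oplus>u\<in>words (length t). ?d u \<otimes> f (u @ w)) = ?d t \<otimes> f (t @ w)" for w
    using f by (intro finsum_only) auto
  then show "shl t f = ract (length t) ?d f" using f by (simp add: fun_eq_iff ract_def shl_def)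
qed

lemma hop_funpow: "hop e T \<Longrightarrow> hop (j * e) (T ^^ j)"
proof (induction j)
  case 0
  have "hop (length ([] :: bool list)) (shl [])" by (rule hop_shl)
  moreover have "shl [] = (\<lambda>f. f :: bool list \<Rightarrow> 'a)" by (simp add: shl_def fun_eq_iff)
  ultimately show ?case by (simp add: id_def)
next
  case (Suc j)
  have "hop (j * e + e) (\<lambda>f. T ((T ^^ j) f))" using Suc by (intro hop_comp) auto
  then show ?case by (simp add: o_def add.commute)
qed

lemma hop_trunc:
  assumes "hop e T" "f \<in> Fn" shows "T (trunc (l + e) f) = trunc l (T f)"
proof -
  obtain p where p: "p \<in> Fn" "\<And>f. f \<in> Fn \<Longrightarrow> T f = ract e p f" by (rule hopE[OF assms(1)]) (rule that)
  have tF: "trunc (l + e) f \<in> Fn" using FnD[OF assms(2)] by (intro FnI) (simp add: trunc_def)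
  have "ract e p (trunc (l + e) f) w = trunc l (ract e p f) w" for w
  proof (cases "length w = l")
    case True
    have "(\<Oplus>u\<in>words e. p u \<otimes> trunc (l + e) f (u @ w)) = (\<Oplus>u\<in>words e. p u \<otimes> f (u @ w))"
    proof (rule finsum_cong'[OF refl])
      fix u assume "u \<in> words e"
      then have "length (u @ w) = l + e" using True by simp
      then show "p u \<otimes> trunc (l + e) f (u @ w) = p u \<otimes> f (u @ w)" unfolding trunc_def by (simp only: refl if_True)
    qed (intro Pi_I m_closed FnD p(1) assms(2))
    then show ?thesis using True by (simp only: ract_def trunc_def[of l] refl if_True)
  next
    case False
    have "(\<Oplus>u\<in>words e. p u \<otimes> trunc (l + e) f (u @ w)) = \<zero>"
    proof (rule finsum_0I)
      fix u assume "u \<in> words e"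
      then have "length (u @ w) \<noteq> l + e" using False by simp
      then show "p u \<otimes> trunc (l + e) f (u @ w) = \<zero>" unfolding trunc_def using FnD[OF p(1)] by (simp only: if_False r_null)
    qed
    then show ?thesis using False by (simp only: ract_def trunc_def[of l] refl if_False)
  qed
  then show ?thesis unfolding p(2)[OF assms(2)] p(2)[OF tF] by (intro ext)
qed

text \<open>
  The action of an element without constant term and of degree at most \<open>D\<close>, not necessarily homogeneous.
\<close>
definition sact :: "nat \<Rightarrow> (bool list \<Rightarrow> 'a) \<Rightarrow> (bool list \<Rightarrow> 'a) \<Rightarrow> bool list \<Rightarrow> 'a" where
  "sact D p f w = (\<Oplus>u\<in>short_words D. p u \<otimes> f (u @ w))"

lemma sact_Fn [simp]: "p \<in> Fn \<Longrightarrow> f \<in> Fn \<Longrightarrow> sact D p f \<in> Fn"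
proof (rule FnI)
  fix w assume "p \<in> Fn" "f \<in> Fn"
  then have "p u \<otimes> f (u @ w) \<in> carrier R" for u by (intro m_closed FnD)
  then show "sact D p f w \<in> carrier R" unfolding sact_def by (intro finsum_closed')
qed

lemma sact_funpow:
  assumes "p \<in> Fn" "f \<in> Fn"
  shows "(sact D p ^^ m) f w =
    (\<Oplus>l\<in>{l. set l \<subseteq> short_words D \<and> length l = m}. coeff_prod p l \<otimes> f (concat l @ w))"
  using assms(2)
proof (induction m arbitrary: f)
  case 0
  have "{l. set l \<subseteq> short_words D \<and> length l = 0} = {[]}" by auto
  then show ?case using 0 by simp
next
  case (Suc m)
  let ?L = "{l. set l \<subseteq> short_words D \<and> length l = m}"
  let ?g = "\<lambda>l. coeff_prod p l \<otimes> f (concat l @ w)"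
  have finL: "finite ?L" by (rule finite_lists_length_eq) simp
  have pcl: "coeff_prod p l \<in> carrier R" for l using assms(1) by (intro coeff_prod_closed) simp
  have gcl: "?g l \<in> carrier R" for l using pcl Suc.prems by simp
  have "{l. set l \<subseteq> short_words D \<and> length l = Suc m} = (\<lambda>(u, l). u # l) ` (short_words D \<times> ?L)"
  proof
    show "{l. set l \<subseteq> short_words D \<and> length l = Suc m} \<subseteq> (\<lambda>(u, l). u # l) ` (short_words D \<times> ?L)"
    proof
      fix l assume "l \<in> {l. set l \<subseteq> short_words D \<and> length l = Suc m}"
      then show "l \<in> (\<lambda>(u, l). u # l) ` (short_words D \<times> ?L)"
        by (intro image_eqI[of _ _ "(hd l, tl l)"]; cases l) auto
    qed
  qed auto
  then have "finsum R ?g {l. set l \<subseteq> short_words D \<and> length l = Suc m}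
     = finsum R (\<lambda>x. ?g ((\<lambda>(u, l). u # l) x)) (short_words D \<times> ?L)"
    using gcl by (simp only:) (rule finsum_reindex, auto simp: inj_on_def)
  also have "\<dots> = (\<Oplus>u\<in>short_words D. \<Oplus>l\<in>?L. ?g (case (u, l) of (u, l) \<Rightarrow> u # l))"
    by (rule finsum_cartesian[OF finite_short_words finL]) (rule gcl)
  also have "\<dots> = (\<Oplus>u\<in>short_words D. \<Oplus>l\<in>?L. ?g (u # l))" by (simp only: prod.case)
  also have "\<dots> = (\<Oplus>l\<in>?L. \<Oplus>u\<in>short_words D. ?g (u # l))"
    by (rule finsum_swap[OF finite_short_words finL]) (rule gcl)
  also have "\<dots> = (\<Oplus>l\<in>?L. coeff_prod p l \<otimes> sact D p f (concat l @ w))"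
  proof (rule finsum_cong'[OF refl])
    fix l
    have cl: "coeff_prod p l \<in> carrier R" "p u \<in> carrier R" "f v \<in> carrier R" for u v
      using pcl assms(1) Suc.prems by simp_all
    have "?g (u # l) = coeff_prod p l \<otimes> (p u \<otimes> f (u @ concat l @ w))" for u
      using cl by (simp add: m_ac)
    then have "(\<Oplus>u\<in>short_words D. ?g (u # l)) = (\<Oplus>u\<in>short_words D. coeff_prod p l \<otimes> (p u \<otimes> f (u @ concat l @ w)))"
      by (simp only:)
    also have "\<dots> = coeff_prod p l \<otimes> sact D p f (concat l @ w)"
      unfolding sact_def using cl by (intro finsum_rdistr[symmetric]) auto
    finally show "(\<Oplus>u\<in>short_words D. ?g (u # l)) = coeff_prod p l \<otimes> sact D p f (concat l @ w)" .
  qed (intro Pi_I m_closed FnD pcl sact_Fn assms(1) Suc.prems)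
  also have "\<dots> = (sact D p ^^ m) (sact D p f) w"
    using assms(1) Suc.prems by (intro Suc.IH[symmetric]) simp
  finally show ?case by (simp add: funpow_swap1)
qed

end

section \<open>Separating functionals on a just infinite module\<close>

definition two_sided :: "((bool list \<Rightarrow> 'c) \<Rightarrow> bool list \<Rightarrow> 'c) set" where "two_sided = range shr"

text \<open>
  \<open>UI\<close> is dual to a just infinite graded nil algebra \<open>J\<close> and \<open>U\<close> to a just infinite cyclic left \<open>J\<close>-module
  \<open>M\<close> whose generator is killed by the letter \<open>False\<close>, called \<open>y\<close> below.
\<close>
locale just_infinite_pair = field R for R (structure) +
  fixes UI U :: "(bool list \<Rightarrow> 'a) set"
  assumes UI: "minimal_stable two_sided UI" and U: "minimal_stable {} U" and U_sub: "U \<subseteq> UI"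
    and U_last: "f \<in> U \<Longrightarrow> f (w @ [False]) = \<zero>"
    and nil_UI: "f \<in> UI \<Longrightarrow> p \<in> Fn \<Longrightarrow> (sact D p ^^ nil_exponent D) f w = \<zero>"
begin

lemma UI_stable: "stable two_sided UI" and UI_full: "full UI" and U_stable: "stable {} U" and U_full: "full U"
  using UI U by (auto simp: minimal_stable_def)

lemma U_Fn: "f \<in> U \<Longrightarrow> f \<in> Fn" and UI_Fn: "f \<in> UI \<Longrightarrow> f \<in> Fn"
  using stable_Fn U_stable UI_stable by blast+

lemma shr_UI: "f \<in> UI \<Longrightarrow> shr u f \<in> UI"
  using stableD(4)[OF UI_stable, of "shr u" f] by (auto simp: two_sided_def)

text \<open>
  The element that acts by \<open>T\<close> annihilates \<open>M\<close>.
\<close>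
definition zero_op :: "((bool list \<Rightarrow> 'a) \<Rightarrow> bool list \<Rightarrow> 'a) \<Rightarrow> bool" where
  "zero_op T \<longleftrightarrow> (\<forall>f\<in>U. \<forall>w. T f w = \<zero>)"

text \<open>
  These are the functionals on \<open>J\<close> that vanish on the two-sided ideal generated by \<open>p\<close>.
\<close>
lemma kernel_stable:
  assumes "p \<in> Fn"
  shows "stable two_sided {f \<in> UI. \<forall>a b. ract e p (shl a f) b = \<zero>}"
proof (rule stableI)
  let ?K = "{f \<in> UI. \<forall>a b. ract e p (shl a f) b = \<zero>}"
  note S = stableD[OF UI_stable] and F = fun_subspaceD[OF stableD(1)[OF UI_stable]]
  show "fun_subspace ?K"
  proof (rule fun_subspaceI)
    show "f i \<in> carrier R" if "f \<in> ?K" for f i using that F(1) by simp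
    show "(\<lambda>_. \<zero>) \<in> ?K" using F(2) assms by (auto simp: ract_def shl_def intro!: finsum_0I)
    fix f g c assume f: "f \<in> ?K" and g: "g \<in> ?K" and c: "c \<in> carrier R"
    have "ract e p (shl a (\<lambda>i. f i \<oplus> c \<otimes> g i)) b = ract e p (shl a f) b \<oplus> c \<otimes> ract e p (shl a g) b" for a b
    proof -
      have cl: "f w \<in> carrier R" "g w \<in> carrier R" "p w \<in> carrier R" for w using f g F(1) assms by auto
      have "ract e p (shl a (\<lambda>i. f i \<oplus> c \<otimes> g i)) b
         = (\<Oplus>u\<in>words e. p u \<otimes> shl a f (u @ b) \<oplus> c \<otimes> (p u \<otimes> shl a g (u @ b)))"
        unfolding ract_def using cl c by (intro finsum_cong') (auto simp: shl_def r_distr m_lcomm)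
      also have "\<dots> = ract e p (shl a f) b \<oplus> (\<Oplus>u\<in>words e. c \<otimes> (p u \<otimes> shl a g (u @ b)))"
        unfolding ract_def using cl c by (intro finsum_addf) (auto simp: shl_def)
      also have "(\<Oplus>u\<in>words e. c \<otimes> (p u \<otimes> shl a g (u @ b))) = c \<otimes> ract e p (shl a g) b"
        unfolding ract_def using cl c by (intro finsum_rdistr[symmetric]) (auto simp: shl_def)
      finally show ?thesis .
    qed
    then show "(\<lambda>i. f i \<oplus> c \<otimes> g i) \<in> ?K" using f g c F(3) by simp
  qed
  show "trunc n f \<in> ?K" if f: "f \<in> ?K" for n f
  proof -
    have "ract e p (shl a (trunc n f)) b = \<zero>" for a b
    proof (cases "length a + e + length b = n")
      case True
      then have "trunc n f (a @ u @ b) = f (a @ u @ b)" if "u \<in> words e" for u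
        using that by (auto simp: trunc_def)
      then have "ract e p (shl a (trunc n f)) b = ract e p (shl a f) b"
        unfolding ract_def shl_def using F(1) f FnD[OF assms] by (intro finsum_cong') auto
      then show ?thesis using f by simp
    next
      case False
      then have "trunc n f (a @ u @ b) = \<zero>" if "u \<in> words e" for u
        using that by (auto simp: trunc_def)
      then show ?thesis unfolding ract_def shl_def using FnD[OF assms] by (intro finsum_0I) simp
    qed
    then show ?thesis using f S(2) by simp
  qed
  show "shl u f \<in> ?K" if f: "f \<in> ?K" for u f
    using f S(3) by (simp add: shl_shl)
  show "g f \<in> ?K" if g: "g \<in> two_sided" and f: "f \<in> ?K" for g f
  proof -
    obtain u where u: "g = shr u" using g by (auto simp: two_sided_def)
    have "ract e p (shl a (shr u f)) b = ract e p (shl a f) (b @ u)" for a b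
      by (simp add: ract_def shl_def shr_def)
    then show ?thesis using f shr_UI u by simp
  qed
qed

text \<open>
  \<open>J\<close> is just infinite, so modulo the ideal generated by an element \<open>p \<noteq> 0\<close> it has bounded degree.
\<close>
lemma kernel_vanishes:
  assumes "p \<in> Fn" "f0 \<in> UI" "ract e p f0 w0 \<noteq> \<zero>"
  shows "\<exists>m. \<forall>f\<in>UI. (\<forall>a b. ract e p (shl a f) b = \<zero>) \<longrightarrow> (\<forall>w. m \<le> length w \<longrightarrow> f w = \<zero>)"
proof -
  have "shl [] f0 = f0" by (simp add: shl_def fun_eq_iff)
  then have "f0 \<notin> {f \<in> UI. \<forall>a b. ract e p (shl a f) b = \<zero>}"
    using assms(3) by (metis (mono_tags, lifting) mem_Collect_eq)
  from minimal_stable_vanish[OF UI kernel_stable[OF assms(1)] _ assms(2) this] obtain m where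
    m: "\<forall>f\<in>{f \<in> UI. \<forall>a b. ract e p (shl a f) b = \<zero>}. \<forall>w. m \<le> length w \<longrightarrow> f w = \<zero>" by auto
  show ?thesis
  proof (intro exI ballI impI allI)
    fix f and w :: "bool list" assume "f \<in> UI" "\<forall>a b. ract e p (shl a f) b = \<zero>" "m \<le> length w"
    then show "f w = \<zero>" by (intro m[rule_format]) simp_all
  qed
qed

text \<open>
  Let \<open>p\<close> be the element that acts by \<open>T\<close>. If \<open>p\<close> killed all elements of \<open>M\<close> of degree at least \<open>n\<close>, then for \<open>f\<close> in \<open>U\<close>
  and words \<open>z\<close> of length \<open>n\<close> the functionals \<open>shr z f\<close> would vanish on the ideal generated by \<open>p\<close>, hence in high degrees;
  but \<open>M\<close> is infinite dimensional.
\<close>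
lemma torsion_free:
  assumes "hop e T" "\<not> zero_op T"
  shows "\<exists>f\<in>U. \<exists>w. n \<le> length w \<and> T f w \<noteq> \<zero>"
proof (rule ccontr)
  assume neg: "\<not> ?thesis"
  obtain p where p: "p \<in> Fn" "\<And>f. f \<in> Fn \<Longrightarrow> T f = ract e p f" by (rule hopE[OF assms(1)]) (rule that)
  have z: "ract e p f w = \<zero>" if "f \<in> U" "n \<le> length w" for f w
    using neg that p(2)[OF U_Fn[OF that(1)]] by auto
  obtain f0 w0 where f0: "f0 \<in> U" "T f0 w0 \<noteq> \<zero>" using assms(2) unfolding zero_op_def by blast
  then have f0': "ract e p f0 w0 \<noteq> \<zero>" using p(2)[OF U_Fn[OF f0(1)]] by simp
  from kernel_vanishes[OF p(1) subsetD[OF U_sub f0(1)] f0'] obtain m where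
    m: "\<forall>f\<in>UI. (\<forall>a b. ract e p (shl a f) b = \<zero>) \<longrightarrow> (\<forall>w. m \<le> length w \<longrightarrow> f w = \<zero>)" ..
  obtain f w where f: "f \<in> U" "length w = m + n" "f w \<noteq> \<zero>" using U_full unfolding full_def by blast
  let ?g = "shr (drop m w) f"
  have "?g (take m w) = \<zero>"
  proof (rule m[rule_format])
    show "?g \<in> UI" using f(1) U_sub shr_UI by blast
    fix a b
    have "ract e p (shl a ?g) b = ract e p (shl a f) (b @ drop m w)"
      by (simp add: ract_def shl_def shr_def)
    then show "ract e p (shl a ?g) b = \<zero>" using f z[OF stableD(3)[OF U_stable f(1)]] by simp
  qed (use f in simp)
  then show False using f(3) by (simp add: shr_def)
qed

text \<open>
  Let \<open>p\<close> be the element that acts by \<open>T\<close>. If \<open>p t p\<close> annihilated \<open>M\<close> for all nonempty words \<open>t\<close>, then for \<open>f\<close> in \<open>U\<close> and a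
  letter \<open>x\<close> the functional \<open>z \<mapsto> f (p x z)\<close> would vanish on the ideal generated by \<open>p\<close>, hence in high degrees, against
  \<open>torsion_free\<close>.
\<close>
lemma semiprime:
  assumes "hop e T" "\<not> zero_op T"
  shows "\<exists>t. t \<noteq> [] \<and> \<not> zero_op (\<lambda>f. T (shl t (T f)))"
proof (rule ccontr)
  assume neg: "\<not> ?thesis"
  obtain p where p: "p \<in> Fn" "\<And>f. f \<in> Fn \<Longrightarrow> T f = ract e p f" by (rule hopE[OF assms(1)]) (rule that)
  obtain f0 w0 where f0: "f0 \<in> U" "T f0 w0 \<noteq> \<zero>" using assms(2) unfolding zero_op_def by blast
  then have f0': "ract e p f0 w0 \<noteq> \<zero>" using p(2)[OF U_Fn[OF f0(1)]] by simp
  from kernel_vanishes[OF p(1) subsetD[OF U_sub f0(1)] f0'] obtain m where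
    m: "\<forall>f\<in>UI. (\<forall>a b. ract e p (shl a f) b = \<zero>) \<longrightarrow> (\<forall>w. m \<le> length w \<longrightarrow> f w = \<zero>)" ..
  obtain f w where f: "f \<in> U" "Suc m \<le> length w" "T f w \<noteq> \<zero>" using torsion_free[OF assms] by blast
  obtain x v where w: "w = x # v" using f(2) by (cases w) auto
  have TU: "T f \<in> U" by (rule hop_stable[OF assms(1) U_stable f(1)])
  have "shl [x] (T f) v = \<zero>"
  proof (rule m[rule_format])
    show "shl [x] (T f) \<in> UI" using stableD(3)[OF U_stable TU] U_sub by blast
    fix a b
    have "shl (x # a) (T f) \<in> U" by (rule stableD(3)[OF U_stable TU])
    then have "ract e p (shl (x # a) (T f)) b = T (shl (x # a) (T f)) b" using p(2)[OF U_Fn] by simp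
    also have "\<dots> = \<zero>" using neg f(1) unfolding zero_op_def by blast
    finally show "ract e p (shl a (shl [x] (T f))) b = \<zero>" by (simp add: shl_shl)
  qed (use f w in simp)
  then show False using f(3) w by (simp add: shl_def)
qed

text \<open>
  This is the nilness of \<open>J\<close>; a homogeneous element of positive degree is a combination of short words.
\<close>
lemma hop_nilpotent:
  assumes "hop e T" "0 < e" shows "\<exists>m. zero_op (T ^^ m)"
proof -
  obtain p where p: "p \<in> Fn" "\<And>f. f \<in> Fn \<Longrightarrow> T f = ract e p f" by (rule hopE[OF assms(1)]) (rule that)
  define q where "q w = (if length w = e then p w else \<zero>)" for w
  have q: "q \<in> Fn" using p(1) by (intro FnI) (simp add: q_def)
  have Tq: "T f = sact e q f" if "f \<in> Fn" for f
  proof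
    fix w
    have "words e \<subseteq> short_words e" using assms(2) by (auto simp: short_words_def)
    moreover have "q u \<otimes> f (u @ w) = \<zero>" if "u \<in> short_words e - words e" for u
    proof -
      have "q u = \<zero>" using that by (simp add: q_def)
      then show ?thesis using FnD[OF \<open>f \<in> Fn\<close>] by simp
    qed
    ultimately have "sact e q f w = (\<Oplus>u\<in>words e. q u \<otimes> f (u @ w))"
      unfolding sact_def
      by (intro finsum_superset finite_short_words m_closed FnD q \<open>f \<in> Fn\<close>)
    also have "\<dots> = ract e p f w"
      unfolding ract_def using that p(1) by (intro finsum_cong') (auto simp: q_def)
    finally show "T f w = sact e q f w" using p(2)[OF that] by simp
  qed
  have pow: "(T ^^ m) f = (sact e q ^^ m) f \<and> (T ^^ m) f \<in> Fn" if "f \<in> Fn" for f m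
  proof (induction m)
    case (Suc m)
    have "(T ^^ Suc m) f = sact e q ((T ^^ m) f)" by (simp add: Tq[OF conjunct2[OF Suc]])
    moreover have "T ((T ^^ m) f) \<in> Fn" by (rule hop_Fn[OF assms(1) conjunct2[OF Suc]])
    ultimately show ?case using Suc by simp
  qed (use that in simp)
  have "zero_op (T ^^ nil_exponent e)"
    unfolding zero_op_def
  proof (intro ballI allI)
    fix f w assume f: "f \<in> U"
    have "(T ^^ nil_exponent e) f w = (sact e q ^^ nil_exponent e) f w" using pow[OF U_Fn[OF f]] by simp
    also have "\<dots> = \<zero>" by (rule nil_UI[OF subsetD[OF U_sub f] q])
    finally show "(T ^^ nil_exponent e) f w = \<zero>" .
  qed
  then show ?thesis ..
qed

lemma shl_False_pow: "shl [False] ^^ k = (shl (replicate k False) :: (bool list \<Rightarrow> 'a) \<Rightarrow> _)"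
proof (induction k)
  case (Suc k)
  have "(shl [False] ^^ Suc k) f = shl (replicate (Suc k) False) f" for f :: "bool list \<Rightarrow> 'a"
    using Suc by (simp add: shl_shl replicate_append_same)
  then show ?case by blast
qed (simp add: fun_eq_iff shl_def)

text \<open>
  The nilpotency index of \<open>y\<close> on \<open>M\<close>; the element \<open>y ^ (\<kappa> - 1)\<close>, which acts by \<open>Y\<close>, does not annihilate \<open>M\<close>.
\<close>
definition \<kappa> :: nat where "\<kappa> = (LEAST k. zero_op (shl (replicate k False)))"

lemma zero_\<kappa>: "zero_op (shl (replicate \<kappa> False))"
proof -
  have "\<exists>m. zero_op (shl [False] ^^ m)" by (rule hop_nilpotent[OF hop_shl]) simp
  then have "\<exists>m. zero_op (shl (replicate m False))" by (simp add: shl_False_pow)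
  then show ?thesis unfolding \<kappa>_def by (rule LeastI_ex)
qed

lemma \<kappa>_pos: "0 < \<kappa>"
proof (rule ccontr)
  assume "\<not> 0 < \<kappa>"
  then have "zero_op (shl [])" using zero_\<kappa> by simp
  moreover obtain f w where "f \<in> U" "f w \<noteq> \<zero>" using U_full unfolding full_def by blast
  ultimately show False by (auto simp: zero_op_def shl_def)
qed

abbreviation Y where "Y \<equiv> shl (replicate (\<kappa> - 1) False)"

lemma nonzero_Y: "\<not> zero_op Y"
  using not_less_Least[of "\<kappa> - 1" "\<lambda>k. zero_op (shl (replicate k False))"] \<kappa>_pos unfolding \<kappa>_def by simp

lemma hop_zero:
  assumes "hop e T" "f \<in> Fn" "\<And>w. f w = \<zero>" shows "T f w = \<zero>"
proof -
  obtain p where p: "p \<in> Fn" "\<And>f. f \<in> Fn \<Longrightarrow> T f = ract e p f" by (rule hopE[OF assms(1)]) (rule that)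
  have "ract e p f w = \<zero>" unfolding ract_def assms(3) using FnD[OF p(1)] by (intro finsum_0I) simp
  then show ?thesis using p(2)[OF assms(2)] by simp
qed

text \<open>
  Write \<open>T\<close> also for the element that acts by \<open>T\<close>, and let \<open>v = T y ^ (\<kappa> - 1)\<close>, so that \<open>v M \<noteq> 0\<close>. By \<open>semiprime\<close>
  there is a word \<open>t\<close> with \<open>v t v M \<noteq> 0\<close>; put \<open>z = v t\<close>. Then \<open>z\<close> is nilpotent on \<open>M\<close> but not zero, say with index
  \<open>m = j + 2\<close>. With \<open>b = t z ^ j u\<close> one has \<open>v b = z ^ (j + 1) u\<close>, and the word \<open>u\<close>, of any desired length, can be chosen such
  that this acts nontrivially in high degree; this gives \<open>\<gamma>\<close> with \<open>\<gamma> (y ^ (\<kappa> - 1) b w) \<noteq> 0\<close> for some long \<open>w\<close>. On the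
  other hand, the next element \<open>T2 = z T\<close> satisfies \<open>T2 y ^ (\<kappa> - 1) b = z v b = z ^ m u = 0\<close> on \<open>M\<close>, whereas
  \<open>T2 y ^ (\<kappa> - 1) = v t v\<close> still acts nontrivially, so that the step can be repeated.
\<close>
lemma separating_step:
  assumes T: "hop eT T" and nz: "\<not> zero_op (\<lambda>f. Y (T f))"
  shows "\<exists>n b d \<gamma> T2 e2. N < n \<and> M \<le> d \<and> b \<in> Fn \<and>
     (\<exists>\<xi>\<in>U. \<gamma> = T \<xi>) \<and> (\<forall>w. length w \<noteq> \<kappa> - 1 + n + d \<longrightarrow> \<gamma> w = \<zero>) \<and>
     (\<exists>w. length w = d \<and> ract n b (Y \<gamma>) w \<noteq> \<zero>) \<and>
     hop e2 T2 \<and> \<not> zero_op (\<lambda>f. Y (T2 f)) \<and>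
     (\<forall>f\<in>U. \<forall>w. ract n b (Y (T2 f)) w = \<zero>) \<and>
     (\<forall>f\<in>U. \<exists>f'\<in>U. T2 f = T f')"
proof -
  define V where "V f = Y (T f)" for f
  have hV: "hop (eT + (\<kappa> - 1)) V"
    using hop_comp[OF T hop_shl[of "replicate (\<kappa> - 1) False"]] by (simp add: V_def[abs_def])
  have nzV: "\<not> zero_op V" using nz by (simp add: V_def[abs_def])
  obtain t where t: "t \<noteq> []" "\<not> zero_op (\<lambda>f. V (shl t (V f)))" using semiprime[OF hV nzV] by blast
  define z where "z f = shl t (V f)" for f
  define ez where "ez = eT + (\<kappa> - 1) + length t"
  have hz: "hop ez z" using hop_comp[OF hV hop_shl[of t]] by (simp add: z_def[abs_def] ez_def)
  have nzVz: "\<not> zero_op (\<lambda>f. V (z f))" using t by (simp add: z_def)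
  have zU: "z f \<in> U" if "f \<in> U" for f by (rule hop_stable[OF hz U_stable that])
  have nzz: "\<not> zero_op z"
  proof
    assume "zero_op z"
    then have "V (z f) w = \<zero>" if "f \<in> U" for f w
      using that hop_zero[OF hV U_Fn[OF zU[OF that]]] unfolding zero_op_def by blast
    then show False using nzVz unfolding zero_op_def by blast
  qed
  have "0 < ez" using t(1) by (simp add: ez_def)
  define m where "m = (LEAST m. zero_op (z ^^ m))"
  have zm: "zero_op (z ^^ m)" unfolding m_def using hop_nilpotent[OF hz \<open>0 < ez\<close>] by (rule LeastI_ex)
  have "m \<noteq> 0"
  proof
    assume "m = 0"
    then have "\<forall>f\<in>U. \<forall>w. f w = \<zero>" using zm by (simp add: zero_op_def)
    then show False using U_full unfolding full_def by blast
  qed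
  moreover have "m \<noteq> Suc 0" using zm nzz by auto
  ultimately obtain j where j: "m = Suc (Suc j)" by (metis not0_implies_Suc)
  have nzj: "\<not> zero_op (z ^^ Suc j)" using not_less_Least[of "Suc j" "\<lambda>m. zero_op (z ^^ m)"] j unfolding m_def by simp
  obtain f w where f: "f \<in> U" "N + 1 + M \<le> length w" "(z ^^ Suc j) f w \<noteq> \<zero>"
    using torsion_free[OF hop_funpow[OF hz] nzj] by blast
  define u where "u = take (N + 1) w"
  define d where "d = length w - (N + 1)"
  define n where "n = length t + j * ez + length u"
  have lu: "length u = N + 1" using f(2) by (simp add: u_def)
  have "hop n (\<lambda>g. shl u ((z ^^ j) (shl t g)))"
    unfolding n_def by (intro hop_comp[OF hop_comp[OF hop_shl hop_funpow[OF hz]] hop_shl])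
  then obtain b where b: "b \<in> Fn" "\<And>g. g \<in> Fn \<Longrightarrow> shl u ((z ^^ j) (shl t g)) = ract n b g"
    by (rule hopE) (rule that)
  have bV: "ract n b (Y (T g)) = shl u ((z ^^ Suc j) g)" if "g \<in> U" for g
  proof -
    have "V g \<in> Fn" by (rule hop_Fn[OF hV U_Fn[OF that]])
    from b(2)[OF this] show ?thesis by (simp add: V_def z_def funpow_swap1)
  qed
  define L where "L = length w + Suc j * ez"
  define \<xi> where "\<xi> = trunc L f"
  have \<xi>U: "\<xi> \<in> U" unfolding \<xi>_def by (rule stableD(2)[OF U_stable f(1)])
  have len: "L = (\<kappa> - 1 + n + d) + eT"
    using f(2) lu by (simp add: L_def n_def d_def ez_def)
  have supp: "T \<xi> = trunc (\<kappa> - 1 + n + d) (T f)"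
    unfolding \<xi>_def len by (rule hop_trunc[OF T U_Fn[OF f(1)]])
  have "(z ^^ Suc j) \<xi> = trunc (length w) ((z ^^ Suc j) f)"
    unfolding \<xi>_def L_def by (rule hop_trunc[OF hop_funpow[OF hz] U_Fn[OF f(1)]])
  moreover have uw: "u @ drop (N + 1) w = w" by (simp add: u_def)
  ultimately have "ract n b (Y (T \<xi>)) (drop (N + 1) w) = (z ^^ Suc j) f w"
    unfolding bV[OF \<xi>U] shl_def by (simp only: uw trunc_def refl if_True)
  then have nzw: "\<exists>w. length w = d \<and> ract n b (Y (T \<xi>)) w \<noteq> \<zero>"
    using f(3) by (intro exI[of _ "drop (N + 1) w"]) (simp add: d_def)
  define T2 where "T2 g = T (z g)" for g
  have hT2: "hop (ez + eT) T2" using hop_comp[OF hz T] by (simp add: T2_def[abs_def])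
  have nzT2: "\<not> zero_op (\<lambda>f. Y (T2 f))" using nzVz by (simp add: T2_def V_def)
  have kill: "ract n b (Y (T2 g)) v = \<zero>" if "g \<in> U" for g v
  proof -
    have "ract n b (Y (T2 g)) = shl u ((z ^^ m) g)"
      unfolding T2_def bV[OF zU[OF that]] j by (simp add: funpow_swap1)
    then show ?thesis using zm that by (simp add: zero_op_def shl_def)
  qed
  have inh: "\<exists>f'\<in>U. T2 g = T f'" if "g \<in> U" for g using zU[OF that] by (auto simp: T2_def)
  have "N < n" using lu by (simp add: n_def)
  have "M \<le> d" using f(2) by (simp add: d_def)
  have deg: "\<forall>w. length w \<noteq> \<kappa> - 1 + n + d \<longrightarrow> T \<xi> w = \<zero>" by (simp add: supp trunc_def)
  have ex\<xi>: "\<exists>\<xi>'\<in>U. T \<xi> = T \<xi>'" using \<xi>U by blast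
  have kill': "\<forall>g\<in>U. \<forall>v. ract n b (Y (T2 g)) v = \<zero>" by (intro ballI allI kill)
  have inh': "\<forall>g\<in>U. \<exists>f'\<in>U. T2 g = T f'" by (intro ballI inh)
  show ?thesis
    by (intro exI[of _ n] exI[of _ b] exI[of _ d] exI[of _ "T \<xi>"] exI[of _ T2] exI[of _ "ez + eT"] conjI
        \<open>N < n\<close> \<open>M \<le> d\<close> b(1) ex\<xi> deg nzw hT2 nzT2 kill' inh')
qed

text \<open>
  Iterating the step yields functionals \<open>\<gamma> k\<close> in rapidly increasing degrees and elements \<open>b k\<close> that see \<open>\<gamma> k\<close> but
  none of the later \<open>\<gamma> i\<close>, because the later functionals have the form \<open>z \<mapsto> g (T2 z)\<close> with the element \<open>T2\<close> that
  step \<open>k\<close> provides.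
\<close>
lemma separating_sequence:
  "\<exists>n b d \<gamma>. (\<forall>k. k \<le> d k \<and> b k \<in> Fn \<and> \<gamma> k \<in> U \<and> (\<forall>w. length w \<noteq> \<kappa> - 1 + n k + d k \<longrightarrow> \<gamma> k w = \<zero>) \<and>
       \<kappa> - 1 + n k + d k < n (Suc k) \<and>
       (\<exists>w. length w = d k \<and> ract (n k) (b k) (Y (\<gamma> k)) w \<noteq> \<zero>)) \<and>
     (\<forall>i k w. k < i \<longrightarrow> ract (n k) (b k) (Y (\<gamma> i)) w = \<zero>)"
proof -
  define P where "P k x = (case x of (T, n, b, d, \<gamma>, T2) \<Rightarrow> k \<le> d \<and> b \<in> Fn \<and>
     (\<exists>\<xi>\<in>U. \<gamma> = T \<xi>) \<and> (\<forall>w. length w \<noteq> \<kappa> - 1 + n + d \<longrightarrow> \<gamma> w = \<zero>) \<and>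
     (\<exists>w. length w = d \<and> ract n b (Y \<gamma>) w \<noteq> \<zero>) \<and> (\<exists>e. hop e T) \<and>
     (\<exists>e. hop e T2) \<and> \<not> zero_op (\<lambda>f. Y (T2 f)) \<and>
     (\<forall>f\<in>U. \<forall>w. ract n b (Y (T2 f)) w = \<zero>) \<and> (\<forall>f\<in>U. \<exists>f'\<in>U. T2 f = T f'))"
    for k :: nat and x :: "((bool list \<Rightarrow> 'a) \<Rightarrow> bool list \<Rightarrow> 'a) \<times> nat \<times> (bool list \<Rightarrow> 'a) \<times> nat \<times>
       (bool list \<Rightarrow> 'a) \<times> ((bool list \<Rightarrow> 'a) \<Rightarrow> bool list \<Rightarrow> 'a)"
  define Q where "Q k x y = (case x of (T, n, b, d, \<gamma>, T2) \<Rightarrow> case y of (T', n', b', d', \<gamma>', T2') \<Rightarrow>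
     T' = T2 \<and> \<kappa> - 1 + n + d < n')"
    for k :: nat and x y :: "((bool list \<Rightarrow> 'a) \<Rightarrow> bool list \<Rightarrow> 'a) \<times> nat \<times> (bool list \<Rightarrow> 'a) \<times> nat \<times>
       (bool list \<Rightarrow> 'a) \<times> ((bool list \<Rightarrow> 'a) \<Rightarrow> bool list \<Rightarrow> 'a)"
  have step: "\<exists>n b d \<gamma> T2. N < n \<and> P k (T, n, b, d, \<gamma>, T2)"
    if hT: "hop e T" and nzT: "\<not> zero_op (\<lambda>f. Y (T f))" for N k e T
    using separating_step[OF that, of N k] hT unfolding P_def prod.case by (elim exE conjE) (intro exI conjI; assumption)
  have "\<exists>x. \<forall>k. P k (x k) \<and> Q k (x k) (x (Suc k))"
  proof (rule dependent_nat_choice)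
    have "shl [] = (\<lambda>f. f :: bool list \<Rightarrow> 'a)" by (simp add: shl_def fun_eq_iff)
    then have "\<not> zero_op (\<lambda>f. Y (shl [] f))" using nonzero_Y by simp
    from step[OF hop_shl this] show "\<exists>x. P 0 x" by blast
  next
    fix x k assume x: "P k x"
    obtain T n b d \<gamma> T2 where xe: "x = (T, n, b, d, \<gamma>, T2)" by (cases x)
    obtain e where "hop e T2" "\<not> zero_op (\<lambda>f. Y (T2 f))" using x unfolding xe P_def prod.case by blast
    from step[OF this, of "\<kappa> - 1 + n + d" "Suc k"] obtain n' b' d' \<gamma>' T2'
      where "\<kappa> - 1 + n + d < n'" "P (Suc k) (T2, n', b', d', \<gamma>', T2')" by (elim exE conjE)
    then show "\<exists>y. P (Suc k) y \<and> Q k x y"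
      by (intro exI[of _ "(T2, n', b', d', \<gamma>', T2')"]) (simp add: xe Q_def)
  qed
  then obtain x where x: "\<And>k. P k (x k)" "\<And>k. Q k (x k) (x (Suc k))" by blast
  define T where "T k = fst (x k)" for k
  define n where "n k = fst (snd (x k))" for k
  define b where "b k = fst (snd (snd (x k)))" for k
  define d where "d k = fst (snd (snd (snd (x k))))" for k
  define \<gamma> where "\<gamma> k = fst (snd (snd (snd (snd (x k)))))" for k
  define T2 where "T2 k = snd (snd (snd (snd (snd (x k)))))" for k
  have xe: "x k = (T k, n k, b k, d k, \<gamma> k, T2 k)" for k
    by (simp add: T_def n_def b_def d_def \<gamma>_def T2_def)
  note P = x(1)[unfolded xe P_def prod.case] and Q = x(2)[unfolded xe Q_def prod.case]
  have \<gamma>U: "\<gamma> k \<in> U" for k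
  proof -
    obtain e \<xi> where "hop e (T k)" "\<xi> \<in> U" "\<gamma> k = T k \<xi>" using P[of k] by (elim conjE exE bexE)
    then show ?thesis using hop_stable[OF _ U_stable] by simp
  qed
  \<comment> \<open>Every later element arises from T2 by further multiplication on the left.\<close>
  have anc: "\<exists>f'\<in>U. T (k + Suc i) f = T2 k f'" if "f \<in> U" for k i f
    using that
  proof (induction i arbitrary: f)
    case 0
    then show ?case using Q[of k] by auto
  next
    case (Suc i)
    obtain f' where "f' \<in> U" "T (Suc (k + Suc i)) f = T (k + Suc i) f'"
      using P[of "k + Suc i"] Q[of "k + Suc i"] Suc.prems by metis
    then show ?case using Suc.IH by simp
  qed
  have orth: "ract (n k) (b k) (Y (\<gamma> i)) w = \<zero>" if ki: "k < i" for i k w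
  proof -
    obtain r where r: "i = k + Suc r" using ki less_imp_Suc_add by auto
    obtain \<xi> where "\<xi> \<in> U" "\<gamma> i = T i \<xi>" using P[of i] by blast
    then obtain f' where "f' \<in> U" "\<gamma> i = T2 k f'" using anc[of \<xi> k r] r by auto
    then show ?thesis using P[of k] by simp
  qed
  show ?thesis
    using P Q \<gamma>U orth by (intro exI[of _ n] exI[of _ b] exI[of _ d] exI[of _ \<gamma>]) auto
qed

end

section \<open>The cyclic nil module\<close>

text \<open>
  The function \<open>g\<close> factors through the module with basis \<open>S\<close> in which a word \<open>w\<close> equals
  \<open>\<Sum>s\<in>S. f s w * s\<close>, that is, \<open>g\<close> is determined by its values on \<open>S\<close>.
\<close>
definition (in field) functional_on :: "bool list set \<Rightarrow> (bool list \<Rightarrow> bool list \<Rightarrow> 'a) \<Rightarrow> (bool list \<Rightarrow> 'a) \<Rightarrow> bool" where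
  "functional_on S f g \<longleftrightarrow> g \<in> Fn \<and> (\<forall>w. g w = (\<Oplus>s\<in>{s \<in> S. length s = length w}. g s \<otimes> f s w))"

text \<open>
  A cyclic graded module \<open>M\<close> over the free algebra in \<open>x = True\<close> and \<open>y = False\<close>, given by a set \<open>S\<close> of words that
  form a basis and by the coordinate functionals \<open>f\<close>. The axioms say, in this order: \<open>f\<close> is the dual basis of \<open>S\<close> and
  \<open>M\<close> is a module; \<open>M\<close> is infinite dimensional with generator \<open>[]\<close>; \<open>y\<close> kills the generator and \<open>y ^ \<kappa> = 0\<close>; all elements
  without constant term are nilpotent on \<open>M\<close>; there are functionals \<open>\<gamma> k\<close>, in widely separated degrees, and elements
  \<open>b k\<close> of degree \<open>n k\<close> such that \<open>\<gamma> i (y ^ (\<kappa> - 1) b k \<cdot>)\<close> is zero for \<open>i > k\<close> and is for \<open>i = k\<close> a nonzero functional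
  of degree \<open>d k\<close>; and for every vector \<open>h \<noteq> 0\<close> of \<open>M\<close>, every functional \<open>g \<noteq> 0\<close> of sufficiently large degree has a
  translate \<open>g (u \<cdot>)\<close> that does not vanish at \<open>h\<close>.
\<close>
locale cyclic_nil_module = field R for R (structure) +
  fixes S :: "bool list set" and f :: "bool list \<Rightarrow> bool list \<Rightarrow> 'a" and \<kappa> :: nat
    and n d :: "nat \<Rightarrow> nat" and b \<gamma> :: "nat \<Rightarrow> bool list \<Rightarrow> 'a"
  assumes f_Fn: "f t \<in> Fn"
    and f_supp: "f t w \<noteq> \<zero> \<Longrightarrow> t \<in> S \<and> length w = length t"
    and f_dual: "s \<in> S \<Longrightarrow> t \<in> S \<Longrightarrow> f t s = (if t = s then \<one> else \<zero>)"
    and f_functional: "functional_on S f (shl u (f t))"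
    and Nil_in_S: "[] \<in> S"
    and S_infinite: "\<exists>s\<in>S. length s = m"
    and f_False: "f t [False] = \<zero>"
    and \<kappa>_pos: "0 < \<kappa>" and f_power: "f t (replicate \<kappa> False @ w) = \<zero>"
    and f_nil: "p \<in> Fn \<Longrightarrow> (sact D p ^^ nil_exponent D) (f t) w = \<zero>"
    and \<gamma>_functional: "functional_on S f (\<gamma> k)"
    and \<gamma>_supp: "\<gamma> k w \<noteq> \<zero> \<Longrightarrow> length w = \<kappa> - 1 + n k + d k"
    and n_pos: "0 < n k"
    and degrees: "\<kappa> - 1 + n k + d k < n (Suc k)" and d_ge: "k \<le> d k"
    and b_Fn: "b k \<in> Fn"
    and orth: "k < i \<Longrightarrow> ract (n k) (b k) (shl (replicate (\<kappa> - 1) False) (\<gamma> i)) w = \<zero>"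
    and nonorth: "\<exists>w. length w = d k \<and> ract (n k) (b k) (shl (replicate (\<kappa> - 1) False) (\<gamma> k)) w \<noteq> \<zero>"
    and \<theta>_functional: "functional_on S f (shl u (ract (n k) (b k) (shl (replicate (\<kappa> - 1) False) (\<gamma> k))))"
    and separation: "h \<in> Fn \<Longrightarrow> \<exists>s\<in>{s \<in> S. length s = m}. h s \<noteq> \<zero> \<Longrightarrow>
      \<exists>N. \<forall>g M. functional_on S f g \<longrightarrow> (\<forall>w. g w \<noteq> \<zero> \<longrightarrow> length w = M) \<longrightarrow> (\<exists>w. g w \<noteq> \<zero>) \<longrightarrow> N \<le> M \<longrightarrow>
        (\<exists>u. (\<Oplus>s\<in>{s \<in> S. length s = m}. h s \<otimes> g (u @ s)) \<noteq> \<zero>)"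

context just_infinite_pair begin

text \<open>
  The module dual to \<open>U\<close>, with the echelon bases in each degree as coordinates. The last axiom is minimality of
  \<open>U\<close>: the functionals whose translates all vanish on a given vector \<open>h \<noteq> 0\<close> form a proper stable subspace.
\<close>
lemma cyclic_nil_module_exists: "\<exists>S f k n d b \<gamma>. cyclic_nil_module R S f k n d b \<gamma>"
proof -
  have "\<forall>m. \<exists>Te. dual_basis U (words m) (fst Te) (snd Te)"
    using dual_basis_exists[OF finite_words stableD(1)[OF U_stable]] by (metis fst_conv snd_conv)
  then obtain Te where Te: "\<And>m. dual_basis U (words m) (fst (Te m)) (snd (Te m))" by metis
  define T where "T m = fst (Te m)" for m
  define e where "e m = snd (Te m)" for m
  have db: "dual_basis U (words m) (T m) (e m)" for m using Te by (simp add: T_def e_def)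
  define S where "S = (\<Union>m. T m)"
  define f where "f t = (if t \<in> S then trunc (length t) (e (length t) t) else (\<lambda>_. \<zero>))" for t
  have Tlen: "length t = m" if "t \<in> T m" for t m using subsetD[OF dual_basisD(1)[OF db] that] by simp
  have S_len: "{s \<in> S. length s = m} = T m" for m using Tlen by (auto simp: S_def)
  have inT: "t \<in> T (length t)" if "t \<in> S" for t using that Tlen by (auto simp: S_def)
  have fU: "f t \<in> U" for t
    using dual_basisD(2)[OF db inT] stableD(2)[OF U_stable] fun_subspaceD(2)[OF stableD(1)[OF U_stable]]
    by (simp add: f_def)
  have supp: "t \<in> S \<and> length w = length t" if "f t w \<noteq> \<zero>" for t w
    using that by (auto simp: f_def trunc_def split: if_splits)
  have dual: "f t s = (if t = s then \<one> else \<zero>)" if "s \<in> S" "t \<in> S" for s t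
  proof (cases "length s = length t")
    case True
    then have "s \<in> T (length t)" using inT[OF that(1)] by simp
    from dual_basisD(3)[OF db inT[OF that(2)] this] show ?thesis
      using that True by (simp add: f_def trunc_def)
  next
    case False
    then show ?thesis using supp[of t s] by auto
  qed
  have fe: "f s w = e (length w) s w" if "s \<in> T (length w)" for s w
    using that Tlen[OF that] by (auto simp: f_def trunc_def S_def)
  have expand: "g w = (\<Oplus>s\<in>{s \<in> S. length s = length w}. g s \<otimes> f s w)" if g: "g \<in> U" for g w
  proof -
    have "g w = (\<Oplus>s\<in>T (length w). g s \<otimes> e (length w) s w)" by (rule dual_basisD(4)[OF db g]) simp
    also have "\<dots> = (\<Oplus>s\<in>T (length w). g s \<otimes> f s w)"
    proof (rule finsum_cong'[OF refl])
      show "(\<lambda>s. g s \<otimes> f s w) \<in> T (length w) \<rightarrow> carrier R"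
        using FnD[OF U_Fn[OF g]] FnD[OF U_Fn[OF fU]] by simp
    qed (simp add: fe)
    finally show ?thesis by (simp only: S_len)
  qed
  have nonempty: "T m \<noteq> {}" for m
  proof
    assume "T m = {}"
    obtain g w where "g \<in> U" "length w = m" "g w \<noteq> \<zero>" using U_full unfolding full_def by blast
    then show False using expand[of g w] \<open>T m = {}\<close> by (simp add: S_len)
  qed
  obtain n d b \<gamma> where seq: "\<And>k. k \<le> d k" "\<And>k. b k \<in> Fn" "\<And>k. \<gamma> k \<in> U"
    "\<And>k w. length w \<noteq> \<kappa> - 1 + n k + d k \<Longrightarrow> \<gamma> k w = \<zero>" "\<And>k. \<kappa> - 1 + n k + d k < n (Suc k)"
    "\<And>k. \<exists>w. length w = d k \<and> ract (n k) (b k) (Y (\<gamma> k)) w \<noteq> \<zero>"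
    "\<And>i k w. k < i \<Longrightarrow> ract (n k) (b k) (Y (\<gamma> i)) w = \<zero>"
    using separating_sequence by (elim exE conjE) blast
  have sep: "\<exists>N. \<forall>g M. (g \<in> Fn \<and> (\<forall>w. g w = (\<Oplus>s\<in>{s \<in> S. length s = length w}. g s \<otimes> f s w))) \<longrightarrow>
      (\<forall>w. g w \<noteq> \<zero> \<longrightarrow> length w = M) \<longrightarrow> (\<exists>w. g w \<noteq> \<zero>) \<longrightarrow> N \<le> M \<longrightarrow>
        (\<exists>u. (\<Oplus>s\<in>{s \<in> S. length s = m}. h s \<otimes> g (u @ s)) \<noteq> \<zero>)"
    if h: "h \<in> Fn" and hs: "\<exists>s\<in>{s \<in> S. length s = m}. h s \<noteq> \<zero>" for h m
  proof -
    define K where "K = {g \<in> U. \<forall>u. (\<Oplus>s\<in>T m. h s \<otimes> g (u @ s)) = \<zero>}"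
    have finT: "finite (T m)" using dual_basisD(1)[OF db] finite_subset by blast
    note F = fun_subspaceD[OF stableD(1)[OF U_stable]]
    have "stable {} K"
    proof (rule stableI)
      show "fun_subspace K"
      proof (rule fun_subspaceI)
        show "g i \<in> carrier R" if "g \<in> K" for g i using that F(1) by (simp add: K_def)
        have "(\<Oplus>s\<in>T m. h s \<otimes> \<zero>) = \<zero>" using FnD[OF h] by (intro finsum_0I) simp
        then show "(\<lambda>_. \<zero>) \<in> K" using F(2) by (simp add: K_def)
        fix g g' c assume g: "g \<in> K" "g' \<in> K" "c \<in> carrier R"
        have cl: "g w \<in> carrier R" "g' w \<in> carrier R" "h w \<in> carrier R" for w
          using g F(1) FnD[OF h] by (simp_all add: K_def)
        have "(\<Oplus>s\<in>T m. h s \<otimes> (g (u @ s) \<oplus> c \<otimes> g' (u @ s))) = \<zero>" for u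
        proof -
          have "(\<Oplus>s\<in>T m. h s \<otimes> (g (u @ s) \<oplus> c \<otimes> g' (u @ s)))
             = (\<Oplus>s\<in>T m. h s \<otimes> g (u @ s) \<oplus> c \<otimes> (h s \<otimes> g' (u @ s)))"
            using cl g(3) by (intro finsum_cong') (auto simp: r_distr m_lcomm)
          also have "\<dots> = (\<Oplus>s\<in>T m. h s \<otimes> g (u @ s)) \<oplus> (\<Oplus>s\<in>T m. c \<otimes> (h s \<otimes> g' (u @ s)))"
            using cl g(3) by (intro finsum_addf) auto
          also have "(\<Oplus>s\<in>T m. c \<otimes> (h s \<otimes> g' (u @ s))) = c \<otimes> (\<Oplus>s\<in>T m. h s \<otimes> g' (u @ s))"
            using cl g(3) finT by (intro finsum_rdistr[symmetric]) auto
          finally show ?thesis using g by (simp add: K_def)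
        qed
        then show "(\<lambda>i. g i \<oplus> c \<otimes> g' i) \<in> K" using g F(3) by (simp add: K_def)
      qed
      show "shl u g \<in> K" if "g \<in> K" for u g
        using that stableD(3)[OF U_stable, of g u] unfolding K_def shl_def by (simp flip: append_assoc)
      show "trunc l g \<in> K" if g: "g \<in> K" for l g
      proof -
        have cl: "h w \<in> carrier R" "g w \<in> carrier R" for w using FnD[OF h] g F(1) by (simp_all add: K_def)
        have "(\<Oplus>s\<in>T m. h s \<otimes> trunc l g (u @ s)) = \<zero>" for u
        proof (cases "length u + m = l")
          case True
          have "(\<Oplus>s\<in>T m. h s \<otimes> trunc l g (u @ s)) = (\<Oplus>s\<in>T m. h s \<otimes> g (u @ s))"
            using cl True Tlen by (intro finsum_cong') (auto simp: trunc_def)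
          then show ?thesis using g by (simp add: K_def)
        next
          case False
          have "h s \<otimes> trunc l g (u @ s) = \<zero>" if "s \<in> T m" for s
            using cl False Tlen[OF that] by (simp add: trunc_def)
          then show ?thesis by (rule finsum_0I)
        qed
        then show ?thesis using g stableD(2)[OF U_stable] by (simp add: K_def)
      qed
    qed simp
    moreover have "K \<subseteq> U" by (auto simp: K_def)
    moreover obtain s where s: "s \<in> S" "s \<in> T m" "h s \<noteq> \<zero>" using hs S_len by auto
    have "(\<Oplus>s'\<in>T m. h s' \<otimes> f s ([] @ s')) = h s \<otimes> f s s"
    proof (subst finsum_only[of _ s])
      show "h s' \<otimes> f s ([] @ s') = \<zero>" if "s' \<in> T m" "s' \<noteq> s" for s'
      proof -
        have "s' \<in> S" using that(1) by (auto simp: S_def)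
        then show ?thesis using dual[OF _ s(1), of s'] that(2) FnD[OF h] by simp
      qed
    qed (use finT s FnD[OF h] FnD[OF U_Fn[OF fU]] in simp_all)
    then have "(\<Oplus>s'\<in>T m. h s' \<otimes> f s ([] @ s')) \<noteq> \<zero>" using s dual FnD[OF h] by simp
    then have "f s \<notin> K" unfolding K_def by blast
    ultimately obtain N where N: "\<And>g w. g \<in> K \<Longrightarrow> N \<le> length w \<Longrightarrow> g w = \<zero>"
      using minimal_stable_vanish[OF U _ _ fU] by blast
    have "\<exists>u. (\<Oplus>s\<in>T m. h s \<otimes> g (u @ s)) \<noteq> \<zero>"
      if g: "g \<in> Fn" "\<forall>w. g w = (\<Oplus>s\<in>{s \<in> S. length s = length w}. g s \<otimes> f s w)"
        "\<forall>w. g w \<noteq> \<zero> \<longrightarrow> length w = M" "\<exists>w. g w \<noteq> \<zero>" "N \<le> M" for g M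
    proof (rule ccontr)
      assume neg: "\<not> ?thesis"
      have finTM: "finite (T M)" using dual_basisD(1)[OF db] finite_subset by blast
      have "(\<lambda>w. \<Oplus>s\<in>T M. g s \<otimes> f s w) \<in> U"
        using finTM fU FnD[OF g(1)] by (intro fun_subspace_finsum stableD(1)[OF U_stable])
      moreover have "(\<Oplus>s\<in>T M. g s \<otimes> f s w) = g w" for w
      proof (cases "length w = M")
        case True
        then show ?thesis using g(2) S_len by metis
      next
        case False
        have "g s \<otimes> f s w = \<zero>" if "s \<in> T M" for s
          using supp[of s w] Tlen[OF that] False FnD[OF g(1)] by (metis r_null)
        then have "(\<Oplus>s\<in>T M. g s \<otimes> f s w) = \<zero>" by (rule finsum_0I)
        then show ?thesis using g(3) False by metis
      qed
      ultimately have "g \<in> U" by simp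
      then have "g \<in> K" using neg by (simp add: K_def)
      then show False using N g(3,4,5) by metis
    qed
    then show ?thesis unfolding S_len by (intro exI[of _ N]) blast
  qed
  have func: "functional_on S f g" if "g \<in> U" for g
    using expand[OF that] U_Fn[OF that] unfolding functional_on_def by blast
  \<comment> \<open>The shift by one makes all degrees n k positive.\<close>
  have "cyclic_nil_module R S f \<kappa> (n \<circ> Suc) (d \<circ> Suc) (b \<circ> Suc) (\<gamma> \<circ> Suc)"
  proof (unfold_locales, unfold o_def, goal_cases)
    case (1 t) show ?case by (rule U_Fn[OF fU])
  next
    case (2 t w) then show ?case by (rule supp)
  next
    case (3 s t) then show ?case by (rule dual)
  next
    case (4 u t)
    show ?case by (rule func[OF stableD(3)[OF U_stable fU]])
  next
    case 5 then show ?case using nonempty[of 0] Tlen[of _ 0] by (auto simp: S_def)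
  next
    case (6 m) then show ?case using nonempty[of m] Tlen[of _ m] by (auto simp: S_def)
  next
    case (7 t) then show ?case using U_last[OF fU, of t "[]"] by simp
  next
    case 8 then show ?case by (rule \<kappa>_pos)
  next
    case (9 t w) then show ?case using zero_\<kappa> fU by (simp add: zero_op_def shl_def)
  next
    case (10 p D t w) then show ?case using nil_UI fU U_sub by blast
  next
    case (11 k) then show ?case by (rule func[OF seq(3)])
  next
    case (12 k w) then show ?case using seq(4) by blast
  next
    case (13 k) then show ?case using seq(5)[of k] by simp
  next
    case (14 k) then show ?case by (rule seq(5))
  next
    case (15 k) then show ?case using seq(1)[of "Suc k"] by simp
  next
    case (16 k) then show ?case by (rule seq(2))
  next
    case (17 k i w) then show ?case by (intro seq(7)) simp
  next
    case (18 k) then show ?case by (rule seq(6))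
  next
    case (19 u k) then show ?case
      by (intro func stableD(3)[OF U_stable] stable_ract[OF U_stable] seq(2,3))
  next
    case (20 h m) then show ?case using sep unfolding functional_on_def by blast
  qed
  then show ?thesis by blast
qed

end

section \<open>Existence of a just infinite pair\<close>

context field begin

interpretation nil: homogeneous_relations R nil_relations relation_degree
  by (rule homogeneous_nil_relations)

lemma nil_stable: "stable two_sided nil.Ann"
proof (rule stableI)
  show "trunc n f \<in> nil.Ann" if "f \<in> nil.Ann" for n f
    using nil.Ann_truncate[OF that, of n] by (simp add: trunc_def[abs_def])
  show "shl u f \<in> nil.Ann" if "f \<in> nil.Ann" for u f
    using nil.Ann_shift_left[OF that, of u] by (simp add: shl_def[abs_def])
  show "g f \<in> nil.Ann" if g: "g \<in> two_sided" and f: "f \<in> nil.Ann" for g f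
  proof -
    obtain u where "g = shr u" using g by (auto simp: two_sided_def)
    then show ?thesis using nil.Ann_shift_right[OF f, of u] by (simp add: shr_def[abs_def])
  qed
qed (rule nil.Ann_subspace)

text \<open>
  The case \<open>p = y\<close> of the nil relations.
\<close>
lemma nil_right_power:
  assumes "f \<in> nil.Ann" shows "f (w @ replicate (nil_exponent 1) False) = \<zero>"
proof -
  let ?P = "nil_exponent 1"
  let ?p = "\<lambda>u. if u = [False] then \<one> else \<zero>"
  let ?L = "{l. set l \<subseteq> short_words 1 \<and> length l = ?P}"
  let ?l = "replicate ?P [False]"
  have pcl: "?p u \<in> carrier R" for u by simp
  have rep: "coeff_prod ?p (replicate m [False]) = \<one>" for m by (induction m) auto
  have conc: "concat (replicate m [False]) = replicate m False" for m by (induction m) auto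
  have zero: "coeff_prod ?p l = \<zero> \<or> l = replicate (length l) [False]" for l
    by (induction l) (auto simp: coeff_prod_closed[OF pcl])
  have "(\<Oplus>l\<in>?L. coeff_prod ?p l \<otimes> f (w @ concat l @ [])) = coeff_prod ?p ?l \<otimes> f (w @ concat ?l @ [])"
  proof (rule finsum_only)
    show "finite ?L" by (rule finite_lists_length_eq) simp
    show "?l \<in> ?L" by (auto simp: short_words_def)
    show "coeff_prod ?p l \<otimes> f (w @ concat l @ []) = \<zero>" if "l \<in> ?L" "l \<noteq> ?l" for l
    proof -
      have "coeff_prod ?p l = \<zero>" using zero[of l] that by auto
      then show ?thesis using nil.AnnD(1)[OF assms] by simp
    qed
  qed (use nil.AnnD(1)[OF assms] rep in simp)
  moreover have "(\<Oplus>l\<in>?L. coeff_prod ?p l \<otimes> f (w @ concat l @ [])) = \<zero>"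
    by (rule nil_expansion[OF assms pcl])
  ultimately show ?thesis using rep conc nil.AnnD(1)[OF assms] by simp
qed

text \<open>
  \<open>UI\<close> is a minimal full two-sided space below the annihilator of the nil relations, and \<open>U\<close> is a minimal full
  space inside the functionals of \<open>UI\<close> that vanish on the left ideal generated by \<open>y\<close>. The latter are full: starting
  from a functional of high degree, shift it on the right by \<open>y\<close> as long as it stays nonzero; as \<open>y\<close> is nilpotent, few
  shifts are possible, and the last nonzero functional still has high degree. Left shifts then reach every smaller
  degree.
\<close>
lemma just_infinite_pair_exists: "\<exists>UI U. just_infinite_pair R UI U"
proof -
  have "full nil.Ann" using nil_nonzero by (simp add: full_def)
  then obtain UI where UI: "UI \<subseteq> nil.Ann" "minimal_stable two_sided UI"
    using minimal_stable_exists[OF nil_stable] by blast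
  have UIs: "stable two_sided UI" "full UI" using UI(2) by (simp_all add: minimal_stable_def)
  note S = stableD[OF UIs(1)] and F = fun_subspaceD[OF stableD(1)[OF UIs(1)]]
  define U0 where "U0 = {f \<in> UI. \<forall>w. f (w @ [False]) = \<zero>}"
  have "stable {} U0"
  proof (rule stableI)
    show "fun_subspace U0" using F by (intro fun_subspaceI) (simp_all add: U0_def)
    show "trunc n f \<in> U0" if "f \<in> U0" for n f using that S(2) by (simp add: U0_def trunc_def)
    show "shl u f \<in> U0" if f: "f \<in> U0" for u f
    proof -
      have "f ((u @ w) @ [False]) = \<zero>" for w using f unfolding U0_def by blast
      then have "shl u f (w @ [False]) = \<zero>" for w by (simp add: shl_def)
      then show ?thesis using f S(3) by (simp add: U0_def)
    qed
  qed simp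
  moreover have "full U0"
    unfolding full_def
  proof
    fix n
    let ?P = "nil_exponent 1"
    obtain f w where f: "f \<in> UI" "length w = n + ?P" "f w \<noteq> \<zero>" using UIs(2) unfolding full_def by blast
    define f1 where "f1 = trunc (n + ?P) f"
    have f1: "f1 \<in> UI" "f1 w \<noteq> \<zero>" using f S(2) by (simp_all add: f1_def trunc_def)
    define g where "g j = shr (replicate j False) f1" for j
    have gUI: "g j \<in> UI" for j
      unfolding g_def by (rule S(4)[OF _ f1(1)]) (simp add: two_sided_def)
    have ex: "\<exists>j. \<forall>w. g j w = \<zero>"
      using nil_right_power[OF subsetD[OF UI(1) f1(1)]] by (intro exI[of _ ?P]) (simp add: g_def shr_def)
    define m where "m = (LEAST j. \<forall>w. g j w = \<zero>)"
    have m: "\<forall>w. g m w = \<zero>" unfolding m_def using ex by (rule LeastI_ex)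
    have mP: "m \<le> ?P" unfolding m_def 
      using nil_right_power[OF subsetD[OF UI(1) f1(1)]] by (intro Least_le) (simp add: g_def shr_def)
    have "m \<noteq> 0"
    proof
      assume "m = 0"
      then show False using m f1(2) by (simp add: g_def shr_def)
    qed
    then obtain j where j: "m = Suc j" by (cases m) auto
    have "\<exists>w. g j w \<noteq> \<zero>" using not_less_Least[of j "\<lambda>j. \<forall>w. g j w = \<zero>"] j unfolding m_def by auto
    then obtain v where v: "g j v \<noteq> \<zero>" by blast
    have "length v + j = n + ?P"
      using v by (auto simp: g_def shr_def f1_def trunc_def split: if_splits)
    then have lv: "n \<le> length v" using mP j by simp
    have gU0: "g j \<in> U0"
    proof -
      have "g j (w @ [False]) = g m w" for w by (simp add: g_def shr_def j)
      then show ?thesis using gUI m by (simp add: U0_def)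
    qed
    let ?u = "take (length v - n) v" and ?v = "drop (length v - n) v"
    have "shl ?u (g j) \<in> U0" by (rule stableD(3)[OF \<open>stable {} U0\<close> gU0])
    moreover have "shl ?u (g j) ?v \<noteq> \<zero>" using v by (simp add: shl_def)
    moreover have "length ?v = n" using lv by simp
    ultimately show "\<exists>f\<in>U0. \<exists>w. length w = n \<and> f w \<noteq> \<zero>" by blast
  qed
  ultimately obtain U where U: "U \<subseteq> U0" "minimal_stable {} U" using minimal_stable_exists by blast
  have nilp: "(sact D p ^^ nil_exponent D) f w = \<zero>" if f: "f \<in> UI" and p: "p \<in> Fn" for D p f w
  proof -
    have "(\<Oplus>l\<in>{l. set l \<subseteq> short_words D \<and> length l = nil_exponent D}.
       coeff_prod p l \<otimes> f ([] @ concat l @ w)) = \<zero>"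
      by (rule nil_expansion[OF subsetD[OF UI(1) f] FnD[OF p]])
    then show ?thesis using sact_funpow[OF p stable_Fn[OF UIs(1) f]] by simp
  qed
  have "just_infinite_pair R UI U"
  proof (unfold_locales, goal_cases)
    case 3 then show ?case using U(1) by (auto simp: U0_def)
  next
    case (4 f w) then show ?case using U(1) by (auto simp: U0_def)
  qed (use UI U nilp in blast)+
  then show ?thesis by blast
qed

lemma exists_cyclic_nil_module: "\<exists>S f \<kappa> n d b \<gamma>. cyclic_nil_module R S f \<kappa> n d b \<gamma>"
proof -
  obtain UI U where "just_infinite_pair R UI U" using just_infinite_pair_exists by blast
  then interpret just_infinite_pair R UI U .
  show ?thesis by (rule cyclic_nil_module_exists)
qed

end

section \<open>Spans, subalgebras and powers\<close>

lemma (in Module.module) finsum_smult_rdistr: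
  assumes "finite I" "\<And>i. i \<in> I \<Longrightarrow> g i \<in> carrier R" "v \<in> carrier M"
  shows "(\<Oplus>i\<in>I. g i) \<odot>\<^bsub>M\<^esub> v = (\<Oplus>\<^bsub>M\<^esub>i\<in>I. g i \<odot>\<^bsub>M\<^esub> v)"
  using assms by (induction I) (auto simp: smult_l_distr Pi_def R.finsum_closed)

lemma (in Module.module) submoduleI':
  assumes "H \<subseteq> carrier M" "\<zero>\<^bsub>M\<^esub> \<in> H" "\<And>x y. x \<in> H \<Longrightarrow> y \<in> H \<Longrightarrow> x \<oplus>\<^bsub>M\<^esub> y \<in> H"
    "\<And>c x. c \<in> carrier R \<Longrightarrow> x \<in> H \<Longrightarrow> c \<odot>\<^bsub>M\<^esub> x \<in> H"
  shows "submodule H R M"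
proof (rule submoduleI)
  fix x assume x: "x \<in> H"
  then have "x \<in> carrier M" using assms(1) by blast
  then have "\<ominus>\<^bsub>M\<^esub> x = (\<ominus> \<one>) \<odot>\<^bsub>M\<^esub> x" by (simp add: smult_l_minus)
  then show "\<ominus>\<^bsub>M\<^esub> x \<in> H" using assms(4)[OF _ x, of "\<ominus> \<one>"] by simp
qed (use assms in auto)

lemma (in Module.module) submoduleD':
  assumes "submodule H R M"
  shows "H \<subseteq> carrier M" "\<zero>\<^bsub>M\<^esub> \<in> H" "x \<in> H \<Longrightarrow> y \<in> H \<Longrightarrow> x \<oplus>\<^bsub>M\<^esub> y \<in> H"
    "c \<in> carrier R \<Longrightarrow> x \<in> H \<Longrightarrow> c \<odot>\<^bsub>M\<^esub> x \<in> H"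
proof -
  note E = submoduleE[OF assms]
  show "H \<subseteq> carrier M" by (rule E(1))
  show "x \<in> H \<Longrightarrow> y \<in> H \<Longrightarrow> x \<oplus>\<^bsub>M\<^esub> y \<in> H" by (rule E(5))
  show "c \<in> carrier R \<Longrightarrow> x \<in> H \<Longrightarrow> c \<odot>\<^bsub>M\<^esub> x \<in> H" by (rule E(4))
  obtain y where y: "y \<in> H" using E(2) by blast
  then have "y \<in> carrier M" using E(1) by blast
  then show "\<zero>\<^bsub>M\<^esub> \<in> H" using E(4)[OF R.zero_closed y] by simp
qed

lemma (in Module.module) submodule_finsum:
  assumes "submodule H R M" "finite K" "\<And>k. k \<in> K \<Longrightarrow> g k \<in> H"
  shows "finsum M g K \<in> H"
  using assms(2,3)
proof (induction K)
  case empty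
  then show ?case using submoduleD'(2)[OF assms(1)] by simp
next
  case (insert k K)
  have "g \<in> K \<rightarrow> carrier M" "g k \<in> carrier M" using insert.prems submoduleD'(1)[OF assms(1)] by auto
  then show ?case using insert submoduleD'(3)[OF assms(1)] by simp
qed

lemma (in Module.module) lin_span_submodule:
  assumes "S \<subseteq> carrier M" shows "submodule (lin_span R M S) R M"
proof (rule submoduleI')
  have c: "submodule (carrier M) R M" by (rule carrier_is_submodule)
  show "lin_span R M S \<subseteq> carrier M" unfolding lin_span_def by (rule hull_minimal[where S = "\<lambda>W. submodule W R M", OF assms c])
qed (auto simp: lin_span_def hull_def submoduleD')

lemma lin_span_superset: "S \<subseteq> lin_span R M S"
  unfolding lin_span_def by (rule hull_subset)

lemma lin_span_least: "S \<subseteq> W \<Longrightarrow> submodule W R M \<Longrightarrow> lin_span R M S \<subseteq> W"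
  unfolding lin_span_def by (rule hull_minimal)

lemma lin_span_mono: "S \<subseteq> T \<Longrightarrow> lin_span R M S \<subseteq> lin_span R M T"
  unfolding lin_span_def by (rule hull_mono)

lemma (in Module.module) combinations_submodule:
  assumes "finite K" "\<And>k. k \<in> K \<Longrightarrow> e k \<in> carrier M"
  shows "submodule {\<Oplus>\<^bsub>M\<^esub>k\<in>K. q k \<odot>\<^bsub>M\<^esub> e k |q. \<forall>k. q k \<in> carrier R} R M"
proof (rule submoduleI')
  have cl: "(\<lambda>k. q k \<odot>\<^bsub>M\<^esub> e k) \<in> K \<rightarrow> carrier M" if "\<forall>k. q k \<in> carrier R" for q
    using that assms(2) by auto
  show "{\<Oplus>\<^bsub>M\<^esub>k\<in>K. q k \<odot>\<^bsub>M\<^esub> e k |q. \<forall>k. q k \<in> carrier R} \<subseteq> carrier M"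
    using cl by (auto intro!: M.finsum_closed)
  have "(\<Oplus>\<^bsub>M\<^esub>k\<in>K. \<zero> \<odot>\<^bsub>M\<^esub> e k) = \<zero>\<^bsub>M\<^esub>" using assms(2) by (intro M.add.finprod_one_eqI) simp
  then show "\<zero>\<^bsub>M\<^esub> \<in> {\<Oplus>\<^bsub>M\<^esub>k\<in>K. q k \<odot>\<^bsub>M\<^esub> e k |q. \<forall>k. q k \<in> carrier R}"
    by (auto intro!: exI[of _ "\<lambda>_. \<zero>"])
  fix x y assume "x \<in> {\<Oplus>\<^bsub>M\<^esub>k\<in>K. q k \<odot>\<^bsub>M\<^esub> e k |q. \<forall>k. q k \<in> carrier R}"
    "y \<in> {\<Oplus>\<^bsub>M\<^esub>k\<in>K. q k \<odot>\<^bsub>M\<^esub> e k |q. \<forall>k. q k \<in> carrier R}"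
  then obtain q r where q: "x = (\<Oplus>\<^bsub>M\<^esub>k\<in>K. q k \<odot>\<^bsub>M\<^esub> e k)" "\<forall>k. q k \<in> carrier R"
    and r: "y = (\<Oplus>\<^bsub>M\<^esub>k\<in>K. r k \<odot>\<^bsub>M\<^esub> e k)" "\<forall>k. r k \<in> carrier R" by blast
  have "x \<oplus>\<^bsub>M\<^esub> y = (\<Oplus>\<^bsub>M\<^esub>k\<in>K. q k \<odot>\<^bsub>M\<^esub> e k \<oplus>\<^bsub>M\<^esub> r k \<odot>\<^bsub>M\<^esub> e k)"
    unfolding q(1) r(1) by (rule M.finsum_addf[symmetric, OF cl[OF q(2)] cl[OF r(2)]])
  also have "\<dots> = (\<Oplus>\<^bsub>M\<^esub>k\<in>K. (q k \<oplus> r k) \<odot>\<^bsub>M\<^esub> e k)"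
    using q(2) r(2) assms(2) by (intro M.finsum_cong') (auto simp: smult_l_distr)
  finally show "x \<oplus>\<^bsub>M\<^esub> y \<in> {\<Oplus>\<^bsub>M\<^esub>k\<in>K. q k \<odot>\<^bsub>M\<^esub> e k |q. \<forall>k. q k \<in> carrier R}"
    using q(2) r(2) by (intro CollectI exI[of _ "\<lambda>k. q k \<oplus> r k"]) simp
next
  fix c x assume c: "c \<in> carrier R" and "x \<in> {\<Oplus>\<^bsub>M\<^esub>k\<in>K. q k \<odot>\<^bsub>M\<^esub> e k |q. \<forall>k. q k \<in> carrier R}"
  then obtain q where q: "x = (\<Oplus>\<^bsub>M\<^esub>k\<in>K. q k \<odot>\<^bsub>M\<^esub> e k)" "\<forall>k. q k \<in> carrier R" by blast
  have "c \<odot>\<^bsub>M\<^esub> x = (\<Oplus>\<^bsub>M\<^esub>k\<in>K. c \<odot>\<^bsub>M\<^esub> (q k \<odot>\<^bsub>M\<^esub> e k))"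
    unfolding q(1) using q(2) assms c by (intro finsum_smult_ldistr) auto
  also have "\<dots> = (\<Oplus>\<^bsub>M\<^esub>k\<in>K. (c \<otimes> q k) \<odot>\<^bsub>M\<^esub> e k)"
    using q(2) assms(2) c by (intro M.finsum_cong') (auto simp: smult_assoc1)
  finally show "c \<odot>\<^bsub>M\<^esub> x \<in> {\<Oplus>\<^bsub>M\<^esub>k\<in>K. q k \<odot>\<^bsub>M\<^esub> e k |q. \<forall>k. q k \<in> carrier R}"
    using q(2) c by (intro CollectI exI[of _ "\<lambda>k. c \<otimes> q k"]) simp
qed

lemma (in Module.module) basis_combination:
  assumes "finite K" "k \<in> K" "\<And>k. k \<in> K \<Longrightarrow> e k \<in> carrier M"
  shows "e k \<in> {\<Oplus>\<^bsub>M\<^esub>k\<in>K. q k \<odot>\<^bsub>M\<^esub> e k |q. \<forall>k. q k \<in> carrier R}"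
proof -
  have "(\<Oplus>\<^bsub>M\<^esub>j\<in>K. (if j = k then \<one> else \<zero>) \<odot>\<^bsub>M\<^esub> e j) = (if k = k then \<one> else \<zero>) \<odot>\<^bsub>M\<^esub> e k"
    using assms by (intro M.finsum_only) auto
  then have "e k = (\<Oplus>\<^bsub>M\<^esub>j\<in>K. (if j = k then \<one> else \<zero>) \<odot>\<^bsub>M\<^esub> e j)" using assms by simp
  then show ?thesis by (intro CollectI exI[of _ "\<lambda>j. if j = k then \<one> else \<zero>"]) auto
qed

lemma (in Module.module) span_combination:
  fixes K :: "nat \<Rightarrow> 'k set" and e :: "'k \<Rightarrow> _"
  assumes K: "\<And>D. finite (K D)" "\<And>D D'. D \<le> D' \<Longrightarrow> K D \<subseteq> K D'" and e: "\<And>k. e k \<in> carrier M"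
    and x: "x \<in> lin_span R M (\<Union>D. e ` K D)"
  shows "\<exists>D q. (\<forall>k. q k \<in> carrier R) \<and> x = (\<Oplus>\<^bsub>M\<^esub>k\<in>K D. q k \<odot>\<^bsub>M\<^esub> e k)"
proof -
  define C where "C D = {\<Oplus>\<^bsub>M\<^esub>k\<in>K D. q k \<odot>\<^bsub>M\<^esub> e k |q. \<forall>k. q k \<in> carrier R}" for D
  have C: "submodule (C D) R M" for D
    unfolding C_def by (rule combinations_submodule[OF K(1) e])
  have eC: "e k \<in> C D" if "k \<in> K D" for k D
    unfolding C_def by (rule basis_combination[OF K(1) that e])
  have Cmono: "C D \<subseteq> C D'" if "D \<le> D'" for D D'
  proof
    fix z assume "z \<in> C D"
    then obtain q where q: "z = (\<Oplus>\<^bsub>M\<^esub>k\<in>K D. q k \<odot>\<^bsub>M\<^esub> e k)" "\<forall>k. q k \<in> carrier R" unfolding C_def by blast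
    show "z \<in> C D'" unfolding q(1)
    proof (rule submodule_finsum[OF C K(1)])
      fix k assume "k \<in> K D"
      then have "k \<in> K D'" using K(2)[OF that] by blast
      then show "q k \<odot>\<^bsub>M\<^esub> e k \<in> C D'" using q(2) by (intro submoduleD'(4)[OF C] eC) auto
    qed
  qed
  have "submodule (\<Union>D. C D) R M"
  proof (rule submoduleI')
    show "(\<Union>D. C D) \<subseteq> carrier M" using submoduleD'(1)[OF C] by blast
    show "\<zero>\<^bsub>M\<^esub> \<in> (\<Union>D. C D)" using submoduleD'(2)[OF C] by blast
    show "c \<odot>\<^bsub>M\<^esub> z \<in> (\<Union>D. C D)" if "c \<in> carrier R" "z \<in> (\<Union>D. C D)" for c z
      using that submoduleD'(4)[OF C] by blast
    fix z z' assume "z \<in> (\<Union>D. C D)" "z' \<in> (\<Union>D. C D)"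
    then obtain D D' where "z \<in> C D" "z' \<in> C D'" by blast
    then have "z \<in> C (max D D')" "z' \<in> C (max D D')" using Cmono[of D "max D D'"] Cmono[of D' "max D D'"] by auto
    then show "z \<oplus>\<^bsub>M\<^esub> z' \<in> (\<Union>D. C D)" using submoduleD'(3)[OF C] by blast
  qed
  moreover have "(\<Union>D. e ` K D) \<subseteq> (\<Union>D. C D)" using eC by blast
  ultimately have "lin_span R M (\<Union>D. e ` K D) \<subseteq> (\<Union>D. C D)" by (rule lin_span_least[rotated])
  then have "x \<in> (\<Union>D. C D)" using x by (rule subsetD)
  then show ?thesis unfolding C_def by blast
qed

text \<open>
  The coordinates of \<open>card B + 1\<close> vectors with respect to a basis \<open>B\<close> give \<open>card B\<close> equations for their
  coefficients.
\<close>
lemma finite_dimensional_imp_dependent: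
  assumes "field R" "Module.module R M" "finite_dimensional R M"
  shows "\<exists>N::nat. \<forall>x. (\<forall>i. x i \<in> carrier M) \<longrightarrow>
    (\<exists>c. (\<forall>i. c i \<in> carrier R) \<and> (\<exists>i<N. c i \<noteq> \<zero>\<^bsub>R\<^esub>) \<and> (\<Oplus>\<^bsub>M\<^esub>i\<in>{..<N}. c i \<odot>\<^bsub>M\<^esub> x i) = \<zero>\<^bsub>M\<^esub>)"
proof -
  interpret R: field R by fact
  interpret Module.module R M by fact
  obtain B where B: "lin_basis R M B" "finite B" using assms(3) unfolding finite_dimensional_def by blast
  have BM: "B \<subseteq> carrier M" "lin_span R M B = carrier M" using B(1) unfolding lin_basis_def by auto
  let ?C = "{\<Oplus>\<^bsub>M\<^esub>k\<in>B. q k \<odot>\<^bsub>M\<^esub> k |q. \<forall>k. q k \<in> carrier R}"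
  have "submodule ?C R M" using combinations_submodule[of B "\<lambda>k. k"] B(2) BM(1) by blast
  moreover have "B \<subseteq> ?C" using basis_combination[of B _ "\<lambda>k. k"] B(2) BM(1) by blast
  ultimately have sub: "carrier M \<subseteq> ?C" unfolding BM(2)[symmetric] by (intro lin_span_least)
  show ?thesis
  proof (rule exI[of _ "Suc (card B)"], intro allI impI)
    fix x :: "nat \<Rightarrow> _" assume x: "\<forall>i. x i \<in> carrier M"
    let ?N = "Suc (card B)"
    have "\<forall>i. \<exists>q. (\<forall>k. q k \<in> carrier R) \<and> x i = (\<Oplus>\<^bsub>M\<^esub>k\<in>B. q k \<odot>\<^bsub>M\<^esub> k)"
    proof
      fix i
      from x have "x i \<in> carrier M" ..
      with sub have "x i \<in> ?C" ..
      then show "\<exists>q. (\<forall>k. q k \<in> carrier R) \<and> x i = (\<Oplus>\<^bsub>M\<^esub>k\<in>B. q k \<odot>\<^bsub>M\<^esub> k)"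
        by (elim CollectE exE conjE) (intro exI conjI)
    qed
    from choice[OF this] obtain q where "\<forall>i. (\<forall>k. q i k \<in> carrier R) \<and> x i = (\<Oplus>\<^bsub>M\<^esub>k\<in>B. q i k \<odot>\<^bsub>M\<^esub> k)" ..
    then have q: "\<And>i k. q i k \<in> carrier R" "\<And>i. x i = (\<Oplus>\<^bsub>M\<^esub>k\<in>B. q i k \<odot>\<^bsub>M\<^esub> k)" by simp_all
    have "\<exists>h. (\<forall>i. h i \<in> carrier R) \<and> (\<exists>i\<in>{..<?N}. h i \<noteq> \<zero>\<^bsub>R\<^esub>) \<and>
       (\<forall>k\<in>B. (\<Oplus>\<^bsub>R\<^esub>i\<in>{..<?N}. q i k \<otimes>\<^bsub>R\<^esub> h i) = \<zero>\<^bsub>R\<^esub>)"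
      using B(2) q(1) by (intro R.nontrivial_solution) auto
    then obtain h where h: "\<And>i. h i \<in> carrier R" "\<exists>i\<in>{..<?N}. h i \<noteq> \<zero>\<^bsub>R\<^esub>"
      "\<And>k. k \<in> B \<Longrightarrow> (\<Oplus>\<^bsub>R\<^esub>i\<in>{..<?N}. q i k \<otimes>\<^bsub>R\<^esub> h i) = \<zero>\<^bsub>R\<^esub>" by blast
    have kM: "k \<in> carrier M" if "k \<in> B" for k using that BM(1) by blast
    have "(\<Oplus>\<^bsub>M\<^esub>i\<in>{..<?N}. h i \<odot>\<^bsub>M\<^esub> x i) = (\<Oplus>\<^bsub>M\<^esub>i\<in>{..<?N}. \<Oplus>\<^bsub>M\<^esub>k\<in>B. (q i k \<otimes>\<^bsub>R\<^esub> h i) \<odot>\<^bsub>M\<^esub> k)"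
    proof (rule M.finsum_cong'[OF refl])
      fix i :: nat
      have "h i \<odot>\<^bsub>M\<^esub> x i = (\<Oplus>\<^bsub>M\<^esub>k\<in>B. h i \<odot>\<^bsub>M\<^esub> (q i k \<odot>\<^bsub>M\<^esub> k))"
        unfolding q(2) using B(2) h(1) q(1) kM by (intro finsum_smult_ldistr) auto
      also have "\<dots> = (\<Oplus>\<^bsub>M\<^esub>k\<in>B. (q i k \<otimes>\<^bsub>R\<^esub> h i) \<odot>\<^bsub>M\<^esub> k)"
        using h(1) q(1) kM by (intro M.finsum_cong') (auto simp: smult_assoc1 R.m_comm)
      finally show "h i \<odot>\<^bsub>M\<^esub> x i = (\<Oplus>\<^bsub>M\<^esub>k\<in>B. (q i k \<otimes>\<^bsub>R\<^esub> h i) \<odot>\<^bsub>M\<^esub> k)" .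
    qed (use h(1) q(1) kM in \<open>auto intro!: M.finsum_closed\<close>)
    also have "\<dots> = (\<Oplus>\<^bsub>M\<^esub>k\<in>B. \<Oplus>\<^bsub>M\<^esub>i\<in>{..<?N}. (q i k \<otimes>\<^bsub>R\<^esub> h i) \<odot>\<^bsub>M\<^esub> k)"
      using B(2) h(1) q(1) kM by (intro M.finsum_swap) auto
    also have "\<dots> = \<zero>\<^bsub>M\<^esub>"
    proof (rule M.finsum_0I)
      fix k assume k: "k \<in> B"
      have "(\<Oplus>\<^bsub>M\<^esub>i\<in>{..<?N}. (q i k \<otimes>\<^bsub>R\<^esub> h i) \<odot>\<^bsub>M\<^esub> k) = (\<Oplus>\<^bsub>R\<^esub>i\<in>{..<?N}. q i k \<otimes>\<^bsub>R\<^esub> h i) \<odot>\<^bsub>M\<^esub> k"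
        using h(1) q(1) kM[OF k] by (intro finsum_smult_rdistr[symmetric]) auto
      then show "(\<Oplus>\<^bsub>M\<^esub>i\<in>{..<?N}. (q i k \<otimes>\<^bsub>R\<^esub> h i) \<odot>\<^bsub>M\<^esub> k) = \<zero>\<^bsub>M\<^esub>"
        using h(3)[OF k] kM[OF k] by simp
    qed
    finally show "\<exists>c. (\<forall>i. c i \<in> carrier R) \<and> (\<exists>i<?N. c i \<noteq> \<zero>\<^bsub>R\<^esub>) \<and>
      (\<Oplus>\<^bsub>M\<^esub>i\<in>{..<?N}. c i \<odot>\<^bsub>M\<^esub> x i) = \<zero>\<^bsub>M\<^esub>"
      using h(1,2) by (intro exI[of _ h]) auto
  qed
qed

lemma finite_span_imp_finite_dimensional:
  assumes "Module.module R M" "finite G" "G \<subseteq> carrier M" "lin_span R M G = carrier M"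
  shows "finite_dimensional R M"
proof -
  interpret Module.module R M by fact
  define P where "P m \<longleftrightarrow> (\<exists>H. H \<subseteq> G \<and> lin_span R M H = carrier M \<and> card H = m)" for m
  have "P (card G)" using assms by (auto simp: P_def)
  then have "P (LEAST m. P m)" by (rule LeastI)
  then obtain H where H: "H \<subseteq> G" "lin_span R M H = carrier M" "card H = (LEAST m. P m)" unfolding P_def by blast
  have finH: "finite H" using H(1) assms(2) finite_subset by blast
  have "x \<notin> lin_span R M (H - {x})" if x: "x \<in> H" for x
  proof
    assume mem: "x \<in> lin_span R M (H - {x})"
    have sub: "submodule (lin_span R M (H - {x})) R M" using H(1) assms(3) by (intro lin_span_submodule) blast
    have "H \<subseteq> lin_span R M (H - {x})" using mem lin_span_superset[of "H - {x}" R M] by blast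
    then have "lin_span R M H \<subseteq> lin_span R M (H - {x})" using sub by (rule lin_span_least)
    moreover have "lin_span R M (H - {x}) \<subseteq> carrier M" by (rule submoduleD'(1)[OF sub])
    ultimately have "P (card (H - {x}))" unfolding P_def using H by (intro exI[of _ "H - {x}"]) auto
    then have "card H \<le> card (H - {x})" unfolding H(3) by (rule Least_le)
    then show False using x finH by (metis card_Diff1_less leD)
  qed
  then have "lin_basis R M H" unfolding lin_basis_def using H(1,2) assms(3) by blast
  then show ?thesis unfolding finite_dimensional_def using finH by blast
qed

text \<open>
  \<open>mpow A x m\<close> is \<open>x ^ (m + 1)\<close>: algebras without identity have no zeroth power.
\<close>
primrec mpow :: "('c, 'a, 'm) module_scheme \<Rightarrow> 'a \<Rightarrow> nat \<Rightarrow> 'a" where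
  "mpow A x 0 = x" | "mpow A x (Suc m) = x \<otimes>\<^bsub>A\<^esub> mpow A x m"

lemma mpow_carrier_update [simp]: "mpow (A\<lparr>carrier := H\<rparr>) x m = mpow A x m"
  by (induction m) auto

lemma alg_generated_superset: "S \<subseteq> alg_generated R A S"
  unfolding alg_generated_def by (rule hull_subset)

lemma alg_generated_least: "S \<subseteq> H \<Longrightarrow> subalgebra H R A \<Longrightarrow> alg_generated R A S \<subseteq> H"
  unfolding alg_generated_def by (rule hull_minimal)

lemma alg_generated_subalgebra:
  assumes "Module.module R A" "\<And>x y. x \<in> carrier A \<Longrightarrow> y \<in> carrier A \<Longrightarrow> x \<otimes>\<^bsub>A\<^esub> y \<in> carrier A" "S \<subseteq> carrier A"
  shows "subalgebra (alg_generated R A S) R A"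
proof -
  interpret Module.module R A by fact
  have c: "subalgebra (carrier A) R A" unfolding subalgebra_def using carrier_is_submodule assms(2) by blast
  have sub: "submodule H R A" if "subalgebra H R A" for H using that by (simp add: subalgebra_def)
  have "submodule (alg_generated R A S) R A"
  proof (rule submoduleI')
    show "alg_generated R A S \<subseteq> carrier A" by (rule alg_generated_least[OF assms(3) c])
  qed (auto simp: alg_generated_def hull_def submoduleD'[OF sub])
  moreover have "\<forall>x\<in>alg_generated R A S. \<forall>y\<in>alg_generated R A S. x \<otimes>\<^bsub>A\<^esub> y \<in> alg_generated R A S"
    by (auto simp: alg_generated_def hull_def subalgebra_def)
  ultimately show ?thesis unfolding subalgebra_def by blast
qed

context assoc_algebra begin

lemma mpow_closed [simp]: "x \<in> carrier A \<Longrightarrow> mpow A x m \<in> carrier A"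
  by (induction m) (auto simp: mult_closed)

lemma subalgebra_subset_carrier: "subalgebra H F A \<Longrightarrow> H \<subseteq> carrier A"
  using A.submoduleD'(1) by (simp add: subalgebra_def)

lemma zero_mult: "x \<in> carrier A \<Longrightarrow> \<zero>\<^bsub>A\<^esub> \<otimes>\<^bsub>A\<^esub> x = \<zero>\<^bsub>A\<^esub>"
  using mult_smult_left[of "\<zero>\<^bsub>F\<^esub>" "\<zero>\<^bsub>A\<^esub>" x] by (simp add: mult_closed)

lemma mult_zero: "x \<in> carrier A \<Longrightarrow> x \<otimes>\<^bsub>A\<^esub> \<zero>\<^bsub>A\<^esub> = \<zero>\<^bsub>A\<^esub>"
  using mult_smult_right[of "\<zero>\<^bsub>F\<^esub>" x "\<zero>\<^bsub>A\<^esub>"] by (simp add: mult_closed)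

lemma mult_finsum:
  assumes "finite I" "x \<in> carrier A" "\<And>i. i \<in> I \<Longrightarrow> y i \<in> carrier A"
  shows "x \<otimes>\<^bsub>A\<^esub> (\<Oplus>\<^bsub>A\<^esub>i\<in>I. y i) = (\<Oplus>\<^bsub>A\<^esub>i\<in>I. x \<otimes>\<^bsub>A\<^esub> y i)"
  using assms
proof (induction I)
  case empty
  then show ?case by (simp add: mult_zero)
next
  case (insert i I)
  have "y \<in> I \<rightarrow> carrier A" "(\<lambda>i. x \<otimes>\<^bsub>A\<^esub> y i) \<in> I \<rightarrow> carrier A" using insert.prems by (auto simp: mult_closed)
  then show ?case using insert by (simp add: mult_r_distr mult_closed)
qed

lemma finsum_mult:
  assumes "finite I" "x \<in> carrier A" "\<And>i. i \<in> I \<Longrightarrow> y i \<in> carrier A"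
  shows "(\<Oplus>\<^bsub>A\<^esub>i\<in>I. y i) \<otimes>\<^bsub>A\<^esub> x = (\<Oplus>\<^bsub>A\<^esub>i\<in>I. y i \<otimes>\<^bsub>A\<^esub> x)"
  using assms
proof (induction I)
  case empty
  then show ?case by (simp add: zero_mult)
next
  case (insert i I)
  have "y \<in> I \<rightarrow> carrier A" "(\<lambda>i. y i \<otimes>\<^bsub>A\<^esub> x) \<in> I \<rightarrow> carrier A" using insert.prems by (auto simp: mult_closed)
  then show ?case using insert by (simp add: mult_l_distr mult_closed)
qed

lemma generated_subalgebra: "S \<subseteq> carrier A \<Longrightarrow> subalgebra (alg_generated F A S) F A"
  by (rule alg_generated_subalgebra[OF A.module_axioms mult_closed])

lemma left_preimage_submodule:
  assumes "x \<in> carrier A" "submodule W F A" shows "submodule {y \<in> carrier A. x \<otimes>\<^bsub>A\<^esub> y \<in> W} F A"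
  using assms(1) A.submoduleD'[OF assms(2)]
  by (intro A.submoduleI') (auto simp: mult_zero mult_r_distr mult_smult_right)

lemma right_preimage_submodule:
  assumes "y \<in> carrier A" "submodule W F A" shows "submodule {x \<in> carrier A. x \<otimes>\<^bsub>A\<^esub> y \<in> W} F A"
  using assms(1) A.submoduleD'[OF assms(2)]
  by (intro A.submoduleI') (auto simp: zero_mult mult_l_distr mult_smult_left)

lemma span_mult_closed:
  assumes G: "G \<subseteq> carrier A" and H: "H \<subseteq> carrier A" and W: "submodule W F A"
    and prod: "\<And>x y. x \<in> G \<Longrightarrow> y \<in> H \<Longrightarrow> x \<otimes>\<^bsub>A\<^esub> y \<in> W"
    and x: "x \<in> lin_span F A G" and y: "y \<in> lin_span F A H"
  shows "x \<otimes>\<^bsub>A\<^esub> y \<in> W"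
proof -
  have yA: "y \<in> carrier A" using y A.submoduleD'(1)[OF A.lin_span_submodule[OF H]] by blast
  have "g \<otimes>\<^bsub>A\<^esub> y \<in> W" if g: "g \<in> G" for g
  proof -
    have "lin_span F A H \<subseteq> {y \<in> carrier A. g \<otimes>\<^bsub>A\<^esub> y \<in> W}"
      using prod[OF g] G H g by (intro lin_span_least left_preimage_submodule W) auto
    then show ?thesis using y by blast
  qed
  then have "lin_span F A G \<subseteq> {x \<in> carrier A. x \<otimes>\<^bsub>A\<^esub> y \<in> W}"
    using G yA by (intro lin_span_least right_preimage_submodule W) auto
  then show ?thesis using x by blast
qed

text \<open>
  In a linear relation between the powers of \<open>x\<close> the highest power that occurs is a combination of the lower ones. So
  these span a space that is closed under multiplication by \<open>x\<close>, which is then the generated subalgebra.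
\<close>
lemma algebraic_elementI:
  assumes x: "x \<in> carrier A" and c: "\<And>i. c i \<in> carrier F" "\<exists>i<N. c i \<noteq> \<zero>\<^bsub>F\<^esub>"
    and rel: "(\<Oplus>\<^bsub>A\<^esub>i\<in>{..<N}. c i \<odot>\<^bsub>A\<^esub> mpow A x i) = \<zero>\<^bsub>A\<^esub>"
  shows "finite_dimensional F (A\<lparr>carrier := alg_generated F A {x}\<rparr>)"
proof -
  define r where "r = Max {i. i < N \<and> c i \<noteq> \<zero>\<^bsub>F\<^esub>}"
  have fin: "finite {i. i < N \<and> c i \<noteq> \<zero>\<^bsub>F\<^esub>}" and ne: "{i. i < N \<and> c i \<noteq> \<zero>\<^bsub>F\<^esub>} \<noteq> {}" using c(2) by auto
  have r: "r < N" "c r \<noteq> \<zero>\<^bsub>F\<^esub>" using Max_in[OF fin ne] by (auto simp: r_def)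
  have above: "c i = \<zero>\<^bsub>F\<^esub>" if "r < i" "i < N" for i
    using Max_ge[OF fin, of i] that unfolding r_def by (metis (mono_tags, lifting) leD mem_Collect_eq)
  define G where "G = mpow A x ` {..<r}"
  have GA: "G \<subseteq> carrier A" using x by (auto simp: G_def)
  let ?W = "lin_span F A G"
  have W: "submodule ?W F A" by (rule A.lin_span_submodule[OF GA])
  note WD = A.submoduleD'[OF W]
  have top: "mpow A x r \<in> ?W"
  proof -
    have "(\<Oplus>\<^bsub>A\<^esub>i\<in>{..<N}. c i \<odot>\<^bsub>A\<^esub> mpow A x i) = (\<Oplus>\<^bsub>A\<^esub>i\<in>insert r {..<r}. c i \<odot>\<^bsub>A\<^esub> mpow A x i)"
      using r above x c(1) by (intro A.M.finsum_superset) auto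
    also have "\<dots> = c r \<odot>\<^bsub>A\<^esub> mpow A x r \<oplus>\<^bsub>A\<^esub> (\<Oplus>\<^bsub>A\<^esub>i\<in>{..<r}. c i \<odot>\<^bsub>A\<^esub> mpow A x i)"
      using x c(1) by (intro A.M.finsum_insert) auto
    finally have eq: "c r \<odot>\<^bsub>A\<^esub> mpow A x r \<oplus>\<^bsub>A\<^esub> (\<Oplus>\<^bsub>A\<^esub>i\<in>{..<r}. c i \<odot>\<^bsub>A\<^esub> mpow A x i) = \<zero>\<^bsub>A\<^esub>" using rel by simp
    have s: "(\<Oplus>\<^bsub>A\<^esub>i\<in>{..<r}. c i \<odot>\<^bsub>A\<^esub> mpow A x i) \<in> ?W" (is "?s \<in> _")
      using lin_span_superset[of G F A] c(1)
      by (intro A.submodule_finsum[OF W] WD(4)) (auto simp: G_def)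
    have sA: "?s \<in> carrier A" using s WD(1) by blast
    have cr: "c r \<in> Units F" using r c(1) F.field_Units by auto
    have "c r \<odot>\<^bsub>A\<^esub> mpow A x r = \<ominus>\<^bsub>A\<^esub> ?s"
      using eq sA x c(1) by (metis A.M.minus_equality A.smult_closed mpow_closed)
    also have "\<dots> = (\<ominus>\<^bsub>F\<^esub> \<one>\<^bsub>F\<^esub>) \<odot>\<^bsub>A\<^esub> ?s" using sA by (simp add: A.smult_l_minus)
    finally have "inv\<^bsub>F\<^esub> (c r) \<odot>\<^bsub>A\<^esub> (c r \<odot>\<^bsub>A\<^esub> mpow A x r) \<in> ?W" using s cr by (auto intro!: WD(4))
    moreover have "inv\<^bsub>F\<^esub> (c r) \<odot>\<^bsub>A\<^esub> (c r \<odot>\<^bsub>A\<^esub> mpow A x r) = mpow A x r"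
      using cr c(1) x by (simp add: A.smult_assoc1[symmetric])
    ultimately show ?thesis by simp
  qed
  have pw: "mpow A x i \<in> ?W" if "i \<le> r" for i
    using that top lin_span_superset[of G F A] by (cases "i = r") (auto simp: G_def)
  have xW: "x \<in> ?W" using pw[of 0] by simp
  have xmul: "x \<otimes>\<^bsub>A\<^esub> y \<in> ?W" if "y \<in> ?W" for y
  proof -
    have "?W \<subseteq> {y \<in> carrier A. x \<otimes>\<^bsub>A\<^esub> y \<in> ?W}"
    proof (intro lin_span_least left_preimage_submodule x W subsetI)
      fix g assume "g \<in> G"
      then obtain i where i: "i < r" "g = mpow A x i" by (auto simp: G_def)
      then show "g \<in> {y \<in> carrier A. x \<otimes>\<^bsub>A\<^esub> y \<in> ?W}" using pw[of "Suc i"] x by simp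
    qed
    then show ?thesis using that by blast
  qed
  have pmul: "mpow A x i \<otimes>\<^bsub>A\<^esub> y \<in> ?W" if "y \<in> ?W" for i y
  proof (induction i)
    case 0
    then show ?case using xmul that by simp
  next
    case (Suc i)
    have "y \<in> carrier A" using that WD(1) by blast
    then show ?case using xmul[OF Suc] x by (simp add: mult_assoc)
  qed
  have mulW: "y \<otimes>\<^bsub>A\<^esub> z \<in> ?W" if "y \<in> ?W" "z \<in> ?W" for y z
  proof -
    have "z \<in> carrier A" using that WD(1) by blast
    then have "?W \<subseteq> {y \<in> carrier A. y \<otimes>\<^bsub>A\<^esub> z \<in> ?W}"
      using pmul[OF that(2)] x by (intro lin_span_least right_preimage_submodule W) (auto simp: G_def)
    then show ?thesis using that(1) by blast
  qed
  let ?H = "alg_generated F A {x}"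
  have H: "subalgebra ?H F A" using x by (intro generated_subalgebra) simp
  have Hsub: "submodule ?H F A" using H by (simp add: subalgebra_def)
  have "subalgebra ?W F A" unfolding subalgebra_def using W mulW by blast
  then have HW: "?H \<subseteq> ?W" using xW by (intro alg_generated_least) auto
  have pH: "mpow A x i \<in> ?H" for i
  proof (induction i)
    case 0
    then show ?case using alg_generated_superset[of "{x}" F A] by simp
  next
    case (Suc i)
    then show ?case using H alg_generated_superset[of "{x}" F A] by (auto simp: subalgebra_def)
  qed
  then have GH: "G \<subseteq> ?H" by (auto simp: G_def)
  let ?B = "A\<lparr>carrier := ?H\<rparr>"
  have mB: "Module.module F ?B" by (rule submodule.submodule_is_module[OF Hsub A.module_axioms])
  interpret B: Module.module F ?B by (rule mB)
  have "lin_span F ?B G = ?H"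
  proof
    have sB: "submodule (lin_span F ?B G) F ?B" using GH by (intro B.lin_span_submodule) simp
    note D = B.submoduleD'[OF sB]
    show sub: "lin_span F ?B G \<subseteq> ?H" using D(1) by simp
    have "submodule (lin_span F ?B G) F A"
    proof (rule A.submoduleI')
      show "lin_span F ?B G \<subseteq> carrier A" using sub A.submoduleD'(1)[OF Hsub] by blast
    qed (use D(2,3,4) in simp_all)
    then have "?W \<subseteq> lin_span F ?B G" using lin_span_superset[of G F ?B] by (intro lin_span_least)
    then show "?H \<subseteq> lin_span F ?B G" using HW by blast
  qed
  then show ?thesis using GH by (intro finite_span_imp_finite_dimensional[OF mB, of G]) (simp_all add: G_def)
qed

end

lemma (in assoc_algebra) subalgebra_assoc_algebra:
  assumes "subalgebra H F A" shows "assoc_algebra F (A\<lparr>carrier := H\<rparr>)"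
proof -
  have H: "submodule H F A" and m: "\<And>x y. x \<in> H \<Longrightarrow> y \<in> H \<Longrightarrow> x \<otimes>\<^bsub>A\<^esub> y \<in> H"
    using assms by (auto simp: subalgebra_def)
  have "Module.module F (A\<lparr>carrier := H\<rparr>)" by (rule submodule.submodule_is_module[OF H A.module_axioms])
  moreover have "H \<subseteq> carrier A" by (rule A.submoduleD'(1)[OF H])
  ultimately show ?thesis using m
    by (intro assoc_algebra.intro assoc_algebra_axioms.intro F.field_axioms)
      (auto simp: subset_iff mult_assoc mult_l_distr mult_r_distr mult_smult_left mult_smult_right)
qed

lemma (in assoc_algebra) submodule_restrict:
  assumes H: "submodule H F A" and K: "subalgebra K F A" and "H \<subseteq> K"
  shows "submodule H F (A\<lparr>carrier := K\<rparr>)"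
proof -
  interpret K: assoc_algebra F "A\<lparr>carrier := K\<rparr>" by (rule subalgebra_assoc_algebra[OF K])
  show ?thesis using A.submoduleD'[OF H] assms(3) by (intro K.A.submoduleI') simp_all
qed

lemma (in assoc_algebra) submodule_unrestrict:
  assumes K: "subalgebra K F A" and H: "submodule H F (A\<lparr>carrier := K\<rparr>)"
  shows "submodule H F A"
proof -
  interpret K: assoc_algebra F "A\<lparr>carrier := K\<rparr>" by (rule subalgebra_assoc_algebra[OF K])
  show ?thesis using K.A.submoduleD'[OF H] subalgebra_subset_carrier[OF K] by (intro A.submoduleI') auto
qed

lemma (in assoc_algebra) two_generated_subalgebra:
  assumes xy: "x \<in> carrier A" "y \<in> carrier A"
  shows "two_generated F (A\<lparr>carrier := alg_generated F A {x, y}\<rparr>)" (is "two_generated F ?B")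
proof -
  let ?H = "alg_generated F A {x, y}"
  have H: "subalgebra ?H F A" using xy by (intro generated_subalgebra) simp
  have xyH: "{x, y} \<subseteq> ?H" by (rule alg_generated_superset)
  interpret B: assoc_algebra F ?B by (rule subalgebra_assoc_algebra[OF H])
  let ?G = "alg_generated F ?B {x, y}"
  have G: "subalgebra ?G F ?B" using xyH by (intro B.generated_subalgebra) simp
  then have "submodule ?G F A" using submodule_unrestrict[OF H] by (simp add: subalgebra_def)
  then have "subalgebra ?G F A" using G by (simp add: subalgebra_def)
  then have "?H \<subseteq> ?G" by (intro alg_generated_least alg_generated_superset)
  moreover have "?G \<subseteq> ?H" using B.subalgebra_subset_carrier[OF G] by simp
  ultimately show ?thesis unfolding two_generated_def using xyH by auto
qed

lemma algebraic_imp_power_relation: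
  fixes F (structure)
  assumes F: "field F" and M: "Module.module F A"
    and mult: "\<And>x y. x \<in> carrier A \<Longrightarrow> y \<in> carrier A \<Longrightarrow> x \<otimes>\<^bsub>A\<^esub> y \<in> carrier A"
    and alg: "algebraic_algebra F A" and x: "x \<in> carrier A"
  shows "\<exists>N c. (\<forall>i. c i \<in> carrier F) \<and> (\<exists>i<N. c i \<noteq> \<zero>) \<and>
    (\<Oplus>\<^bsub>A\<^esub>i\<in>{..<N::nat}. c i \<odot>\<^bsub>A\<^esub> mpow A x i) = \<zero>\<^bsub>A\<^esub>"
proof -
  interpret A: Module.module F A by fact
  let ?H = "alg_generated F A {x}"
  let ?B = "A\<lparr>carrier := ?H\<rparr>"
  have H: "subalgebra ?H F A" using x by (intro alg_generated_subalgebra M mult) auto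
  then have Hsub: "submodule ?H F A" by (simp add: subalgebra_def)
  have mB: "Module.module F ?B" by (rule submodule.submodule_is_module[OF Hsub M])
  have pH: "mpow A x i \<in> ?H" for i
  proof (induction i)
    case 0
    then show ?case using alg_generated_superset[of "{x}" F A] by simp
  next
    case (Suc i)
    then show ?case using H alg_generated_superset[of "{x}" F A] by (auto simp: subalgebra_def)
  qed
  have "finite_dimensional F ?B" using alg x unfolding algebraic_algebra_def by blast
  from finite_dimensional_imp_dependent[OF F mB this] obtain N :: nat where
    N: "\<forall>x. (\<forall>i. x i \<in> carrier ?B) \<longrightarrow>
    (\<exists>c. (\<forall>i. c i \<in> carrier F) \<and> (\<exists>i<N. c i \<noteq> \<zero>) \<and> (\<Oplus>\<^bsub>?B\<^esub>i\<in>{..<N}. c i \<odot>\<^bsub>?B\<^esub> x i) = \<zero>\<^bsub>?B\<^esub>)" ..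
  have "\<forall>i. mpow A x i \<in> carrier ?B" using pH by simp
  from mp[OF spec[OF N] this] obtain c where c': "(\<forall>i. c i \<in> carrier F) \<and> (\<exists>i<N. c i \<noteq> \<zero>) \<and>
    (\<Oplus>\<^bsub>?B\<^esub>i\<in>{..<N}. c i \<odot>\<^bsub>?B\<^esub> mpow A x i) = \<zero>\<^bsub>?B\<^esub>" ..
  then have c: "\<And>i. c i \<in> carrier F" "\<exists>i<N. c i \<noteq> \<zero>"
    "(\<Oplus>\<^bsub>?B\<^esub>i\<in>{..<N}. c i \<odot>\<^bsub>?B\<^esub> mpow A x i) = \<zero>\<^bsub>?B\<^esub>" by simp_all
  interpret B: Module.module F ?B by (rule mB)
  have HA: "?H \<subseteq> carrier A" by (rule A.submoduleD'(1)[OF Hsub])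
  have "finsum ?B g I = finsum A g I" if "finite I" "\<And>i. i \<in> I \<Longrightarrow> g i \<in> ?H" for g and I :: "nat set"
    using that
  proof (induction I)
    case (insert i I)
    have "g \<in> I \<rightarrow> carrier ?B" "g i \<in> carrier ?B" "g \<in> I \<rightarrow> carrier A" "g i \<in> carrier A"
      using insert.prems subsetD[OF HA] by simp_all
    then show ?case using insert by (simp add: B.M.finsum_insert A.M.finsum_insert)
  qed (simp add: B.M.finsum_empty A.M.finsum_empty)
  then have "(\<Oplus>\<^bsub>?B\<^esub>i\<in>{..<N}. c i \<odot>\<^bsub>?B\<^esub> mpow A x i) = (\<Oplus>\<^bsub>A\<^esub>i\<in>{..<N}. c i \<odot>\<^bsub>A\<^esub> mpow A x i)"
    using c(1) pH A.submoduleD'(4)[OF Hsub] by simp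
  then show ?thesis using c by (intro exI[of _ N] exI[of _ c]) simp
qed

section \<open>Homomorphisms\<close>

lemma alg_homD:
  assumes "\<phi> \<in> alg_hom F A B"
  shows "x \<in> carrier A \<Longrightarrow> \<phi> x \<in> carrier B"
    "x \<in> carrier A \<Longrightarrow> y \<in> carrier A \<Longrightarrow> \<phi> (x \<oplus>\<^bsub>A\<^esub> y) = \<phi> x \<oplus>\<^bsub>B\<^esub> \<phi> y"
    "x \<in> carrier A \<Longrightarrow> y \<in> carrier A \<Longrightarrow> \<phi> (x \<otimes>\<^bsub>A\<^esub> y) = \<phi> x \<otimes>\<^bsub>B\<^esub> \<phi> y"
    "c \<in> carrier F \<Longrightarrow> x \<in> carrier A \<Longrightarrow> \<phi> (c \<odot>\<^bsub>A\<^esub> x) = c \<odot>\<^bsub>B\<^esub> \<phi> x"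
  using assms by (auto simp: alg_hom_def)

lemma alg_homI:
  assumes "\<And>x. x \<in> carrier A \<Longrightarrow> \<phi> x \<in> carrier B"
    "\<And>x y. x \<in> carrier A \<Longrightarrow> y \<in> carrier A \<Longrightarrow> \<phi> (x \<oplus>\<^bsub>A\<^esub> y) = \<phi> x \<oplus>\<^bsub>B\<^esub> \<phi> y"
    "\<And>x y. x \<in> carrier A \<Longrightarrow> y \<in> carrier A \<Longrightarrow> \<phi> (x \<otimes>\<^bsub>A\<^esub> y) = \<phi> x \<otimes>\<^bsub>B\<^esub> \<phi> y"
    "\<And>c x. c \<in> carrier F \<Longrightarrow> x \<in> carrier A \<Longrightarrow> \<phi> (c \<odot>\<^bsub>A\<^esub> x) = c \<odot>\<^bsub>B\<^esub> \<phi> x"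
  shows "\<phi> \<in> alg_hom F A B"
  using assms by (auto simp: alg_hom_def)

lemma alg_hom_comp: "\<phi> \<in> alg_hom F A B \<Longrightarrow> \<psi> \<in> alg_hom F B C \<Longrightarrow> \<psi> \<circ> \<phi> \<in> alg_hom F A C"
  by (auto simp: alg_hom_def Pi_iff)

lemma alg_hom_mpow:
  assumes "\<phi> \<in> alg_hom F A B" "x \<in> carrier A"
    and "\<And>x y. x \<in> carrier A \<Longrightarrow> y \<in> carrier A \<Longrightarrow> x \<otimes>\<^bsub>A\<^esub> y \<in> carrier A"
  shows "\<phi> (mpow A x i) = mpow B (\<phi> x) i"
proof -
  have "mpow A x i \<in> carrier A \<and> \<phi> (mpow A x i) = mpow B (\<phi> x) i"
    by (induction i) (simp_all add: alg_homD(3)[OF assms(1)] assms(2,3))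
  then show ?thesis ..
qed

lemma alg_hom_zero:
  assumes \<phi>: "\<phi> \<in> alg_hom F A B" and A: "Module.module F A" and B: "Module.module F B"
  shows "\<phi> \<zero>\<^bsub>A\<^esub> = \<zero>\<^bsub>B\<^esub>"
proof -
  interpret A: Module.module F A by fact
  interpret B: Module.module F B by fact
  have "\<phi> (\<zero>\<^bsub>F\<^esub> \<odot>\<^bsub>A\<^esub> \<zero>\<^bsub>A\<^esub>) = \<zero>\<^bsub>F\<^esub> \<odot>\<^bsub>B\<^esub> \<phi> \<zero>\<^bsub>A\<^esub>" by (rule alg_homD(4)[OF \<phi>]) simp_all
  then show ?thesis using alg_homD(1)[OF \<phi> A.M.zero_closed] by simp
qed

lemma alg_hom_combination:
  assumes \<phi>: "\<phi> \<in> alg_hom F A B" and A: "Module.module F A" and B: "Module.module F B"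
    and "finite I" "\<And>i. i \<in> I \<Longrightarrow> x i \<in> carrier A" "\<And>i. c i \<in> carrier F"
  shows "\<phi> (\<Oplus>\<^bsub>A\<^esub>i\<in>I. c i \<odot>\<^bsub>A\<^esub> x i) = (\<Oplus>\<^bsub>B\<^esub>i\<in>I. c i \<odot>\<^bsub>B\<^esub> \<phi> (x i))"
proof -
  interpret A: Module.module F A by fact
  interpret B: Module.module F B by fact
  note H = alg_homD[OF \<phi>]
  show ?thesis using assms(4,5)
  proof (induction I)
    case empty
    then show ?case using alg_hom_zero[OF \<phi> A B] by simp
  next
    case (insert i I)
    have cl: "(\<lambda>i. c i \<odot>\<^bsub>A\<^esub> x i) \<in> I \<rightarrow> carrier A" "(\<lambda>i. c i \<odot>\<^bsub>B\<^esub> \<phi> (x i)) \<in> I \<rightarrow> carrier B"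
      "x i \<in> carrier A" using insert.prems assms(6) H(1) by auto
    have "\<phi> (finsum A (\<lambda>i. c i \<odot>\<^bsub>A\<^esub> x i) I) = (\<Oplus>\<^bsub>B\<^esub>i\<in>I. c i \<odot>\<^bsub>B\<^esub> \<phi> (x i))"
      using insert.IH insert.prems by blast
    then show ?case using insert.hyps cl H(1)[OF cl(3)] assms(6) A.M.finsum_closed[OF cl(1)]
      by (simp add: A.M.finsum_insert B.M.finsum_insert H(2,4))
  qed
qed

section \<open>Algebraic elements\<close>

text \<open>
  Some finitely many distinct powers of \<open>x\<close> are linearly dependent. Allowing arbitrary exponents makes the property
  pass from a power of \<open>x\<close> to \<open>x\<close>, and unlike finite dimension of the generated subalgebra it is visibly preserved by
  homomorphisms.
\<close>
definition power_dependent :: "('c, 'n) ring_scheme \<Rightarrow> ('c, 'a, 'm) module_scheme \<Rightarrow> 'a \<Rightarrow> bool" where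
  "power_dependent F A x \<longleftrightarrow> (\<exists>N (e::nat \<Rightarrow> nat) c. inj e \<and> (\<forall>i. c i \<in> carrier F) \<and> (\<exists>i<N. c i \<noteq> \<zero>\<^bsub>F\<^esub>) \<and>
     (\<Oplus>\<^bsub>A\<^esub>i\<in>{..<N::nat}. c i \<odot>\<^bsub>A\<^esub> mpow A x (e i)) = \<zero>\<^bsub>A\<^esub>)"

lemma power_dependentI:
  assumes "inj (e::nat \<Rightarrow> nat)" "\<And>i. c i \<in> carrier F" "\<exists>i<N. c i \<noteq> \<zero>\<^bsub>F\<^esub>" "(\<Oplus>\<^bsub>A\<^esub>i\<in>{..<N}. c i \<odot>\<^bsub>A\<^esub> mpow A x (e i)) = \<zero>\<^bsub>A\<^esub>"
  shows "power_dependent F A x"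
  unfolding power_dependent_def
  by (intro exI[of _ N] exI[of _ e] exI[of _ c] conjI allI assms)

lemma power_dependentE:
  assumes "power_dependent F A x"
  obtains N e c where "inj (e::nat \<Rightarrow> nat)" "\<And>i. c i \<in> carrier F" "\<exists>i<N. c i \<noteq> \<zero>\<^bsub>F\<^esub>"
    "(\<Oplus>\<^bsub>A\<^esub>i\<in>{..<N}. c i \<odot>\<^bsub>A\<^esub> mpow A x (e i)) = \<zero>\<^bsub>A\<^esub>"
proof -
  from assms obtain N c and e :: "nat \<Rightarrow> nat" where *: "inj e \<and> (\<forall>i. c i \<in> carrier F) \<and> (\<exists>i<N. c i \<noteq> \<zero>\<^bsub>F\<^esub>) \<and>
     (\<Oplus>\<^bsub>A\<^esub>i\<in>{..<N}. c i \<odot>\<^bsub>A\<^esub> mpow A x (e i)) = \<zero>\<^bsub>A\<^esub>"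
    unfolding power_dependent_def by (elim exE)
  show ?thesis by (rule that[of e c N]) (use * in simp_all)
qed

lemma power_dependent_hom:
  assumes \<phi>: "\<phi> \<in> alg_hom F A B" and A: "Module.module F A" and B: "Module.module F B"
    and mult: "\<And>x y. x \<in> carrier A \<Longrightarrow> y \<in> carrier A \<Longrightarrow> x \<otimes>\<^bsub>A\<^esub> y \<in> carrier A"
    and x: "x \<in> carrier A" and pd: "power_dependent F A x"
  shows "power_dependent F B (\<phi> x)"
proof -
  from pd obtain N e c where c: "inj (e::nat \<Rightarrow> nat)" "\<And>i. c i \<in> carrier F" "\<exists>i<N. c i \<noteq> \<zero>\<^bsub>F\<^esub>"
    "(\<Oplus>\<^bsub>A\<^esub>i\<in>{..<N}. c i \<odot>\<^bsub>A\<^esub> mpow A x (e i)) = \<zero>\<^bsub>A\<^esub>" by (rule power_dependentE) (rule that)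
  have cl: "mpow A x i \<in> carrier A" for i by (induction i) (simp_all add: x mult)
  have "(\<Oplus>\<^bsub>B\<^esub>i\<in>{..<N}. c i \<odot>\<^bsub>B\<^esub> mpow B (\<phi> x) (e i)) = \<phi> (\<Oplus>\<^bsub>A\<^esub>i\<in>{..<N}. c i \<odot>\<^bsub>A\<^esub> mpow A x (e i))"
    using alg_hom_combination[OF \<phi> A B, of "{..<N}" "\<lambda>i. mpow A x (e i)" c] cl c(2)
    by (simp add: alg_hom_mpow[OF \<phi> x mult])
  also have "\<dots> = \<zero>\<^bsub>B\<^esub>" using c(4) alg_hom_zero[OF \<phi> A B] by simp
  finally show ?thesis by (rule power_dependentI[OF c(1-3)])
qed

context assoc_algebra begin

lemma mpow_mult: "x \<in> carrier A \<Longrightarrow> mpow A x i \<otimes>\<^bsub>A\<^esub> mpow A x j = mpow A x (Suc (i + j))"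
  by (induction i) (simp_all add: mult_assoc)

lemma mpow_mpow: "x \<in> carrier A \<Longrightarrow> mpow A (mpow A x p) i = mpow A x (p + Suc p * i)"
  by (induction i) (simp_all add: mpow_mult algebra_simps)

lemma power_dependent_mpow:
  assumes x: "x \<in> carrier A" and pd: "power_dependent F A (mpow A x p)" shows "power_dependent F A x"
proof -
  from pd obtain N e c where c: "inj (e::nat \<Rightarrow> nat)" "\<And>i. c i \<in> carrier F" "\<exists>i<N. c i \<noteq> \<zero>\<^bsub>F\<^esub>"
    "(\<Oplus>\<^bsub>A\<^esub>i\<in>{..<N}. c i \<odot>\<^bsub>A\<^esub> mpow A (mpow A x p) (e i)) = \<zero>\<^bsub>A\<^esub>" by (rule power_dependentE) (rule that)
  have "inj (\<lambda>i. p + Suc p * e i)" using c(1) by (intro injI) (simp only: add_left_cancel Suc_mult_cancel1 inj_eq)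
  then show ?thesis using c(2-4) x by (intro power_dependentI[of _ c _ N]) (simp_all add: mpow_mpow)
qed

text \<open>
  Relations with arbitrary exponents are relations with consecutive exponents, some coefficients being zero.
\<close>
lemma power_dependent_imp_algebraic:
  assumes x: "x \<in> carrier A" and pd: "power_dependent F A x"
  shows "finite_dimensional F (A\<lparr>carrier := alg_generated F A {x}\<rparr>)"
proof -
  from pd obtain N e c where c: "inj (e::nat \<Rightarrow> nat)" "\<And>i. c i \<in> carrier F" "\<exists>i<N. c i \<noteq> \<zero>\<^bsub>F\<^esub>"
    "(\<Oplus>\<^bsub>A\<^esub>i\<in>{..<N}. c i \<odot>\<^bsub>A\<^esub> mpow A x (e i)) = \<zero>\<^bsub>A\<^esub>" by (rule power_dependentE) (rule that)
  obtain N' where N': "e ` {..<N} \<subseteq> {..<N'}" using finite_nat_iff_bounded[of "e ` {..<N}"] by auto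
  define c' where "c' j = (if j \<in> e ` {..<N} then c (inv_into UNIV e j) else \<zero>\<^bsub>F\<^esub>)" for j
  have c': "c' j \<in> carrier F" "i < N \<Longrightarrow> c' (e i) = c i" for i j using c(1,2) by (simp_all add: c'_def)
  have c'_out: "j \<notin> e ` {..<N} \<Longrightarrow> c' j = \<zero>\<^bsub>F\<^esub>" for j by (simp only: c'_def if_False)
  have "(\<Oplus>\<^bsub>A\<^esub>j\<in>{..<N'}. c' j \<odot>\<^bsub>A\<^esub> mpow A x j) = (\<Oplus>\<^bsub>A\<^esub>j\<in>e ` {..<N}. c' j \<odot>\<^bsub>A\<^esub> mpow A x j)"
    using N' x c'(1) by (intro A.M.finsum_superset) (simp_all add: c'_out)
  also have "\<dots> = (\<Oplus>\<^bsub>A\<^esub>i\<in>{..<N}. c' (e i) \<odot>\<^bsub>A\<^esub> mpow A x (e i))"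
    using inj_on_subset[OF c(1)] x c'(1) by (intro A.M.finsum_reindex) auto
  also have "\<dots> = (\<Oplus>\<^bsub>A\<^esub>i\<in>{..<N}. c i \<odot>\<^bsub>A\<^esub> mpow A x (e i))"
    using c'(2) c(2) x by (intro A.M.finsum_cong') auto
  finally have rel: "(\<Oplus>\<^bsub>A\<^esub>j\<in>{..<N'}. c' j \<odot>\<^bsub>A\<^esub> mpow A x j) = \<zero>\<^bsub>A\<^esub>" using c(4) by simp
  obtain i where i: "i < N" "c i \<noteq> \<zero>\<^bsub>F\<^esub>" using c(3) by blast
  have "\<exists>j<N'. c' j \<noteq> \<zero>\<^bsub>F\<^esub>" using N' i c'(2)[OF i(1)] by (intro exI[of _ "e i"]) auto
  from algebraic_elementI[OF x c'(1) this rel] show ?thesis .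
qed

section \<open>Coordinates in a 2-generated algebra\<close>

text \<open>
  A 2-generated algebra is spanned by the countably many words in its generators. A choice of coefficients for each
  element identifies it with a sequence of scalars.
\<close>
lemma two_generated_imp_coordinates:
  assumes "two_generated F A"
  shows "\<exists>enc :: 'c \<Rightarrow> nat \<Rightarrow> 'a. inj_on enc (carrier A)"
proof -
  obtain x y where xy: "x \<in> carrier A" "y \<in> carrier A" and gen: "alg_generated F A {x, y} = carrier A"
    using assms unfolding two_generated_def by blast
  \<comment> \<open>The pair (u, g) encodes the nonempty word u followed by the letter g.\<close>
  define word where "word l = foldr (\<lambda>g z. (if g then x else y) \<otimes>\<^bsub>A\<^esub> z) (fst l) (if snd l then x else y)" for l :: "bool list \<times> bool"
  have wcl: "word l \<in> carrier A" for l
  proof -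
    have "foldr (\<lambda>g z. (if g then x else y) \<otimes>\<^bsub>A\<^esub> z) u (if g then x else y) \<in> carrier A" for u g
      by (induction u) (simp_all add: xy mult_closed)
    then show ?thesis by (simp add: word_def)
  qed
  have wmult: "word (u, g) \<otimes>\<^bsub>A\<^esub> word l = word (u @ g # fst l, snd l)" for u g l
  proof (induction u)
    case Nil
    then show ?case by (simp add: word_def)
  next
    case (Cons h u)
    have "word (h # u, g) = (if h then x else y) \<otimes>\<^bsub>A\<^esub> word (u, g)" by (simp add: word_def)
    moreover have "word ((h # u) @ g # fst l, snd l) = (if h then x else y) \<otimes>\<^bsub>A\<^esub> word (u @ g # fst l, snd l)"
      by (simp add: word_def)
    ultimately show ?case using Cons wcl xy by (simp add: mult_assoc)
  qed
  define e where "e = (\<lambda>i::nat. word (from_nat i))"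
  have ecl: "e i \<in> carrier A" for i by (simp add: e_def wcl)
  have re: "range e = range word"
  proof
    show "range word \<subseteq> range e"
    proof
      fix z assume "z \<in> range word"
      then obtain l where "z = word l" by blast
      then have "z = e (to_nat l)" by (simp add: e_def)
      then show "z \<in> range e" by blast
    qed
  qed (auto simp: e_def)
  have eA: "range e \<subseteq> carrier A" using ecl by blast
  have sub: "submodule (lin_span F A (range e)) F A" by (rule A.lin_span_submodule[OF eA])
  have "subalgebra (lin_span F A (range e)) F A"
    unfolding subalgebra_def
  proof (intro conjI ballI sub)
    fix u v assume "u \<in> lin_span F A (range e)" "v \<in> lin_span F A (range e)"
    then show "u \<otimes>\<^bsub>A\<^esub> v \<in> lin_span F A (range e)"
    proof (rule span_mult_closed[OF eA eA sub, rotated])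
      fix z z' assume "z \<in> range e" "z' \<in> range e"
      then obtain l l' where "z = word l" "z' = word l'" unfolding re by blast
      then have "z \<otimes>\<^bsub>A\<^esub> z' \<in> range e" using wmult[of "fst l" "snd l" l'] unfolding re by simp
      then show "z \<otimes>\<^bsub>A\<^esub> z' \<in> lin_span F A (range e)" by (rule subsetD[OF lin_span_superset])
    qed
  qed
  moreover have "{x, y} \<subseteq> lin_span F A (range e)"
  proof -
    have "x = word ([], True)" "y = word ([], False)" by (simp_all add: word_def)
    then have "{x, y} \<subseteq> range e" unfolding re by blast
    then show ?thesis using lin_span_superset[of "range e" F A] by (rule subset_trans)
  qed
  ultimately have "alg_generated F A {x, y} \<subseteq> lin_span F A (range e)" by (intro alg_generated_least)
  then have span: "carrier A \<subseteq> lin_span F A (range e)" using gen by simp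
  have all: "\<exists>N q. (\<forall>k. q k \<in> carrier F) \<and> z = (\<Oplus>\<^bsub>A\<^esub>k\<in>{..<N}. q k \<odot>\<^bsub>A\<^esub> e k)" if "z \<in> carrier A" for z
  proof (rule A.span_combination[OF finite_lessThan _ ecl])
    have "range e = (\<Union>D. e ` {..<D})" by auto
    then show "z \<in> lin_span F A (\<Union>D. e ` {..<D})" using subsetD[OF span that] by (simp only:)
  qed simp
  \<comment> \<open>Coefficient sequences of finite support; the bound N makes the sum meaningful.\<close>
  define coord where "coord z q \<longleftrightarrow> (\<forall>k. q k \<in> carrier F) \<and>
    (\<exists>N. (\<forall>k\<ge>N. q k = \<zero>\<^bsub>F\<^esub>) \<and> z = (\<Oplus>\<^bsub>A\<^esub>k\<in>{..<N}. q k \<odot>\<^bsub>A\<^esub> e k))" for z q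
  have ex: "\<exists>q. coord z q" if z: "z \<in> carrier A" for z
  proof -
    obtain N q where q: "z = (\<Oplus>\<^bsub>A\<^esub>k\<in>{..<N}. q k \<odot>\<^bsub>A\<^esub> e k)" "\<forall>k. q k \<in> carrier F"
      using all[OF z] by blast
    let ?q = "\<lambda>k. if k < N then q k else \<zero>\<^bsub>F\<^esub>"
    have "z = (\<Oplus>\<^bsub>A\<^esub>k\<in>{..<N}. ?q k \<odot>\<^bsub>A\<^esub> e k)"
      unfolding q(1) using q(2) ecl by (intro A.M.finsum_cong') auto
    then show ?thesis unfolding coord_def using q(2) by (intro exI[of _ ?q] conjI exI[of _ N]) auto
  qed
  have uniq: "z = z'" if coord: "coord z q" "coord z' q" for z z' q
  proof -
    obtain N N' where q: "\<forall>k. q k \<in> carrier F" "\<forall>k\<ge>N. q k = \<zero>\<^bsub>F\<^esub>" "\<forall>k\<ge>N'. q k = \<zero>\<^bsub>F\<^esub>"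
      and z: "z = (\<Oplus>\<^bsub>A\<^esub>k\<in>{..<N}. q k \<odot>\<^bsub>A\<^esub> e k)" "z' = (\<Oplus>\<^bsub>A\<^esub>k\<in>{..<N'}. q k \<odot>\<^bsub>A\<^esub> e k)"
      using coord unfolding coord_def by blast
    have "(\<Oplus>\<^bsub>A\<^esub>k\<in>{..<max N N'}. q k \<odot>\<^bsub>A\<^esub> e k) = z"
      unfolding z using q ecl by (intro A.M.finsum_superset) auto
    moreover have "(\<Oplus>\<^bsub>A\<^esub>k\<in>{..<max N N'}. q k \<odot>\<^bsub>A\<^esub> e k) = z'"
      unfolding z using q ecl by (intro A.M.finsum_superset) auto
    ultimately show ?thesis by simp
  qed
  have "inj_on (\<lambda>z. SOME q. coord z q) (carrier A)"
  proof (rule inj_onI)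
    fix z z' assume z: "z \<in> carrier A" "z' \<in> carrier A" and eq: "(SOME q. coord z q) = (SOME q. coord z' q)"
    show "z = z'" using uniq[OF someI_ex[OF ex[OF z(1)]]] someI_ex[OF ex[OF z(2)]] eq by simp
  qed
  then show ?thesis by blast
qed

end

section \<open>Transport along a bijection\<close>

definition transported :: "('a \<Rightarrow> 'e) \<Rightarrow> ('c, 'a, 'm) module_scheme \<Rightarrow> ('c, 'e) module" where
  "transported g A = (let h = inv_into (carrier A) g in
     \<lparr>carrier = g ` carrier A, monoid.mult = (\<lambda>x y. g (h x \<otimes>\<^bsub>A\<^esub> h y)), one = undefined, zero = g \<zero>\<^bsub>A\<^esub>,
      add = (\<lambda>x y. g (h x \<oplus>\<^bsub>A\<^esub> h y)), smult = (\<lambda>c x. g (c \<odot>\<^bsub>A\<^esub> h x))\<rparr>)"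

locale transport = assoc_algebra F A for F (structure) and A (structure) +
  fixes g :: "'c \<Rightarrow> 'e"
  assumes inj: "inj_on g (carrier A)"
begin

abbreviation B where "B \<equiv> transported g A"

lemma B_simps [simp]:
  "carrier B = g ` carrier A" "\<zero>\<^bsub>B\<^esub> = g \<zero>\<^bsub>A\<^esub>"
  "x \<in> carrier A \<Longrightarrow> y \<in> carrier A \<Longrightarrow> g x \<oplus>\<^bsub>B\<^esub> g y = g (x \<oplus>\<^bsub>A\<^esub> y)"
  "x \<in> carrier A \<Longrightarrow> y \<in> carrier A \<Longrightarrow> g x \<otimes>\<^bsub>B\<^esub> g y = g (x \<otimes>\<^bsub>A\<^esub> y)"
  "x \<in> carrier A \<Longrightarrow> c \<odot>\<^bsub>B\<^esub> g x = g (c \<odot>\<^bsub>A\<^esub> x)"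
  using inj by (simp_all add: transported_def Let_def)

lemma g_hom: "g \<in> alg_hom F A B"
  by (rule alg_homI) simp_all

lemma transported_assoc_algebra: "assoc_algebra F B"
proof -
  have "abelian_group B"
  proof (rule abelian_groupI)
    show "\<exists>y\<in>carrier B. y \<oplus>\<^bsub>B\<^esub> x = \<zero>\<^bsub>B\<^esub>" if x: "x \<in> carrier B" for x
    proof -
      obtain w where w: "w \<in> carrier A" "x = g w" using x by auto
      then show ?thesis by (intro bexI[of _ "g (\<ominus>\<^bsub>A\<^esub> w)"]) (auto simp: A.M.l_neg)
    qed
  qed (auto simp: A.M.a_ac)
  then have "Module.module F B"
    by (intro moduleI F.is_cring) (auto simp: A.smult_l_distr A.smult_r_distr A.smult_assoc1)
  then show ?thesis
    by (intro assoc_algebra.intro assoc_algebra_axioms.intro F.field_axioms)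
      (auto simp: mult_closed mult_assoc mult_l_distr mult_r_distr mult_smult_left mult_smult_right)
qed

lemma preimage_submodule: "submodule H F B \<Longrightarrow> submodule {x \<in> carrier A. g x \<in> H} F A"
proof -
  interpret B: assoc_algebra F B by (rule transported_assoc_algebra)
  assume H: "submodule H F B"
  note D = B.A.submoduleD'[OF H]
  show ?thesis
  proof (rule A.submoduleI')
    show "\<zero>\<^bsub>A\<^esub> \<in> {x \<in> carrier A. g x \<in> H}" using D(2) by simp
    show "x \<oplus>\<^bsub>A\<^esub> y \<in> {x \<in> carrier A. g x \<in> H}" if "x \<in> {x \<in> carrier A. g x \<in> H}" "y \<in> {x \<in> carrier A. g x \<in> H}" for x y
      using that D(3)[of "g x" "g y"] by simp
    show "c \<odot>\<^bsub>A\<^esub> x \<in> {x \<in> carrier A. g x \<in> H}" if "c \<in> carrier F" "x \<in> {x \<in> carrier A. g x \<in> H}" for c x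
      using that D(4)[of c "g x"] by simp
  qed auto
qed

lemma image_submodule: "submodule H F A \<Longrightarrow> submodule (g ` H) F B"
proof -
  interpret B: assoc_algebra F B by (rule transported_assoc_algebra)
  assume H: "submodule H F A"
  note D = A.submoduleD'[OF H]
  show ?thesis
  proof (rule B.A.submoduleI')
    show "g ` H \<subseteq> carrier B" using D(1) by auto
    show "\<zero>\<^bsub>B\<^esub> \<in> g ` H" using D(2) by simp
    show "x \<oplus>\<^bsub>B\<^esub> y \<in> g ` H" if "x \<in> g ` H" "y \<in> g ` H" for x y
      using that D(1,3) by (auto simp: subset_iff)
    show "c \<odot>\<^bsub>B\<^esub> x \<in> g ` H" if "c \<in> carrier F" "x \<in> g ` H" for c x
      using that D(1,4) by (auto simp: subset_iff)
  qed
qed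

lemma transported_two_generated: "two_generated F A \<Longrightarrow> two_generated F B"
proof -
  interpret B: assoc_algebra F B by (rule transported_assoc_algebra)
  assume "two_generated F A"
  then obtain x y where xy: "x \<in> carrier A" "y \<in> carrier A" and gen: "alg_generated F A {x, y} = carrier A"
    unfolding two_generated_def by blast
  let ?G = "alg_generated F B {g x, g y}"
  have G: "subalgebra ?G F B" using xy by (intro B.generated_subalgebra) simp
  then have Gs: "submodule ?G F B" and Gm: "\<And>u v. u \<in> ?G \<Longrightarrow> v \<in> ?G \<Longrightarrow> u \<otimes>\<^bsub>B\<^esub> v \<in> ?G"
    by (simp_all add: subalgebra_def)
  have "subalgebra {z \<in> carrier A. g z \<in> ?G} F A"
    unfolding subalgebra_def
  proof (intro conjI ballI preimage_submodule Gs)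
    fix u v assume "u \<in> {z \<in> carrier A. g z \<in> ?G}" "v \<in> {z \<in> carrier A. g z \<in> ?G}"
    then show "u \<otimes>\<^bsub>A\<^esub> v \<in> {z \<in> carrier A. g z \<in> ?G}" using Gm[of "g u" "g v"] by (simp add: mult_closed)
  qed
  then have "carrier A \<subseteq> {z \<in> carrier A. g z \<in> ?G}"
    unfolding gen[symmetric] using xy alg_generated_superset[of "{g x, g y}" F B]
    by (elim alg_generated_least[rotated]) (auto simp: gen)
  then have "carrier B \<subseteq> ?G" by auto
  then have "?G = carrier B" using B.A.submoduleD'(1)[OF Gs] by blast
  then show ?thesis unfolding two_generated_def using xy by auto
qed

lemma transported_algebraic:
  assumes "\<And>x. x \<in> carrier A \<Longrightarrow> power_dependent F A x" shows "algebraic_algebra F B"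
proof -
  interpret B: assoc_algebra F B by (rule transported_assoc_algebra)
  have "power_dependent F B x" if "x \<in> carrier B" for x
    using that power_dependent_hom[OF g_hom A.module_axioms B.A.module_axioms mult_closed] assms by auto
  then show ?thesis unfolding algebraic_algebra_def using B.power_dependent_imp_algebraic by blast
qed

lemma transported_primitive:
  assumes irr: "irreducible_left_module F A V act" and faith: "faithful_action A V act"
  shows "primitive_algebra F B"
proof -
  interpret B: assoc_algebra F B by (rule transported_assoc_algebra)
  interpret left_module F A V act using irr by (simp add: irreducible_left_module_def)
  let ?h = "inv_into (carrier A) g"
  let ?act = "\<lambda>y. act (?h y)"
  have [simp]: "?h (g x) = x" if "x \<in> carrier A" for x using that inj by simp
  have "left_module F B V ?act"
    by (intro left_module.intro left_module_axioms.intro B.assoc_algebra_axioms V.module_axioms)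
      (auto simp: act_closed act_mult act_add_left act_add_right act_smult_left act_smult_right mult_closed)
  moreover have "\<exists>a\<in>carrier B. \<exists>v\<in>carrier V. ?act a v \<noteq> \<zero>\<^bsub>V\<^esub>"
    using irr unfolding irreducible_left_module_def by (auto intro!: bexI)
  ultimately have "irreducible_left_module F B V ?act"
    using irr unfolding irreducible_left_module_def by auto
  moreover have "faithful_action B V ?act"
    using faith unfolding faithful_action_def by auto
  ultimately show ?thesis by (rule primitiveI)
qed

lemma transported_embeddable:
  assumes "M_infinity_embeddable_as_left_ideal Y F A' A" shows "M_infinity_embeddable_as_left_ideal Y F A' B"
proof -
  obtain \<phi> where \<phi>: "\<phi> \<in> alg_hom F (matrix_algebra Y A') A" "inj_on \<phi> (carrier (matrix_algebra Y A'))"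
    "left_ideal (\<phi> ` carrier (matrix_algebra Y A')) F A"
    using assms unfolding M_infinity_embeddable_as_left_ideal_def by blast
  let ?I = "\<phi> ` carrier (matrix_algebra Y A')"
  have I: "?I \<subseteq> carrier A" using alg_homD(1)[OF \<phi>(1)] by blast
  have "inj_on (g \<circ> \<phi>) (carrier (matrix_algebra Y A'))"
    using \<phi>(2) inj_on_subset[OF inj I] by (rule comp_inj_on)
  moreover have "left_ideal (g ` ?I) F B"
    unfolding left_ideal_def
  proof (intro conjI ballI image_submodule)
    show "submodule ?I F A" using \<phi>(3) by (simp add: left_ideal_def)
    fix b x assume "b \<in> carrier B" "x \<in> g ` ?I"
    then obtain b' x' where bx: "b' \<in> carrier A" "b = g b'" "x' \<in> ?I" "x = g x'" by auto
    then have "b' \<otimes>\<^bsub>A\<^esub> x' \<in> ?I" using \<phi>(3) unfolding left_ideal_def by blast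
    moreover have "b \<otimes>\<^bsub>B\<^esub> x = g (b' \<otimes>\<^bsub>A\<^esub> x')" using bx subsetD[OF I bx(3)] by simp
    ultimately show "b \<otimes>\<^bsub>B\<^esub> x \<in> g ` ?I" by blast
  qed
  ultimately show ?thesis
    unfolding M_infinity_embeddable_as_left_ideal_def
    using alg_hom_comp[OF \<phi>(1) g_hom] by (intro bexI[of _ "g \<circ> \<phi>"]) (simp_all add: image_comp)
qed

end

section \<open>The module \<open>M \<otimes> V\<close> and its endomorphisms\<close>

text \<open>
  Endomorphisms are made extensional, so that operators are equal if they agree on the carrier.
\<close>
definition lin_end :: "('c, 'n) ring_scheme \<Rightarrow> ('c, 'v, 'm) module_scheme \<Rightarrow> ('v \<Rightarrow> 'v) set" where
  "lin_end R V = {T. T \<in> extensional (carrier V) \<and> T \<in> carrier V \<rightarrow> carrier V \<and>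
     (\<forall>x\<in>carrier V. \<forall>y\<in>carrier V. T (x \<oplus>\<^bsub>V\<^esub> y) = T x \<oplus>\<^bsub>V\<^esub> T y) \<and>
     (\<forall>c\<in>carrier R. \<forall>x\<in>carrier V. T (c \<odot>\<^bsub>V\<^esub> x) = c \<odot>\<^bsub>V\<^esub> T x)}"

definition end_algebra :: "('c, 'n) ring_scheme \<Rightarrow> ('c, 'v, 'm) module_scheme \<Rightarrow> ('c, 'v \<Rightarrow> 'v) module" where
  "end_algebra R V = \<lparr>carrier = lin_end R V, monoid.mult = compose (carrier V), one = undefined,
     zero = (\<lambda>x\<in>carrier V. \<zero>\<^bsub>V\<^esub>), add = (\<lambda>S T. \<lambda>x\<in>carrier V. S x \<oplus>\<^bsub>V\<^esub> T x),
     smult = (\<lambda>c T. \<lambda>x\<in>carrier V. c \<odot>\<^bsub>V\<^esub> T x)\<rparr>"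

lemma end_algebra_simps [simp]:
  "carrier (end_algebra R V) = lin_end R V"
  "x \<in> carrier V \<Longrightarrow> (S \<otimes>\<^bsub>end_algebra R V\<^esub> T) x = S (T x)"
  "x \<in> carrier V \<Longrightarrow> \<zero>\<^bsub>end_algebra R V\<^esub> x = \<zero>\<^bsub>V\<^esub>"
  "x \<in> carrier V \<Longrightarrow> (S \<oplus>\<^bsub>end_algebra R V\<^esub> T) x = S x \<oplus>\<^bsub>V\<^esub> T x"
  "x \<in> carrier V \<Longrightarrow> (c \<odot>\<^bsub>end_algebra R V\<^esub> T) x = c \<odot>\<^bsub>V\<^esub> T x"
  by (simp_all add: end_algebra_def compose_def)

lemma lin_endI:
  assumes "T \<in> extensional (carrier V)" "\<And>x. x \<in> carrier V \<Longrightarrow> T x \<in> carrier V"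
    "\<And>x y. x \<in> carrier V \<Longrightarrow> y \<in> carrier V \<Longrightarrow> T (x \<oplus>\<^bsub>V\<^esub> y) = T x \<oplus>\<^bsub>V\<^esub> T y"
    "\<And>c x. c \<in> carrier R \<Longrightarrow> x \<in> carrier V \<Longrightarrow> T (c \<odot>\<^bsub>V\<^esub> x) = c \<odot>\<^bsub>V\<^esub> T x"
  shows "T \<in> lin_end R V"
  using assms by (simp add: lin_end_def)

lemma lin_endD:
  assumes "T \<in> lin_end R V"
  shows "x \<in> carrier V \<Longrightarrow> T x \<in> carrier V"
    "x \<in> carrier V \<Longrightarrow> y \<in> carrier V \<Longrightarrow> T (x \<oplus>\<^bsub>V\<^esub> y) = T x \<oplus>\<^bsub>V\<^esub> T y"
    "c \<in> carrier R \<Longrightarrow> x \<in> carrier V \<Longrightarrow> T (c \<odot>\<^bsub>V\<^esub> x) = c \<odot>\<^bsub>V\<^esub> T x"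
    "T \<in> extensional (carrier V)"
  using assms by (auto simp: lin_end_def)

lemma lin_end_eqI:
  assumes "S \<in> lin_end R V" "T \<in> lin_end R V" "\<And>x. x \<in> carrier V \<Longrightarrow> S x = T x"
  shows "S = T"
  by (rule extensionalityI[OF lin_endD(4)[OF assms(1)] lin_endD(4)[OF assms(2)] assms(3)])

lemma end_assoc_algebra:
  assumes "field R" "Module.module R V"
  shows "assoc_algebra R (end_algebra R V)"
proof -
  interpret R: field R by fact
  interpret V: Module.module R V by fact
  let ?E = "end_algebra R V"
  have ext: "x \<in> extensional (carrier V)" if "x = restrict h (carrier V)" for x h using that by simp
  have add: "S \<oplus>\<^bsub>?E\<^esub> T \<in> lin_end R V" if "S \<in> lin_end R V" "T \<in> lin_end R V" for S T
  proof (rule lin_endI)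
    note D = lin_endD[OF that(1)] lin_endD[OF that(2)]
    show "S \<oplus>\<^bsub>?E\<^esub> T \<in> extensional (carrier V)" by (simp add: end_algebra_def)
  qed (use lin_endD(1,2,3)[OF that(1)] lin_endD(1,2,3)[OF that(2)] in \<open>simp_all add: V.M.a_ac V.smult_r_distr\<close>)
  have smult: "c \<odot>\<^bsub>?E\<^esub> T \<in> lin_end R V" if "c \<in> carrier R" "T \<in> lin_end R V" for c T
  proof (rule lin_endI)
    show "c \<odot>\<^bsub>?E\<^esub> T \<in> extensional (carrier V)" by (simp add: end_algebra_def)
    fix c' x assume "c' \<in> carrier R" "x \<in> carrier V"
    then show "(c \<odot>\<^bsub>?E\<^esub> T) (c' \<odot>\<^bsub>V\<^esub> x) = c' \<odot>\<^bsub>V\<^esub> (c \<odot>\<^bsub>?E\<^esub> T) x"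
      using that lin_endD(1,3)[OF that(2)] by (simp add: V.smult_assoc1[symmetric] R.m_comm)
  qed (use that(1) lin_endD(1,2)[OF that(2)] in \<open>simp_all add: V.smult_r_distr\<close>)
  have mult: "S \<otimes>\<^bsub>?E\<^esub> T \<in> lin_end R V" if "S \<in> lin_end R V" "T \<in> lin_end R V" for S T
  proof (rule lin_endI)
    show "S \<otimes>\<^bsub>?E\<^esub> T \<in> extensional (carrier V)" by (simp add: end_algebra_def)
  qed (use lin_endD(1,2,3)[OF that(1)] lin_endD(1,2,3)[OF that(2)] in simp_all)
  have zero: "\<zero>\<^bsub>?E\<^esub> \<in> lin_end R V"
    by (rule lin_endI) (simp_all, simp add: end_algebra_def)
  have grp: "abelian_group ?E"
  proof (rule abelian_groupI)
    show "\<exists>T\<in>carrier ?E. T \<oplus>\<^bsub>?E\<^esub> S = \<zero>\<^bsub>?E\<^esub>" if S: "S \<in> carrier ?E" for S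
    proof (rule bexI)
      have m: "(\<ominus>\<^bsub>R\<^esub> \<one>\<^bsub>R\<^esub>) \<odot>\<^bsub>?E\<^esub> S \<in> lin_end R V" using S by (intro smult) simp_all
      then show "(\<ominus>\<^bsub>R\<^esub> \<one>\<^bsub>R\<^esub>) \<odot>\<^bsub>?E\<^esub> S \<in> carrier ?E" by simp
      show "(\<ominus>\<^bsub>R\<^esub> \<one>\<^bsub>R\<^esub>) \<odot>\<^bsub>?E\<^esub> S \<oplus>\<^bsub>?E\<^esub> S = \<zero>\<^bsub>?E\<^esub>"
      proof (rule lin_end_eqI)
        show "(\<ominus>\<^bsub>R\<^esub> \<one>\<^bsub>R\<^esub>) \<odot>\<^bsub>?E\<^esub> S \<oplus>\<^bsub>?E\<^esub> S \<in> lin_end R V" using m S by (intro add) simp_all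
        fix x assume "x \<in> carrier V"
        then show "((\<ominus>\<^bsub>R\<^esub> \<one>\<^bsub>R\<^esub>) \<odot>\<^bsub>?E\<^esub> S \<oplus>\<^bsub>?E\<^esub> S) x = \<zero>\<^bsub>?E\<^esub> x"
          using S lin_endD(1)[of S R V x] by (simp add: V.smult_l_minus V.M.l_neg)
      qed (rule zero)
    qed
    fix S T U assume S: "S \<in> carrier ?E" and T: "T \<in> carrier ?E"
    note D = lin_endD(1)[of S R V] lin_endD(1)[of T R V]
    show "S \<oplus>\<^bsub>?E\<^esub> T \<in> carrier ?E" using add S T by simp
    show "S \<oplus>\<^bsub>?E\<^esub> T = T \<oplus>\<^bsub>?E\<^esub> S"
      using S T D by (intro lin_end_eqI[of _ R V]) (simp_all add: add V.M.a_comm)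
    show "\<zero>\<^bsub>?E\<^esub> \<oplus>\<^bsub>?E\<^esub> S = S"
      using S D by (intro lin_end_eqI[of _ R V]) (simp_all add: add zero)
    show "S \<oplus>\<^bsub>?E\<^esub> T \<oplus>\<^bsub>?E\<^esub> U = S \<oplus>\<^bsub>?E\<^esub> (T \<oplus>\<^bsub>?E\<^esub> U)" if "U \<in> carrier ?E"
      using S T that D lin_endD(1)[of U R V] by (intro lin_end_eqI[of _ R V]) (simp_all add: add V.M.a_assoc)
  qed (simp_all add: zero)
  have "Module.module R ?E"
  proof (rule moduleI)
    fix c c' S assume c: "c \<in> carrier R" "c' \<in> carrier R" and S: "S \<in> carrier ?E"
    note D = lin_endD(1)[of S R V]
    show "(c \<oplus>\<^bsub>R\<^esub> c') \<odot>\<^bsub>?E\<^esub> S = c \<odot>\<^bsub>?E\<^esub> S \<oplus>\<^bsub>?E\<^esub> c' \<odot>\<^bsub>?E\<^esub> S"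
      using c S D by (intro lin_end_eqI[of _ R V]) (simp_all add: add smult V.smult_l_distr)
    show "(c \<otimes>\<^bsub>R\<^esub> c') \<odot>\<^bsub>?E\<^esub> S = c \<odot>\<^bsub>?E\<^esub> (c' \<odot>\<^bsub>?E\<^esub> S)"
      using c S D by (intro lin_end_eqI[of _ R V]) (simp_all add: smult V.smult_assoc1)
  next
    fix c S T assume c: "c \<in> carrier R" and S: "S \<in> carrier ?E" "T \<in> carrier ?E"
    then show "c \<odot>\<^bsub>?E\<^esub> (S \<oplus>\<^bsub>?E\<^esub> T) = c \<odot>\<^bsub>?E\<^esub> S \<oplus>\<^bsub>?E\<^esub> c \<odot>\<^bsub>?E\<^esub> T"
      using lin_endD(1)[of S R V] lin_endD(1)[of T R V]
      by (intro lin_end_eqI[of _ R V]) (simp_all add: add smult V.smult_r_distr)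
  next
    fix S assume S: "S \<in> carrier ?E"
    then show "\<one>\<^bsub>R\<^esub> \<odot>\<^bsub>?E\<^esub> S = S"
      using lin_endD(1)[of S R V] by (intro lin_end_eqI[of _ R V]) (simp_all add: smult)
  qed (use R.is_cring grp smult in simp_all)
  then show ?thesis
  proof (intro assoc_algebra.intro assoc_algebra_axioms.intro)
    fix S T U assume S: "S \<in> carrier ?E" and T: "T \<in> carrier ?E"
    note D = lin_endD(1)[of S R V] lin_endD(1)[of T R V]
    show "S \<otimes>\<^bsub>?E\<^esub> T \<in> carrier ?E" using S T mult by simp
    assume U: "U \<in> carrier ?E"
    note D = D lin_endD(1)[of U R V]
    show "S \<otimes>\<^bsub>?E\<^esub> T \<otimes>\<^bsub>?E\<^esub> U = S \<otimes>\<^bsub>?E\<^esub> (T \<otimes>\<^bsub>?E\<^esub> U)"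
      using S T U D by (intro lin_end_eqI[of _ R V]) (simp_all add: mult)
    show "(S \<oplus>\<^bsub>?E\<^esub> T) \<otimes>\<^bsub>?E\<^esub> U = S \<otimes>\<^bsub>?E\<^esub> U \<oplus>\<^bsub>?E\<^esub> T \<otimes>\<^bsub>?E\<^esub> U"
      using S T U D by (intro lin_end_eqI[of _ R V]) (simp_all add: mult add)
    show "U \<otimes>\<^bsub>?E\<^esub> (S \<oplus>\<^bsub>?E\<^esub> T) = U \<otimes>\<^bsub>?E\<^esub> S \<oplus>\<^bsub>?E\<^esub> U \<otimes>\<^bsub>?E\<^esub> T"
      using S T U D lin_endD(2)[of U R V] by (intro lin_end_eqI[of _ R V]) (simp_all add: mult add)
  next
    fix c S T assume c: "c \<in> carrier R" and S: "S \<in> carrier ?E" "T \<in> carrier ?E"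
    note D = lin_endD(1)[of S R V] lin_endD(1)[of T R V] lin_endD(3)[of S R V]
    show "(c \<odot>\<^bsub>?E\<^esub> S) \<otimes>\<^bsub>?E\<^esub> T = c \<odot>\<^bsub>?E\<^esub> (S \<otimes>\<^bsub>?E\<^esub> T)"
      using c S D by (intro lin_end_eqI[of _ R V]) (simp_all add: mult smult)
    show "S \<otimes>\<^bsub>?E\<^esub> (c \<odot>\<^bsub>?E\<^esub> T) = c \<odot>\<^bsub>?E\<^esub> (S \<otimes>\<^bsub>?E\<^esub> T)"
      using c S D by (intro lin_end_eqI[of _ R V]) (simp_all add: mult smult)
  qed (rule assms(1))
qed

text \<open>
  The data of the construction: the cyclic nil module \<open>M\<close>, a faithful irreducible module \<open>V\<close> of \<open>A\<close>, and an
  enumeration \<open>a\<close> of a spanning set of \<open>A\<close> in which every element recurs infinitely often.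
\<close>
locale row_extension = cyclic_nil_module R S f \<kappa> n d b \<gamma> + left_module R A V act
  for R :: "('a, 'r) ring_scheme" (structure) and S f \<kappa> n d b \<gamma> and A :: "('a, 'b, 'm) module_scheme"
    and V :: "('a, 'd, 'l) module_scheme" and act +
  fixes a :: "nat \<Rightarrow> 'b"
  assumes irreducible: "irreducible_left_module R A V act" and faithful: "faithful_action A V act"
    and a_closed: "a k \<in> carrier A" and a_span: "lin_span R A (range a) = carrier A"
    and a_infinite: "infinite {j. a j = a k}"
begin

lemma f_closed [simp, intro]: "f t w \<in> carrier R" by (rule FnD[OF f_Fn])

abbreviation SL where "SL m \<equiv> {s \<in> S. length s = m}"

lemma finite_SL [simp, intro]: "finite (SL m)" by (rule finite_subset[OF _ finite_words[of m]]) auto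

lemma f_zero: "t \<notin> S \<or> length w \<noteq> length t \<Longrightarrow> f t w = \<zero>" using f_supp by blast

lemma act_zero_right: "x \<in> carrier A \<Longrightarrow> act x \<zero>\<^bsub>V\<^esub> = \<zero>\<^bsub>V\<^esub>"
  using act_smult_right[of \<zero> x "\<zero>\<^bsub>V\<^esub>"] by (simp add: act_closed)

lemma act_zero_left: "v \<in> carrier V \<Longrightarrow> act \<zero>\<^bsub>A\<^esub> v = \<zero>\<^bsub>V\<^esub>"
  using act_smult_left[of \<zero> "\<zero>\<^bsub>A\<^esub>" v] by (simp add: act_closed)

lemma act_finsum:
  assumes "finite I" "\<And>i. i \<in> I \<Longrightarrow> x i \<in> carrier A" "v \<in> carrier V"
  shows "act (\<Oplus>\<^bsub>A\<^esub>i\<in>I. x i) v = (\<Oplus>\<^bsub>V\<^esub>i\<in>I. act (x i) v)"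
  using assms
proof (induction I)
  case empty
  then show ?case by (simp add: act_zero_left)
next
  case (insert i I)
  have "x \<in> I \<rightarrow> carrier A" "(\<lambda>i. act (x i) v) \<in> I \<rightarrow> carrier V" using insert.prems by (auto simp: act_closed)
  then show ?case using insert by (simp add: act_add_left act_closed)
qed

text \<open>
  This is \<open>M \<otimes> V\<close>, written in coordinates with respect to the basis \<open>S\<close> of \<open>M\<close>: finitely supported functions from \<open>S\<close>
  to \<open>V\<close>.
\<close>
definition W :: "('a, bool list \<Rightarrow> 'd) module" where
  "W = \<lparr>carrier = {g. (\<forall>w. g w \<in> carrier V) \<and> (\<forall>w. g w \<noteq> \<zero>\<^bsub>V\<^esub> \<longrightarrow> w \<in> S) \<and> finite {w. g w \<noteq> \<zero>\<^bsub>V\<^esub>}},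
     monoid.mult = undefined, one = undefined, zero = (\<lambda>_. \<zero>\<^bsub>V\<^esub>), add = (\<lambda>g h w. g w \<oplus>\<^bsub>V\<^esub> h w),
     smult = (\<lambda>c g w. c \<odot>\<^bsub>V\<^esub> g w)\<rparr>"

lemma W_simps [simp]: "\<zero>\<^bsub>W\<^esub> = (\<lambda>_. \<zero>\<^bsub>V\<^esub>)" "(g \<oplus>\<^bsub>W\<^esub> h) w = g w \<oplus>\<^bsub>V\<^esub> h w" "(c \<odot>\<^bsub>W\<^esub> g) w = c \<odot>\<^bsub>V\<^esub> g w"
  by (simp_all add: W_def)

lemma WI:
  assumes "\<And>w. g w \<in> carrier V" "\<And>w. g w \<noteq> \<zero>\<^bsub>V\<^esub> \<Longrightarrow> w \<in> S" "finite {w. g w \<noteq> \<zero>\<^bsub>V\<^esub>}"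
  shows "g \<in> carrier W"
  using assms by (simp add: W_def)

lemma WD:
  assumes "g \<in> carrier W"
  shows "g w \<in> carrier V" "g w \<noteq> \<zero>\<^bsub>V\<^esub> \<Longrightarrow> w \<in> S" "finite {w. g w \<noteq> \<zero>\<^bsub>V\<^esub>}"
  using assms by (simp_all add: W_def)

lemma W_module: "Module.module R W"
proof -
  have add: "g \<oplus>\<^bsub>W\<^esub> h \<in> carrier W" if g: "g \<in> carrier W" and h: "h \<in> carrier W" for g h
  proof (rule WI)
    fix w
    show "(g \<oplus>\<^bsub>W\<^esub> h) w \<in> carrier V" using WD(1)[OF g] WD(1)[OF h] by simp
    show "w \<in> S" if "(g \<oplus>\<^bsub>W\<^esub> h) w \<noteq> \<zero>\<^bsub>V\<^esub>"
    proof (rule ccontr)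
      assume "w \<notin> S"
      then have "g w = \<zero>\<^bsub>V\<^esub>" "h w = \<zero>\<^bsub>V\<^esub>" using WD(2)[OF g] WD(2)[OF h] by blast+
      then show False using that by simp
    qed
  next
    have "{w. (g \<oplus>\<^bsub>W\<^esub> h) w \<noteq> \<zero>\<^bsub>V\<^esub>} \<subseteq> {w. g w \<noteq> \<zero>\<^bsub>V\<^esub>} \<union> {w. h w \<noteq> \<zero>\<^bsub>V\<^esub>}" by auto
    then show "finite {w. (g \<oplus>\<^bsub>W\<^esub> h) w \<noteq> \<zero>\<^bsub>V\<^esub>}" using WD(3)[OF g] WD(3)[OF h] finite_subset by blast
  qed
  have smult: "c \<odot>\<^bsub>W\<^esub> g \<in> carrier W" if c: "c \<in> carrier R" and g: "g \<in> carrier W" for c g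
  proof (rule WI)
    fix w
    show "(c \<odot>\<^bsub>W\<^esub> g) w \<in> carrier V" using WD(1)[OF g] c by simp
    show "w \<in> S" if "(c \<odot>\<^bsub>W\<^esub> g) w \<noteq> \<zero>\<^bsub>V\<^esub>"
      using that c by (intro WD(2)[OF g]) auto
  next
    have "{w. (c \<odot>\<^bsub>W\<^esub> g) w \<noteq> \<zero>\<^bsub>V\<^esub>} \<subseteq> {w. g w \<noteq> \<zero>\<^bsub>V\<^esub>}" using c by auto
    then show "finite {w. (c \<odot>\<^bsub>W\<^esub> g) w \<noteq> \<zero>\<^bsub>V\<^esub>}" using WD(3)[OF g] finite_subset by blast
  qed
  have zero: "\<zero>\<^bsub>W\<^esub> \<in> carrier W" by (rule WI) simp_all
  have "abelian_group W"
  proof (rule abelian_groupI)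
    show "\<exists>h\<in>carrier W. h \<oplus>\<^bsub>W\<^esub> g = \<zero>\<^bsub>W\<^esub>" if g: "g \<in> carrier W" for g
    proof (rule bexI)
      show "(\<ominus> \<one>) \<odot>\<^bsub>W\<^esub> g \<in> carrier W" using g by (intro smult) simp_all
      show "(\<ominus> \<one>) \<odot>\<^bsub>W\<^esub> g \<oplus>\<^bsub>W\<^esub> g = \<zero>\<^bsub>W\<^esub>"
        using WD(1)[OF g] by (intro ext) (simp add: V.smult_l_minus V.M.l_neg)
    qed
  qed (use zero add in \<open>auto simp: fun_eq_iff WD(1) V.M.a_ac\<close>)
  then show ?thesis
    by (intro moduleI smult is_cring) (auto simp: fun_eq_iff WD(1) V.smult_l_distr V.smult_r_distr V.smult_assoc1)
qed

end

section \<open>Word operators and row operators\<close>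

lemma lin_end_zero:
  assumes "Module.module R V" "T \<in> lin_end R V" shows "T \<zero>\<^bsub>V\<^esub> = \<zero>\<^bsub>V\<^esub>"
proof -
  interpret V: Module.module R V by fact
  have "T (\<zero>\<^bsub>R\<^esub> \<odot>\<^bsub>V\<^esub> \<zero>\<^bsub>V\<^esub>) = \<zero>\<^bsub>R\<^esub> \<odot>\<^bsub>V\<^esub> T \<zero>\<^bsub>V\<^esub>"
    by (rule lin_endD(3)[OF assms(2)]) simp_all
  then show ?thesis using lin_endD(1)[OF assms(2) V.M.zero_closed] by simp
qed

context row_extension begin

interpretation W: Module.module R W by (rule W_module)

definition E where "E = end_algebra R W"

interpretation E: assoc_algebra R E
  unfolding E_def by (rule end_assoc_algebra[OF field_axioms W_module])

lemma E_carrier: "carrier E = lin_end R W" by (simp add: E_def)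

lemma E_simps:
  assumes "g \<in> carrier W"
  shows "(T \<otimes>\<^bsub>E\<^esub> T') g = T (T' g)" "\<zero>\<^bsub>E\<^esub> g = \<zero>\<^bsub>W\<^esub>" "(T \<oplus>\<^bsub>E\<^esub> T') g = T g \<oplus>\<^bsub>W\<^esub> T' g"
    "(c \<odot>\<^bsub>E\<^esub> T) g = c \<odot>\<^bsub>W\<^esub> T g"
  using assms unfolding E_def by (rule end_algebra_simps)+

text \<open>
  The element \<open>w \<otimes> v\<close> of \<open>M \<otimes> V\<close> for an arbitrary word \<open>w\<close>.
\<close>
definition tens :: "bool list \<Rightarrow> 'd \<Rightarrow> bool list \<Rightarrow> 'd" where "tens w v t = f t w \<odot>\<^bsub>V\<^esub> v"

lemma tens_W [simp]: "v \<in> carrier V \<Longrightarrow> tens w v \<in> carrier W"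
proof (rule WI)
  assume v: "v \<in> carrier V"
  have nz: "t \<in> S \<and> length t = length w" if "tens w v t \<noteq> \<zero>\<^bsub>V\<^esub>" for t
  proof (rule ccontr)
    assume "\<not> ?thesis"
    then have "f t w = \<zero>" by (intro f_zero) auto
    then show False using that v by (simp add: tens_def)
  qed
  show "tens w v t \<in> carrier V" for t using v by (simp add: tens_def)
  show "t \<in> S" if "tens w v t \<noteq> \<zero>\<^bsub>V\<^esub>" for t using nz[OF that] by simp
  have "{t. tens w v t \<noteq> \<zero>\<^bsub>V\<^esub>} \<subseteq> SL (length w)" using nz by blast
  then show "finite {t. tens w v t \<noteq> \<zero>\<^bsub>V\<^esub>}" using finite_SL finite_subset by blast
qed

lemma tens_basis: "s \<in> S \<Longrightarrow> v \<in> carrier V \<Longrightarrow> tens s v t = (if t = s then v else \<zero>\<^bsub>V\<^esub>)"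
  using f_dual[of s t] f_zero[of t s] by (cases "t \<in> S") (auto simp: tens_def)

lemma W_induct:
  assumes H: "submodule H R W" and gen: "\<And>s v. s \<in> S \<Longrightarrow> v \<in> carrier V \<Longrightarrow> tens s v \<in> H"
  shows "carrier W \<subseteq> H"
proof
  fix g assume g: "g \<in> carrier W"
  have "g \<in> H" if "finite K" "\<And>w. g w \<noteq> \<zero>\<^bsub>V\<^esub> \<Longrightarrow> w \<in> K" "g \<in> carrier W" for K g
    using that
  proof (induction K arbitrary: g)
    case empty
    then have "g = \<zero>\<^bsub>W\<^esub>" by (intro ext) auto
    then show ?case using W.submoduleD'(2)[OF H] by simp
  next
    case (insert s K)
    note gW = WD[OF insert.prems(2)]
    show ?case
    proof (cases "g s = \<zero>\<^bsub>V\<^esub>")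
      case True
      then show ?thesis using insert by (intro insert.IH) auto
    next
      case False
      then have s: "s \<in> S" by (rule gW(2))
      let ?g = "g(s := \<zero>\<^bsub>V\<^esub>)"
      have "{w. ?g w \<noteq> \<zero>\<^bsub>V\<^esub>} \<subseteq> {w. g w \<noteq> \<zero>\<^bsub>V\<^esub>}" by auto
      then have fin: "finite {w. ?g w \<noteq> \<zero>\<^bsub>V\<^esub>}" using gW(3) finite_subset by blast
      have "?g \<in> carrier W" using gW(1,2) by (intro WI fin) (auto split: if_splits)
      then have "?g \<in> H"
      proof (rule insert.IH[rotated])
        show "w \<in> K" if "?g w \<noteq> \<zero>\<^bsub>V\<^esub>" for w
          using that insert.prems(1)[of w] by (cases "w = s") simp_all
      qed
      moreover have "tens s (g s) \<in> H" using s gW(1) by (rule gen)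
      ultimately have "tens s (g s) \<oplus>\<^bsub>W\<^esub> ?g \<in> H" by (intro W.submoduleD'(3)[OF H])
      moreover have "tens s (g s) \<oplus>\<^bsub>W\<^esub> ?g = g"
        using gW(1) s by (intro ext) (simp add: tens_basis)
      ultimately show ?thesis by simp
    qed
  qed
  from this[OF WD(3)[OF g] _ g] show "g \<in> H" by simp
qed

lemma op_eqI:
  assumes T: "T \<in> carrier E" "T' \<in> carrier E"
    and eq: "\<And>s v. s \<in> S \<Longrightarrow> v \<in> carrier V \<Longrightarrow> T (tens s v) = T' (tens s v)"
  shows "T = T'"
proof -
  have L: "T \<in> lin_end R W" "T' \<in> lin_end R W" using T by (simp_all add: E_carrier)
  note D = lin_endD[OF L(1)] and D' = lin_endD[OF L(2)]
  have z: "T \<zero>\<^bsub>W\<^esub> = T' \<zero>\<^bsub>W\<^esub>" using lin_end_zero[OF W_module] L by metis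
  have "submodule {g \<in> carrier W. T g = T' g} R W"
  proof (rule W.submoduleI')
    show "\<zero>\<^bsub>W\<^esub> \<in> {g \<in> carrier W. T g = T' g}" using z W.M.zero_closed by blast
  qed (use D(2,3) D'(2,3) in auto)
  from W_induct[OF this] have "T g = T' g" if "g \<in> carrier W" for g
    using that eq by auto
  then show ?thesis by (rule lin_end_eqI[OF L])
qed

text \<open>
  Left multiplication by the word \<open>u\<close> on the factor \<open>M\<close> of \<open>M \<otimes> V\<close>.
\<close>
definition word_op :: "bool list \<Rightarrow> (bool list \<Rightarrow> 'd) \<Rightarrow> bool list \<Rightarrow> 'd" where
  "word_op u = (\<lambda>g\<in>carrier W. \<lambda>t. \<Oplus>\<^bsub>V\<^esub>s\<in>{s \<in> S. length u + length s = length t}. f t (u @ s) \<odot>\<^bsub>V\<^esub> g s)"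

lemma finite_word_op_range: "finite {s \<in> S. length u + length s = m}"
  by (rule finite_subset[OF _ finite_words[of "m - length u"]]) auto

lemma word_op_E [simp]: "word_op u \<in> carrier E"
  unfolding E_carrier
proof (rule lin_endI)
  show "word_op u \<in> extensional (carrier W)" by (simp add: word_op_def)
  show "word_op u g \<in> carrier W" if g: "g \<in> carrier W" for g
  proof (rule WI)
    have eq: "word_op u g t = (\<Oplus>\<^bsub>V\<^esub>s\<in>{s \<in> S. length u + length s = length t}. f t (u @ s) \<odot>\<^bsub>V\<^esub> g s)" for t
      using g by (simp add: word_op_def)
    show "word_op u g t \<in> carrier V" for t
      unfolding eq using WD(1)[OF g] by (intro V.M.finsum_closed) auto
    have nz: "t \<in> S \<and> (\<exists>s\<in>{s. g s \<noteq> \<zero>\<^bsub>V\<^esub>}. length t = length u + length s)" if "word_op u g t \<noteq> \<zero>\<^bsub>V\<^esub>" for t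
    proof (rule ccontr)
      assume neg: "\<not> ?thesis"
      have "f t (u @ s) \<odot>\<^bsub>V\<^esub> g s = \<zero>\<^bsub>V\<^esub>" if "s \<in> {s \<in> S. length u + length s = length t}" for s
      proof (cases "t \<in> S")
        case False
        then have "f t (u @ s) = \<zero>" by (intro f_zero) simp
        then show ?thesis using WD(1)[OF g] by simp
      next
        case True
        then have "g s = \<zero>\<^bsub>V\<^esub>" using neg that by force
        then show ?thesis by simp
      qed
      then have "word_op u g t = \<zero>\<^bsub>V\<^esub>" unfolding eq by (rule V.M.finsum_0I)
      then show False using that by simp
    qed
    show "t \<in> S" if "word_op u g t \<noteq> \<zero>\<^bsub>V\<^esub>" for t using nz[OF that] by simp
    have "{t. word_op u g t \<noteq> \<zero>\<^bsub>V\<^esub>} \<subseteq> (\<Union>s\<in>{s. g s \<noteq> \<zero>\<^bsub>V\<^esub>}. words (length u + length s))"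
      using nz by auto
    then show "finite {t. word_op u g t \<noteq> \<zero>\<^bsub>V\<^esub>}"
      by (rule finite_subset) (use WD(3)[OF g] in auto)
  qed
  show "word_op u (g \<oplus>\<^bsub>W\<^esub> h) = word_op u g \<oplus>\<^bsub>W\<^esub> word_op u h" if g: "g \<in> carrier W" and h: "h \<in> carrier W" for g h
  proof
    fix t :: "bool list"
    let ?I = "{s \<in> S. length u + length s = length t}"
    have "(\<Oplus>\<^bsub>V\<^esub>s\<in>?I. f t (u @ s) \<odot>\<^bsub>V\<^esub> (g s \<oplus>\<^bsub>V\<^esub> h s)) = (\<Oplus>\<^bsub>V\<^esub>s\<in>?I. f t (u @ s) \<odot>\<^bsub>V\<^esub> g s \<oplus>\<^bsub>V\<^esub> f t (u @ s) \<odot>\<^bsub>V\<^esub> h s)"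
      using WD(1)[OF g] WD(1)[OF h] by (intro V.M.finsum_cong') (auto simp: V.smult_r_distr)
    also have "\<dots> = (\<Oplus>\<^bsub>V\<^esub>s\<in>?I. f t (u @ s) \<odot>\<^bsub>V\<^esub> g s) \<oplus>\<^bsub>V\<^esub> (\<Oplus>\<^bsub>V\<^esub>s\<in>?I. f t (u @ s) \<odot>\<^bsub>V\<^esub> h s)"
      using WD(1)[OF g] WD(1)[OF h] by (intro V.M.finsum_addf) auto
    finally show "word_op u (g \<oplus>\<^bsub>W\<^esub> h) t = (word_op u g \<oplus>\<^bsub>W\<^esub> word_op u h) t"
      using g h W.M.a_closed[OF g h] by (simp add: word_op_def)
  qed
  show "word_op u (c \<odot>\<^bsub>W\<^esub> g) = c \<odot>\<^bsub>W\<^esub> word_op u g" if c: "c \<in> carrier R" and g: "g \<in> carrier W" for c g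
  proof
    fix t :: "bool list"
    let ?I = "{s \<in> S. length u + length s = length t}"
    have "(\<Oplus>\<^bsub>V\<^esub>s\<in>?I. f t (u @ s) \<odot>\<^bsub>V\<^esub> (c \<odot>\<^bsub>V\<^esub> g s)) = (\<Oplus>\<^bsub>V\<^esub>s\<in>?I. c \<odot>\<^bsub>V\<^esub> (f t (u @ s) \<odot>\<^bsub>V\<^esub> g s))"
      using WD(1)[OF g] c by (intro V.M.finsum_cong') (auto simp: V.smult_assoc1[symmetric] m_comm)
    also have "\<dots> = c \<odot>\<^bsub>V\<^esub> (\<Oplus>\<^bsub>V\<^esub>s\<in>?I. f t (u @ s) \<odot>\<^bsub>V\<^esub> g s)"
      using WD(1)[OF g] c finite_word_op_range by (intro V.finsum_smult_ldistr[symmetric]) auto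
    finally show "word_op u (c \<odot>\<^bsub>W\<^esub> g) t = (c \<odot>\<^bsub>W\<^esub> word_op u g) t"
      using c g W.smult_closed[OF c g] by (simp add: word_op_def)
  qed
qed

lemma word_op_tens [simp]:
  assumes v: "v \<in> carrier V" shows "word_op u (tens w v) = tens (u @ w) v"
proof
  fix t :: "bool list"
  let ?I = "{s \<in> S. length u + length s = length t}"
  have eq: "word_op u (tens w v) t = (\<Oplus>\<^bsub>V\<^esub>s\<in>?I. f t (u @ s) \<odot>\<^bsub>V\<^esub> (f s w \<odot>\<^bsub>V\<^esub> v))"
    using v by (simp add: word_op_def) (simp add: tens_def)
  show "word_op u (tens w v) t = tens (u @ w) v t"
  proof (cases "length t = length u + length w")
    case True
    then have I: "?I = SL (length w)" by auto
    have "f t (u @ w) = (\<Oplus>s\<in>SL (length w). f t (u @ s) \<otimes> f s w)"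
      using f_functional[of u t] unfolding functional_on_def shl_def by blast
    then have "tens (u @ w) v t = (\<Oplus>s\<in>SL (length w). f t (u @ s) \<otimes> f s w) \<odot>\<^bsub>V\<^esub> v"
      unfolding tens_def by (rule arg_cong)
    also have "\<dots> = (\<Oplus>\<^bsub>V\<^esub>s\<in>SL (length w). (f t (u @ s) \<otimes> f s w) \<odot>\<^bsub>V\<^esub> v)"
      using v by (intro V.finsum_smult_rdistr) auto
    also have "\<dots> = (\<Oplus>\<^bsub>V\<^esub>s\<in>SL (length w). f t (u @ s) \<odot>\<^bsub>V\<^esub> (f s w \<odot>\<^bsub>V\<^esub> v))"
      using v by (intro V.M.finsum_cong') (auto simp: V.smult_assoc1)
    finally show ?thesis unfolding eq I by simp
  next
    case False
    have "f t (u @ s) \<odot>\<^bsub>V\<^esub> (f s w \<odot>\<^bsub>V\<^esub> v) = \<zero>\<^bsub>V\<^esub>" if "s \<in> ?I" for s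
    proof -
      have "f s w = \<zero>" using that False by (intro f_zero) auto
      then show ?thesis using v by simp
    qed
    then have "word_op u (tens w v) t = \<zero>\<^bsub>V\<^esub>" unfolding eq by (rule V.M.finsum_0I)
    moreover have "f t (u @ w) = \<zero>" using False by (intro f_zero) auto
    ultimately show ?thesis using v by (simp add: tens_def)
  qed
qed

text \<open>
  The \<open>A\<close>-valued functions on words that factor through \<open>M\<close>, that is, linear maps from \<open>M\<close> to \<open>A\<close>.
\<close>
definition afun :: "(bool list \<Rightarrow> 'b) \<Rightarrow> bool" where
  "afun \<theta> \<longleftrightarrow> (\<forall>w. \<theta> w \<in> carrier A) \<and> (\<forall>w. \<theta> w = (\<Oplus>\<^bsub>A\<^esub>s\<in>SL (length w). f s w \<odot>\<^bsub>A\<^esub> \<theta> s))"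

lemma afunD: "afun \<theta> \<Longrightarrow> \<theta> w \<in> carrier A" "afun \<theta> \<Longrightarrow> \<theta> w = (\<Oplus>\<^bsub>A\<^esub>s\<in>SL (length w). f s w \<odot>\<^bsub>A\<^esub> \<theta> s)"
  unfolding afun_def by blast+

text \<open>
  The operator \<open>w \<otimes> v \<mapsto> [] \<otimes> \<theta> w v\<close>, a matrix over \<open>A\<close> with a single nonzero row. Infinitely many entries of that row may
  be nonzero, since elements of \<open>M \<otimes> V\<close> have finite support.
\<close>
definition row :: "(bool list \<Rightarrow> 'b) \<Rightarrow> (bool list \<Rightarrow> 'd) \<Rightarrow> bool list \<Rightarrow> 'd" where
  "row \<theta> = (\<lambda>g\<in>carrier W. \<lambda>t. if t = [] then \<Oplus>\<^bsub>V\<^esub>s\<in>{s. g s \<noteq> \<zero>\<^bsub>V\<^esub>}. act (\<theta> s) (g s) else \<zero>\<^bsub>V\<^esub>)"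

lemma row_sum:
  assumes g: "g \<in> carrier W" and \<theta>: "\<And>w. \<theta> w \<in> carrier A" and K: "finite K" "\<And>s. g s \<noteq> \<zero>\<^bsub>V\<^esub> \<Longrightarrow> s \<in> K"
  shows "row \<theta> g t = (if t = [] then \<Oplus>\<^bsub>V\<^esub>s\<in>K. act (\<theta> s) (g s) else \<zero>\<^bsub>V\<^esub>)"
proof -
  have "(\<Oplus>\<^bsub>V\<^esub>s\<in>K. act (\<theta> s) (g s)) = (\<Oplus>\<^bsub>V\<^esub>s\<in>{s. g s \<noteq> \<zero>\<^bsub>V\<^esub>}. act (\<theta> s) (g s))"
  proof (rule V.M.finsum_superset[OF K(1)])
    show "act (\<theta> s) (g s) = \<zero>\<^bsub>V\<^esub>" if "s \<in> K - {s. g s \<noteq> \<zero>\<^bsub>V\<^esub>}" for s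
      using that act_zero_right[OF \<theta>] by simp
  qed (use K(2) WD(1)[OF g] \<theta> in \<open>auto intro: act_closed\<close>)
  then show ?thesis using g by (simp add: row_def)
qed

lemma row_E [simp]:
  assumes \<theta>: "\<And>w. \<theta> w \<in> carrier A" shows "row \<theta> \<in> carrier E"
  unfolding E_carrier
proof (rule lin_endI)
  show "row \<theta> \<in> extensional (carrier W)" by (simp add: row_def)
  have cl: "act (\<theta> s) (g s) \<in> carrier V" if "g \<in> carrier W" for g s
    using WD(1)[OF that] \<theta> by (rule_tac act_closed)
  show "row \<theta> g \<in> carrier W" if g: "g \<in> carrier W" for g
  proof (rule WI)
    have eq: "row \<theta> g t = (if t = [] then \<Oplus>\<^bsub>V\<^esub>s\<in>{s. g s \<noteq> \<zero>\<^bsub>V\<^esub>}. act (\<theta> s) (g s) else \<zero>\<^bsub>V\<^esub>)" for t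
      using g by (simp add: row_def)
    show "row \<theta> g t \<in> carrier V" for t unfolding eq using cl[OF g] by (auto intro!: V.M.finsum_closed)
    show "t \<in> S" if "row \<theta> g t \<noteq> \<zero>\<^bsub>V\<^esub>" for t
      using that Nil_in_S unfolding eq by (cases "t = []") auto
    have "{t. row \<theta> g t \<noteq> \<zero>\<^bsub>V\<^esub>} \<subseteq> {[]}" unfolding eq by auto
    then show "finite {t. row \<theta> g t \<noteq> \<zero>\<^bsub>V\<^esub>}" by (rule finite_subset) simp
  qed
  show "row \<theta> (g \<oplus>\<^bsub>W\<^esub> h) = row \<theta> g \<oplus>\<^bsub>W\<^esub> row \<theta> h" if g: "g \<in> carrier W" and h: "h \<in> carrier W" for g h
  proof
    fix t :: "bool list"
    let ?K = "{s. g s \<noteq> \<zero>\<^bsub>V\<^esub>} \<union> {s. h s \<noteq> \<zero>\<^bsub>V\<^esub>}"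
    have K: "finite ?K" using WD(3)[OF g] WD(3)[OF h] by simp
    have "(\<Oplus>\<^bsub>V\<^esub>s\<in>?K. act (\<theta> s) ((g \<oplus>\<^bsub>W\<^esub> h) s)) = (\<Oplus>\<^bsub>V\<^esub>s\<in>?K. act (\<theta> s) (g s) \<oplus>\<^bsub>V\<^esub> act (\<theta> s) (h s))"
      using cl[OF g] cl[OF h] by (intro V.M.finsum_cong') (auto simp: act_add_right \<theta> WD(1)[OF g] WD(1)[OF h])
    also have "\<dots> = (\<Oplus>\<^bsub>V\<^esub>s\<in>?K. act (\<theta> s) (g s)) \<oplus>\<^bsub>V\<^esub> (\<Oplus>\<^bsub>V\<^esub>s\<in>?K. act (\<theta> s) (h s))"
      using cl[OF g] cl[OF h] by (intro V.M.finsum_addf) auto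
    finally have *: "(\<Oplus>\<^bsub>V\<^esub>s\<in>?K. act (\<theta> s) ((g \<oplus>\<^bsub>W\<^esub> h) s)) = (\<Oplus>\<^bsub>V\<^esub>s\<in>?K. act (\<theta> s) (g s)) \<oplus>\<^bsub>V\<^esub> (\<Oplus>\<^bsub>V\<^esub>s\<in>?K. act (\<theta> s) (h s))" .
    have "row \<theta> (g \<oplus>\<^bsub>W\<^esub> h) t = (if t = [] then \<Oplus>\<^bsub>V\<^esub>s\<in>?K. act (\<theta> s) ((g \<oplus>\<^bsub>W\<^esub> h) s) else \<zero>\<^bsub>V\<^esub>)"
      by (rule row_sum[OF W.M.a_closed[OF g h] \<theta> K]) auto
    moreover have "row \<theta> g t = (if t = [] then \<Oplus>\<^bsub>V\<^esub>s\<in>?K. act (\<theta> s) (g s) else \<zero>\<^bsub>V\<^esub>)"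
      by (rule row_sum[OF g \<theta> K]) auto
    moreover have "row \<theta> h t = (if t = [] then \<Oplus>\<^bsub>V\<^esub>s\<in>?K. act (\<theta> s) (h s) else \<zero>\<^bsub>V\<^esub>)"
      by (rule row_sum[OF h \<theta> K]) auto
    ultimately show "row \<theta> (g \<oplus>\<^bsub>W\<^esub> h) t = (row \<theta> g \<oplus>\<^bsub>W\<^esub> row \<theta> h) t" using * by simp
  qed
  show "row \<theta> (c \<odot>\<^bsub>W\<^esub> g) = c \<odot>\<^bsub>W\<^esub> row \<theta> g" if c: "c \<in> carrier R" and g: "g \<in> carrier W" for c g
  proof
    fix t :: "bool list"
    let ?K = "{s. g s \<noteq> \<zero>\<^bsub>V\<^esub>}"
    have K: "finite ?K" using WD(3)[OF g] by simp
    have "(\<Oplus>\<^bsub>V\<^esub>s\<in>?K. act (\<theta> s) ((c \<odot>\<^bsub>W\<^esub> g) s)) = (\<Oplus>\<^bsub>V\<^esub>s\<in>?K. c \<odot>\<^bsub>V\<^esub> act (\<theta> s) (g s))"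
      using cl[OF g] c by (intro V.M.finsum_cong') (auto simp: act_smult_right \<theta> WD(1)[OF g])
    also have "\<dots> = c \<odot>\<^bsub>V\<^esub> (\<Oplus>\<^bsub>V\<^esub>s\<in>?K. act (\<theta> s) (g s))"
      using cl[OF g] c K by (intro V.finsum_smult_ldistr[symmetric]) auto
    finally have *: "(\<Oplus>\<^bsub>V\<^esub>s\<in>?K. act (\<theta> s) ((c \<odot>\<^bsub>W\<^esub> g) s)) = c \<odot>\<^bsub>V\<^esub> (\<Oplus>\<^bsub>V\<^esub>s\<in>?K. act (\<theta> s) (g s))" .
    have "row \<theta> (c \<odot>\<^bsub>W\<^esub> g) t = (if t = [] then \<Oplus>\<^bsub>V\<^esub>s\<in>?K. act (\<theta> s) ((c \<odot>\<^bsub>W\<^esub> g) s) else \<zero>\<^bsub>V\<^esub>)"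
      using c by (intro row_sum[OF W.smult_closed[OF c g] \<theta> K]) auto
    moreover have "row \<theta> g t = (if t = [] then \<Oplus>\<^bsub>V\<^esub>s\<in>?K. act (\<theta> s) (g s) else \<zero>\<^bsub>V\<^esub>)"
      by (rule row_sum[OF g \<theta> K]) auto
    ultimately show "row \<theta> (c \<odot>\<^bsub>W\<^esub> g) t = (c \<odot>\<^bsub>W\<^esub> row \<theta> g) t" using * c by simp
  qed
qed

lemma row_tens:
  assumes \<theta>: "afun \<theta>" and v: "v \<in> carrier V"
  shows "row \<theta> (tens w v) = tens [] (act (\<theta> w) v)"
proof
  fix t :: "bool list"
  note cl = afunD(1)[OF \<theta>]
  have K: "s \<in> SL (length w)" if "tens w v s \<noteq> \<zero>\<^bsub>V\<^esub>" for s
  proof (rule ccontr)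
    assume "s \<notin> SL (length w)"
    then have "f s w = \<zero>" by (intro f_zero) auto
    then show False using that v by (simp add: tens_def)
  qed
  have "row \<theta> (tens w v) t = (if t = [] then \<Oplus>\<^bsub>V\<^esub>s\<in>SL (length w). act (\<theta> s) (tens w v s) else \<zero>\<^bsub>V\<^esub>)"
    using v by (intro row_sum cl K) auto
  also have "(\<Oplus>\<^bsub>V\<^esub>s\<in>SL (length w). act (\<theta> s) (tens w v s)) = (\<Oplus>\<^bsub>V\<^esub>s\<in>SL (length w). act (f s w \<odot>\<^bsub>A\<^esub> \<theta> s) v)"
    using cl v by (intro V.M.finsum_cong') (auto simp: tens_def act_smult_right act_smult_left act_closed)
  also have "\<dots> = act (\<Oplus>\<^bsub>A\<^esub>s\<in>SL (length w). f s w \<odot>\<^bsub>A\<^esub> \<theta> s) v"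
    using cl v by (intro act_finsum[symmetric]) auto
  also have "(\<Oplus>\<^bsub>A\<^esub>s\<in>SL (length w). f s w \<odot>\<^bsub>A\<^esub> \<theta> s) = \<theta> w" by (rule afunD(2)[OF \<theta>, symmetric])
  finally show "row \<theta> (tens w v) t = tens [] (act (\<theta> w) v) t"
    using tens_basis[OF Nil_in_S, of "act (\<theta> w) v" t] cl v by (simp add: act_closed)
qed

lemma afun_shl: assumes "afun \<theta>" shows "afun (shl u \<theta>)"
  unfolding afun_def
proof (intro conjI allI)
  note cl = afunD(1)[OF assms]
  show "shl u \<theta> w \<in> carrier A" for w using cl by (simp add: shl_def)
  fix w
  let ?I = "SL (length (u @ w))" and ?J = "SL (length w)"
  have "\<theta> (u @ w) = (\<Oplus>\<^bsub>A\<^esub>t\<in>?I. f t (u @ w) \<odot>\<^bsub>A\<^esub> \<theta> t)" by (rule afunD(2)[OF assms])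
  also have "\<dots> = (\<Oplus>\<^bsub>A\<^esub>t\<in>?I. \<Oplus>\<^bsub>A\<^esub>s\<in>?J. f s w \<odot>\<^bsub>A\<^esub> (f t (u @ s) \<odot>\<^bsub>A\<^esub> \<theta> t))"
  proof (rule A.M.finsum_cong'[OF refl])
    fix t :: "bool list"
    have "f t (u @ w) = (\<Oplus>s\<in>?J. f t (u @ s) \<otimes> f s w)"
      using f_functional[of u t] unfolding functional_on_def shl_def by blast
    then have "f t (u @ w) \<odot>\<^bsub>A\<^esub> \<theta> t = (\<Oplus>s\<in>?J. f t (u @ s) \<otimes> f s w) \<odot>\<^bsub>A\<^esub> \<theta> t" by (rule arg_cong)
    also have "\<dots> = (\<Oplus>\<^bsub>A\<^esub>s\<in>?J. (f t (u @ s) \<otimes> f s w) \<odot>\<^bsub>A\<^esub> \<theta> t)"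
      using cl by (intro A.finsum_smult_rdistr) auto
    also have "\<dots> = (\<Oplus>\<^bsub>A\<^esub>s\<in>?J. f s w \<odot>\<^bsub>A\<^esub> (f t (u @ s) \<odot>\<^bsub>A\<^esub> \<theta> t))"
      using cl by (intro A.M.finsum_cong') (auto simp: A.smult_assoc1[symmetric] m_comm)
    finally show "f t (u @ w) \<odot>\<^bsub>A\<^esub> \<theta> t = (\<Oplus>\<^bsub>A\<^esub>s\<in>?J. f s w \<odot>\<^bsub>A\<^esub> (f t (u @ s) \<odot>\<^bsub>A\<^esub> \<theta> t))" .
  qed (use cl in \<open>auto intro!: A.M.finsum_closed\<close>)
  also have "\<dots> = (\<Oplus>\<^bsub>A\<^esub>s\<in>?J. \<Oplus>\<^bsub>A\<^esub>t\<in>?I. f s w \<odot>\<^bsub>A\<^esub> (f t (u @ s) \<odot>\<^bsub>A\<^esub> \<theta> t))"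
    using cl by (intro A.M.finsum_swap) auto
  also have "\<dots> = (\<Oplus>\<^bsub>A\<^esub>s\<in>?J. f s w \<odot>\<^bsub>A\<^esub> \<theta> (u @ s))"
  proof (rule A.M.finsum_cong'[OF refl])
    fix s assume s: "s \<in> ?J"
    have "(\<Oplus>\<^bsub>A\<^esub>t\<in>?I. f s w \<odot>\<^bsub>A\<^esub> (f t (u @ s) \<odot>\<^bsub>A\<^esub> \<theta> t)) = f s w \<odot>\<^bsub>A\<^esub> (\<Oplus>\<^bsub>A\<^esub>t\<in>?I. f t (u @ s) \<odot>\<^bsub>A\<^esub> \<theta> t)"
      using cl by (intro A.finsum_smult_ldistr[symmetric]) auto
    also have "(\<Oplus>\<^bsub>A\<^esub>t\<in>?I. f t (u @ s) \<odot>\<^bsub>A\<^esub> \<theta> t) = \<theta> (u @ s)"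
      using afunD(2)[OF assms, of "u @ s"] s by simp
    finally show "(\<Oplus>\<^bsub>A\<^esub>t\<in>?I. f s w \<odot>\<^bsub>A\<^esub> (f t (u @ s) \<odot>\<^bsub>A\<^esub> \<theta> t)) = f s w \<odot>\<^bsub>A\<^esub> \<theta> (u @ s)" .
  qed (use cl in auto)
  finally show "shl u \<theta> w = (\<Oplus>\<^bsub>A\<^esub>s\<in>?J. f s w \<odot>\<^bsub>A\<^esub> shl u \<theta> s)" by (simp only: shl_def)
qed

lemma afun_add: assumes "afun \<theta>" "afun \<eta>" shows "afun (\<lambda>w. \<theta> w \<oplus>\<^bsub>A\<^esub> \<eta> w)"
  unfolding afun_def
proof (intro conjI allI)
  note cl = afunD(1)[OF assms(1)] afunD(1)[OF assms(2)]
  show "\<theta> w \<oplus>\<^bsub>A\<^esub> \<eta> w \<in> carrier A" for w using cl by simp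
  fix w
  have "\<theta> w \<oplus>\<^bsub>A\<^esub> \<eta> w = (\<Oplus>\<^bsub>A\<^esub>s\<in>SL (length w). f s w \<odot>\<^bsub>A\<^esub> \<theta> s) \<oplus>\<^bsub>A\<^esub> (\<Oplus>\<^bsub>A\<^esub>s\<in>SL (length w). f s w \<odot>\<^bsub>A\<^esub> \<eta> s)"
    by (rule arg_cong2[OF afunD(2)[OF assms(1)] afunD(2)[OF assms(2)]])
  also have "\<dots> = (\<Oplus>\<^bsub>A\<^esub>s\<in>SL (length w). f s w \<odot>\<^bsub>A\<^esub> \<theta> s \<oplus>\<^bsub>A\<^esub> f s w \<odot>\<^bsub>A\<^esub> \<eta> s)"
    using cl by (intro A.M.finsum_addf[symmetric]) auto
  also have "\<dots> = (\<Oplus>\<^bsub>A\<^esub>s\<in>SL (length w). f s w \<odot>\<^bsub>A\<^esub> (\<theta> s \<oplus>\<^bsub>A\<^esub> \<eta> s))"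
    using cl by (intro A.M.finsum_cong') (auto simp: A.smult_r_distr)
  finally show "\<theta> w \<oplus>\<^bsub>A\<^esub> \<eta> w = (\<Oplus>\<^bsub>A\<^esub>s\<in>SL (length w). f s w \<odot>\<^bsub>A\<^esub> (\<theta> s \<oplus>\<^bsub>A\<^esub> \<eta> s))" .
qed

lemma afun_smult: assumes "c \<in> carrier R" "afun \<theta>" shows "afun (\<lambda>w. c \<odot>\<^bsub>A\<^esub> \<theta> w)"
  unfolding afun_def
proof (intro conjI allI)
  note cl = afunD(1)[OF assms(2)]
  show "c \<odot>\<^bsub>A\<^esub> \<theta> w \<in> carrier A" for w using cl assms(1) by simp
  fix w
  have "c \<odot>\<^bsub>A\<^esub> \<theta> w = c \<odot>\<^bsub>A\<^esub> (\<Oplus>\<^bsub>A\<^esub>s\<in>SL (length w). f s w \<odot>\<^bsub>A\<^esub> \<theta> s)"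
    by (rule arg_cong[OF afunD(2)[OF assms(2)]])
  also have "\<dots> = (\<Oplus>\<^bsub>A\<^esub>s\<in>SL (length w). c \<odot>\<^bsub>A\<^esub> (f s w \<odot>\<^bsub>A\<^esub> \<theta> s))"
    using cl assms(1) by (intro A.finsum_smult_ldistr) auto
  also have "\<dots> = (\<Oplus>\<^bsub>A\<^esub>s\<in>SL (length w). f s w \<odot>\<^bsub>A\<^esub> (c \<odot>\<^bsub>A\<^esub> \<theta> s))"
    using cl assms(1) by (intro A.M.finsum_cong') (auto simp: A.smult_assoc1[symmetric] m_comm)
  finally show "c \<odot>\<^bsub>A\<^esub> \<theta> w = (\<Oplus>\<^bsub>A\<^esub>s\<in>SL (length w). f s w \<odot>\<^bsub>A\<^esub> (c \<odot>\<^bsub>A\<^esub> \<theta> s))" .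
qed

lemma afun_lmult: assumes "x \<in> carrier A" "afun \<theta>" shows "afun (\<lambda>w. x \<otimes>\<^bsub>A\<^esub> \<theta> w)"
  unfolding afun_def
proof (intro conjI allI)
  note cl = afunD(1)[OF assms(2)]
  show "x \<otimes>\<^bsub>A\<^esub> \<theta> w \<in> carrier A" for w using cl assms(1) by (simp add: mult_closed)
  fix w
  have "x \<otimes>\<^bsub>A\<^esub> \<theta> w = x \<otimes>\<^bsub>A\<^esub> (\<Oplus>\<^bsub>A\<^esub>s\<in>SL (length w). f s w \<odot>\<^bsub>A\<^esub> \<theta> s)"
    by (rule arg_cong[OF afunD(2)[OF assms(2)]])
  also have "\<dots> = (\<Oplus>\<^bsub>A\<^esub>s\<in>SL (length w). x \<otimes>\<^bsub>A\<^esub> (f s w \<odot>\<^bsub>A\<^esub> \<theta> s))"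
    using cl assms(1) by (intro mult_finsum) auto
  also have "\<dots> = (\<Oplus>\<^bsub>A\<^esub>s\<in>SL (length w). f s w \<odot>\<^bsub>A\<^esub> (x \<otimes>\<^bsub>A\<^esub> \<theta> s))"
    using cl assms(1) by (intro A.M.finsum_cong') (auto simp: mult_smult_right mult_closed)
  finally show "x \<otimes>\<^bsub>A\<^esub> \<theta> w = (\<Oplus>\<^bsub>A\<^esub>s\<in>SL (length w). f s w \<odot>\<^bsub>A\<^esub> (x \<otimes>\<^bsub>A\<^esub> \<theta> s))" .
qed

lemma afun_scalar: assumes g: "functional_on S f g" and x: "x \<in> carrier A" shows "afun (\<lambda>w. g w \<odot>\<^bsub>A\<^esub> x)"
  unfolding afun_def
proof (intro conjI allI)
  have cl: "g w \<in> carrier R" for w by (rule FnD) (rule conjunct1[OF g[unfolded functional_on_def]])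
  show "g w \<odot>\<^bsub>A\<^esub> x \<in> carrier A" for w using cl x by simp
  fix w
  have "g w = (\<Oplus>s\<in>SL (length w). g s \<otimes> f s w)" using g unfolding functional_on_def by blast
  then have "g w \<odot>\<^bsub>A\<^esub> x = (\<Oplus>s\<in>SL (length w). g s \<otimes> f s w) \<odot>\<^bsub>A\<^esub> x" by (rule arg_cong)
  also have "\<dots> = (\<Oplus>\<^bsub>A\<^esub>s\<in>SL (length w). (g s \<otimes> f s w) \<odot>\<^bsub>A\<^esub> x)"
    by (rule A.finsum_smult_rdistr[OF finite_SL]) (simp_all add: cl x)
  also have "\<dots> = (\<Oplus>\<^bsub>A\<^esub>s\<in>SL (length w). f s w \<odot>\<^bsub>A\<^esub> (g s \<odot>\<^bsub>A\<^esub> x))"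
  proof (rule A.M.finsum_cong'[OF refl])
    fix s
    have "g s \<otimes> f s w = f s w \<otimes> g s" by (rule m_comm[OF cl f_closed])
    then show "(g s \<otimes> f s w) \<odot>\<^bsub>A\<^esub> x = f s w \<odot>\<^bsub>A\<^esub> (g s \<odot>\<^bsub>A\<^esub> x)"
      using A.smult_assoc1[OF f_closed cl x] by simp
  qed (simp add: cl x)
  finally show "g w \<odot>\<^bsub>A\<^esub> x = (\<Oplus>\<^bsub>A\<^esub>s\<in>SL (length w). f s w \<odot>\<^bsub>A\<^esub> (g s \<odot>\<^bsub>A\<^esub> x))" .
qed

lemma word_op_word_op: "word_op u \<otimes>\<^bsub>E\<^esub> word_op w = word_op (u @ w)"
  by (rule op_eqI) (simp_all add: E.mult_closed E_simps)

lemma row_word_op: "afun \<theta> \<Longrightarrow> row \<theta> \<otimes>\<^bsub>E\<^esub> word_op u = row (shl u \<theta>)"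
  by (rule op_eqI) (simp_all add: E.mult_closed E_simps afunD(1) row_tens afun_shl, simp_all add: shl_def afunD(1))

lemma row_word_op_row:
  assumes "afun \<theta>" "afun \<eta>"
  shows "row \<theta> \<otimes>\<^bsub>E\<^esub> (word_op u \<otimes>\<^bsub>E\<^esub> row \<eta>) = row (\<lambda>w. \<theta> u \<otimes>\<^bsub>A\<^esub> \<eta> w)"
  using assms afunD(1)[OF assms(1)] afunD(1)[OF assms(2)]
  by (intro op_eqI) (simp_all add: E.mult_closed E_simps row_tens afun_lmult act_closed act_mult mult_closed)

lemma row_row:
  assumes "afun \<theta>" "afun \<eta>"
  shows "row \<theta> \<otimes>\<^bsub>E\<^esub> row \<eta> = row (\<lambda>w. \<theta> [] \<otimes>\<^bsub>A\<^esub> \<eta> w)"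
  using assms afunD(1)[OF assms(1)] afunD(1)[OF assms(2)]
  by (intro op_eqI) (simp_all add: E.mult_closed E_simps row_tens afun_lmult act_closed act_mult mult_closed)

lemma row_add:
  assumes "afun \<theta>" "afun \<eta>"
  shows "row \<theta> \<oplus>\<^bsub>E\<^esub> row \<eta> = row (\<lambda>w. \<theta> w \<oplus>\<^bsub>A\<^esub> \<eta> w)"
proof -
  note cl = afunD(1)[OF assms(1)] afunD(1)[OF assms(2)]
  have "tens [] x \<oplus>\<^bsub>W\<^esub> tens [] y = tens [] (x \<oplus>\<^bsub>V\<^esub> y)" if "x \<in> carrier V" "y \<in> carrier V" for x y
    using that by (intro ext) (simp add: tens_def V.smult_r_distr)
  then show ?thesis using cl
    by (intro op_eqI) (simp_all add: E_simps row_tens assms afun_add act_closed act_add_left)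
qed

lemma row_smult:
  assumes "c \<in> carrier R" "afun \<theta>"
  shows "c \<odot>\<^bsub>E\<^esub> row \<theta> = row (\<lambda>w. c \<odot>\<^bsub>A\<^esub> \<theta> w)"
proof -
  note cl = afunD(1)[OF assms(2)]
  have "c \<odot>\<^bsub>W\<^esub> tens [] x = tens [] (c \<odot>\<^bsub>V\<^esub> x)" if "x \<in> carrier V" for x
    using that assms(1) by (intro ext) (simp add: tens_def V.smult_assoc1[symmetric] m_comm)
  then show ?thesis using cl assms(1)
    by (intro op_eqI) (simp_all add: E_simps row_tens assms afun_smult act_closed act_smult_left)
qed

text \<open>
  The generator of \<open>M\<close> is killed by \<open>y\<close>. This is the reason why powers of \<open>Z\<close> below stay simple.
\<close>
lemma word_op_False_row:
  assumes "afun \<theta>" shows "word_op [False] \<otimes>\<^bsub>E\<^esub> row \<theta> = \<zero>\<^bsub>E\<^esub>"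
proof -
  have "tens [False] x = \<zero>\<^bsub>W\<^esub>" if "x \<in> carrier V" for x
    using that by (intro ext) (simp add: tens_def f_False)
  then show ?thesis using afunD(1)[OF assms]
    by (intro op_eqI) (simp_all add: E.mult_closed E_simps row_tens assms act_closed del: W_simps)
qed

lemma word_op_Nil: "word_op [] \<otimes>\<^bsub>E\<^esub> T = T" if "T \<in> carrier E"
proof (rule op_eqI)
  have "word_op [] g = g" if "g \<in> carrier W" for g
  proof -
    have "submodule {g \<in> carrier W. word_op [] g = g} R W"
      using lin_endD[OF word_op_E[unfolded E_carrier, of "[]"]]
    proof (intro W.submoduleI')
      show "\<zero>\<^bsub>W\<^esub> \<in> {g \<in> carrier W. word_op [] g = g}"
        using lin_end_zero[OF W_module word_op_E[unfolded E_carrier]] W.M.zero_closed by blast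
    qed auto
    from subsetD[OF W_induct[OF this] that] show ?thesis by simp
  qed
  then show "(word_op [] \<otimes>\<^bsub>E\<^esub> T) (tens s v) = T (tens s v)" if "s \<in> S" "v \<in> carrier V" for s v
    using that \<open>T \<in> carrier E\<close> lin_endD(1)[of T R W] by (simp add: E_simps E_carrier)
qed (use that in \<open>simp_all add: E.mult_closed\<close>)

end

section \<open>The two generators\<close>

text \<open>
  The same facts about sums in the field; in the locales below the short names refer to sums in a module.
\<close>
lemmas (in cyclic_nil_module) R_finsum_0I = finsum_0I and R_finsum_cong' = finsum_cong' and R_finsum_addf = finsum_addf
  and R_finsum_rdistr = finsum_rdistr and R_finsum_only = finsum_only

context row_extension begin

interpretation W: Module.module R W by (rule W_module)
interpretation E: assoc_algebra R E
  unfolding E_def by (rule end_assoc_algebra[OF field_axioms W_module])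

text \<open>
  The degree of \<open>\<gamma> k\<close>.
\<close>
definition deg where "deg k = \<kappa> - 1 + n k + d k"

lemma deg_less_n: assumes "i < k" shows "deg i < n k"
proof -
  have "deg i < n (Suc (i + r))" for r
  proof (induction r)
    case 0
    then show ?case using degrees[of i] by (simp add: deg_def)
  next
    case (Suc r)
    then show ?case using degrees[of "Suc (i + r)"] by (simp add: deg_def)
  qed
  from this[of "k - Suc i"] show ?thesis using assms by simp
qed

lemma deg_less_iff: "deg i < deg k \<longleftrightarrow> i < k"
proof -
  have *: "deg i < deg k" if "i < k" for i k
    using deg_less_n[OF that] by (simp add: deg_def)
  show ?thesis using *[of i k] *[of k i] by (cases i k rule: linorder_cases) auto
qed

lemma deg_pos: "0 < deg k" using n_pos[of k] by (simp add: deg_def)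

text \<open>
  The index \<open>k\<close> such that \<open>\<gamma> k\<close> has degree \<open>length w\<close>. For words without such an index the value is arbitrary, which does
  no harm because all \<open>\<gamma> k\<close> vanish there.
\<close>
definition stage :: "bool list \<Rightarrow> nat" where "stage w = (SOME k. length w = deg k)"

lemma stage_eq: assumes "length w = deg k" shows "stage w = k"
proof -
  have "length w = deg (stage w)" unfolding stage_def using assms by (rule someI)
  then show ?thesis using assms deg_less_iff by (metis less_irrefl linorder_neqE_nat)
qed

text \<open>
  The formal sum \<open>\<Sum>k. \<gamma> k \<cdot> a k\<close>. It makes sense because at most one \<open>\<gamma> k\<close> is nonzero on a given word.
\<close>
definition \<Gamma> :: "bool list \<Rightarrow> 'b" where "\<Gamma> w = \<gamma> (stage w) w \<odot>\<^bsub>A\<^esub> a (stage w)"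

lemma \<gamma>_closed [simp]: "\<gamma> k w \<in> carrier R"
  by (rule FnD) (rule conjunct1[OF \<gamma>_functional[unfolded functional_on_def]])

lemma \<gamma>_zero: "length w \<noteq> deg k \<Longrightarrow> \<gamma> k w = \<zero>" using \<gamma>_supp unfolding deg_def by blast

lemma \<Gamma>_at: "length w = deg k \<Longrightarrow> \<Gamma> w = \<gamma> k w \<odot>\<^bsub>A\<^esub> a k" by (simp add: \<Gamma>_def stage_eq)

lemma \<Gamma>_zero: assumes "\<And>k. length w \<noteq> deg k" shows "\<Gamma> w = \<zero>\<^bsub>A\<^esub>"
  using \<gamma>_zero[OF assms] a_closed by (simp add: \<Gamma>_def)

lemma \<Gamma>_afun: "afun \<Gamma>"
  unfolding afun_def
proof (intro conjI allI)
  show "\<Gamma> w \<in> carrier A" for w by (simp add: \<Gamma>_def a_closed)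
  fix w
  have "\<Gamma> w = (\<Oplus>\<^bsub>A\<^esub>s\<in>SL (length w). f s w \<odot>\<^bsub>A\<^esub> (\<gamma> (stage w) s \<odot>\<^bsub>A\<^esub> a (stage w)))"
    unfolding \<Gamma>_def using afunD(2)[OF afun_scalar[OF \<gamma>_functional a_closed]] .
  also have "\<dots> = (\<Oplus>\<^bsub>A\<^esub>s\<in>SL (length w). f s w \<odot>\<^bsub>A\<^esub> \<Gamma> s)"
  proof (rule A.M.finsum_cong'[OF refl])
    fix s assume "s \<in> SL (length w)"
    then have "stage s = stage w" by (simp add: stage_def)
    then show "f s w \<odot>\<^bsub>A\<^esub> (\<gamma> (stage w) s \<odot>\<^bsub>A\<^esub> a (stage w)) = f s w \<odot>\<^bsub>A\<^esub> \<Gamma> s" by (simp add: \<Gamma>_def)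
  qed (simp add: \<Gamma>_def a_closed)
  finally show "\<Gamma> w = (\<Oplus>\<^bsub>A\<^esub>s\<in>SL (length w). f s w \<odot>\<^bsub>A\<^esub> \<Gamma> s)" .
qed

lemma \<Gamma>_closed [simp]: "\<Gamma> w \<in> carrier A" by (rule afunD(1)[OF \<Gamma>_afun])

lemma \<Gamma>_Nil: "\<Gamma> [] = \<zero>\<^bsub>A\<^esub>" using deg_pos by (intro \<Gamma>_zero) (metis less_irrefl list.size(3))

text \<open>
  The generators of the 2-generated algebra: \<open>x\<close> acts as it does on \<open>M\<close>, and the action of \<open>y\<close> is perturbed by a row
  operator whose entries involve all elements \<open>a k\<close>, separated by degree.
\<close>
definition X where "X = word_op [True]"
definition Z where "Z = word_op [False] \<oplus>\<^bsub>E\<^esub> row \<Gamma>"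
definition B0 where "B0 = alg_generated R E {X, Z}"

lemma X_E [simp]: "X \<in> carrier E" and Z_E [simp]: "Z \<in> carrier E" by (simp_all add: X_def Z_def)

lemma B0_subalgebra: "subalgebra B0 R E" unfolding B0_def by (rule E.generated_subalgebra) simp
lemma B0_submodule: "submodule B0 R E" using B0_subalgebra by (simp add: subalgebra_def)
lemma B0_mult: "T1 \<in> B0 \<Longrightarrow> T2 \<in> B0 \<Longrightarrow> T1 \<otimes>\<^bsub>E\<^esub> T2 \<in> B0" using B0_subalgebra by (simp add: subalgebra_def)
lemma XZ_B0: "X \<in> B0" "Z \<in> B0" using alg_generated_superset[of "{X, Z}" R E] by (simp_all add: B0_def)
lemmas B0D = E.submoduleD'[OF B0_submodule]

text \<open>
  The row functions whose operators lie in the generated algebra. The aim is to show that all functions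
  \<open>f s \<cdot> x\<close> with \<open>s \<in> S\<close> and \<open>x\<close> in \<open>A\<close> are among them.
\<close>
definition gen_rows :: "(bool list \<Rightarrow> 'b) set" where "gen_rows = {\<theta>. afun \<theta> \<and> row \<theta> \<in> B0}"

lemma gen_rowsD: "\<theta> \<in> gen_rows \<Longrightarrow> afun \<theta>" "\<theta> \<in> gen_rows \<Longrightarrow> row \<theta> \<in> B0" "\<theta> \<in> gen_rows \<Longrightarrow> \<theta> w \<in> carrier A"
  using afunD(1) by (auto simp: gen_rows_def)

lemma gen_rows_add: "\<theta> \<in> gen_rows \<Longrightarrow> \<eta> \<in> gen_rows \<Longrightarrow> (\<lambda>w. \<theta> w \<oplus>\<^bsub>A\<^esub> \<eta> w) \<in> gen_rows"
  using B0D(3)[of "row \<theta>" "row \<eta>"] by (simp add: gen_rows_def afun_add row_add)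

lemma gen_rows_smult: "c \<in> carrier R \<Longrightarrow> \<theta> \<in> gen_rows \<Longrightarrow> (\<lambda>w. c \<odot>\<^bsub>A\<^esub> \<theta> w) \<in> gen_rows"
  using B0D(4)[of c "row \<theta>"] by (simp add: gen_rows_def afun_smult row_smult)

lemma gen_rows_zero: "(\<lambda>_. \<zero>\<^bsub>A\<^esub>) \<in> gen_rows"
proof -
  have z: "afun (\<lambda>_. \<zero>\<^bsub>A\<^esub>)"
    unfolding afun_def by (auto intro!: A.M.finsum_0I[symmetric])
  have "tens [] (act \<zero>\<^bsub>A\<^esub> v) = \<zero>\<^bsub>W\<^esub>" if "v \<in> carrier V" for v
    using that by (intro ext) (simp add: tens_def act_zero_left)
  then have "row (\<lambda>_. \<zero>\<^bsub>A\<^esub>) = \<zero>\<^bsub>E\<^esub>"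
    by (intro op_eqI) (simp_all add: E_simps row_tens[OF z] del: W_simps)
  then show ?thesis using z B0D(2) by (simp add: gen_rows_def)
qed

lemma gen_rows_finsum:
  assumes "finite I" "\<And>i. i \<in> I \<Longrightarrow> \<theta> i \<in> gen_rows"
  shows "(\<lambda>w. \<Oplus>\<^bsub>A\<^esub>i\<in>I. \<theta> i w) \<in> gen_rows"
  using assms
proof (induction I)
  case empty
  then show ?case using gen_rows_zero by simp
next
  case (insert i I)
  have cl: "\<theta> j w \<in> carrier A" if "j \<in> insert i I" for j w using insert.prems[OF that] by (rule gen_rowsD(3))
  have "(\<lambda>w. \<Oplus>\<^bsub>A\<^esub>j\<in>insert i I. \<theta> j w) = (\<lambda>w. \<theta> i w \<oplus>\<^bsub>A\<^esub> (\<Oplus>\<^bsub>A\<^esub>j\<in>I. \<theta> j w))"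
    using insert.hyps cl by (intro ext A.M.finsum_insert) auto
  then show ?case using gen_rows_add[OF insert.prems[of i] insert.IH] insert.prems by simp
qed

lemma gen_rows_True: assumes "\<theta> \<in> gen_rows" shows "shl [True] \<theta> \<in> gen_rows"
proof -
  have "row \<theta> \<otimes>\<^bsub>E\<^esub> X \<in> B0" using gen_rowsD(2)[OF assms] XZ_B0 by (intro B0_mult)
  then show ?thesis using gen_rowsD(1)[OF assms] by (simp add: gen_rows_def X_def row_word_op afun_shl)
qed

text \<open>
  Multiplication by \<open>Z\<close> on the right realizes the shift by \<open>y\<close> only up to a multiple of \<open>\<Gamma>\<close>.
\<close>
lemma gen_rows_False: assumes "\<theta> \<in> gen_rows" shows "(\<lambda>w. shl [False] \<theta> w \<oplus>\<^bsub>A\<^esub> \<theta> [] \<otimes>\<^bsub>A\<^esub> \<Gamma> w) \<in> gen_rows"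
proof -
  note \<theta> = gen_rowsD(1)[OF assms] and cl = gen_rowsD(3)[OF assms]
  have l: "afun (\<lambda>w. \<theta> [] \<otimes>\<^bsub>A\<^esub> \<Gamma> w)" by (rule afun_lmult[OF cl \<Gamma>_afun])
  have "row \<theta> \<otimes>\<^bsub>E\<^esub> Z = row \<theta> \<otimes>\<^bsub>E\<^esub> word_op [False] \<oplus>\<^bsub>E\<^esub> row \<theta> \<otimes>\<^bsub>E\<^esub> row \<Gamma>"
    unfolding Z_def using cl by (intro E.mult_r_distr) simp_all
  also have "\<dots> = row (\<lambda>w. shl [False] \<theta> w \<oplus>\<^bsub>A\<^esub> \<theta> [] \<otimes>\<^bsub>A\<^esub> \<Gamma> w)"
    by (simp add: row_word_op[OF \<theta>] row_row[OF \<theta> \<Gamma>_afun] row_add[OF afun_shl[OF \<theta>] l])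
  finally have "row (\<lambda>w. shl [False] \<theta> w \<oplus>\<^bsub>A\<^esub> \<theta> [] \<otimes>\<^bsub>A\<^esub> \<Gamma> w) \<in> B0"
    using B0_mult[OF gen_rowsD(2)[OF assms] XZ_B0(2)] by simp
  then show ?thesis using afun_add[OF afun_shl[OF \<theta>] l] by (simp add: gen_rows_def)
qed

text \<open>
  The coefficients for which the error term in \<open>gen_rows_False\<close> is harmless. In the end these are all elements of \<open>A\<close>.
\<close>
definition gen_coeffs where "gen_coeffs = {x \<in> carrier A. (\<lambda>w. x \<otimes>\<^bsub>A\<^esub> \<Gamma> w) \<in> gen_rows}"

lemma gen_coeffs_submodule: "submodule gen_coeffs R A"
proof (rule A.submoduleI')
  have "(\<lambda>w. \<zero>\<^bsub>A\<^esub> \<otimes>\<^bsub>A\<^esub> \<Gamma> w) = (\<lambda>_. \<zero>\<^bsub>A\<^esub>)" by (intro ext) (simp add: zero_mult)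
  then show "\<zero>\<^bsub>A\<^esub> \<in> gen_coeffs" using gen_rows_zero by (simp add: gen_coeffs_def)
  show "x \<oplus>\<^bsub>A\<^esub> y \<in> gen_coeffs" if "x \<in> gen_coeffs" "y \<in> gen_coeffs" for x y
    using that gen_rows_add[of "\<lambda>w. x \<otimes>\<^bsub>A\<^esub> \<Gamma> w" "\<lambda>w. y \<otimes>\<^bsub>A\<^esub> \<Gamma> w"] by (simp add: gen_coeffs_def mult_l_distr)
  show "c \<odot>\<^bsub>A\<^esub> x \<in> gen_coeffs" if "c \<in> carrier R" "x \<in> gen_coeffs" for c x
    using that gen_rows_smult[of c "\<lambda>w. x \<otimes>\<^bsub>A\<^esub> \<Gamma> w"] by (simp add: gen_coeffs_def mult_smult_left)
qed (auto simp: gen_coeffs_def)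

lemmas gen_coeffsD = A.submoduleD'[OF gen_coeffs_submodule]

lemma gen_rows_shl:
  assumes "\<theta> \<in> gen_rows" "\<And>u' v'. u = u' @ v' \<Longrightarrow> v' \<noteq> [] \<Longrightarrow> \<theta> u' \<in> gen_coeffs"
  shows "shl u \<theta> \<in> gen_rows"
  using assms
proof (induction u arbitrary: \<theta>)
  case Nil
  have "shl [] \<theta> = \<theta>" by (simp add: shl_def fun_eq_iff)
  then show ?case using Nil by simp
next
  case (Cons x u)
  have "shl [x] \<theta> \<in> gen_rows"
  proof (cases x)
    case True
    then show ?thesis using gen_rows_True Cons.prems(1) by simp
  next
    case False
    let ?\<eta> = "\<lambda>w. \<theta> [] \<otimes>\<^bsub>A\<^esub> \<Gamma> w"
    have "\<theta> [] \<in> gen_coeffs" using Cons.prems(2)[of "[]" "x # u"] by simp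
    then have \<eta>: "?\<eta> \<in> gen_rows" by (simp add: gen_coeffs_def)
    have "(\<lambda>w. (shl [False] \<theta> w \<oplus>\<^bsub>A\<^esub> ?\<eta> w) \<oplus>\<^bsub>A\<^esub> (\<ominus> \<one>) \<odot>\<^bsub>A\<^esub> ?\<eta> w) \<in> gen_rows"
      by (intro gen_rows_add[OF gen_rows_False[OF Cons.prems(1)]] gen_rows_smult \<eta>) simp
    moreover have "(shl [False] \<theta> w \<oplus>\<^bsub>A\<^esub> ?\<eta> w) \<oplus>\<^bsub>A\<^esub> (\<ominus> \<one>) \<odot>\<^bsub>A\<^esub> ?\<eta> w = shl [False] \<theta> w" for w
    proof -
      have "shl [False] \<theta> w \<in> carrier A" "?\<eta> w \<in> carrier A"
        using gen_rowsD(3)[OF Cons.prems(1)] gen_rowsD(3)[OF \<eta>] by (simp_all add: shl_def)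
      then show ?thesis by (simp add: A.smult_l_minus A.M.a_assoc A.M.r_neg)
    qed
    ultimately show ?thesis using False by simp
  qed
  then have "shl u (shl [x] \<theta>) \<in> gen_rows"
  proof (rule Cons.IH)
    fix u' v' assume "u = u' @ v'" "v' \<noteq> []"
    then show "shl [x] \<theta> u' \<in> gen_coeffs" using Cons.prems(2)[of "x # u'" v'] by (simp add: shl_def)
  qed
  then show ?case by (simp add: shl_shl)
qed

text \<open>
  A row operator is killed from the left by \<open>y\<close>, since \<open>y\<close> kills the generator of \<open>M\<close>, and by \<open>row \<Gamma>\<close>, since
  \<open>\<Gamma> [] = 0\<close>.
\<close>
lemma Z_power: "mpow E Z m = word_op (replicate (Suc m) False) \<oplus>\<^bsub>E\<^esub> row (shl (replicate m False) \<Gamma>)"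
proof (induction m)
  case 0
  have "shl [] \<Gamma> = \<Gamma>" by (simp add: shl_def fun_eq_iff)
  then show ?case by (simp add: Z_def)
next
  case (Suc m)
  let ?u = "word_op (replicate (Suc m) False)" and ?r = "row (shl (replicate m False) \<Gamma>)"
  have af: "afun (shl (replicate k False) \<Gamma>)" for k by (rule afun_shl[OF \<Gamma>_afun])
  have rE: "row (shl (replicate k False) \<Gamma>) \<in> carrier E" for k by (rule row_E[OF afunD(1)[OF af]])
  have gE: "row \<Gamma> \<in> carrier E" by simp
  have z1: "word_op [False] \<otimes>\<^bsub>E\<^esub> ?r = \<zero>\<^bsub>E\<^esub>" by (rule word_op_False_row[OF af])
  have z2: "row \<Gamma> \<otimes>\<^bsub>E\<^esub> ?r = \<zero>\<^bsub>E\<^esub>"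
  proof -
    have "row \<Gamma> \<otimes>\<^bsub>E\<^esub> ?r = row (\<lambda>w. \<zero>\<^bsub>A\<^esub>)"
      using afunD(1)[OF af] by (simp add: row_row[OF \<Gamma>_afun af] \<Gamma>_Nil zero_mult)
    also have "\<dots> = \<zero>\<^bsub>E\<^esub>"
    proof (rule op_eqI)
      fix s v assume v: "v \<in> carrier V"
      have "tens [] (act \<zero>\<^bsub>A\<^esub> v) = \<zero>\<^bsub>W\<^esub>" using v by (intro ext) (simp add: tens_def act_zero_left)
      then show "row (\<lambda>w. \<zero>\<^bsub>A\<^esub>) (tens s v) = \<zero>\<^bsub>E\<^esub> (tens s v)"
        using v by (simp add: E_simps row_tens[OF gen_rowsD(1)[OF gen_rows_zero]] del: W_simps)
    qed simp_all
    finally show ?thesis .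
  qed
  have "mpow E Z (Suc m) = (word_op [False] \<oplus>\<^bsub>E\<^esub> row \<Gamma>) \<otimes>\<^bsub>E\<^esub> (?u \<oplus>\<^bsub>E\<^esub> ?r)"
    by (simp only: mpow.simps Suc) (simp only: Z_def)
  also have "\<dots> = (word_op [False] \<otimes>\<^bsub>E\<^esub> ?u \<oplus>\<^bsub>E\<^esub> word_op [False] \<otimes>\<^bsub>E\<^esub> ?r) \<oplus>\<^bsub>E\<^esub> (row \<Gamma> \<otimes>\<^bsub>E\<^esub> ?u \<oplus>\<^bsub>E\<^esub> row \<Gamma> \<otimes>\<^bsub>E\<^esub> ?r)"
    using rE[of m] gE
    by (subst E.mult_l_distr) (simp_all only: E.mult_r_distr word_op_E E.A.M.a_closed)
  also have "\<dots> = word_op (replicate (Suc (Suc m)) False) \<oplus>\<^bsub>E\<^esub> row (shl (replicate (Suc m) False) \<Gamma>)"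
    unfolding z1 z2 using rE[of "Suc m"] by (simp add: word_op_word_op row_word_op[OF \<Gamma>_afun])
  finally show ?case .
qed

definition \<Gamma>' where "\<Gamma>' = shl (replicate (\<kappa> - 1) False) \<Gamma>"

text \<open>
  Since \<open>y ^ \<kappa> = 0\<close>, the power \<open>Z ^ \<kappa>\<close> is a pure row operator.
\<close>
lemma \<Gamma>'_gen_rows: "\<Gamma>' \<in> gen_rows"
proof -
  have af: "afun \<Gamma>'" unfolding \<Gamma>'_def by (rule afun_shl[OF \<Gamma>_afun])
  have "word_op (replicate \<kappa> False) = \<zero>\<^bsub>E\<^esub>"
  proof (rule op_eqI)
    fix s v assume v: "v \<in> carrier V"
    have "tens (replicate \<kappa> False @ s) v = \<zero>\<^bsub>W\<^esub>" using v by (intro ext) (simp add: tens_def f_power)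
    then show "word_op (replicate \<kappa> False) (tens s v) = \<zero>\<^bsub>E\<^esub> (tens s v)" using v by (simp add: E_simps del: W_simps)
  qed simp_all
  then have "mpow E Z (\<kappa> - 1) = row \<Gamma>'"
    using Z_power[of "\<kappa> - 1"] \<kappa>_pos afunD(1)[OF af] by (simp add: \<Gamma>'_def)
  moreover have "mpow E Z m \<in> B0" for m by (induction m) (simp_all add: XZ_B0 B0_mult)
  ultimately show ?thesis using af unfolding gen_rows_def by (metis (mono_tags, lifting) mem_Collect_eq)
qed

text \<open>
  The functional \<open>w \<mapsto> \<gamma> k (y ^ (\<kappa> - 1) b k w)\<close>.
\<close>
definition \<theta> where "\<theta> k = ract (n k) (b k) (shl (replicate (\<kappa> - 1) False) (\<gamma> k))"

lemma \<theta>_functional': "functional_on S f (shl u (\<theta> k))" unfolding \<theta>_def by (rule \<theta>_functional)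

lemma \<theta>_Fn: "\<theta> k \<in> Fn"
proof -
  have "shl [] (\<theta> k) \<in> Fn" using \<theta>_functional'[of "[]" k] unfolding functional_on_def by blast
  moreover have "shl [] (\<theta> k) = \<theta> k" by (simp add: shl_def fun_eq_iff)
  ultimately show ?thesis by simp
qed

lemma \<theta>_closed [simp]: "\<theta> k w \<in> carrier R" by (rule FnD[OF \<theta>_Fn])

lemma b_closed [simp]: "b k u \<in> carrier R" by (rule FnD[OF b_Fn])

lemma \<theta>_zero: assumes "length w \<noteq> d k" shows "\<theta> k w = \<zero>"
  unfolding \<theta>_def ract_def
proof (rule R_finsum_0I)
  fix u assume "u \<in> words (n k)"
  then have "\<gamma> k (replicate (\<kappa> - 1) False @ u @ w) = \<zero>" using assms by (intro \<gamma>_zero) (simp add: deg_def)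
  then show "b k u \<otimes> shl (replicate (\<kappa> - 1) False) (\<gamma> k) (u @ w) = \<zero>" by (simp add: shl_def)
qed

text \<open>
  Shifting by \<open>b k\<close> isolates the \<open>k\<close>-th summand of \<open>\<Gamma>\<close>: the later summands are annihilated by \<open>b k\<close>, and the earlier ones
  have degree less than \<open>n k\<close>, the degree of \<open>b k\<close>.
\<close>
lemma \<theta>_sum: "(\<Oplus>\<^bsub>A\<^esub>u\<in>words (n k). b k u \<odot>\<^bsub>A\<^esub> \<Gamma>' (u @ w)) = \<theta> k w \<odot>\<^bsub>A\<^esub> a k"
proof -
  let ?F = "replicate (\<kappa> - 1) False"
  have len: "length (?F @ u @ w) = \<kappa> - 1 + n k + length w" if "u \<in> words (n k)" for u
    using that by simp
  have at: "(\<Oplus>\<^bsub>A\<^esub>u\<in>words (n k). b k u \<odot>\<^bsub>A\<^esub> \<Gamma>' (u @ w)) = ract (n k) (b k) (shl ?F (\<gamma> i)) w \<odot>\<^bsub>A\<^esub> a i"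
    if i: "\<kappa> - 1 + n k + length w = deg i" for i
  proof -
    have "ract (n k) (b k) (shl ?F (\<gamma> i)) w \<odot>\<^bsub>A\<^esub> a i = (\<Oplus>\<^bsub>A\<^esub>u\<in>words (n k). (b k u \<otimes> shl ?F (\<gamma> i) (u @ w)) \<odot>\<^bsub>A\<^esub> a i)"
      unfolding ract_def by (rule A.finsum_smult_rdistr[OF finite_words]) (simp_all add: shl_def a_closed)
    also have "\<dots> = (\<Oplus>\<^bsub>A\<^esub>u\<in>words (n k). b k u \<odot>\<^bsub>A\<^esub> \<Gamma>' (u @ w))"
    proof (rule A.M.finsum_cong'[OF refl])
      fix u assume u: "u \<in> words (n k)"
      have "\<Gamma>' (u @ w) = \<gamma> i (?F @ u @ w) \<odot>\<^bsub>A\<^esub> a i"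
        unfolding \<Gamma>'_def shl_def using len[OF u] i by (intro \<Gamma>_at) simp
      then show "(b k u \<otimes> shl ?F (\<gamma> i) (u @ w)) \<odot>\<^bsub>A\<^esub> a i = b k u \<odot>\<^bsub>A\<^esub> \<Gamma>' (u @ w)"
        by (simp add: shl_def A.smult_assoc1 a_closed)
    qed (simp add: \<Gamma>'_def shl_def)
    finally show ?thesis by simp
  qed
  consider "length w = d k" | i where "length w \<noteq> d k" "\<kappa> - 1 + n k + length w = deg i"
    | "length w \<noteq> d k" "\<And>i. \<kappa> - 1 + n k + length w \<noteq> deg i" by blast
  then show ?thesis
  proof cases
    case 1
    then show ?thesis using at[of k] by (simp add: deg_def \<theta>_def)
  next
    case (2 i)
    have "i \<noteq> k" using 2 by (auto simp: deg_def)
    moreover have "\<not> i < k" using deg_less_n[of i k] 2(2) by auto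
    ultimately have "k < i" by simp
    then have "ract (n k) (b k) (shl ?F (\<gamma> i)) w = \<zero>" by (rule orth)
    then show ?thesis using at[OF 2(2)] \<theta>_zero[OF 2(1)] a_closed by simp
  next
    case 3
    have "(\<Oplus>\<^bsub>A\<^esub>u\<in>words (n k). b k u \<odot>\<^bsub>A\<^esub> \<Gamma>' (u @ w)) = \<zero>\<^bsub>A\<^esub>"
    proof (rule A.M.finsum_0I)
      fix u assume u: "u \<in> words (n k)"
      have "\<Gamma>' (u @ w) = \<zero>\<^bsub>A\<^esub>"
        unfolding \<Gamma>'_def shl_def using len[OF u] 3(2) by (intro \<Gamma>_zero) (simp add: add.assoc)
      then show "b k u \<odot>\<^bsub>A\<^esub> \<Gamma>' (u @ w) = \<zero>\<^bsub>A\<^esub>" by simp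
    qed
    then show ?thesis using \<theta>_zero[OF 3(1)] a_closed by simp
  qed
qed

text \<open>
  By induction on \<open>k\<close>. The shift of \<open>\<Gamma>'\<close> by \<open>b k\<close> can be carried out inside the generated algebra, because the error terms
  involve only values of \<open>\<Gamma>'\<close> at words shorter than \<open>n k\<close>, hence only \<open>a i\<close> with \<open>i < k\<close>. The result is
  \<open>\<theta> k \<cdot> a k\<close>. Shifting on by a word \<open>w0\<close> with \<open>\<theta> k w0 \<noteq> 0\<close> leaves the row with the single entry \<open>a k\<close> at \<open>[]\<close>, up to a
  scalar, and a multiplication by \<open>Z\<close> turns it into \<open>a k \<cdot> \<Gamma>\<close>.
\<close>
lemma \<theta>_a: "a k \<in> gen_coeffs \<and> (\<lambda>w. \<theta> k w \<odot>\<^bsub>A\<^esub> a k) \<in> gen_rows"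
proof (induction k rule: less_induct)
  case (less k)
  have small: "\<Gamma>' u' \<in> gen_coeffs" if "length u' < n k" for u'
  proof (cases "\<exists>i. length (replicate (\<kappa> - 1) False @ u') = deg i")
    case True
    then obtain i where i: "length (replicate (\<kappa> - 1) False @ u') = deg i" ..
    then have "deg i < deg k" using that by (simp add: deg_def)
    then have "i < k" by (simp only: deg_less_iff)
    then show ?thesis using less.IH i by (simp add: \<Gamma>'_def shl_def \<Gamma>_at gen_coeffsD(4))
  next
    case False
    then have "\<Gamma>' u' = \<zero>\<^bsub>A\<^esub>" unfolding \<Gamma>'_def shl_def by (intro \<Gamma>_zero) blast
    then show ?thesis using gen_coeffsD(2) by simp
  qed
  have "shl u \<Gamma>' \<in> gen_rows" if "u \<in> words (n k)" for u
    by (rule gen_rows_shl[OF \<Gamma>'_gen_rows]) (rule small, use that in \<open>auto simp: neq_Nil_conv\<close>)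
  then have "(\<lambda>w. \<Oplus>\<^bsub>A\<^esub>u\<in>words (n k). b k u \<odot>\<^bsub>A\<^esub> shl u \<Gamma>' w) \<in> gen_rows"
    by (intro gen_rows_finsum finite_words gen_rows_smult) simp_all
  then have th: "(\<lambda>w. \<theta> k w \<odot>\<^bsub>A\<^esub> a k) \<in> gen_rows" by (simp add: shl_def \<theta>_sum)
  obtain w0 where w0: "length w0 = d k" "\<theta> k w0 \<noteq> \<zero>" using nonorth[of k] unfolding \<theta>_def by blast
  have "shl w0 (\<lambda>w. \<theta> k w \<odot>\<^bsub>A\<^esub> a k) \<in> gen_rows"
  proof (rule gen_rows_shl[OF th])
    fix u' v' assume "w0 = u' @ v'" "v' \<noteq> []"
    then have "length u' \<noteq> d k" using w0(1) by auto
    then show "\<theta> k u' \<odot>\<^bsub>A\<^esub> a k \<in> gen_coeffs" using \<theta>_zero gen_coeffsD(2) a_closed by simp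
  qed
  moreover have c: "\<theta> k w0 \<in> Units R" using w0(2) field_Units by simp
  ultimately have "(\<lambda>w. inv (\<theta> k w0) \<odot>\<^bsub>A\<^esub> shl w0 (\<lambda>w. \<theta> k w \<odot>\<^bsub>A\<^esub> a k) w) \<in> gen_rows"
    by (intro gen_rows_smult) simp_all
  moreover have "inv (\<theta> k w0) \<odot>\<^bsub>A\<^esub> shl w0 (\<lambda>w. \<theta> k w \<odot>\<^bsub>A\<^esub> a k) w = (if w = [] then a k else \<zero>\<^bsub>A\<^esub>)" for w
  proof (cases "w = []")
    case True
    then show ?thesis using c a_closed by (simp add: shl_def A.smult_assoc1[symmetric])
  next
    case False
    then have "\<theta> k (w0 @ w) = \<zero>" using w0(1) by (intro \<theta>_zero) simp
    then show ?thesis using c a_closed False by (simp add: shl_def)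
  qed
  ultimately have e: "(\<lambda>w. if w = [] then a k else \<zero>\<^bsub>A\<^esub>) \<in> gen_rows" (is "?e \<in> gen_rows") by simp
  have "(\<lambda>w. shl [False] ?e w \<oplus>\<^bsub>A\<^esub> ?e [] \<otimes>\<^bsub>A\<^esub> \<Gamma> w) \<in> gen_rows" by (rule gen_rows_False[OF e])
  then have "(\<lambda>w. a k \<otimes>\<^bsub>A\<^esub> \<Gamma> w) \<in> gen_rows" using a_closed by (simp add: shl_def mult_closed)
  then show ?case using th a_closed by (simp add: gen_coeffs_def)
qed

lemma gen_coeffs_all: "gen_coeffs = carrier A"
proof -
  have "lin_span R A (range a) \<subseteq> gen_coeffs" using \<theta>_a by (intro lin_span_least gen_coeffs_submodule) blast
  then show ?thesis using a_span gen_coeffsD(1) by blast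
qed

lemma gen_rows_shl_all: "\<eta> \<in> gen_rows \<Longrightarrow> shl u \<eta> \<in> gen_rows"
  by (rule gen_rows_shl) (simp_all add: gen_coeffs_all gen_rowsD(3))

text \<open>
  The functions \<open>g\<close> of degree \<open>m\<close> for which \<open>g \<cdot> a k\<close> is available contain the translates of \<open>\<theta> j\<close> for every \<open>j\<close> with
  \<open>a j = a k\<close>. There are infinitely many such \<open>j\<close>, so for each nonzero vector of degree \<open>m\<close> one of the \<open>\<theta> j\<close> has
  sufficiently large degree to possess a translate that does not vanish at this vector. Hence the available functions
  are all functionals on the component of degree \<open>m\<close>.
\<close>
lemma gen_rows_f_a:
  assumes s: "s \<in> S" shows "(\<lambda>w. f s w \<odot>\<^bsub>A\<^esub> a k) \<in> gen_rows"
proof -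
  define m where "m = length s"
  \<comment> \<open>The functional on M that has degree m and the values g on the basis words of length m.\<close>
  define ext where "ext g w = (\<Oplus>t\<in>SL m. g t \<otimes> f t w)" for g w
  define U where "U = {g \<in> Fn. (\<lambda>w. ext g w \<odot>\<^bsub>A\<^esub> a k) \<in> gen_rows}"
  have ext_cl: "ext g w \<in> carrier R" if "g \<in> Fn" for g w
    unfolding ext_def using FnD[OF that] by (intro finsum_closed') simp
  have U: "fun_subspace U"
  proof (rule fun_subspaceI)
    show "g i \<in> carrier R" if "g \<in> U" for g i using that by (simp add: U_def)
    have "ext (\<lambda>_. \<zero>) w = \<zero>" for w unfolding ext_def by (intro R_finsum_0I) simp
    then show "(\<lambda>_. \<zero>) \<in> U" using gen_rows_zero a_closed by (simp add: U_def FnI)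
    fix g g' c assume g: "g \<in> U" "g' \<in> U" "c \<in> carrier R"
    have cl: "g w \<in> carrier R" "g' w \<in> carrier R" for w using g by (simp_all add: U_def)
    have "ext (\<lambda>i. g i \<oplus> c \<otimes> g' i) w = ext g w \<oplus> c \<otimes> ext g' w" for w
    proof -
      have "ext (\<lambda>i. g i \<oplus> c \<otimes> g' i) w = (\<Oplus>t\<in>SL m. g t \<otimes> f t w \<oplus> c \<otimes> (g' t \<otimes> f t w))"
        unfolding ext_def
      proof (rule R_finsum_cong'[OF refl])
        fix t show "(g t \<oplus> c \<otimes> g' t) \<otimes> f t w = g t \<otimes> f t w \<oplus> c \<otimes> (g' t \<otimes> f t w)"
          using cl g(3) by (simp add: l_distr m_assoc)
      qed (use cl g(3) in simp)
      also have "\<dots> = ext g w \<oplus> (\<Oplus>t\<in>SL m. c \<otimes> (g' t \<otimes> f t w))"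
        unfolding ext_def using cl g(3) by (intro R_finsum_addf) simp_all
      also have "(\<Oplus>t\<in>SL m. c \<otimes> (g' t \<otimes> f t w)) = c \<otimes> ext g' w"
        unfolding ext_def using cl g(3) by (intro R_finsum_rdistr[symmetric]) simp_all
      finally show ?thesis .
    qed
    then have "(\<lambda>w. ext (\<lambda>i. g i \<oplus> c \<otimes> g' i) w \<odot>\<^bsub>A\<^esub> a k) = (\<lambda>w. ext g w \<odot>\<^bsub>A\<^esub> a k \<oplus>\<^bsub>A\<^esub> c \<odot>\<^bsub>A\<^esub> (ext g' w \<odot>\<^bsub>A\<^esub> a k))"
      using g ext_cl a_closed by (intro ext) (simp add: U_def A.smult_l_distr A.smult_assoc1)
    moreover have "(\<lambda>w. ext g w \<odot>\<^bsub>A\<^esub> a k \<oplus>\<^bsub>A\<^esub> c \<odot>\<^bsub>A\<^esub> (ext g' w \<odot>\<^bsub>A\<^esub> a k)) \<in> gen_rows"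
      using g by (intro gen_rows_add gen_rows_smult) (simp_all add: U_def)
    ultimately show "(\<lambda>i. g i \<oplus> c \<otimes> g' i) \<in> U" using cl g(3) by (simp add: U_def FnI)
  qed
  have "\<exists>g\<in>U. \<forall>t\<in>SL m. g t = (if t = s then \<one> else \<zero>)"
  proof (rule separating_imp_all[OF finite_SL U])
    fix h assume h: "\<And>s. h s \<in> carrier R" and ann: "\<And>g. g \<in> U \<Longrightarrow> (\<Oplus>t\<in>SL m. h t \<otimes> g t) = \<zero>"
    show "\<forall>t\<in>SL m. h t = \<zero>"
    proof (rule ccontr)
      assume "\<not> ?thesis"
      then have "\<exists>t\<in>SL m. h t \<noteq> \<zero>" by blast
      from separation[OF FnI[OF h] this] obtain N where
        N: "\<forall>g M. functional_on S f g \<longrightarrow> (\<forall>w. g w \<noteq> \<zero> \<longrightarrow> length w = M) \<longrightarrow> (\<exists>w. g w \<noteq> \<zero>) \<longrightarrow> N \<le> M \<longrightarrow>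
          (\<exists>u. (\<Oplus>s\<in>SL m. h s \<otimes> g (u @ s)) \<noteq> \<zero>)" ..
      obtain j where j: "N < j" "a j = a k" using a_infinite[of k] unfolding infinite_nat_iff_unbounded by blast
      have "shl [] (\<theta> j) = \<theta> j" by (simp add: shl_def fun_eq_iff)
      then have "functional_on S f (\<theta> j)" using \<theta>_functional'[of "[]" j] by simp
      moreover have "\<forall>w. \<theta> j w \<noteq> \<zero> \<longrightarrow> length w = d j" using \<theta>_zero by blast
      moreover have "\<exists>w. \<theta> j w \<noteq> \<zero>" using nonorth[of j] unfolding \<theta>_def by blast
      moreover have "N \<le> d j" using j(1) d_ge[of j] by simp
      ultimately obtain u where u: "(\<Oplus>s\<in>SL m. h s \<otimes> \<theta> j (u @ s)) \<noteq> \<zero>" using N by blast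
      have "\<exists>t\<in>SL m. \<theta> j (u @ t) \<noteq> \<zero>"
      proof (rule ccontr)
        assume "\<not> ?thesis"
        then have "(\<Oplus>s\<in>SL m. h s \<otimes> \<theta> j (u @ s)) = \<zero>" using h by (intro R_finsum_0I) simp
        then show False using u by simp
      qed
      then obtain t where "t \<in> SL m" "\<theta> j (u @ t) \<noteq> \<zero>" by blast
      then have len: "length u + m = d j" using \<theta>_zero[of "u @ t" j] by auto
      have "ext (shl u (\<theta> j)) w = \<theta> j (u @ w)" for w
      proof (cases "length w = m")
        case True
        have "shl u (\<theta> j) w = (\<Oplus>s\<in>SL (length w). shl u (\<theta> j) s \<otimes> f s w)"
          using \<theta>_functional'[of u j] unfolding functional_on_def by blast
        then show ?thesis unfolding ext_def True by (simp add: shl_def)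
      next
        case False
        have "ext (shl u (\<theta> j)) w = \<zero>" unfolding ext_def
        proof (rule R_finsum_0I)
          fix t assume "t \<in> SL m"
          then have "f t w = \<zero>" using False by (intro f_zero) auto
          then show "shl u (\<theta> j) t \<otimes> f t w = \<zero>" by (simp add: shl_def)
        qed
        moreover have "\<theta> j (u @ w) = \<zero>" using len False by (intro \<theta>_zero) simp
        ultimately show ?thesis by simp
      qed
      moreover have "shl u (\<lambda>w. \<theta> j w \<odot>\<^bsub>A\<^esub> a j) \<in> gen_rows" using \<theta>_a by (intro gen_rows_shl_all) blast
      moreover have "shl u (\<lambda>w. \<theta> j w \<odot>\<^bsub>A\<^esub> a j) = (\<lambda>w. \<theta> j (u @ w) \<odot>\<^bsub>A\<^esub> a j)" by (simp add: shl_def fun_eq_iff)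
      ultimately have "(\<lambda>w. ext (shl u (\<theta> j)) w \<odot>\<^bsub>A\<^esub> a k) \<in> gen_rows" using j(2) by simp
      then have "shl u (\<theta> j) \<in> U" using FnD[OF \<theta>_Fn] by (simp add: U_def FnI shl_def[of _ "\<theta> j", abs_def])
      from ann[OF this] show False using u by (simp add: shl_def)
    qed
  qed simp
  then obtain g where g: "g \<in> U" "\<And>t. t \<in> SL m \<Longrightarrow> g t = (if t = s then \<one> else \<zero>)" by blast
  have "ext g w = f s w" for w
  proof -
    have "ext g w = g s \<otimes> f s w" unfolding ext_def
    proof (rule R_finsum_only[OF finite_SL])
      show "s \<in> SL m" using s by (simp add: m_def)
    qed (use g in \<open>simp_all add: U_def\<close>)
    then show ?thesis using g(2)[of s] s by (simp add: m_def)
  qed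
  then show ?thesis using g(1) by (simp add: U_def)
qed

lemma gen_rows_f: assumes s: "s \<in> S" and x: "x \<in> carrier A" shows "(\<lambda>w. f s w \<odot>\<^bsub>A\<^esub> x) \<in> gen_rows"
proof -
  let ?H = "{x \<in> carrier A. (\<lambda>w. f s w \<odot>\<^bsub>A\<^esub> x) \<in> gen_rows}"
  have "submodule ?H R A"
  proof (rule A.submoduleI')
    show "\<zero>\<^bsub>A\<^esub> \<in> ?H" using gen_rows_zero by simp
    show "x \<oplus>\<^bsub>A\<^esub> y \<in> ?H" if "x \<in> ?H" "y \<in> ?H" for x y
      using that gen_rows_add[of "\<lambda>w. f s w \<odot>\<^bsub>A\<^esub> x" "\<lambda>w. f s w \<odot>\<^bsub>A\<^esub> y"] by (simp add: A.smult_r_distr)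
    show "c \<odot>\<^bsub>A\<^esub> x \<in> ?H" if c: "c \<in> carrier R" and x: "x \<in> ?H" for c x
    proof -
      have "f s w \<odot>\<^bsub>A\<^esub> (c \<odot>\<^bsub>A\<^esub> x) = c \<odot>\<^bsub>A\<^esub> (f s w \<odot>\<^bsub>A\<^esub> x)" for w
        using c x by (simp add: A.smult_assoc1[symmetric] m_comm)
      then show ?thesis using c x gen_rows_smult[of c "\<lambda>w. f s w \<odot>\<^bsub>A\<^esub> x"] by simp
    qed
  qed auto
  then have "lin_span R A (range a) \<subseteq> ?H" using gen_rows_f_a[OF s] a_closed by (intro lin_span_least) auto
  then show ?thesis using x a_span by auto
qed

lemma f_afun: "s \<in> S \<Longrightarrow> x \<in> carrier A \<Longrightarrow> afun (\<lambda>w. f s w \<odot>\<^bsub>A\<^esub> x)" by (rule gen_rowsD(1)[OF gen_rows_f])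

text \<open>
  For \<open>w \<in> S\<close> this is the matrix over \<open>A\<close> whose only nonzero entry is \<open>x\<close>, at position \<open>(w, s)\<close>.
\<close>
definition elementary where "elementary w s x = word_op w \<otimes>\<^bsub>E\<^esub> row (\<lambda>v. f s v \<odot>\<^bsub>A\<^esub> x)"

lemma elementary_E: "x \<in> carrier A \<Longrightarrow> elementary w s x \<in> carrier E" by (simp add: elementary_def E.mult_closed)

lemma X_word_op_row:
  assumes "afun \<eta>" shows "X \<otimes>\<^bsub>E\<^esub> (word_op w \<otimes>\<^bsub>E\<^esub> row \<eta>) = word_op (True # w) \<otimes>\<^bsub>E\<^esub> row \<eta>"
  using afunD(1)[OF assms] by (simp add: X_def E.mult_assoc[symmetric] word_op_word_op)

lemma Z_word_op_row:
  assumes "afun \<eta>"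
  shows "Z \<otimes>\<^bsub>E\<^esub> (word_op w \<otimes>\<^bsub>E\<^esub> row \<eta>) = word_op (False # w) \<otimes>\<^bsub>E\<^esub> row \<eta> \<oplus>\<^bsub>E\<^esub> row (\<lambda>v. \<Gamma> w \<otimes>\<^bsub>A\<^esub> \<eta> v)"
proof -
  have "Z \<otimes>\<^bsub>E\<^esub> (word_op w \<otimes>\<^bsub>E\<^esub> row \<eta>) = word_op [False] \<otimes>\<^bsub>E\<^esub> (word_op w \<otimes>\<^bsub>E\<^esub> row \<eta>) \<oplus>\<^bsub>E\<^esub> row \<Gamma> \<otimes>\<^bsub>E\<^esub> (word_op w \<otimes>\<^bsub>E\<^esub> row \<eta>)"
    unfolding Z_def using afunD(1)[OF assms] by (intro E.mult_l_distr) (simp_all add: E.mult_closed)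
  then show ?thesis using afunD(1)[OF assms]
    by (simp add: E.mult_assoc[symmetric] word_op_word_op) (simp add: E.mult_assoc row_word_op_row[OF \<Gamma>_afun assms])
qed

lemma elementary_lmult: "s \<in> S \<Longrightarrow> x \<in> carrier A \<Longrightarrow> (\<lambda>v. \<Gamma> w \<otimes>\<^bsub>A\<^esub> (f s v \<odot>\<^bsub>A\<^esub> x)) = (\<lambda>v. f s v \<odot>\<^bsub>A\<^esub> (\<Gamma> w \<otimes>\<^bsub>A\<^esub> x))"
  by (simp add: mult_smult_right)

lemma X_elementary: "s \<in> S \<Longrightarrow> x \<in> carrier A \<Longrightarrow> X \<otimes>\<^bsub>E\<^esub> elementary w s x = elementary (True # w) s x"
  unfolding elementary_def by (rule X_word_op_row[OF f_afun])

lemma Z_elementary: "s \<in> S \<Longrightarrow> x \<in> carrier A \<Longrightarrow> Z \<otimes>\<^bsub>E\<^esub> elementary w s x = elementary (False # w) s x \<oplus>\<^bsub>E\<^esub> elementary [] s (\<Gamma> w \<otimes>\<^bsub>A\<^esub> x)"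
  unfolding elementary_def by (simp add: Z_word_op_row[OF f_afun] elementary_lmult word_op_Nil mult_closed)

lemma elementary_B0: assumes "s \<in> S" "x \<in> carrier A" shows "elementary w s x \<in> B0"
  using assms(2)
proof (induction w arbitrary: x)
  case Nil
  then show ?case using gen_rowsD(2)[OF gen_rows_f[OF assms(1) Nil]] by (simp add: elementary_def word_op_Nil)
next
  case (Cons c w)
  have *: "elementary [] s y \<in> B0" if "y \<in> carrier A" for y
    using gen_rowsD(2)[OF gen_rows_f[OF assms(1) that]] that by (simp add: elementary_def word_op_Nil)
  show ?case
  proof (cases c)
    case True
    then show ?thesis using X_elementary[OF assms(1) Cons.prems, of w] B0_mult[OF XZ_B0(1) Cons.IH[OF Cons.prems]] by simp
  next
    case False
    let ?y = "elementary [] s (\<Gamma> w \<otimes>\<^bsub>A\<^esub> x)"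
    have y: "?y \<in> B0" using Cons.prems by (intro *) (simp add: mult_closed)
    have "elementary (False # w) s x = (elementary (False # w) s x \<oplus>\<^bsub>E\<^esub> ?y) \<oplus>\<^bsub>E\<^esub> (\<ominus> \<one>) \<odot>\<^bsub>E\<^esub> ?y"
      using elementary_E[OF Cons.prems, of "False # w" s] subsetD[OF B0D(1) y]
      by (simp add: E.A.smult_l_minus E.A.M.a_assoc E.A.M.r_neg)
    also have "\<dots> \<in> B0"
      using B0_mult[OF XZ_B0(2) Cons.IH[OF Cons.prems]] y
      unfolding Z_elementary[OF assms(1) Cons.prems] by (rule_tac B0D(3)) (auto intro: B0D(4))
    finally show ?thesis using False by simp
  qed
qed

lemma elementary_tens:
  assumes "s \<in> S" "x \<in> carrier A" "v \<in> carrier V"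
  shows "elementary w s x (tens t v) = tens w (f s t \<odot>\<^bsub>V\<^esub> act x v)"
  using assms by (simp add: elementary_def E_simps row_tens[OF f_afun] act_smult_left act_closed)

end

section \<open>Operators as matrices over the given algebra\<close>

context row_extension begin

interpretation W: Module.module R W by (rule W_module)
interpretation E: assoc_algebra R E
  unfolding E_def by (rule end_assoc_algebra[OF field_axioms W_module])

lemma E_apply_W [simp]: "T \<in> carrier E \<Longrightarrow> g \<in> carrier W \<Longrightarrow> T g \<in> carrier W"
  unfolding E_carrier by (rule lin_endD(1))

lemma E_apply_V [simp]: "T \<in> carrier E \<Longrightarrow> g \<in> carrier W \<Longrightarrow> T g t \<in> carrier V"
  using WD(1)[OF E_apply_W] .

lemma E_finsum_apply:
  assumes "finite I" "\<And>i. i \<in> I \<Longrightarrow> T i \<in> carrier E" "g \<in> carrier W"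
  shows "(\<Oplus>\<^bsub>E\<^esub>i\<in>I. T i) g t = (\<Oplus>\<^bsub>V\<^esub>i\<in>I. T i g t)"
  using assms
proof (induction I)
  case empty
  then show ?case by (simp add: E_simps)
next
  case (insert i I)
  have "T \<in> I \<rightarrow> carrier E" "T i \<in> carrier E" "(\<lambda>i. T i g t) \<in> I \<rightarrow> carrier V" "T i g t \<in> carrier V" using insert.prems by auto
  then show ?case using insert by (simp add: E_simps)
qed

text \<open>
  \<open>\<alpha>\<close> is the matrix of \<open>T\<close> over \<open>A\<close> with respect to the basis \<open>S\<close>: the first index gives the row.
\<close>
definition rep :: "((bool list \<Rightarrow> 'd) \<Rightarrow> bool list \<Rightarrow> 'd) \<Rightarrow> (bool list \<Rightarrow> bool list \<Rightarrow> 'b) \<Rightarrow> bool" where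
  "rep T \<alpha> \<longleftrightarrow> T \<in> carrier E \<and> (\<forall>t s. \<alpha> t s \<in> carrier A) \<and>
     (\<forall>s\<in>S. \<forall>v\<in>carrier V. \<forall>t. T (tens s v) t = act (\<alpha> t s) v)"

lemma repD:
  assumes "rep T \<alpha>"
  shows "T \<in> carrier E" "\<alpha> t s \<in> carrier A" "s \<in> S \<Longrightarrow> v \<in> carrier V \<Longrightarrow> T (tens s v) t = act (\<alpha> t s) v"
  using assms by (simp_all add: rep_def)

lemma repI:
  assumes "T \<in> carrier E" "\<And>t s. \<alpha> t s \<in> carrier A"
    "\<And>s v t. s \<in> S \<Longrightarrow> v \<in> carrier V \<Longrightarrow> T (tens s v) t = act (\<alpha> t s) v"
  shows "rep T \<alpha>"
  using assms by (simp add: rep_def)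

lemma rep_eq:
  assumes "rep T \<alpha>" "rep T' \<alpha>'" "\<And>t s. s \<in> S \<Longrightarrow> \<alpha> t s = \<alpha>' t s" shows "T = T'"
proof (rule op_eqI[OF repD(1)[OF assms(1)] repD(1)[OF assms(2)]])
  fix s v assume "s \<in> S" "v \<in> carrier V"
  then show "T (tens s v) = T' (tens s v)"
    using repD(3)[OF assms(1)] repD(3)[OF assms(2)] assms(3) by (intro ext) simp
qed

text \<open>
  Faithfulness of \<open>V\<close> is what makes matrix entries unique.
\<close>
lemma faithful_eqI:
  assumes x: "x \<in> carrier A" "y \<in> carrier A" and eq: "\<And>v. v \<in> carrier V \<Longrightarrow> act x v = act y v"
  shows "x = y"
proof -
  let ?z = "(\<ominus> \<one>) \<odot>\<^bsub>A\<^esub> y"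
  have z: "?z \<in> carrier A" using x by simp
  have "\<forall>v\<in>carrier V. act (x \<oplus>\<^bsub>A\<^esub> ?z) v = \<zero>\<^bsub>V\<^esub>"
    using x z eq by (simp add: act_add_left act_smult_left act_closed V.smult_l_minus V.M.r_neg)
  then have "x \<oplus>\<^bsub>A\<^esub> ?z = \<zero>\<^bsub>A\<^esub>" using faithful x z unfolding faithful_action_def by simp
  then have "x \<oplus>\<^bsub>A\<^esub> (\<ominus>\<^bsub>A\<^esub> y) = \<zero>\<^bsub>A\<^esub>" using x by (simp add: A.smult_l_minus)
  then show ?thesis using x by (metis A.M.a_inv_closed A.M.minus_equality A.M.minus_minus)
qed

lemma rep_unique:
  assumes "rep T \<alpha>" "rep T \<alpha>'" "s \<in> S" shows "\<alpha> t s = \<alpha>' t s"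
proof (rule faithful_eqI)
  fix v assume "v \<in> carrier V"
  then show "act (\<alpha> t s) v = act (\<alpha>' t s) v" using repD(3)[OF assms(1,3)] repD(3)[OF assms(2,3)] by metis
qed (rule repD(2)[OF assms(1)], rule repD(2)[OF assms(2)])

lemma rep_zero: "rep \<zero>\<^bsub>E\<^esub> (\<lambda>_ _. \<zero>\<^bsub>A\<^esub>)"
  by (rule repI) (simp_all add: E_simps act_zero_left)

lemma rep_add:
  assumes "rep T \<alpha>" "rep T' \<alpha>'" shows "rep (T \<oplus>\<^bsub>E\<^esub> T') (\<lambda>t s. \<alpha> t s \<oplus>\<^bsub>A\<^esub> \<alpha>' t s)"
  using repD[OF assms(1)] repD[OF assms(2)] by (intro repI) (simp_all add: E_simps act_add_left)

lemma rep_smult: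
  assumes "c \<in> carrier R" "rep T \<alpha>" shows "rep (c \<odot>\<^bsub>E\<^esub> T) (\<lambda>t s. c \<odot>\<^bsub>A\<^esub> \<alpha> t s)"
  using repD[OF assms(2)] assms(1) by (intro repI) (simp_all add: E_simps act_smult_left)

lemma rep_finsum:
  assumes "finite I" "\<And>i. i \<in> I \<Longrightarrow> rep (T i) (\<alpha> i)"
  shows "rep (\<Oplus>\<^bsub>E\<^esub>i\<in>I. T i) (\<lambda>t s. \<Oplus>\<^bsub>A\<^esub>i\<in>I. \<alpha> i t s)"
  using assms
proof (induction I)
  case empty
  then show ?case using rep_zero by simp
next
  case (insert i I)
  note r = insert.prems[OF insertI1]
  have "T \<in> I \<rightarrow> carrier E" using repD(1)[OF insert.prems] by blast
  then have 1: "(\<Oplus>\<^bsub>E\<^esub>i\<in>insert i I. T i) = T i \<oplus>\<^bsub>E\<^esub> (\<Oplus>\<^bsub>E\<^esub>i\<in>I. T i)"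
    using insert.hyps repD(1)[OF r] by (intro E.A.M.finsum_insert) auto
  have 2: "(\<Oplus>\<^bsub>A\<^esub>i\<in>insert i I. \<alpha> i t s) = \<alpha> i t s \<oplus>\<^bsub>A\<^esub> (\<Oplus>\<^bsub>A\<^esub>i\<in>I. \<alpha> i t s)" for t s
    using insert.hyps repD(2)[OF insert.prems] by (intro A.M.finsum_insert) auto
  show ?case unfolding 1 2 by (rule rep_add[OF r insert.IH]) (rule insert.prems, simp)
qed

lemma rep_word_op_row:
  assumes "afun \<eta>" shows "rep (word_op w \<otimes>\<^bsub>E\<^esub> row \<eta>) (\<lambda>t s. f t w \<odot>\<^bsub>A\<^esub> \<eta> s)"
proof (rule repI)
  note cl = afunD(1)[OF assms]
  show "word_op w \<otimes>\<^bsub>E\<^esub> row \<eta> \<in> carrier E" using cl by (simp add: E.mult_closed)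
  show "f t w \<odot>\<^bsub>A\<^esub> \<eta> s \<in> carrier A" for t s using cl by simp
  fix s v t assume "v \<in> carrier V"
  then show "(word_op w \<otimes>\<^bsub>E\<^esub> row \<eta>) (tens s v) t = act (f t w \<odot>\<^bsub>A\<^esub> \<eta> s) v"
    using cl by (simp add: E_simps row_tens[OF assms] act_closed act_smult_left) (simp add: tens_def)
qed

lemma rep_elementary:
  assumes "s \<in> S" "x \<in> carrier A" shows "rep (elementary w s x) (\<lambda>t r. f t w \<odot>\<^bsub>A\<^esub> (f s r \<odot>\<^bsub>A\<^esub> x))"
  unfolding elementary_def by (rule rep_word_op_row[OF f_afun[OF assms]])

lemma rep_apply:
  assumes "rep T \<alpha>" "finite K" "g \<in> carrier W" "\<And>r. g r \<noteq> \<zero>\<^bsub>V\<^esub> \<Longrightarrow> r \<in> K" "K \<subseteq> S"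
  shows "T g t = (\<Oplus>\<^bsub>V\<^esub>r\<in>K. act (\<alpha> t r) (g r))"
  using assms(2-)
proof (induction K arbitrary: g)
  case empty
  then have "g = \<zero>\<^bsub>W\<^esub>" by (intro ext) auto
  moreover have "T \<zero>\<^bsub>W\<^esub> = \<zero>\<^bsub>W\<^esub>"
    using lin_end_zero[OF W_module] repD(1)[OF assms(1)] by (simp add: E_carrier)
  ultimately show ?case by simp
next
  case (insert s K)
  note gW = WD[OF insert.prems(1)]
  let ?g = "g(s := \<zero>\<^bsub>V\<^esub>)"
  have s: "s \<in> S" using insert.prems(3) by simp
  have "{w. ?g w \<noteq> \<zero>\<^bsub>V\<^esub>} \<subseteq> {w. g w \<noteq> \<zero>\<^bsub>V\<^esub>}" by auto
  then have fin: "finite {w. ?g w \<noteq> \<zero>\<^bsub>V\<^esub>}" using gW(3) finite_subset by blast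
  have g': "?g \<in> carrier W" using gW(1,2) by (intro WI fin) (auto split: if_splits)
  have "T ?g t = (\<Oplus>\<^bsub>V\<^esub>r\<in>K. act (\<alpha> t r) (?g r))"
  proof (rule insert.IH[OF g'])
    show "r \<in> K" if "?g r \<noteq> \<zero>\<^bsub>V\<^esub>" for r
      using that insert.prems(2)[of r] by (cases "r = s") simp_all
  qed (use insert.prems(3) in simp)
  also have "\<dots> = (\<Oplus>\<^bsub>V\<^esub>r\<in>K. act (\<alpha> t r) (g r))"
    using insert.hyps(2) gW(1) repD(2)[OF assms(1)] by (intro V.M.finsum_cong') (auto simp: act_closed)
  finally have IH: "T ?g t = (\<Oplus>\<^bsub>V\<^esub>r\<in>K. act (\<alpha> t r) (g r))" .
  have "g = tens s (g s) \<oplus>\<^bsub>W\<^esub> ?g" using gW(1) s by (intro ext) (simp add: tens_basis)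
  then have "T g = T (tens s (g s)) \<oplus>\<^bsub>W\<^esub> T ?g"
    using lin_endD(2)[of T R W "tens s (g s)" ?g] repD(1)[OF assms(1)] g' gW(1) by (simp add: E_carrier)
  then have "T g t = act (\<alpha> t s) (g s) \<oplus>\<^bsub>V\<^esub> (\<Oplus>\<^bsub>V\<^esub>r\<in>K. act (\<alpha> t r) (g r))"
    using IH repD(3)[OF assms(1) s gW(1)] by simp
  also have "\<dots> = (\<Oplus>\<^bsub>V\<^esub>r\<in>insert s K. act (\<alpha> t r) (g r))"
    using insert.hyps gW(1) repD(2)[OF assms(1)] by (intro V.M.finsum_insert[symmetric]) (auto simp: act_closed)
  finally show ?case .
qed

text \<open>
  The product formula for matrices; \<open>K\<close> contains the indices of the rows of the second factor that are not zero.
\<close>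
lemma rep_mult:
  assumes T: "rep T \<alpha>" and T': "rep T' \<alpha>'" and K: "finite K" "K \<subseteq> S"
    "\<And>r s. s \<in> S \<Longrightarrow> \<alpha>' r s \<noteq> \<zero>\<^bsub>A\<^esub> \<Longrightarrow> r \<in> K"
  shows "rep (T \<otimes>\<^bsub>E\<^esub> T') (\<lambda>t s. \<Oplus>\<^bsub>A\<^esub>r\<in>K. \<alpha> t r \<otimes>\<^bsub>A\<^esub> \<alpha>' r s)"
proof (rule repI)
  note D = repD[OF T] and D' = repD[OF T']
  show "T \<otimes>\<^bsub>E\<^esub> T' \<in> carrier E" using D(1) D'(1) by (rule E.mult_closed)
  show "(\<Oplus>\<^bsub>A\<^esub>r\<in>K. \<alpha> t r \<otimes>\<^bsub>A\<^esub> \<alpha>' r s) \<in> carrier A" for t s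
    using D(2) D'(2) by (intro A.M.finsum_closed) (auto simp: mult_closed)
  fix s v t assume s: "s \<in> S" and v: "v \<in> carrier V"
  have "(T \<otimes>\<^bsub>E\<^esub> T') (tens s v) t = T (T' (tens s v)) t" using v by (simp add: E_simps)
  also have "\<dots> = (\<Oplus>\<^bsub>V\<^esub>r\<in>K. act (\<alpha> t r) (T' (tens s v) r))"
  proof (rule rep_apply[OF T K(1) _ _ K(2)])
    show "T' (tens s v) \<in> carrier W" using D'(1) v by simp
    fix r assume "T' (tens s v) r \<noteq> \<zero>\<^bsub>V\<^esub>"
    then have "\<alpha>' r s \<noteq> \<zero>\<^bsub>A\<^esub>" using D'(3)[OF s v] v by (auto simp: act_zero_left)
    then show "r \<in> K" by (rule K(3)[OF s])
  qed
  also have "\<dots> = (\<Oplus>\<^bsub>V\<^esub>r\<in>K. act (\<alpha> t r \<otimes>\<^bsub>A\<^esub> \<alpha>' r s) v)"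
    using D(2) D'(2,3) s v by (intro V.M.finsum_cong') (auto simp: act_mult act_closed)
  also have "\<dots> = act (\<Oplus>\<^bsub>A\<^esub>r\<in>K. \<alpha> t r \<otimes>\<^bsub>A\<^esub> \<alpha>' r s) v"
    using D(2) D'(2) v K(1) by (intro act_finsum[symmetric]) (auto simp: mult_closed)
  finally show "(T \<otimes>\<^bsub>E\<^esub> T') (tens s v) t = act (\<Oplus>\<^bsub>A\<^esub>r\<in>K. \<alpha> t r \<otimes>\<^bsub>A\<^esub> \<alpha>' r s) v" .
qed

end

section \<open>Matrix algebras\<close>

lemma matrix_algebra_carrier:
  "M \<in> carrier (matrix_algebra Y A) \<longleftrightarrow> (\<forall>i j. M i j \<in> carrier A) \<and>
     (\<forall>i j. M i j \<noteq> \<zero>\<^bsub>A\<^esub> \<longrightarrow> i \<in> Y \<and> j \<in> Y) \<and> finite {(i, j). M i j \<noteq> \<zero>\<^bsub>A\<^esub>}"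
  by (simp add: matrix_algebra_def)

lemma matrix_algebra_simps [simp]:
  "(M \<oplus>\<^bsub>matrix_algebra Y A\<^esub> N) i j = M i j \<oplus>\<^bsub>A\<^esub> N i j"
  "(c \<odot>\<^bsub>matrix_algebra Y A\<^esub> M) i j = c \<odot>\<^bsub>A\<^esub> M i j"
  "\<zero>\<^bsub>matrix_algebra Y A\<^esub> = (\<lambda>i j. \<zero>\<^bsub>A\<^esub>)"
  "(M \<otimes>\<^bsub>matrix_algebra Y A\<^esub> N) i j = (\<Oplus>\<^bsub>A\<^esub>k\<in>{k \<in> Y. M i k \<noteq> \<zero>\<^bsub>A\<^esub>}. M i k \<otimes>\<^bsub>A\<^esub> N k j)"
  by (simp_all add: matrix_algebra_def)

lemma matrix_algebra_memI:
  assumes "\<And>i j. M i j \<in> carrier A" "\<And>i j. M i j \<noteq> \<zero>\<^bsub>A\<^esub> \<Longrightarrow> (i, j) \<in> P" "finite P" "P \<subseteq> Y \<times> Y"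
  shows "M \<in> carrier (matrix_algebra Y A)"
proof -
  have "finite {(i, j). M i j \<noteq> \<zero>\<^bsub>A\<^esub>}" using assms(2,3) by (elim finite_subset[rotated]) auto
  then show ?thesis unfolding matrix_algebra_carrier using assms by blast
qed

definition msupp where "msupp A M = {(i, j). M i j \<noteq> \<zero>\<^bsub>A\<^esub>}"

lemma matrix_algebraD:
  assumes "M \<in> carrier (matrix_algebra Y A)"
  shows "M i j \<in> carrier A" "finite (msupp A M)" "msupp A M \<subseteq> Y \<times> Y" "M i j \<noteq> \<zero>\<^bsub>A\<^esub> \<Longrightarrow> (i, j) \<in> msupp A M"
  using assms unfolding matrix_algebra_carrier by (auto simp: msupp_def)

context assoc_algebra begin

lemma matrix_algebra_add:
  assumes M: "M \<in> carrier (matrix_algebra Y A)" and N: "N \<in> carrier (matrix_algebra Y A)"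
  shows "M \<oplus>\<^bsub>matrix_algebra Y A\<^esub> N \<in> carrier (matrix_algebra Y A)"
  using matrix_algebraD[OF M] matrix_algebraD[OF N]
  by (intro matrix_algebra_memI[where P = "msupp A M \<union> msupp A N"]) (auto simp: msupp_def)

lemma matrix_algebra_smult:
  assumes c: "c \<in> carrier F" and M: "M \<in> carrier (matrix_algebra Y A)"
  shows "c \<odot>\<^bsub>matrix_algebra Y A\<^esub> M \<in> carrier (matrix_algebra Y A)"
  using matrix_algebraD[OF M] c
  by (intro matrix_algebra_memI[where P = "msupp A M"]) (auto simp: msupp_def)

lemma matrix_algebra_mult:
  assumes M: "M \<in> carrier (matrix_algebra Y A)" and N: "N \<in> carrier (matrix_algebra Y A)"
  shows "M \<otimes>\<^bsub>matrix_algebra Y A\<^esub> N \<in> carrier (matrix_algebra Y A)"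
proof (rule matrix_algebra_memI[where P = "fst ` msupp A M \<times> snd ` msupp A N"])
  note D = matrix_algebraD[OF M] matrix_algebraD[OF N]
  show "(M \<otimes>\<^bsub>matrix_algebra Y A\<^esub> N) i j \<in> carrier A" for i j
    unfolding matrix_algebra_simps using D(1,5) by (intro A.M.finsum_closed) (auto simp: mult_closed)
  show "(i, j) \<in> fst ` msupp A M \<times> snd ` msupp A N" if nz: "(M \<otimes>\<^bsub>matrix_algebra Y A\<^esub> N) i j \<noteq> \<zero>\<^bsub>A\<^esub>" for i j
  proof (rule ccontr)
    assume neg: "\<not> ?thesis"
    have "M i k \<otimes>\<^bsub>A\<^esub> N k j = \<zero>\<^bsub>A\<^esub>" for k
    proof (cases "M i k = \<zero>\<^bsub>A\<^esub>")
      case True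
      then show ?thesis using D(5) by (simp add: zero_mult)
    next
      case False
      then have "i \<in> fst ` msupp A M" using D(4) by force
      then have "N k j = \<zero>\<^bsub>A\<^esub>" using neg D(8)[of k j] by force
      then show ?thesis using D(1) by (simp add: mult_zero)
    qed
    then have "(M \<otimes>\<^bsub>matrix_algebra Y A\<^esub> N) i j = \<zero>\<^bsub>A\<^esub>"
      unfolding matrix_algebra_simps by (rule A.M.finsum_0I)
    then show False using nz by simp
  qed
qed (use matrix_algebraD(2,3)[OF M] matrix_algebraD(2,3)[OF N] in auto)

lemma matrix_algebra_module: "Module.module F (matrix_algebra Y A)"
proof -
  have zero: "\<zero>\<^bsub>matrix_algebra Y A\<^esub> \<in> carrier (matrix_algebra Y A)"
    by (rule matrix_algebra_memI[where P = "{}"]) simp_all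
  note cl = matrix_algebraD(1)
  have "abelian_group (matrix_algebra Y A)"
  proof (rule abelian_groupI)
    show "\<exists>N\<in>carrier (matrix_algebra Y A). N \<oplus>\<^bsub>matrix_algebra Y A\<^esub> M = \<zero>\<^bsub>matrix_algebra Y A\<^esub>"
      if M: "M \<in> carrier (matrix_algebra Y A)" for M
    proof (rule bexI)
      show "(\<ominus>\<^bsub>F\<^esub> \<one>\<^bsub>F\<^esub>) \<odot>\<^bsub>matrix_algebra Y A\<^esub> M \<in> carrier (matrix_algebra Y A)"
        using M by (intro matrix_algebra_smult) simp_all
      show "(\<ominus>\<^bsub>F\<^esub> \<one>\<^bsub>F\<^esub>) \<odot>\<^bsub>matrix_algebra Y A\<^esub> M \<oplus>\<^bsub>matrix_algebra Y A\<^esub> M = \<zero>\<^bsub>matrix_algebra Y A\<^esub>"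
        using cl[OF M] by (intro ext) (simp add: A.smult_l_minus A.M.l_neg)
    qed
  qed (use zero matrix_algebra_add in \<open>auto simp: fun_eq_iff cl A.M.a_ac\<close>)
  then show ?thesis
    by (intro moduleI matrix_algebra_smult F.is_cring)
      (auto simp: fun_eq_iff cl A.smult_l_distr A.smult_r_distr A.smult_assoc1)
qed

end

context row_extension begin

interpretation W: Module.module R W by (rule W_module)
interpretation E: assoc_algebra R E
  unfolding E_def by (rule end_assoc_algebra[OF field_axioms W_module])

text \<open>
  The operator of a finite matrix whose index \<open>i\<close> is placed at the basis word \<open>\<tau> i\<close>. It is used for two index sets: a set
  in bijection with all of \<open>S\<close>, and \<open>{..<N}\<close> in bijection with the basis words up to a given length.
\<close>
definition mop :: "('i \<Rightarrow> bool list) \<Rightarrow> ('i \<Rightarrow> 'i \<Rightarrow> 'b) \<Rightarrow> (bool list \<Rightarrow> 'd) \<Rightarrow> bool list \<Rightarrow> 'd" where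
  "mop \<tau> M = (\<Oplus>\<^bsub>E\<^esub>p\<in>msupp A M. elementary (\<tau> (fst p)) (\<tau> (snd p)) (M (fst p) (snd p)))"

text \<open>
  The matrix over words to which \<open>M\<close> is relabelled by \<open>\<tau>\<close>.
\<close>
definition mat :: "'i set \<Rightarrow> ('i \<Rightarrow> bool list) \<Rightarrow> ('i \<Rightarrow> 'i \<Rightarrow> 'b) \<Rightarrow> bool list \<Rightarrow> bool list \<Rightarrow> 'b" where
  "mat Y \<tau> M t s = (if t \<in> \<tau> ` Y \<and> s \<in> \<tau> ` Y then M (inv_into Y \<tau> t) (inv_into Y \<tau> s) else \<zero>\<^bsub>A\<^esub>)"

context
  fixes Y :: "'i set" and \<tau> :: "'i \<Rightarrow> bool list"
  assumes inj: "inj_on \<tau> Y" and \<tau>S: "\<tau> ` Y \<subseteq> S"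
begin

lemma mat_at: "i \<in> Y \<Longrightarrow> k \<in> Y \<Longrightarrow> mat Y \<tau> M (\<tau> i) (\<tau> k) = M i k"
  using inj by (simp add: mat_def)

lemma mat_other: "t \<notin> \<tau> ` Y \<or> s \<notin> \<tau> ` Y \<Longrightarrow> mat Y \<tau> M t s = \<zero>\<^bsub>A\<^esub>"
  by (auto simp: mat_def)

lemma rep_mop:
  assumes M: "M \<in> carrier (matrix_algebra Y A)" shows "rep (mop \<tau> M) (mat Y \<tau> M)"
proof (rule repI)
  note D = matrix_algebraD[OF M]
  let ?u = "\<lambda>p. elementary (\<tau> (fst p)) (\<tau> (snd p)) (M (fst p) (snd p))"
  let ?\<alpha> = "\<lambda>p t s. f t (\<tau> (fst p)) \<odot>\<^bsub>A\<^esub> (f (\<tau> (snd p)) s \<odot>\<^bsub>A\<^esub> M (fst p) (snd p))"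
  have inS: "\<tau> (fst p) \<in> S" "\<tau> (snd p) \<in> S" "fst p \<in> Y" "snd p \<in> Y" if "p \<in> msupp A M" for p
    using subsetD[OF D(3) that] \<tau>S by (auto simp: mem_Times_iff)
  have r: "rep (mop \<tau> M) (\<lambda>t s. \<Oplus>\<^bsub>A\<^esub>p\<in>msupp A M. ?\<alpha> p t s)"
    unfolding mop_def by (rule rep_finsum[OF D(2)]) (rule rep_elementary[OF inS(2) D(1)])
  show "mop \<tau> M \<in> carrier E" by (rule repD(1)[OF r])
  show "mat Y \<tau> M t s \<in> carrier A" for t s using D(1) by (simp add: mat_def)
  fix s v t assume s: "s \<in> S" and v: "v \<in> carrier V"
  have "(\<Oplus>\<^bsub>A\<^esub>p\<in>msupp A M. ?\<alpha> p t s) = mat Y \<tau> M t s"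
  proof (cases "t \<in> \<tau> ` Y \<and> s \<in> \<tau> ` Y \<and> mat Y \<tau> M t s \<noteq> \<zero>\<^bsub>A\<^esub>")
    case True
    then obtain i k where ik: "i \<in> Y" "k \<in> Y" "t = \<tau> i" "s = \<tau> k" by blast
    have nz: "M i k \<noteq> \<zero>\<^bsub>A\<^esub>" using True ik by (simp add: mat_at)
    have "(\<Oplus>\<^bsub>A\<^esub>p\<in>msupp A M. ?\<alpha> p t s) = ?\<alpha> (i, k) t s"
    proof (rule A.M.finsum_only[OF D(2) D(4)[OF nz]])
      fix p assume p: "p \<in> msupp A M" "p \<noteq> (i, k)"
      then have "\<tau> (fst p) \<noteq> t \<or> \<tau> (snd p) \<noteq> s"
        using inj_onD[OF inj _ inS(3)[OF p(1)] ik(1)] inj_onD[OF inj _ inS(4)[OF p(1)] ik(2)] ik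
        by (metis prod.collapse)
      then show "?\<alpha> p t s = \<zero>\<^bsub>A\<^esub>"
        using f_dual[OF inS(1)[OF p(1)], of t] f_dual[OF s inS(2)[OF p(1)]] ik \<tau>S D(1) by auto
    qed (use D(1) in simp)
    also have "\<dots> = mat Y \<tau> M t s"
      using ik D(1) f_dual[of t t] f_dual[OF s s] s \<tau>S by (simp add: mat_at image_subset_iff)
    finally show ?thesis .
  next
    case False
    have "(\<Oplus>\<^bsub>A\<^esub>p\<in>msupp A M. ?\<alpha> p t s) = \<zero>\<^bsub>A\<^esub>"
    proof (rule A.M.finsum_0I)
      fix p assume p: "p \<in> msupp A M"
      show "?\<alpha> p t s = \<zero>\<^bsub>A\<^esub>"
      proof (cases "t = \<tau> (fst p) \<and> s = \<tau> (snd p)")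
        case True
        then have "M (fst p) (snd p) = \<zero>\<^bsub>A\<^esub>" using False inS(3,4)[OF p] by (auto simp: mat_at)
        then show ?thesis by simp
      next
        case neq: False
        show ?thesis
        proof (cases "t \<in> S")
          case True
          then show ?thesis using neq f_dual[OF inS(1)[OF p], of t] f_dual[OF s inS(2)[OF p]] D(1) by auto
        next
          case False
          then have "f t (\<tau> (fst p)) = \<zero>" by (intro f_zero) simp
          then show ?thesis using D(1) by simp
        qed
      qed
    qed
    moreover have "mat Y \<tau> M t s = \<zero>\<^bsub>A\<^esub>" using False mat_other by blast
    ultimately show ?thesis by simp
  qed
  then show "mop \<tau> M (tens s v) t = act (mat Y \<tau> M t s) v" using repD(3)[OF r s v] by simp
qed

lemma mop_E: "M \<in> carrier (matrix_algebra Y A) \<Longrightarrow> mop \<tau> M \<in> carrier E"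
  by (rule repD(1)[OF rep_mop])

lemma mop_eqI:
  assumes T: "rep T \<alpha>" and M: "M \<in> carrier (matrix_algebra Y A)"
    and at: "\<And>i k. i \<in> Y \<Longrightarrow> k \<in> Y \<Longrightarrow> \<alpha> (\<tau> i) (\<tau> k) = M i k"
    and other: "\<And>t s. s \<in> S \<Longrightarrow> t \<notin> \<tau> ` Y \<or> s \<notin> \<tau> ` Y \<Longrightarrow> \<alpha> t s = \<zero>\<^bsub>A\<^esub>"
  shows "T = mop \<tau> M"
proof (rule rep_eq[OF T rep_mop[OF M]])
  fix t s assume s: "s \<in> S"
  show "\<alpha> t s = mat Y \<tau> M t s"
  proof (cases "t \<in> \<tau> ` Y \<and> s \<in> \<tau> ` Y")
    case True
    then show ?thesis using at by (auto simp: mat_at)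
  next
    case False
    then show ?thesis using other[OF s, of t] mat_other[of t s M] by auto
  qed
qed

lemma mop_zero: "mop \<tau> \<zero>\<^bsub>matrix_algebra Y A\<^esub> = \<zero>\<^bsub>E\<^esub>"
  by (simp add: mop_def msupp_def)

lemma mop_add:
  assumes "M \<in> carrier (matrix_algebra Y A)" "N \<in> carrier (matrix_algebra Y A)"
  shows "mop \<tau> (M \<oplus>\<^bsub>matrix_algebra Y A\<^esub> N) = mop \<tau> M \<oplus>\<^bsub>E\<^esub> mop \<tau> N"
proof (rule mop_eqI[OF rep_add[OF rep_mop[OF assms(1)] rep_mop[OF assms(2)]] matrix_algebra_add[OF assms], symmetric])
qed (use mat_at mat_other in simp_all)

lemma mop_smult:
  assumes "c \<in> carrier R" "M \<in> carrier (matrix_algebra Y A)"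
  shows "mop \<tau> (c \<odot>\<^bsub>matrix_algebra Y A\<^esub> M) = c \<odot>\<^bsub>E\<^esub> mop \<tau> M"
proof (rule mop_eqI[OF rep_smult[OF assms(1) rep_mop[OF assms(2)]] matrix_algebra_smult[OF assms], symmetric])
qed (use mat_at mat_other assms(1) in simp_all)

lemma mop_mult:
  assumes M: "M \<in> carrier (matrix_algebra Y A)" and N: "N \<in> carrier (matrix_algebra Y A)"
  shows "mop \<tau> (M \<otimes>\<^bsub>matrix_algebra Y A\<^esub> N) = mop \<tau> M \<otimes>\<^bsub>E\<^esub> mop \<tau> N"
proof -
  note D = matrix_algebraD[OF M] and D' = matrix_algebraD[OF N]
  let ?J = "fst ` msupp A N"
  let ?K = "\<tau> ` ?J"
  have J: "finite ?J" "?J \<subseteq> Y" using D'(2,3) by auto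
  have r: "rep (mop \<tau> M \<otimes>\<^bsub>E\<^esub> mop \<tau> N) (\<lambda>t s. \<Oplus>\<^bsub>A\<^esub>r\<in>?K. mat Y \<tau> M t r \<otimes>\<^bsub>A\<^esub> mat Y \<tau> N r s)"
  proof (rule rep_mult[OF rep_mop[OF M] rep_mop[OF N]])
    show "r \<in> ?K" if nz: "mat Y \<tau> N r s \<noteq> \<zero>\<^bsub>A\<^esub>" for r s
    proof -
      from nz mat_other have "r \<in> \<tau> ` Y \<and> s \<in> \<tau> ` Y" by blast
      then obtain i k where ik: "i \<in> Y" "k \<in> Y" "r = \<tau> i" "s = \<tau> k" by blast
      then have "(i, k) \<in> msupp A N" using nz by (intro D'(4)) (simp add: mat_at)
      then show ?thesis using ik by force
    qed
  qed (use J \<tau>S in auto)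
  show ?thesis
  proof (rule mop_eqI[OF r matrix_algebra_mult[OF M N], symmetric])
    fix i k assume ik: "i \<in> Y" "k \<in> Y"
    have "(\<Oplus>\<^bsub>A\<^esub>r\<in>?K. mat Y \<tau> M (\<tau> i) r \<otimes>\<^bsub>A\<^esub> mat Y \<tau> N r (\<tau> k)) =
        (\<Oplus>\<^bsub>A\<^esub>j\<in>?J. mat Y \<tau> M (\<tau> i) (\<tau> j) \<otimes>\<^bsub>A\<^esub> mat Y \<tau> N (\<tau> j) (\<tau> k))"
      using inj_on_subset[OF inj J(2)] D(1) D'(1)
      by (intro A.M.finsum_reindex) (auto intro!: mult_closed simp: mat_def)
    also have "\<dots> = (\<Oplus>\<^bsub>A\<^esub>j\<in>?J. M i j \<otimes>\<^bsub>A\<^esub> N j k)"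
      using J(2) ik D(1) D'(1) by (intro A.M.finsum_cong') (auto intro!: mult_closed simp: mat_at subset_iff)
    also have "\<dots> = (\<Oplus>\<^bsub>A\<^esub>j\<in>?J \<union> {j \<in> Y. M i j \<noteq> \<zero>\<^bsub>A\<^esub>}. M i j \<otimes>\<^bsub>A\<^esub> N j k)" (is "_ = finsum A _ ?U")
    proof (rule A.M.finsum_superset[symmetric])
      have "{j \<in> Y. M i j \<noteq> \<zero>\<^bsub>A\<^esub>} \<subseteq> snd ` msupp A M" using D(4) by force
      then show "finite ?U" using J(1) D(2) finite_subset by blast
      show "M i j \<otimes>\<^bsub>A\<^esub> N j k = \<zero>\<^bsub>A\<^esub>" if "j \<in> ?U - ?J" for j
      proof -
        have "N j k = \<zero>\<^bsub>A\<^esub>" using that D'(4)[of j k] by force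
        then show ?thesis using D(1) by (simp add: mult_zero)
      qed
    qed (use D(1) D'(1) in \<open>auto intro: mult_closed\<close>)
    also have "\<dots> = (\<Oplus>\<^bsub>A\<^esub>j\<in>{j \<in> Y. M i j \<noteq> \<zero>\<^bsub>A\<^esub>}. M i j \<otimes>\<^bsub>A\<^esub> N j k)"
    proof (rule A.M.finsum_superset)
      have "{j \<in> Y. M i j \<noteq> \<zero>\<^bsub>A\<^esub>} \<subseteq> snd ` msupp A M" using D(4) by force
      then show "finite ?U" using J(1) D(2) finite_subset by blast
      show "M i j \<otimes>\<^bsub>A\<^esub> N j k = \<zero>\<^bsub>A\<^esub>" if "j \<in> ?U - {j \<in> Y. M i j \<noteq> \<zero>\<^bsub>A\<^esub>}" for j
      proof -
        have "M i j = \<zero>\<^bsub>A\<^esub>" using that J(2) by blast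
        then show ?thesis using D'(1) by (simp add: zero_mult)
      qed
    qed (use D(1) D'(1) in \<open>auto intro: mult_closed\<close>)
    finally show "(\<Oplus>\<^bsub>A\<^esub>r\<in>?K. mat Y \<tau> M (\<tau> i) r \<otimes>\<^bsub>A\<^esub> mat Y \<tau> N r (\<tau> k)) = (M \<otimes>\<^bsub>matrix_algebra Y A\<^esub> N) i k"
      by simp
  next
    fix t s assume ts: "t \<notin> \<tau> ` Y \<or> s \<notin> \<tau> ` Y"
    have cl: "mat Y \<tau> M t r \<in> carrier A" "mat Y \<tau> N r s \<in> carrier A" for r
      using D(1) D'(1) by (simp_all add: mat_def)
    show "(\<Oplus>\<^bsub>A\<^esub>r\<in>?K. mat Y \<tau> M t r \<otimes>\<^bsub>A\<^esub> mat Y \<tau> N r s) = \<zero>\<^bsub>A\<^esub>"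
    proof (rule A.M.finsum_0I)
      fix r
      show "mat Y \<tau> M t r \<otimes>\<^bsub>A\<^esub> mat Y \<tau> N r s = \<zero>\<^bsub>A\<^esub>"
        using ts mat_other[of t r M] mat_other[of r s N] cl by (auto simp: zero_mult mult_zero)
    qed
  qed
qed

lemma mop_inj: "inj_on (mop \<tau>) (carrier (matrix_algebra Y A))"
proof (rule inj_onI)
  fix M N assume M: "M \<in> carrier (matrix_algebra Y A)" and N: "N \<in> carrier (matrix_algebra Y A)"
    and eq: "mop \<tau> M = mop \<tau> N"
  have r: "rep (mop \<tau> M) (mat Y \<tau> N)" unfolding eq by (rule rep_mop[OF N])
  show "M = N"
  proof (intro ext)
    fix i k
    show "M i k = N i k"
    proof (cases "i \<in> Y \<and> k \<in> Y")
      case True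
      then have "\<tau> k \<in> S" using \<tau>S by blast
      from rep_unique[OF rep_mop[OF M] r this, of "\<tau> i"] show ?thesis using True by (simp add: mat_at)
    next
      case False
      then have "M i k = \<zero>\<^bsub>A\<^esub>" "N i k = \<zero>\<^bsub>A\<^esub>"
        using matrix_algebraD(3,4)[OF M] matrix_algebraD(3,4)[OF N] by blast+
      then show ?thesis by simp
    qed
  qed
qed

end

end

section \<open>The generated algebra\<close>

context row_extension begin

interpretation W: Module.module R W by (rule W_module)
interpretation E: assoc_algebra R E
  unfolding E_def by (rule end_assoc_algebra[OF field_axioms W_module])

definition B where "B = E\<lparr>carrier := B0\<rparr>"

lemma XZ_E: "X \<in> carrier E" "Z \<in> carrier E" using subsetD[OF B0D(1) XZ_B0(1)] subsetD[OF B0D(1) XZ_B0(2)] .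

lemma B_simps [simp]: "carrier B = B0" "x \<otimes>\<^bsub>B\<^esub> y = x \<otimes>\<^bsub>E\<^esub> y" "x \<oplus>\<^bsub>B\<^esub> y = x \<oplus>\<^bsub>E\<^esub> y" "c \<odot>\<^bsub>B\<^esub> x = c \<odot>\<^bsub>E\<^esub> x" "\<zero>\<^bsub>B\<^esub> = \<zero>\<^bsub>E\<^esub>"
  by (simp_all add: B_def)

lemma B_assoc_algebra: "assoc_algebra R B"
  unfolding B_def by (rule E.subalgebra_assoc_algebra[OF B0_subalgebra])

lemma B_two_generated: "two_generated R B"
  unfolding B_def B0_def by (rule E.two_generated_subalgebra[OF XZ_E])

section \<open>The matrices form a left ideal\<close>

lemma mop_hom:
  assumes "inj_on \<tau> Y" "\<tau> ` Y \<subseteq> S" shows "mop \<tau> \<in> alg_hom R (matrix_algebra Y A) E"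
  by (rule alg_homI) (rule mop_E[OF assms] mop_add[OF assms] mop_mult[OF assms] mop_smult[OF assms], assumption+)+

lemma mop_mem:
  assumes M: "M \<in> carrier (matrix_algebra Y A)" and \<tau>: "\<tau> ` Y \<subseteq> S" and H: "submodule H R E"
    and u: "\<And>w s x. s \<in> S \<Longrightarrow> x \<in> carrier A \<Longrightarrow> elementary w s x \<in> H"
  shows "mop \<tau> M \<in> H"
  unfolding mop_def
proof (rule E.A.submodule_finsum[OF H matrix_algebraD(2)[OF M]])
  fix p assume "p \<in> msupp A M"
  then have "snd p \<in> Y" using matrix_algebraD(3)[OF M] by auto
  then show "elementary (\<tau> (fst p)) (\<tau> (snd p)) (M (fst p) (snd p)) \<in> H"
    using \<tau> matrix_algebraD(1)[OF M] by (intro u) auto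
qed

context
  fixes Y :: "'i set" and \<tau> :: "'i \<Rightarrow> bool list"
  assumes bij: "bij_betw \<tau> Y S"
begin

lemma \<tau>: "inj_on \<tau> Y" "\<tau> ` Y = S" "\<tau> ` Y \<subseteq> S" using bij by (auto simp: bij_betw_def)

definition I where "I = mop \<tau> ` carrier (matrix_algebra Y A)"

lemma I_submodule: "submodule I R E"
proof (rule E.A.submoduleI')
  interpret Y: Module.module R "matrix_algebra Y A" by (rule matrix_algebra_module)
  note h = alg_homD[OF mop_hom[OF \<tau>(1,3)]]
  show "I \<subseteq> carrier E" using h(1) by (auto simp: I_def)
  show "\<zero>\<^bsub>E\<^esub> \<in> I" unfolding I_def using Y.M.zero_closed
    by (rule image_eqI[where f = "mop \<tau>", OF mop_zero[OF \<tau>(1,3), symmetric]])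
  show "x \<oplus>\<^bsub>E\<^esub> y \<in> I" if "x \<in> I" "y \<in> I" for x y
    using that Y.M.a_closed unfolding I_def by (auto simp: h(2)[symmetric] simp del: matrix_algebra_simps)
  show "c \<odot>\<^bsub>E\<^esub> x \<in> I" if "c \<in> carrier R" "x \<in> I" for c x
    using that Y.smult_closed unfolding I_def by (auto simp: h(4)[symmetric] simp del: matrix_algebra_simps)
qed

text \<open>
  For \<open>u \<notin> S\<close> the word \<open>u\<close> is a combination of basis words, so the operator is a finite combination of elementary
  matrices.
\<close>
lemma elementary_I: assumes s: "s \<in> S" and x: "x \<in> carrier A" shows "elementary u s x \<in> I"
proof -
  define M where "M i k = (if i \<in> Y \<and> k \<in> Y \<and> \<tau> k = s then f (\<tau> i) u \<odot>\<^bsub>A\<^esub> x else \<zero>\<^bsub>A\<^esub>)" for i k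
  have "finite (\<tau> -` SL (length u) \<inter> Y)" "finite (\<tau> -` {s} \<inter> Y)"
    by (rule finite_vimage_IntI[OF _ \<tau>(1)], simp)+
  then have M: "M \<in> carrier (matrix_algebra Y A)"
  proof (intro matrix_algebra_memI)
    fix i k assume nz: "M i k \<noteq> \<zero>\<^bsub>A\<^esub>"
    then have ik: "i \<in> Y" "k \<in> Y" "\<tau> k = s" by (auto simp: M_def split: if_splits)
    have "\<tau> i \<in> SL (length u)"
    proof (rule ccontr)
      assume "\<not> ?thesis"
      then have "f (\<tau> i) u = \<zero>" by (intro f_zero) auto
      then show False using nz x by (simp add: M_def split: if_splits)
    qed
    then show "(i, k) \<in> (\<tau> -` SL (length u) \<inter> Y) \<times> (\<tau> -` {s} \<inter> Y)" using ik by simp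
  qed (use x in \<open>auto simp: M_def\<close>)
  have "elementary u s x = mop \<tau> M"
  proof (rule mop_eqI[OF \<tau>(1,3) rep_elementary[OF s x] M])
    fix i k assume ik: "i \<in> Y" "k \<in> Y"
    then have "\<tau> k \<in> S" using \<tau>(3) by blast
    from f_dual[OF this s] show "f (\<tau> i) u \<odot>\<^bsub>A\<^esub> (f s (\<tau> k) \<odot>\<^bsub>A\<^esub> x) = M i k"
      using ik x by (simp add: M_def)
  next
    fix t r assume "r \<in> S" "t \<notin> \<tau> ` Y \<or> r \<notin> \<tau> ` Y"
    then have "t \<notin> S" using \<tau>(2) by blast
    then have "f t u = \<zero>" by (intro f_zero) simp
    then show "f t u \<odot>\<^bsub>A\<^esub> (f s r \<odot>\<^bsub>A\<^esub> x) = \<zero>\<^bsub>A\<^esub>" using x by simp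
  qed
  then show ?thesis using M unfolding I_def by blast
qed

lemma I_B0: "I \<subseteq> B0"
proof
  fix T assume "T \<in> I"
  then obtain M where M: "M \<in> carrier (matrix_algebra Y A)" "T = mop \<tau> M" unfolding I_def by blast
  have "submodule B0 R E" using B0_subalgebra by (simp add: subalgebra_def)
  from mop_mem[OF M(1) \<tau>(3) this elementary_B0] show "T \<in> B0" unfolding M(2) .
qed

text \<open>
  Both generators map elementary operators to sums of elementary operators.
\<close>
lemma I_left_mult: assumes T: "T \<in> B0" and y: "y \<in> I" shows "T \<otimes>\<^bsub>E\<^esub> y \<in> I"
proof -
  note D = E.A.submoduleD'[OF I_submodule]
  let ?H = "{T \<in> carrier E. \<forall>y\<in>I. T \<otimes>\<^bsub>E\<^esub> y \<in> I}"
  have IE: "y \<in> carrier E" if "y \<in> I" for y using that D(1) by blast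
  \<comment> \<open>Matrices are sums of elementary operators, so these are enough.\<close>
  have gen: "T \<in> ?H" if T: "T \<in> carrier E" and u: "\<And>w s x. s \<in> S \<Longrightarrow> x \<in> carrier A \<Longrightarrow> T \<otimes>\<^bsub>E\<^esub> elementary w s x \<in> I" for T
  proof -
    have "T \<otimes>\<^bsub>E\<^esub> y \<in> I" if y: "y \<in> I" for y
    proof -
      obtain M where M: "M \<in> carrier (matrix_algebra Y A)" "y = mop \<tau> M" using y unfolding I_def by blast
      have "mop \<tau> M \<in> {y \<in> carrier E. T \<otimes>\<^bsub>E\<^esub> y \<in> I}"
        by (rule mop_mem[OF M(1) \<tau>(3) E.left_preimage_submodule[OF T I_submodule]]) (use u elementary_E in simp)
      then show ?thesis using M(2) by simp
    qed
    then show ?thesis using T by simp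
  qed
  have "subalgebra ?H R E"
    unfolding subalgebra_def
  proof (intro conjI E.A.submoduleI')
    show "\<zero>\<^bsub>E\<^esub> \<in> ?H" using D(2) IE by (simp add: E.zero_mult)
    show "T1 \<oplus>\<^bsub>E\<^esub> T2 \<in> ?H" if "T1 \<in> ?H" "T2 \<in> ?H" for T1 T2
      using that D(3) IE by (simp add: E.mult_l_distr)
    show "c \<odot>\<^bsub>E\<^esub> T1 \<in> ?H" if "c \<in> carrier R" "T1 \<in> ?H" for c T1
      using that D(4) IE by (simp add: E.mult_smult_left)
    show "\<forall>T1\<in>?H. \<forall>T2\<in>?H. T1 \<otimes>\<^bsub>E\<^esub> T2 \<in> ?H" using IE by (simp add: E.mult_assoc E.mult_closed)
  qed auto
  moreover have "X \<in> ?H"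
    by (rule gen[OF XZ_E(1)]) (simp add: X_elementary elementary_I)
  moreover have "Z \<in> ?H"
    by (rule gen[OF XZ_E(2)]) (simp add: Z_elementary elementary_I D(3) mult_closed)
  ultimately have "B0 \<subseteq> ?H" unfolding B0_def by (intro alg_generated_least) auto
  then show ?thesis using T y by blast
qed

lemma matrices_embed: "M_infinity_embeddable_as_left_ideal Y R A B"
  unfolding M_infinity_embeddable_as_left_ideal_def
proof (intro bexI conjI)
  note h = alg_homD[OF mop_hom[OF \<tau>(1,3)]]
  show "mop \<tau> \<in> alg_hom R (matrix_algebra Y A) B"
    by (rule alg_homI) (use I_B0 h(2-4) in \<open>auto simp: I_def simp del: matrix_algebra_simps\<close>)
  show "inj_on (mop \<tau>) (carrier (matrix_algebra Y A))" by (rule mop_inj[OF \<tau>(1,3)])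
  have "submodule I R B"
    unfolding B_def by (rule E.submodule_restrict[OF I_submodule B0_subalgebra I_B0])
  then show "left_ideal (mop \<tau> ` carrier (matrix_algebra Y A)) R B"
    unfolding left_ideal_def using I_left_mult by (simp add: I_def)
qed

end

section \<open>Primitivity\<close>

text \<open>
  The vectors annihilated by \<open>A\<close> form a proper submodule, so they are zero; hence \<open>A v\<close> is a nonzero submodule.
\<close>
lemma irreducible_transitive:
  assumes v: "v \<in> carrier V" "v \<noteq> \<zero>\<^bsub>V\<^esub>" shows "(\<lambda>x. act x v) ` carrier A = carrier V"
proof -
  have irr: "H = {\<zero>\<^bsub>V\<^esub>} \<or> H = carrier V" if "submodule H R V" "\<forall>x\<in>carrier A. \<forall>w\<in>H. act x w \<in> H" for H
    using irreducible that unfolding irreducible_left_module_def by blast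
  let ?N = "{v \<in> carrier V. \<forall>x\<in>carrier A. act x v = \<zero>\<^bsub>V\<^esub>}"
  have "submodule ?N R V"
  proof (rule V.submoduleI')
    show "\<zero>\<^bsub>V\<^esub> \<in> ?N" by (simp add: act_zero_right)
  qed (auto simp: act_add_right act_smult_right)
  moreover have "\<forall>x\<in>carrier A. \<forall>w\<in>?N. act x w \<in> ?N" by (auto simp: act_zero_right)
  moreover have "?N \<noteq> carrier V" using irreducible unfolding irreducible_left_module_def by blast
  ultimately have "?N = {\<zero>\<^bsub>V\<^esub>}" using irr[of ?N] by blast
  then obtain x where x: "x \<in> carrier A" "act x v \<noteq> \<zero>\<^bsub>V\<^esub>" using v by blast
  let ?H = "(\<lambda>x. act x v) ` carrier A"
  have "submodule ?H R V"
  proof (rule V.submoduleI')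
    show "\<zero>\<^bsub>V\<^esub> \<in> ?H" using act_zero_left[OF v(1)] by (metis A.M.zero_closed image_eqI)
  qed (use v in \<open>auto simp: act_closed act_add_left[symmetric] act_smult_left[symmetric]\<close>)
  moreover have "\<forall>x\<in>carrier A. \<forall>w\<in>?H. act x w \<in> ?H"
    using v by (auto simp: act_mult[symmetric] mult_closed)
  ultimately have "?H = {\<zero>\<^bsub>V\<^esub>} \<or> ?H = carrier V" by (rule irr)
  then show ?thesis using x by blast
qed

lemma elementary_apply:
  assumes s: "s \<in> S" and x: "x \<in> carrier A" and g: "g \<in> carrier W"
  shows "elementary w s x g = tens w (act x (g s))"
proof
  fix t
  let ?K = "insert s {r. g r \<noteq> \<zero>\<^bsub>V\<^esub>}"
  have K: "finite ?K" "?K \<subseteq> S" using WD(2,3)[OF g] s by auto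
  have "elementary w s x g t = (\<Oplus>\<^bsub>V\<^esub>r\<in>?K. act (f t w \<odot>\<^bsub>A\<^esub> (f s r \<odot>\<^bsub>A\<^esub> x)) (g r))"
    by (rule rep_apply[OF rep_elementary[OF s x] K(1) g _ K(2)]) simp
  also have "\<dots> = act (f t w \<odot>\<^bsub>A\<^esub> (f s s \<odot>\<^bsub>A\<^esub> x)) (g s)"
  proof (rule V.M.finsum_only[OF K(1)])
    fix r assume "r \<in> ?K" "r \<noteq> s"
    then have "f s r = \<zero>" using f_dual[OF _ s, of r] K(2) by auto
    then show "act (f t w \<odot>\<^bsub>A\<^esub> (f s r \<odot>\<^bsub>A\<^esub> x)) (g r) = \<zero>\<^bsub>V\<^esub>"
      using x WD(1)[OF g] by (simp add: act_zero_left)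
  qed (use x WD(1)[OF g] in \<open>simp_all add: act_closed\<close>)
  also have "\<dots> = tens w (act x (g s)) t"
    using x WD(1)[OF g] f_dual[OF s s] by (simp add: act_smult_left tens_def)
  finally show "elementary w s x g t = tens w (act x (g s)) t" .
qed

text \<open>
  From an element with a nonzero coordinate \<open>g s\<close>, elementary operators produce \<open>w \<otimes> act x (g s)\<close> for all \<open>w\<close> and
  \<open>x\<close>. By irreducibility of \<open>V\<close> this gives all \<open>w \<otimes> v\<close>.
\<close>
lemma B_irreducible: "irreducible_left_module R B W (\<lambda>T. T)"
  unfolding irreducible_left_module_def
proof (intro conjI allI impI)
  have BE: "T \<in> carrier E" if "T \<in> B0" for T using that B0D(1) by blast
  note L = lin_endD[OF BE[unfolded E_carrier]]
  show "left_module R B W (\<lambda>T. T)"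
    by (intro left_module.intro left_module_axioms.intro B_assoc_algebra W_module)
      (simp_all add: E_simps BE L(2,3) del: W_simps)
  obtain x v where xv: "x \<in> carrier A" "v \<in> carrier V" "act x v \<noteq> \<zero>\<^bsub>V\<^esub>"
    using irreducible unfolding irreducible_left_module_def by blast
  have "elementary [] [] x (tens [] v) [] = act x v"
    using xv Nil_in_S f_dual[OF Nil_in_S Nil_in_S]
    by (simp add: elementary_tens act_closed) (simp add: tens_def act_closed)
  then have "elementary [] [] x (tens [] v) \<noteq> \<zero>\<^bsub>W\<^esub>" using xv(3) by auto
  then show "\<exists>T\<in>carrier B. \<exists>g\<in>carrier W. T g \<noteq> \<zero>\<^bsub>W\<^esub>"
    using elementary_B0[OF Nil_in_S xv(1)] tens_W[OF xv(2)] unfolding B_simps by blast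
  fix H assume "submodule H R W \<and> (\<forall>T\<in>carrier B. \<forall>g\<in>H. T g \<in> H)"
  then have H: "submodule H R W" and inv: "\<And>T g. T \<in> B0 \<Longrightarrow> g \<in> H \<Longrightarrow> T g \<in> H" by auto
  note D = W.submoduleD'[OF H]
  show "H = {\<zero>\<^bsub>W\<^esub>} \<or> H = carrier W"
  proof (cases "H = {\<zero>\<^bsub>W\<^esub>}")
    case False
    then obtain g where g: "g \<in> H" "g \<noteq> \<zero>\<^bsub>W\<^esub>" using D(2) by blast
    have gW: "g \<in> carrier W" using g D(1) by blast
    obtain s where s: "g s \<noteq> \<zero>\<^bsub>V\<^esub>" using g(2) by (auto simp: fun_eq_iff)
    have sS: "s \<in> S" by (rule WD(2)[OF gW s])
    have "tens w v \<in> H" if "v \<in> carrier V" for w v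
    proof -
      have "v \<in> (\<lambda>x. act x (g s)) ` carrier A"
        using that by (simp only: irreducible_transitive[OF WD(1)[OF gW] s])
      then obtain x where x: "x \<in> carrier A" "v = act x (g s)" by (elim imageE) simp
      show ?thesis using inv[OF elementary_B0[OF sS x(1)] g(1), of w] unfolding elementary_apply[OF sS x(1) gW] x(2) .
    qed
    then have "carrier W \<subseteq> H" by (intro W_induct H)
    then show ?thesis using D(1) by blast
  qed simp
qed

lemma B_faithful: "faithful_action B W (\<lambda>T. T)"
  unfolding faithful_action_def
proof (intro ballI impI)
  fix T assume T: "T \<in> carrier B" and z: "\<forall>g\<in>carrier W. T g = \<zero>\<^bsub>W\<^esub>"
  have "T = \<zero>\<^bsub>E\<^esub>"
  proof (rule op_eqI)
    show "T \<in> carrier E" using T B0D(1) by auto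
    show "T (tens s v) = \<zero>\<^bsub>E\<^esub> (tens s v)" if "v \<in> carrier V" for s v
      using z that by (simp add: E_simps del: W_simps)
  qed simp
  then show "T = \<zero>\<^bsub>B\<^esub>" by simp
qed

end

section \<open>Algebraicity\<close>

context row_extension begin

interpretation W: Module.module R W by (rule W_module)
interpretation E: assoc_algebra R E
  unfolding E_def by (rule end_assoc_algebra[OF field_axioms W_module])

text \<open>
  The generated algebra lies in the sum of the two parts. The word part acts through \<open>M\<close> and is therefore nil, and the
  row part absorbs products with both parts.
\<close>
definition row_part where "row_part = lin_span R E {word_op w \<otimes>\<^bsub>E\<^esub> row \<eta> |w \<eta>. afun \<eta>}"
definition word_part where "word_part = lin_span R E {word_op u |u. u \<noteq> []}"

lemma row_gen_E: "{word_op w \<otimes>\<^bsub>E\<^esub> row \<eta> |w \<eta>. afun \<eta>} \<subseteq> carrier E"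
  using afunD(1) by (auto intro!: E.mult_closed)

lemma word_gen_E: "{word_op u |u. u \<noteq> []} \<subseteq> carrier E" by auto

lemma row_part_submodule: "submodule row_part R E"
  unfolding row_part_def by (rule E.A.lin_span_submodule[OF row_gen_E])

lemma word_part_submodule: "submodule word_part R E"
  unfolding word_part_def by (rule E.A.lin_span_submodule[OF word_gen_E])

lemmas row_partD = E.A.submoduleD'[OF row_part_submodule]
  and word_partD = E.A.submoduleD'[OF word_part_submodule]

lemma row_partI: "afun \<eta> \<Longrightarrow> word_op w \<otimes>\<^bsub>E\<^esub> row \<eta> \<in> row_part"
  unfolding row_part_def by (rule subsetD[OF lin_span_superset]) blast

lemma word_partI: "u \<noteq> [] \<Longrightarrow> word_op u \<in> word_part"
  unfolding word_part_def by (rule subsetD[OF lin_span_superset]) blast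

lemma row_row_part:
  assumes "x \<in> row_part" "y \<in> row_part" shows "x \<otimes>\<^bsub>E\<^esub> y \<in> row_part"
proof (rule E.span_mult_closed[OF row_gen_E row_gen_E row_part_submodule _ assms[unfolded row_part_def]])
  fix x y assume "x \<in> {word_op w \<otimes>\<^bsub>E\<^esub> row \<eta> |w \<eta>. afun \<eta>}" "y \<in> {word_op w \<otimes>\<^bsub>E\<^esub> row \<eta> |w \<eta>. afun \<eta>}"
  then obtain w \<eta> w' \<eta>' where *: "x = word_op w \<otimes>\<^bsub>E\<^esub> row \<eta>" "afun \<eta>" "y = word_op w' \<otimes>\<^bsub>E\<^esub> row \<eta>'" "afun \<eta>'" by blast
  note cl = afunD(1)[OF *(2)] afunD(1)[OF *(4)]
  have "x \<otimes>\<^bsub>E\<^esub> y = word_op w \<otimes>\<^bsub>E\<^esub> row (\<lambda>v. \<eta> w' \<otimes>\<^bsub>A\<^esub> \<eta>' v)"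
    unfolding *(1,3) using cl by (subst E.mult_assoc) (simp_all add: E.mult_closed row_word_op_row[OF *(2,4)])
  then show "x \<otimes>\<^bsub>E\<^esub> y \<in> row_part" using row_partI[OF afun_lmult[OF cl(1) *(4)]] by simp
qed

lemma word_row_part:
  assumes "x \<in> word_part" "y \<in> row_part" shows "x \<otimes>\<^bsub>E\<^esub> y \<in> row_part"
proof (rule E.span_mult_closed[OF word_gen_E row_gen_E row_part_submodule _ assms[unfolded row_part_def word_part_def]])
  fix x y assume "x \<in> {word_op u |u. u \<noteq> []}" "y \<in> {word_op w \<otimes>\<^bsub>E\<^esub> row \<eta> |w \<eta>. afun \<eta>}"
  then obtain u w \<eta> where *: "x = word_op u" "y = word_op w \<otimes>\<^bsub>E\<^esub> row \<eta>" "afun \<eta>" by blast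
  have "x \<otimes>\<^bsub>E\<^esub> y = word_op (u @ w) \<otimes>\<^bsub>E\<^esub> row \<eta>"
    unfolding *(1,2) using afunD(1)[OF *(3)] by (simp add: E.mult_assoc[symmetric] word_op_word_op)
  then show "x \<otimes>\<^bsub>E\<^esub> y \<in> row_part" using row_partI[OF *(3)] by simp
qed

lemma row_word_part:
  assumes "x \<in> row_part" "y \<in> word_part" shows "x \<otimes>\<^bsub>E\<^esub> y \<in> row_part"
proof (rule E.span_mult_closed[OF row_gen_E word_gen_E row_part_submodule _ assms[unfolded row_part_def word_part_def]])
  fix x y assume "y \<in> {word_op u |u. u \<noteq> []}" "x \<in> {word_op w \<otimes>\<^bsub>E\<^esub> row \<eta> |w \<eta>. afun \<eta>}"
  then obtain u w \<eta> where *: "y = word_op u" "x = word_op w \<otimes>\<^bsub>E\<^esub> row \<eta>" "afun \<eta>" by blast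
  have "x \<otimes>\<^bsub>E\<^esub> y = word_op w \<otimes>\<^bsub>E\<^esub> row (shl u \<eta>)"
    unfolding *(1,2) using afunD(1)[OF *(3)] by (simp add: E.mult_assoc row_word_op[OF *(3)])
  then show "x \<otimes>\<^bsub>E\<^esub> y \<in> row_part" using row_partI[OF afun_shl[OF *(3)]] by simp
qed

lemma word_word_part:
  assumes "x \<in> word_part" "y \<in> word_part" shows "x \<otimes>\<^bsub>E\<^esub> y \<in> word_part"
proof (rule E.span_mult_closed[OF word_gen_E word_gen_E word_part_submodule _ assms[unfolded word_part_def]])
  fix x y assume "x \<in> {word_op u |u. u \<noteq> []}" "y \<in> {word_op u |u. u \<noteq> []}"
  then show "x \<otimes>\<^bsub>E\<^esub> y \<in> word_part" by (auto simp: word_op_word_op intro!: word_partI)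
qed

lemma sum_mult:
  assumes "x \<in> word_part" "l \<in> row_part" "x' \<in> word_part" "l' \<in> row_part"
  shows "\<exists>l''\<in>row_part. (x \<oplus>\<^bsub>E\<^esub> l) \<otimes>\<^bsub>E\<^esub> (x' \<oplus>\<^bsub>E\<^esub> l') = x \<otimes>\<^bsub>E\<^esub> x' \<oplus>\<^bsub>E\<^esub> l''"
proof (rule bexI)
  have cl: "x \<in> carrier E" "l \<in> carrier E" "x' \<in> carrier E" "l' \<in> carrier E"
    using assms word_partD(1) row_partD(1) by auto
  show "x \<otimes>\<^bsub>E\<^esub> l' \<oplus>\<^bsub>E\<^esub> (l \<otimes>\<^bsub>E\<^esub> x' \<oplus>\<^bsub>E\<^esub> l \<otimes>\<^bsub>E\<^esub> l') \<in> row_part"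
    by (intro row_partD(3) word_row_part row_word_part row_row_part assms)
  have "(x \<oplus>\<^bsub>E\<^esub> l) \<otimes>\<^bsub>E\<^esub> (x' \<oplus>\<^bsub>E\<^esub> l') = (x \<otimes>\<^bsub>E\<^esub> x' \<oplus>\<^bsub>E\<^esub> x \<otimes>\<^bsub>E\<^esub> l') \<oplus>\<^bsub>E\<^esub> (l \<otimes>\<^bsub>E\<^esub> x' \<oplus>\<^bsub>E\<^esub> l \<otimes>\<^bsub>E\<^esub> l')"
    using cl by (subst E.mult_l_distr) (simp_all add: E.mult_r_distr)
  then show "(x \<oplus>\<^bsub>E\<^esub> l) \<otimes>\<^bsub>E\<^esub> (x' \<oplus>\<^bsub>E\<^esub> l') = x \<otimes>\<^bsub>E\<^esub> x' \<oplus>\<^bsub>E\<^esub> (x \<otimes>\<^bsub>E\<^esub> l' \<oplus>\<^bsub>E\<^esub> (l \<otimes>\<^bsub>E\<^esub> x' \<oplus>\<^bsub>E\<^esub> l \<otimes>\<^bsub>E\<^esub> l'))"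
    using cl by (simp add: E.A.M.a_assoc E.mult_closed)
qed

lemma B0_decomposition:
  assumes "T \<in> B0" shows "\<exists>x\<in>word_part. \<exists>l\<in>row_part. T = x \<oplus>\<^bsub>E\<^esub> l"
proof -
  let ?P = "{x \<oplus>\<^bsub>E\<^esub> l |x l. x \<in> word_part \<and> l \<in> row_part}"
  have cl: "x \<in> carrier E" if "x \<in> word_part \<or> x \<in> row_part" for x
    using that word_partD(1) row_partD(1) by blast
  have "subalgebra ?P R E"
    unfolding subalgebra_def
  proof (intro conjI E.A.submoduleI')
    show "?P \<subseteq> carrier E" using cl by auto
    have "\<zero>\<^bsub>E\<^esub> = \<zero>\<^bsub>E\<^esub> \<oplus>\<^bsub>E\<^esub> \<zero>\<^bsub>E\<^esub>" by simp
    then show "\<zero>\<^bsub>E\<^esub> \<in> ?P" using word_partD(2) row_partD(2) by blast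
    fix y z assume "y \<in> ?P" "z \<in> ?P"
    then obtain x l x' l' where *: "y = x \<oplus>\<^bsub>E\<^esub> l" "z = x' \<oplus>\<^bsub>E\<^esub> l'"
      "x \<in> word_part" "x' \<in> word_part" "l \<in> row_part" "l' \<in> row_part" by blast
    have "y \<oplus>\<^bsub>E\<^esub> z = (x \<oplus>\<^bsub>E\<^esub> x') \<oplus>\<^bsub>E\<^esub> (l \<oplus>\<^bsub>E\<^esub> l')"
      unfolding * using *(3-6) cl by (simp add: E.A.M.a_ac)
    then show "y \<oplus>\<^bsub>E\<^esub> z \<in> ?P" using word_partD(3)[OF *(3,4)] row_partD(3)[OF *(5,6)] by blast
  next
    fix c y assume c: "c \<in> carrier R" and "y \<in> ?P"
    then obtain x l where *: "y = x \<oplus>\<^bsub>E\<^esub> l" "x \<in> word_part" "l \<in> row_part" by blast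
    have "c \<odot>\<^bsub>E\<^esub> y = c \<odot>\<^bsub>E\<^esub> x \<oplus>\<^bsub>E\<^esub> c \<odot>\<^bsub>E\<^esub> l" unfolding * using *(2,3) cl c by (simp add: E.A.smult_r_distr)
    then show "c \<odot>\<^bsub>E\<^esub> y \<in> ?P" using word_partD(4)[OF c *(2)] row_partD(4)[OF c *(3)] by blast
  next
    show "\<forall>y\<in>?P. \<forall>z\<in>?P. y \<otimes>\<^bsub>E\<^esub> z \<in> ?P"
    proof (intro ballI)
      fix y z assume "y \<in> ?P" "z \<in> ?P"
      then obtain x l x' l' where *: "y = x \<oplus>\<^bsub>E\<^esub> l" "z = x' \<oplus>\<^bsub>E\<^esub> l'"
        "x \<in> word_part" "x' \<in> word_part" "l \<in> row_part" "l' \<in> row_part" by blast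
      show "y \<otimes>\<^bsub>E\<^esub> z \<in> ?P"
        using sum_mult[OF *(3,5,4,6)] word_word_part[OF *(3,4)] unfolding *(1,2) by blast
    qed
  qed
  moreover have "X \<in> ?P"
  proof -
    have "X = word_op [True] \<oplus>\<^bsub>E\<^esub> \<zero>\<^bsub>E\<^esub>" by (simp add: X_def)
    then show ?thesis using word_partI[of "[True]"] row_partD(2) by blast
  qed
  moreover have "Z \<in> ?P"
  proof -
    have "row \<Gamma> = word_op [] \<otimes>\<^bsub>E\<^esub> row \<Gamma>" by (simp add: word_op_Nil)
    then have "row \<Gamma> \<in> row_part" using row_partI[OF \<Gamma>_afun] by metis
    then show ?thesis using word_partI[of "[False]"] unfolding Z_def by blast
  qed
  ultimately have "B0 \<subseteq> ?P" unfolding B0_def by (intro alg_generated_least) auto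
  then show ?thesis using assms by blast
qed

lemma mpow_sum:
  assumes x: "x \<in> word_part" and l: "l \<in> row_part"
  shows "\<exists>l'\<in>row_part. mpow E (x \<oplus>\<^bsub>E\<^esub> l) m = mpow E x m \<oplus>\<^bsub>E\<^esub> l'"
proof (induction m)
  case 0
  then show ?case using l by auto
next
  case (Suc m)
  then obtain l' where l': "l' \<in> row_part" "mpow E (x \<oplus>\<^bsub>E\<^esub> l) m = mpow E x m \<oplus>\<^bsub>E\<^esub> l'" by blast
  have "mpow E x m \<in> word_part" by (induction m) (simp_all add: x word_word_part)
  from sum_mult[OF x l this l'(1)] show ?case by (simp add: l'(2))
qed

lemma word_part_combination:
  assumes "x \<in> word_part"
  shows "\<exists>D p. p \<in> Fn \<and> x = (\<Oplus>\<^bsub>E\<^esub>u\<in>short_words D. p u \<odot>\<^bsub>E\<^esub> word_op u)"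
proof -
  have "{word_op u |u. u \<noteq> []} = (\<Union>D. word_op ` short_words D)"
    by (auto simp: short_words_def)
  then have span: "x \<in> lin_span R E (\<Union>D. word_op ` short_words D)" using assms by (simp add: word_part_def)
  have "\<exists>D q. (\<forall>u. q u \<in> carrier R) \<and> x = (\<Oplus>\<^bsub>E\<^esub>u\<in>short_words D. q u \<odot>\<^bsub>E\<^esub> word_op u)"
    by (rule E.A.span_combination[OF finite_short_words _ word_op_E span]) (auto simp: short_words_def)
  then obtain D q where q: "\<forall>u. q u \<in> carrier R" "x = (\<Oplus>\<^bsub>E\<^esub>u\<in>short_words D. q u \<odot>\<^bsub>E\<^esub> word_op u)"
    by blast
  have "q \<in> Fn" using q(1) by (intro FnI) simp
  then show ?thesis using q(2) by blast
qed

text \<open>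
  The matrix coefficients of the powers of \<open>x\<close> are obtained from coordinate functionals by the repeated action of an
  element \<open>p\<close> without constant term, which is nilpotent.
\<close>
lemma word_part_nilpotent:
  assumes "x \<in> word_part" shows "\<exists>m. mpow E x m = \<zero>\<^bsub>E\<^esub>"
proof -
  obtain D p where p: "p \<in> Fn" and x: "x = (\<Oplus>\<^bsub>E\<^esub>u\<in>short_words D. p u \<odot>\<^bsub>E\<^esub> word_op u)"
    using word_part_combination[OF assms] by blast
  have xE: "x \<in> carrier E" using assms word_partD(1) by blast
  note pc = FnD[OF p]
  \<comment> \<open>Multiplying an operator by x on the right lets p act on its matrix coefficients.\<close>
  have step: "(T \<otimes>\<^bsub>E\<^esub> x) (tens w v) t = sact D p h w \<odot>\<^bsub>V\<^esub> v"
    if T: "T \<in> carrier E" and v: "v \<in> carrier V" and h: "h \<in> Fn" "\<And>w. T (tens w v) t = h w \<odot>\<^bsub>V\<^esub> v" for T h v t w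
  proof -
    have "T \<otimes>\<^bsub>E\<^esub> x = (\<Oplus>\<^bsub>E\<^esub>u\<in>short_words D. T \<otimes>\<^bsub>E\<^esub> (p u \<odot>\<^bsub>E\<^esub> word_op u))"
      unfolding x using T pc by (intro E.mult_finsum) auto
    then have "(T \<otimes>\<^bsub>E\<^esub> x) (tens w v) t = (\<Oplus>\<^bsub>V\<^esub>u\<in>short_words D. (T \<otimes>\<^bsub>E\<^esub> (p u \<odot>\<^bsub>E\<^esub> word_op u)) (tens w v) t)"
      using T pc v E_finsum_apply[of "short_words D" "\<lambda>u. T \<otimes>\<^bsub>E\<^esub> (p u \<odot>\<^bsub>E\<^esub> word_op u)" "tens w v" t]
      by (simp add: E.mult_closed)
    also have "\<dots> = (\<Oplus>\<^bsub>V\<^esub>u\<in>short_words D. (p u \<otimes> h (u @ w)) \<odot>\<^bsub>V\<^esub> v)"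
    proof (rule V.M.finsum_cong'[OF refl])
      show "(\<lambda>u. (p u \<otimes> h (u @ w)) \<odot>\<^bsub>V\<^esub> v) \<in> short_words D \<rightarrow> carrier V" using pc FnD[OF h(1)] v by simp
      show "(T \<otimes>\<^bsub>E\<^esub> (p u \<odot>\<^bsub>E\<^esub> word_op u)) (tens w v) t = (p u \<otimes> h (u @ w)) \<odot>\<^bsub>V\<^esub> v" for u
        using T pc v FnD[OF h(1)] by (simp add: E.mult_smult_right E_simps h(2) V.smult_assoc1)
    qed
    also have "\<dots> = sact D p h w \<odot>\<^bsub>V\<^esub> v"
      unfolding sact_def using pc FnD[OF h(1)] v by (intro V.finsum_smult_rdistr[symmetric]) auto
    finally show ?thesis .
  qed
  have pow: "mpow E x m (tens w v) t = (sact D p ^^ Suc m) (f t) w \<odot>\<^bsub>V\<^esub> v" if v: "v \<in> carrier V" for m w v t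
  proof -
    have F: "(sact D p ^^ m) (f t) \<in> Fn" for m
      by (induction m) (simp_all add: f_Fn p)
    have "\<forall>w. mpow E x m (tens w v) t = (sact D p ^^ Suc m) (f t) w \<odot>\<^bsub>V\<^esub> v"
    proof (induction m)
      case 0
      have "(word_op [] \<otimes>\<^bsub>E\<^esub> x) (tens w v) t = sact D p (f t) w \<odot>\<^bsub>V\<^esub> v" for w
        using v by (intro step f_Fn) (simp_all add: tens_def[of _ v])
      then show ?case using xE by (simp add: word_op_Nil)
    next
      case (Suc m)
      have "mpow E x (Suc m) = mpow E x m \<otimes>\<^bsub>E\<^esub> x" using E.mpow_mult[OF xE, of m 0] xE by simp
      moreover have "(mpow E x m \<otimes>\<^bsub>E\<^esub> x) (tens w v) t = sact D p ((sact D p ^^ Suc m) (f t)) w \<odot>\<^bsub>V\<^esub> v" for w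
        using Suc by (intro step F v E.mpow_closed xE) blast
      ultimately show ?case by simp
    qed
    then show ?thesis by blast
  qed
  have "mpow E x (nil_exponent D - 1) = \<zero>\<^bsub>E\<^esub>"
  proof (rule op_eqI)
    fix s v assume v: "v \<in> carrier V"
    have "Suc (nil_exponent D - 1) = nil_exponent D" using nil_exponent(1)[of D] by simp
    then have "mpow E x (nil_exponent D - 1) (tens s v) t = \<zero>\<^bsub>V\<^esub>" for t
      using pow[OF v, of "nil_exponent D - 1" s t] f_nil[OF p, of D t s] v by (simp del: funpow.simps)
    then show "mpow E x (nil_exponent D - 1) (tens s v) = \<zero>\<^bsub>E\<^esub> (tens s v)"
      using v by (simp add: E_simps fun_eq_iff)
  qed (use xE in simp_all)
  then show ?thesis by blast
qed

text \<open>
  This holds for the operators \<open>word_op w \<otimes> row \<eta>\<close>, whose nonzero rows are at words of the length of \<open>w\<close>, and it is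
  preserved under linear combinations.
\<close>
lemma row_part_rep:
  assumes "T \<in> row_part"
  shows "\<exists>N \<alpha>. rep T \<alpha> \<and> (\<forall>t s. length t > N \<longrightarrow> \<alpha> t s = \<zero>\<^bsub>A\<^esub>)"
proof -
  let ?H = "{T \<in> carrier E. \<exists>N \<alpha>. rep T \<alpha> \<and> (\<forall>t s. length t > N \<longrightarrow> \<alpha> t s = \<zero>\<^bsub>A\<^esub>)}"
  have "submodule ?H R E"
  proof (rule E.A.submoduleI')
    show "\<zero>\<^bsub>E\<^esub> \<in> ?H" using rep_zero by auto
    fix T T' assume "T \<in> ?H" "T' \<in> ?H"
    then obtain N \<alpha> N' \<alpha>' where *: "T \<in> carrier E" "T' \<in> carrier E" "rep T \<alpha>" "rep T' \<alpha>'"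
      "\<forall>t s. length t > N \<longrightarrow> \<alpha> t s = \<zero>\<^bsub>A\<^esub>" "\<forall>t s. length t > N' \<longrightarrow> \<alpha>' t s = \<zero>\<^bsub>A\<^esub>" by blast
    show "T \<oplus>\<^bsub>E\<^esub> T' \<in> ?H"
    proof (intro CollectI conjI exI[of _ "max N N'"] exI[of _ "\<lambda>t s. \<alpha> t s \<oplus>\<^bsub>A\<^esub> \<alpha>' t s"])
      show "rep (T \<oplus>\<^bsub>E\<^esub> T') (\<lambda>t s. \<alpha> t s \<oplus>\<^bsub>A\<^esub> \<alpha>' t s)" by (rule rep_add[OF *(3,4)])
    qed (use * in simp_all)
  next
    fix c T assume c: "c \<in> carrier R" and "T \<in> ?H"
    then obtain N \<alpha> where *: "T \<in> carrier E" "rep T \<alpha>" "\<forall>t s. length t > N \<longrightarrow> \<alpha> t s = \<zero>\<^bsub>A\<^esub>" by blast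
    show "c \<odot>\<^bsub>E\<^esub> T \<in> ?H"
    proof (intro CollectI conjI exI[of _ N] exI[of _ "\<lambda>t s. c \<odot>\<^bsub>A\<^esub> \<alpha> t s"])
      show "rep (c \<odot>\<^bsub>E\<^esub> T) (\<lambda>t s. c \<odot>\<^bsub>A\<^esub> \<alpha> t s)" by (rule rep_smult[OF c *(2)])
    qed (use * c in simp_all)
  qed auto
  moreover have "{word_op w \<otimes>\<^bsub>E\<^esub> row \<eta> |w \<eta>. afun \<eta>} \<subseteq> ?H"
  proof
    fix T assume "T \<in> {word_op w \<otimes>\<^bsub>E\<^esub> row \<eta> |w \<eta>. afun \<eta>}"
    then obtain w \<eta> where *: "T = word_op w \<otimes>\<^bsub>E\<^esub> row \<eta>" "afun \<eta>" by blast
    have r: "rep T (\<lambda>t s. f t w \<odot>\<^bsub>A\<^esub> \<eta> s)" unfolding *(1) by (rule rep_word_op_row[OF *(2)])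
    show "T \<in> ?H"
    proof (intro CollectI conjI exI[of _ "length w"] exI[of _ "\<lambda>t s. f t w \<odot>\<^bsub>A\<^esub> \<eta> s"] allI impI r repD(1)[OF r])
      fix t s :: "bool list" assume "length w < length t"
      then have "f t w = \<zero>" by (intro f_zero) simp
      then show "f t w \<odot>\<^bsub>A\<^esub> \<eta> s = \<zero>\<^bsub>A\<^esub>" using afunD(1)[OF *(2)] by simp
    qed
  qed
  ultimately have "row_part \<subseteq> ?H" unfolding row_part_def by (intro lin_span_least)
  then show ?thesis using assms by blast
qed

text \<open>
  Let \<open>K\<close> be the finite set of basis words up to the length of the nonzero rows, and let \<open>M\<close> be the finite matrix formed
  by the entries of \<open>T\<close> at rows and columns in \<open>K\<close>. As the image of \<open>T\<close> is supported in \<open>K\<close>, the operators \<open>T\<close> and \<open>M\<close> agree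
  on it, so \<open>M ^ i T = T ^ (i + 1)\<close>. A polynomial relation for \<open>M\<close>, which exists because \<open>A\<close> is stable algebraic, therefore
  yields one for \<open>T\<close>.
\<close>
lemma row_part_power_dependent:
  assumes stable: "stable_algebraic R A" and T: "T \<in> row_part" shows "power_dependent R E T"
proof -
  obtain N \<alpha> where r: "rep T \<alpha>" and \<alpha>: "\<And>t s. length t > N \<Longrightarrow> \<alpha> t s = \<zero>\<^bsub>A\<^esub>"
    using row_part_rep[OF T] by blast
  note D = repD[OF r]
  define K where "K = {t \<in> S. length t \<le> N}"
  have "K \<subseteq> (\<Union>m\<le>N. words m)" by (auto simp: K_def)
  then have K: "finite K" by (rule finite_subset) auto
  have "[] \<in> K" using Nil_in_S by (simp add: K_def)
  then have c: "card K \<ge> 1" using K by (simp add: Suc_le_eq card_gt_0_iff) blast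
  obtain \<tau> where "bij_betw \<tau> {0..<card K} K" using ex_bij_betw_nat_finite[OF K] by blast
  then have \<tau>: "inj_on \<tau> {..<card K}" "\<tau> ` {..<card K} = K" by (auto simp: bij_betw_def lessThan_atLeast0)
  have \<tau>S: "\<tau> ` {..<card K} \<subseteq> S" unfolding \<tau>(2) by (auto simp: K_def)
  let ?A = "matrix_algebra {..<card K} A"
  define M where "M i k = (if i < card K \<and> k < card K then \<alpha> (\<tau> i) (\<tau> k) else \<zero>\<^bsub>A\<^esub>)" for i k
  have M: "M \<in> carrier ?A"
    by (rule matrix_algebra_memI[where P = "{..<card K} \<times> {..<card K}"]) (auto simp: M_def D(2) split: if_splits)
  have rM: "rep (mop \<tau> M) (mat {..<card K} \<tau> M)" by (rule rep_mop[OF \<tau>(1) \<tau>S M])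
  have h: "mop \<tau> \<in> alg_hom R ?A E" by (rule mop_hom[OF \<tau>(1) \<tau>S])
  have mE: "mop \<tau> M \<in> carrier E" by (rule repD(1)[OF rM])
  have T_out: "T g t = \<zero>\<^bsub>V\<^esub>" if g: "g \<in> carrier W" and t: "t \<notin> K" for g t
  proof (cases "t \<in> S")
    case True
    then have "length t > N" using t by (simp add: K_def)
    then have "act (\<alpha> t r) (g r) = \<zero>\<^bsub>V\<^esub>" for r using \<alpha> WD(1)[OF g] by (simp add: act_zero_left)
    moreover have "T g t = (\<Oplus>\<^bsub>V\<^esub>r\<in>{r. g r \<noteq> \<zero>\<^bsub>V\<^esub>}. act (\<alpha> t r) (g r))"
      using WD[OF g] by (intro rep_apply[OF r _ g]) auto
    ultimately show ?thesis by (simp add: V.M.finsum_0I)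
  next
    case False
    then show ?thesis using WD(2)[OF E_apply_W[OF D(1) g], of t] by blast
  qed
  have "mop \<tau> M \<otimes>\<^bsub>E\<^esub> T = T \<otimes>\<^bsub>E\<^esub> T"
  proof (rule op_eqI)
    fix s v assume v: "v \<in> carrier V"
    let ?g = "T (tens s v)"
    have g: "?g \<in> carrier W" using D(1) v by simp
    have supp: "r \<in> K" if "?g r \<noteq> \<zero>\<^bsub>V\<^esub>" for r using T_out[OF tens_W[OF v], of r s] that by blast
    have KS: "K \<subseteq> S" by (auto simp: K_def)
    have "mop \<tau> M ?g t = T ?g t" for t
    proof (cases "t \<in> K")
      case True
      have "mop \<tau> M ?g t = (\<Oplus>\<^bsub>V\<^esub>r\<in>K. act (mat {..<card K} \<tau> M t r) (?g r))"
        by (rule rep_apply[OF rM K g supp KS])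
      also have "\<dots> = (\<Oplus>\<^bsub>V\<^esub>r\<in>K. act (\<alpha> t r) (?g r))"
      proof (rule V.M.finsum_cong'[OF refl])
        show "(\<lambda>r. act (\<alpha> t r) (?g r)) \<in> K \<rightarrow> carrier V" using D(2) WD(1)[OF g] by (simp add: act_closed)
        fix k assume "k \<in> K"
        then obtain i j where ij: "i < card K" "j < card K" "t = \<tau> i" "k = \<tau> j" using True \<tau>(2) by blast
        have "mat {..<card K} \<tau> M (\<tau> i) (\<tau> j) = M i j" using ij by (intro mat_at[OF \<tau>(1) \<tau>S]) simp_all
        then show "act (mat {..<card K} \<tau> M t k) (?g k) = act (\<alpha> t k) (?g k)" using ij by (simp add: M_def)
      qed
      also have "\<dots> = T ?g t" by (rule rep_apply[OF r K g supp KS, symmetric])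
      finally show ?thesis .
    next
      case False
      have "mop \<tau> M ?g t = (\<Oplus>\<^bsub>V\<^esub>r\<in>K. act (mat {..<card K} \<tau> M t r) (?g r))"
        by (rule rep_apply[OF rM K g supp KS])
      also have "\<dots> = \<zero>\<^bsub>V\<^esub>"
      proof (rule V.M.finsum_0I)
        fix k
        have "mat {..<card K} \<tau> M t k = \<zero>\<^bsub>A\<^esub>" using False \<tau>(2) by (simp add: mat_def)
        then show "act (mat {..<card K} \<tau> M t k) (?g k) = \<zero>\<^bsub>V\<^esub>" using WD(1)[OF g] by (simp add: act_zero_left)
      qed
      finally show ?thesis using T_out[OF g False] by simp
    qed
    then show "(mop \<tau> M \<otimes>\<^bsub>E\<^esub> T) (tens s v) = (T \<otimes>\<^bsub>E\<^esub> T) (tens s v)"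
      using v by (simp add: E_simps fun_eq_iff)
  qed (use mE D(1) in \<open>simp_all add: E.mult_closed\<close>)
  then have absorb: "mpow E (mop \<tau> M) i \<otimes>\<^bsub>E\<^esub> T = mpow E T (Suc i)" for i
  proof (induction i)
    case (Suc i)
    have "mpow E (mop \<tau> M) (Suc i) \<otimes>\<^bsub>E\<^esub> T = mop \<tau> M \<otimes>\<^bsub>E\<^esub> mpow E T (Suc i)"
      using Suc mE D(1) by (simp add: E.mult_assoc)
    also have "\<dots> = (mop \<tau> M \<otimes>\<^bsub>E\<^esub> T) \<otimes>\<^bsub>E\<^esub> mpow E T i" using mE D(1) by (simp add: E.mult_assoc)
    also have "\<dots> = mpow E T (Suc (Suc i))" using Suc.prems D(1) by (simp add: E.mult_assoc)
    finally show ?case .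
  qed simp
  have mod: "Module.module R ?A" by (rule matrix_algebra_module)
  have alg: "algebraic_algebra R ?A" using stable c unfolding stable_algebraic_def by blast
  have mult: "x \<in> carrier ?A \<Longrightarrow> y \<in> carrier ?A \<Longrightarrow> x \<otimes>\<^bsub>?A\<^esub> y \<in> carrier ?A" for x y
    by (rule matrix_algebra_mult)
  have "\<exists>n' q. (\<forall>i. q i \<in> carrier R) \<and> (\<exists>i<n'. q i \<noteq> \<zero>) \<and>
    (\<Oplus>\<^bsub>?A\<^esub>i\<in>{..<n'::nat}. q i \<odot>\<^bsub>?A\<^esub> mpow ?A M i) = \<zero>\<^bsub>?A\<^esub>"
    by (rule algebraic_imp_power_relation[OF field_axioms mod _ alg M]) (rule mult)
  then obtain n' q where q': "(\<forall>i. q i \<in> carrier R) \<and> (\<exists>i<n'. q i \<noteq> \<zero>) \<and>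
    (\<Oplus>\<^bsub>?A\<^esub>i\<in>{..<n'::nat}. q i \<odot>\<^bsub>?A\<^esub> mpow ?A M i) = \<zero>\<^bsub>?A\<^esub>" by (elim exE)
  note q = q'[THEN conjunct1, THEN spec] q'[THEN conjunct2, THEN conjunct1] q'[THEN conjunct2, THEN conjunct2]
  have cl: "mpow ?A M i \<in> carrier ?A" for i
    by (induction i) (simp_all add: M matrix_algebra_mult del: matrix_algebra_simps)
  have "(\<Oplus>\<^bsub>E\<^esub>i\<in>{..<n'}. q i \<odot>\<^bsub>E\<^esub> mop \<tau> (mpow ?A M i)) = mop \<tau> (\<Oplus>\<^bsub>?A\<^esub>i\<in>{..<n'}. q i \<odot>\<^bsub>?A\<^esub> mpow ?A M i)"
    using cl q(1) by (intro alg_hom_combination[OF h mod E.A.module_axioms, symmetric]) simp_all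
  also have "\<dots> = \<zero>\<^bsub>E\<^esub>" unfolding q(3) by (rule alg_hom_zero[OF h mod E.A.module_axioms])
  finally have rel: "(\<Oplus>\<^bsub>E\<^esub>i\<in>{..<n'}. q i \<odot>\<^bsub>E\<^esub> mpow E (mop \<tau> M) i) = \<zero>\<^bsub>E\<^esub>"
    by (simp only: alg_hom_mpow[OF h M mult])
  have "(\<Oplus>\<^bsub>E\<^esub>i\<in>{..<n'}. q i \<odot>\<^bsub>E\<^esub> mpow E T (Suc i)) = (\<Oplus>\<^bsub>E\<^esub>i\<in>{..<n'}. (q i \<odot>\<^bsub>E\<^esub> mpow E (mop \<tau> M) i) \<otimes>\<^bsub>E\<^esub> T)"
    using q(1) mE D(1) absorb
    by (intro E.A.M.finsum_cong') (auto simp: E.mult_smult_left E.mult_closed simp del: mpow.simps)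
  also have "\<dots> = (\<Oplus>\<^bsub>E\<^esub>i\<in>{..<n'}. q i \<odot>\<^bsub>E\<^esub> mpow E (mop \<tau> M) i) \<otimes>\<^bsub>E\<^esub> T"
    using q(1) mE D(1) by (intro E.finsum_mult[symmetric]) simp_all
  also have "\<dots> = \<zero>\<^bsub>E\<^esub>" unfolding rel using D(1) by (rule E.zero_mult)
  finally show ?thesis by (rule power_dependentI[OF inj_Suc q(1,2)])
qed

text \<open>
  If \<open>T = x + l\<close> with \<open>x ^ m = 0\<close>, then \<open>T ^ m\<close> lies in the row part.
\<close>
lemma B_power_dependent:
  assumes "stable_algebraic R A" "T \<in> B0" shows "power_dependent R B T"
proof -
  obtain x l where *: "x \<in> word_part" "l \<in> row_part" "T = x \<oplus>\<^bsub>E\<^esub> l" using B0_decomposition[OF assms(2)] by blast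
  obtain m where m: "mpow E x m = \<zero>\<^bsub>E\<^esub>" using word_part_nilpotent[OF *(1)] by blast
  obtain l' where l': "l' \<in> row_part" "mpow E T m = mpow E x m \<oplus>\<^bsub>E\<^esub> l'" using mpow_sum[OF *(1,2)] *(3) by blast
  then have "mpow E T m = l'" using m row_partD(1) by auto
  then have "power_dependent R E (mpow E T m)" using row_part_power_dependent[OF assms(1) l'(1)] by simp
  then have pd: "power_dependent R E T" using subsetD[OF B0D(1) assms(2)]
    by (rule_tac E.power_dependent_mpow[where p = m])
  interpret B: assoc_algebra R B by (rule B_assoc_algebra)
  have T: "T \<in> carrier B" using assms(2) by simp
  from pd obtain N e c where c: "inj (e::nat \<Rightarrow> nat)" "\<And>i. c i \<in> carrier R" "\<exists>i<N. c i \<noteq> \<zero>"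
    "(\<Oplus>\<^bsub>E\<^esub>i\<in>{..<N}. c i \<odot>\<^bsub>E\<^esub> mpow E T (e i)) = \<zero>\<^bsub>E\<^esub>" by (rule power_dependentE) (rule that)
  have inc: "(\<lambda>T. T) \<in> alg_hom R B E" using B0D(1) by (intro alg_homI) auto
  have "(\<Oplus>\<^bsub>B\<^esub>i\<in>{..<N}. c i \<odot>\<^bsub>B\<^esub> mpow B T (e i)) = (\<Oplus>\<^bsub>E\<^esub>i\<in>{..<N}. c i \<odot>\<^bsub>E\<^esub> mpow B T (e i))"
    using B.mpow_closed[OF T] T c(2) by (intro alg_hom_combination[OF inc B.A.module_axioms E.A.module_axioms]) simp_all
  also have "\<dots> = \<zero>\<^bsub>B\<^esub>" using c(4) by (simp add: B_def)
  finally show ?thesis by (rule power_dependentI[OF c(1-3)])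
qed

end

section \<open>The embedding theorem\<close>

text \<open>
  Enumerate a basis along the first component of the pairing function. Adding zero makes the enumerated set nonempty.
\<close>
lemma countable_spanning_enumeration:
  assumes "assoc_algebra F A" "countable_dimensional F A"
  shows "\<exists>a :: nat \<Rightarrow> 'a. (\<forall>k. a k \<in> carrier A) \<and> lin_span F A (range a) = carrier A \<and> (\<forall>k. infinite {j. a j = a k})"
proof -
  interpret assoc_algebra F A by fact
  obtain B where B: "lin_basis F A B" "countable B" using assms(2) unfolding countable_dimensional_def by blast
  let ?B = "insert \<zero>\<^bsub>A\<^esub> B"
  have BA: "?B \<subseteq> carrier A" "lin_span F A B = carrier A" using B(1) by (auto simp: lin_basis_def)
  define a where "a k = from_nat_into ?B (fst (prod_decode k))" for k
  have ra: "range a = ?B"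
  proof -
    have "range (\<lambda>k. fst (prod_decode k)) = UNIV" by (intro surjI[of _ "\<lambda>i. prod_encode (i, 0)"]) simp
    then have "range a = range (from_nat_into ?B)" unfolding a_def by (metis image_image)
    then show ?thesis using B(2) range_from_nat_into[of ?B] by simp
  qed
  have "a k \<in> carrier A" for k using ra BA(1) by blast
  moreover have "lin_span F A (range a) = carrier A"
    using lin_span_mono[of B ?B F A] A.submoduleD'(1)[OF A.lin_span_submodule[OF BA(1)]] BA(2)
    unfolding ra by blast
  moreover have "infinite {j. a j = a k}" for k
  proof -
    have "inj (\<lambda>m. prod_encode (fst (prod_decode k), m))" by (auto simp: inj_def)
    then have "infinite (range (\<lambda>m. prod_encode (fst (prod_decode k), m)))" by (simp add: finite_image_iff)
    moreover have "range (\<lambda>m. prod_encode (fst (prod_decode k), m)) \<subseteq> {j. a j = a k}" by (auto simp: a_def)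
    ultimately show ?thesis using finite_subset by blast
  qed
  ultimately show ?thesis by blast
qed

text \<open>
  The algebra sought is the algebra of operators generated by \<open>X\<close> and \<open>Z\<close>, rewritten on sequences of scalars. The index
  set and the basis \<open>S\<close> of \<open>M\<close> are both countable and infinite, so the finite matrices over one correspond to those over
  the other.
\<close>
theorem theorem5p1:
  fixes F :: "('c, 'n) ring_scheme" and A :: "('c, 'a, 'm) module_scheme" and X :: "'i set"
  assumes "field F"
    and "countable X" and "infinite X"
    and "assoc_algebra F A"
    and "countable_dimensional F A"
    and "stable_algebraic F A"
    and "primitive_algebra F A"
  shows "\<exists>B :: ('c, nat \<Rightarrow> 'c) module.
           assoc_algebra F B \<and> two_generated F B \<and> algebraic_algebra F B \<and>
           primitive_algebra F B \<and> M_infinity_embeddable_as_left_ideal X F A B"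
proof -
  obtain V :: "('c, 'a set) module" and act where
    V: "irreducible_left_module F A V act" "faithful_action A V act"
    using assms(7) unfolding primitive_algebra_def by blast
  obtain a :: "nat \<Rightarrow> 'a" where a: "\<forall>k. a k \<in> carrier A" "lin_span F A (range a) = carrier A"
    "\<forall>k. infinite {j. a j = a k}"
    using countable_spanning_enumeration[OF assms(4,5)] by (elim exE conjE) (rule that)
  obtain S f \<kappa> n d b \<gamma> where "cyclic_nil_module F S f \<kappa> n d b \<gamma>"
    using field.exists_cyclic_nil_module[OF assms(1)] by blast
  then have "row_extension F S f \<kappa> n d b \<gamma> A V act a"
    using V a by (intro row_extension.intro row_extension_axioms.intro) (simp_all add: irreducible_left_module_def)
  then interpret E: row_extension F S f \<kappa> n d b \<gamma> A V act a .
  have "infinite S"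
  proof
    assume fin: "finite S"
    obtain s where s: "s \<in> S" "length s = Suc (Max (length ` S))" using E.S_infinite by blast
    have "length s \<le> Max (length ` S)" using s(1) fin by (intro Max_ge) simp_all
    then show False using s(2) by simp
  qed
  then have "bij_betw (from_nat_into S \<circ> to_nat_on X) X S"
    using assms(2,3) bij_betw_from_nat_into[of S] to_nat_on_infinite[of X] by (blast intro: bij_betw_trans)
  then have emb: "M_infinity_embeddable_as_left_ideal X F A E.B" by (rule E.matrices_embed)
  interpret B: assoc_algebra F E.B by (rule E.B_assoc_algebra)
  obtain enc :: "_ \<Rightarrow> nat \<Rightarrow> 'c" where enc: "inj_on enc (carrier E.B)"
    using B.two_generated_imp_coordinates[OF E.B_two_generated] by blast
  interpret T: transport F E.B enc by unfold_locales (rule enc)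
  have "algebraic_algebra F T.B"
    by (rule T.transported_algebraic) (simp add: E.B_power_dependent[OF assms(6)])
  then show ?thesis
    using T.transported_assoc_algebra T.transported_two_generated[OF E.B_two_generated]
      T.transported_primitive[OF E.B_irreducible E.B_faithful] T.transported_embeddable[OF emb] by blast
qed

end
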